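(* Let $(M,\omega)$ be a symplectic manifold equipped with a proper symplectic action of a Lie group $G$, and let $H\subset G$ be a closed co-compact subgroup. Let $h\in C^\infty(M)^G$ be a Hamiltonian having a $G$-nondegenerate equilibrium $m\in M$, and let $(h_\lambda)$ be an $H$-perturbation of $h$. Then the number of $H$-orbits of equilibria that persist near $G\cdot m$ under a small $H$-perturbation is bounded below by $\mathrm{Cat}_H(G/G_m)$; that is, there is a $G$-invariant neighbourhood $U\subset M$ of $m$ such that, for all sufficiently small $\lambda$, the Hamiltonian vector field $X_{h_\lambda}$ has at least $\mathrm{Cat}_H(G/G_m)$ distinct $H$-orbits of equilibria in $U$.
   Context: $C^\infty(M)^G$ denotes the $G$-invariant smooth real-valued functions on $M$ (similarly for $H$). $G_m$ is the stabilizer of $m$, and $H$ acts on $G/G_m$ by left multiplication. A closed subgroup $H\subset G$ is co-compact if $H\backslash G$ is compact. The Hamiltonian vector field $X_h$ is defined by $\iota_{X_h}\omega=-dh$; an equilibrium of $h$ is a zero of $X_h$, equivalently a critical point of $h$. An $H$-perturbation of $h\in C^\infty(M)^G$ is a family of functions $h_\lambda\in C^\infty(M)^H$, with $\lambda$ in a neighbourhood of $0$ in $\mathbb{R}$, such that $(m,\lambda)\mapsto h_\lambda(m)$ is smooth and $h_0=h$. For $x\in\mathfrak g$ (the Lie algebra of $G$), $x_M(m)=\frac{d}{dt}\big|_{t=0}\exp(tx)\cdot m$, and $\mathfrak g\cdot m=\{x_M(m): x\in\mathfrak g\}=T_m(G\cdot m)$. A point $m\in M$ is a $G$-nondegenerate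 equilibrium of $h\in C^\infty(M)^G$ if (i) $dh(m)=0$, and (ii) if $\mathcal N$ is any subspace of $T_mM$ complementary to $\mathfrak g\cdot m$, the restriction of the Hessian $D^2h(m)$ to $\mathcal N\times\mathcal N$ is non-singular. For a Lie group $H$ acting properly on a manifold $X$, the equivariant Lyusternik–Schnirelmann category $\mathrm{Cat}_H(X)$ is the least number of $H$-invariant open subsets of $X$, each contractible by means of an $H$-homotopy onto an $H$-orbit, that are required to cover $X$. *)

theory Defs
  imports
    "HOL-Analysis.Analysis"
    "HOL-Algebra.Group_Action"
    "HOL-Library.Extended_Nat"
begin

section \<open>Smooth maps and smooth manifolds\<close>

text \<open>
  Used for open \<open>S\<close> in a finite-dimensional space, where continuity of all iterated
  directional derivatives is the usual notion of class \<open>C^k\<close>.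
\<close>

fun Ck_on :: "nat \<Rightarrow> 'a::real_normed_vector set \<Rightarrow> ('a \<Rightarrow> 'b::real_normed_vector) \<Rightarrow> bool" where
  "Ck_on 0 S f \<longleftrightarrow> continuous_on S f"
| "Ck_on (Suc k) S f \<longleftrightarrow>
     (\<forall>x\<in>S. f differentiable (at x)) \<and> (\<forall>v. Ck_on k S (\<lambda>x. frechet_derivative f (at x) v))"

definition smooth_on :: "'a::real_normed_vector set \<Rightarrow> ('a \<Rightarrow> 'b::real_normed_vector) \<Rightarrow> bool" where
  "smooth_on S f \<longleftrightarrow> (\<forall>k. Ck_on k S f)"

text \<open>A chart is a pair of its domain and its coordinate map. The underlying set is the
  \<open>topspace\<close> of the first component.\<close>

record ('a, 'e) smooth_space =
  top_of :: "'a topology"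
  atlas :: "('a set \<times> ('a \<Rightarrow> 'e)) set"

abbreviation points :: "('a, 'e) smooth_space \<Rightarrow> 'a set" where
  "points M \<equiv> topspace (top_of M)"

text \<open>The model space is a finite-dimensional normed space rather than a \<open>euclidean_space\<close>
  because the latter class excludes dimension 0, and discrete Lie groups are to be covered.\<close>

definition smooth_manifold :: "('a, 'e::real_normed_vector) smooth_space \<Rightarrow> bool" where
  "smooth_manifold M \<longleftrightarrow>
     (\<exists>B::'e set. finite B \<and> span B = UNIV) \<and>
     Hausdorff_space (top_of M) \<and> second_countable (top_of M) \<and>
     \<Union>(fst ` atlas M) = points M \<and>
     (\<forall>(U, \<phi>) \<in> atlas M. openin (top_of M) U \<and> open (\<phi> ` U) \<and>
        homeomorphic_map (subtopology (top_of M) U) (top_of_set (\<phi> ` U)) \<phi>) \<and>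
     (\<forall>(U, \<phi>) \<in> atlas M. \<forall>(V, \<psi>) \<in> atlas M. smooth_on (\<phi> ` (U \<inter> V)) (\<psi> \<circ> inv_into U \<phi>))"

definition standard_space :: "('e::real_normed_vector, 'e) smooth_space" where
  "standard_space = \<lparr>top_of = euclidean, atlas = {(UNIV, id)}\<rparr>"

definition product_space ::
  "('a, 'e) smooth_space \<Rightarrow> ('b, 'f) smooth_space \<Rightarrow> ('a \<times> 'b, 'e \<times> 'f) smooth_space" where
  "product_space M N =
     \<lparr>top_of = prod_topology (top_of M) (top_of N),
      atlas = {(U \<times> V, map_prod \<phi> \<psi>) | U \<phi> V \<psi>. (U, \<phi>) \<in> atlas M \<and> (V, \<psi>) \<in> atlas N}\<rparr>"

definition open_subspace :: "('a, 'e) smooth_space \<Rightarrow> 'a set \<Rightarrow> ('a, 'e) smooth_space" where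
  "open_subspace M S =
     \<lparr>top_of = subtopology (top_of M) S, atlas = {(U \<inter> S, \<phi>) | U \<phi>. (U, \<phi>) \<in> atlas M}\<rparr>"

definition smooth_map ::
  "('a, 'e::real_normed_vector) smooth_space \<Rightarrow> ('b, 'f::real_normed_vector) smooth_space
     \<Rightarrow> ('a \<Rightarrow> 'b) \<Rightarrow> bool" where
  "smooth_map M N f \<longleftrightarrow> continuous_map (top_of M) (top_of N) f \<and>
     (\<forall>(U, \<phi>) \<in> atlas M. \<forall>(V, \<psi>) \<in> atlas N.
        smooth_on (\<phi> ` (U \<inter> f -` V)) (\<psi> \<circ> f \<circ> inv_into U \<phi>))"


section \<open>Tangent vectors\<close>

text \<open>
  For every point \<open>x\<close> of a manifold modelled on \<open>'e\<close> one chart around \<open>x\<close> is selected, and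
  the tangent space at \<open>x\<close> is \<open>'e\<close> itself: \<open>v :: 'e\<close> stands for the tangent vector
  whose coordinates in the selected chart are \<open>v\<close>. Another selection changes
  the tangent spaces by the derivatives of the transition maps.
\<close>

definition chart_at :: "('a, 'e) smooth_space \<Rightarrow> 'a \<Rightarrow> 'a set \<times> ('a \<Rightarrow> 'e)" where
  "chart_at M x = (SOME c. c \<in> atlas M \<and> x \<in> fst c)"

definition coord :: "('a, 'e) smooth_space \<Rightarrow> 'a \<Rightarrow> 'a \<Rightarrow> 'e" where
  "coord M x = snd (chart_at M x)"

definition coord_inv :: "('a, 'e) smooth_space \<Rightarrow> 'a \<Rightarrow> 'e \<Rightarrow> 'a" where
  "coord_inv M x = inv_into (fst (chart_at M x)) (snd (chart_at M x))"

definition differential ::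
  "('a, 'e::real_normed_vector) smooth_space \<Rightarrow> ('b, 'f::real_normed_vector) smooth_space
     \<Rightarrow> ('a \<Rightarrow> 'b) \<Rightarrow> 'a \<Rightarrow> 'e \<Rightarrow> 'f" where
  "differential M N f x =
     frechet_derivative (coord N (f x) \<circ> f \<circ> coord_inv M x) (at (coord M x x))"

definition velocity ::
  "('a, 'e::real_normed_vector) smooth_space \<Rightarrow> (real \<Rightarrow> 'a) \<Rightarrow> real \<Rightarrow> 'e" where
  "velocity M \<gamma> t = vector_derivative (coord M (\<gamma> t) \<circ> \<gamma>) (at t)"

text \<open>The second derivative in the selected chart. It depends on the chart in general, but
  at a critical point of \<open>h\<close> it is the Hessian, a well-defined bilinear form
  on the tangent space.\<close>

definition hessian ::
  "('a, 'e::real_normed_vector) smooth_space \<Rightarrow> ('a \<Rightarrow> real) \<Rightarrow> 'a \<Rightarrow> 'e \<Rightarrow> 'e \<Rightarrow> real" where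
  "hessian M h x u v =
     frechet_derivative (\<lambda>y. frechet_derivative (h \<circ> coord_inv M x) (at y) v) (at (coord M x x)) u"


section \<open>Symplectic manifolds and Hamiltonian vector fields\<close>

text \<open>The coordinate expression of a 2-form at the point with coordinates \<open>p\<close> in the
  chart \<open>(U, \<phi>)\<close>, evaluated on two constant coordinate vectors.\<close>

definition form_in_chart ::
  "('a, 'e::real_normed_vector) smooth_space \<Rightarrow> ('a \<Rightarrow> 'e \<Rightarrow> 'e \<Rightarrow> real)
     \<Rightarrow> 'a set \<times> ('a \<Rightarrow> 'e) \<Rightarrow> 'e \<Rightarrow> 'e \<Rightarrow> 'e \<Rightarrow> real" where
  "form_in_chart M \<omega> c p a b =
     (let x = inv_into (fst c) (snd c) p;
          T = frechet_derivative (coord M x \<circ> inv_into (fst c) (snd c)) (at p)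
      in \<omega> x (T a) (T b))"

definition smooth_two_form ::
  "('a, 'e::real_normed_vector) smooth_space \<Rightarrow> ('a \<Rightarrow> 'e \<Rightarrow> 'e \<Rightarrow> real) \<Rightarrow> bool" where
  "smooth_two_form M \<omega> \<longleftrightarrow>
     (\<forall>x \<in> points M. bilinear (\<omega> x) \<and> (\<forall>u. \<omega> x u u = 0)) \<and>
     (\<forall>(U, \<phi>) \<in> atlas M. \<forall>a b. smooth_on (\<phi> ` U) (\<lambda>p. form_in_chart M \<omega> (U, \<phi>) p a b))"

text \<open>The three summands below are the exterior derivative of the form evaluated on the
  constant coordinate fields \<open>a\<close>, \<open>b\<close>, \<open>c\<close>, whose Lie brackets vanish.\<close>

definition closed_two_form ::
  "('a, 'e::real_normed_vector) smooth_space \<Rightarrow> ('a \<Rightarrow> 'e \<Rightarrow> 'e \<Rightarrow> real) \<Rightarrow> bool" where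
  "closed_two_form M \<omega> \<longleftrightarrow>
     (\<forall>(U, \<phi>) \<in> atlas M. \<forall>p \<in> \<phi> ` U. \<forall>a b c.
        frechet_derivative (\<lambda>q. form_in_chart M \<omega> (U, \<phi>) q b c) (at p) a +
        frechet_derivative (\<lambda>q. form_in_chart M \<omega> (U, \<phi>) q c a) (at p) b +
        frechet_derivative (\<lambda>q. form_in_chart M \<omega> (U, \<phi>) q a b) (at p) c = 0)"

definition symplectic_manifold ::
  "('a, 'e::real_normed_vector) smooth_space \<Rightarrow> ('a \<Rightarrow> 'e \<Rightarrow> 'e \<Rightarrow> real) \<Rightarrow> bool" where
  "symplectic_manifold M \<omega> \<longleftrightarrow>
     smooth_manifold M \<and> smooth_two_form M \<omega> \<and> closed_two_form M \<omega> \<and>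
     (\<forall>x \<in> points M. \<forall>u. (\<forall>v. \<omega> x u v = 0) \<longrightarrow> u = 0)"

definition hamiltonian_vector_field ::
  "('a, 'e::real_normed_vector) smooth_space \<Rightarrow> ('a \<Rightarrow> 'e \<Rightarrow> 'e \<Rightarrow> real) \<Rightarrow> ('a \<Rightarrow> real)
     \<Rightarrow> 'a \<Rightarrow> 'e" where
  "hamiltonian_vector_field M \<omega> h x =
     (THE u. \<forall>v. \<omega> x u v = - differential M standard_space h x v)"

definition equilibria ::
  "('a, 'e::real_normed_vector) smooth_space \<Rightarrow> ('a \<Rightarrow> 'e \<Rightarrow> 'e \<Rightarrow> real) \<Rightarrow> ('a \<Rightarrow> real)
     \<Rightarrow> 'a set" where
  "equilibria M \<omega> h = {x \<in> points M. hamiltonian_vector_field M \<omega> h x = 0}"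


section \<open>Lie groups and their actions\<close>

definition lie_group :: "'g monoid \<Rightarrow> ('g, 'f::real_normed_vector) smooth_space \<Rightarrow> bool" where
  "lie_group G GM \<longleftrightarrow>
     group G \<and> smooth_manifold GM \<and> points GM = carrier G \<and>
     smooth_map (product_space GM GM) GM (\<lambda>(a, b). a \<otimes>\<^bsub>G\<^esub> b) \<and>
     smooth_map GM GM (\<lambda>a. inv\<^bsub>G\<^esub> a)"

definition one_parameter_subgroup ::
  "'g monoid \<Rightarrow> ('g, 'f::real_normed_vector) smooth_space \<Rightarrow> (real \<Rightarrow> 'g) \<Rightarrow> bool" where
  "one_parameter_subgroup G GM \<gamma> \<longleftrightarrow>
     smooth_map standard_space GM \<gamma> \<and> (\<forall>s t. \<gamma> (s + t) = \<gamma> s \<otimes>\<^bsub>G\<^esub> \<gamma> t)"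

text \<open>The Lie algebra is the tangent space at the identity, that is, the model space \<open>'f\<close>.\<close>

definition lie_exp :: "'g monoid \<Rightarrow> ('g, 'f::real_normed_vector) smooth_space \<Rightarrow> 'f \<Rightarrow> 'g" where
  "lie_exp G GM x = (THE \<gamma>. one_parameter_subgroup G GM \<gamma> \<and> velocity GM \<gamma> 0 = x) 1"

definition smooth_action ::
  "'g monoid \<Rightarrow> ('g, 'f::real_normed_vector) smooth_space \<Rightarrow> ('a, 'e::real_normed_vector) smooth_space
     \<Rightarrow> ('g \<Rightarrow> 'a \<Rightarrow> 'a) \<Rightarrow> bool" where
  "smooth_action G GM M \<phi> \<longleftrightarrow>
     group_action G (points M) \<phi> \<and> smooth_map (product_space GM M) M (\<lambda>(g, x). \<phi> g x)"

definition proper_action ::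
  "('g, 'f) smooth_space \<Rightarrow> ('a, 'e) smooth_space \<Rightarrow> ('g \<Rightarrow> 'a \<Rightarrow> 'a) \<Rightarrow> bool" where
  "proper_action GM M \<phi> \<longleftrightarrow>
     proper_map (prod_topology (top_of GM) (top_of M)) (prod_topology (top_of M) (top_of M))
       (\<lambda>(g, x). (\<phi> g x, x))"

definition symplectic_action ::
  "'g monoid \<Rightarrow> ('a, 'e::real_normed_vector) smooth_space \<Rightarrow> ('a \<Rightarrow> 'e \<Rightarrow> 'e \<Rightarrow> real)
     \<Rightarrow> ('g \<Rightarrow> 'a \<Rightarrow> 'a) \<Rightarrow> bool" where
  "symplectic_action G M \<omega> \<phi> \<longleftrightarrow>
     (\<forall>g \<in> carrier G. \<forall>x \<in> points M. \<forall>u v.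
        \<omega> (\<phi> g x) (differential M M (\<phi> g) x u) (differential M M (\<phi> g) x v) = \<omega> x u v)"

definition infinitesimal_generator ::
  "'g monoid \<Rightarrow> ('g, 'f::real_normed_vector) smooth_space \<Rightarrow> ('a, 'e::real_normed_vector) smooth_space
     \<Rightarrow> ('g \<Rightarrow> 'a \<Rightarrow> 'a) \<Rightarrow> 'f \<Rightarrow> 'a \<Rightarrow> 'e" where
  "infinitesimal_generator G GM M \<phi> x m =
     velocity M (\<lambda>t. \<phi> (lie_exp G GM (t *\<^sub>R x)) m) 0"

definition lie_algebra_orbit ::
  "'g monoid \<Rightarrow> ('g, 'f::real_normed_vector) smooth_space \<Rightarrow> ('a, 'e::real_normed_vector) smooth_space
     \<Rightarrow> ('g \<Rightarrow> 'a \<Rightarrow> 'a) \<Rightarrow> 'a \<Rightarrow> 'e set" where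
  "lie_algebra_orbit G GM M \<phi> m = {infinitesimal_generator G GM M \<phi> x m | x. True}"

definition invariant_smooth_functions ::
  "'g monoid \<Rightarrow> ('a, 'e::real_normed_vector) smooth_space \<Rightarrow> ('g \<Rightarrow> 'a \<Rightarrow> 'a) \<Rightarrow> ('a \<Rightarrow> real) set" where
  "invariant_smooth_functions G M \<phi> =
     {h. smooth_map M standard_space h \<and> (\<forall>g \<in> carrier G. \<forall>x \<in> points M. h (\<phi> g x) = h x)}"

definition nondegenerate_equilibrium ::
  "'g monoid \<Rightarrow> ('g, 'f::real_normed_vector) smooth_space \<Rightarrow> ('a, 'e::real_normed_vector) smooth_space
     \<Rightarrow> ('g \<Rightarrow> 'a \<Rightarrow> 'a) \<Rightarrow> ('a \<Rightarrow> real) \<Rightarrow> 'a \<Rightarrow> bool" where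
  "nondegenerate_equilibrium G GM M \<phi> h m \<longleftrightarrow>
     m \<in> points M \<and> (\<forall>v. differential M standard_space h m v = 0) \<and>
     (\<forall>N. subspace N \<and> N \<inter> lie_algebra_orbit G GM M \<phi> m = {0} \<and>
          {u + w | u w. u \<in> N \<and> w \<in> lie_algebra_orbit G GM M \<phi> m} = UNIV \<longrightarrow>
        (\<forall>u \<in> N. (\<forall>v \<in> N. hessian M h m u v = 0) \<longrightarrow> u = 0))"

definition invariant_perturbation ::
  "'g monoid \<Rightarrow> ('a, 'e::real_normed_vector) smooth_space \<Rightarrow> ('g \<Rightarrow> 'a \<Rightarrow> 'a) \<Rightarrow> ('a \<Rightarrow> real)
     \<Rightarrow> real set \<Rightarrow> (real \<Rightarrow> 'a \<Rightarrow> real) \<Rightarrow> bool" where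
  "invariant_perturbation H M \<phi> h \<Lambda> hp \<longleftrightarrow>
     open \<Lambda> \<and> 0 \<in> \<Lambda> \<and>
     (\<forall>s \<in> \<Lambda>. hp s \<in> invariant_smooth_functions H M \<phi>) \<and>
     smooth_map (product_space M (open_subspace standard_space \<Lambda>)) standard_space
       (\<lambda>(x, s). hp s x) \<and>
     (\<forall>x \<in> points M. hp 0 x = h x)"


section \<open>Coset spaces and equivariant Lyusternik--Schnirelmann category\<close>

definition quotient_topology :: "'a topology \<Rightarrow> ('a \<Rightarrow> 'b) \<Rightarrow> 'b topology" where
  "quotient_topology X q =
     topology (\<lambda>W. W \<subseteq> q ` topspace X \<and> openin X {x \<in> topspace X. q x \<in> W})"

lemma openin_quotient_topology:
  "openin (quotient_topology X q) W \<longleftrightarrow>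
     W \<subseteq> q ` topspace X \<and> openin X {x \<in> topspace X. q x \<in> W}"
proof -
  let ?P = "\<lambda>W. W \<subseteq> q ` topspace X \<and> openin X {x \<in> topspace X. q x \<in> W}"
  have "?P (S \<inter> T)" if "?P S" "?P T" for S T
  proof -
    have "{x \<in> topspace X. q x \<in> S \<inter> T} = {x \<in> topspace X. q x \<in> S} \<inter> {x \<in> topspace X. q x \<in> T}"
      by auto
    with that show ?thesis by auto
  qed
  moreover have "?P (\<Union>\<K>)" if "\<forall>K\<in>\<K>. ?P K" for \<K>
  proof -
    have "{x \<in> topspace X. q x \<in> \<Union>\<K>} = (\<Union>K\<in>\<K>. {x \<in> topspace X. q x \<in> K})"
      by auto
    moreover have "openin X (\<Union>K\<in>\<K>. {x \<in> topspace X. q x \<in> K})"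
      using that by blast
    ultimately show ?thesis using that by auto
  qed
  ultimately have "istopology ?P"
    unfolding istopology_def by (intro conjI allI impI) simp_all
  then show ?thesis
    by (simp add: quotient_topology_def)
qed

lemma topspace_quotient_topology: "topspace (quotient_topology X q) = q ` topspace X"
proof
  show "topspace (quotient_topology X q) \<subseteq> q ` topspace X"
    using openin_topspace[of "quotient_topology X q"] by (simp only: openin_quotient_topology)
  have "{x \<in> topspace X. q x \<in> q ` topspace X} = topspace X"
    by auto
  then have "openin (quotient_topology X q) (q ` topspace X)"
    by (simp add: openin_quotient_topology)
  then show "q ` topspace X \<subseteq> topspace (quotient_topology X q)"
    by (rule openin_subset)
qed

lemma quotient_map_quotient_topology: "quotient_map X (quotient_topology X q) q"
  unfolding quotient_map_def
  by (simp add: openin_quotient_topology topspace_quotient_topology)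

definition left_coset_space :: "'g monoid \<Rightarrow> ('g, 'f) smooth_space \<Rightarrow> 'g set \<Rightarrow> 'g set topology" where
  "left_coset_space G GM K = quotient_topology (top_of GM) (\<lambda>g. g <#\<^bsub>G\<^esub> K)"

definition right_coset_space :: "'g monoid \<Rightarrow> ('g, 'f) smooth_space \<Rightarrow> 'g set \<Rightarrow> 'g set topology" where
  "right_coset_space G GM H = quotient_topology (top_of GM) (\<lambda>g. H #>\<^bsub>G\<^esub> g)"

definition subgroup_as_group :: "'g monoid \<Rightarrow> 'g set \<Rightarrow> 'g monoid" where
  "subgroup_as_group G H = G\<lparr>carrier := H\<rparr>"

definition equivariantly_contractible_to_orbit ::
  "'g monoid \<Rightarrow> 'a topology \<Rightarrow> ('g \<Rightarrow> 'a \<Rightarrow> 'a) \<Rightarrow> 'a set \<Rightarrow> bool" where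
  "equivariantly_contractible_to_orbit H X \<psi> U \<longleftrightarrow>
     (\<exists>r. \<exists>x \<in> topspace X. r ` U = orbit H \<psi> x \<and>
        homotopic_with (\<lambda>f. \<forall>k \<in> carrier H. \<forall>y \<in> U. f (\<psi> k y) = \<psi> k (f y))
          (subtopology X U) X id r)"

text \<open>The value is \<open>\<infinity>\<close> if there is no finite cover, as the infimum of the empty set.\<close>

definition equivariant_category ::
  "'g monoid \<Rightarrow> 'a topology \<Rightarrow> ('g \<Rightarrow> 'a \<Rightarrow> 'a) \<Rightarrow> enat" where
  "equivariant_category H X \<psi> =
     Inf {enat (card \<U>) | \<U>. finite \<U> \<and> \<Union>\<U> = topspace X \<and>
       (\<forall>U \<in> \<U>. openin X U \<and> (\<forall>k \<in> carrier H. \<psi> k ` U = U) \<and>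
          equivariantly_contractible_to_orbit H X \<psi> U)}"

definition extended_card :: "'a set \<Rightarrow> enat" where
  "extended_card A = (if finite A then enat (card A) else \<infinity>)"

end

(* Let K be the stabilizer of m. Averaging over K yields a K-equivariant map alpha from a neighbourhood
of m to the tangent space of the orbit G.m that measures the displacement along the orbit; put
rho = |alpha|^2 / 2 for a K-invariant inner product. Since m is G-nondegenerate, y -> h (g y) + rho y has
a nondegenerate critical point at m on the full chart domain, so a contraction argument, uniform in g
because H is cocompact, provides for small s a unique critical point y g near m of
y -> h_s (g y) + rho y. The critical value f g = h_s (g (y g)) + rho (y g) is left H-invariant and right
K-invariant in g. At a critical point of f the term rho drops out because alpha is a submersion along
G-orbits, so g (y g) is an equilibrium of h_s, and critical points in different H-orbits of G/K that are
not close to each other give different H-orbits of equilibria by properness.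

It remains to bound the critical set of f on G/K by Lyusternik-Schnirelmann theory. Flowing along
g -> g Exp (-t xi g) with an invariant gradient-like field xi pushes sublevel sets down off a neighbourhood
of the critical set, and H-orbits in G/K have tubes, of a size uniform in G/K, that contract
H-equivariantly onto the orbit: a tube is a quotient of H x N, where N is a complement of the sum of
the Lie algebras of H and K that is invariant under the compact group H Int K. *)
theory Submission
 imports Defs
begin

text \<open>Along the orbit of m the Hessian of h is degenerate, and its kernel is the tangent space
  of the orbit. The term \<rho> fills this kernel with a positive form, so that the contraction can
  run in one full chart at m; the group variable g records the place on the orbit, and invariance of
  \<rho> under K lets the reduced function descend to G/K.

  Distinct critical orbits of f may give the same orbit of equilibria. Lyusternik-Schnirelmann
  theory is therefore applied to clumps: all critical points leading to one orbit of equilibria lie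
  in one tube and share one critical value, and crossing that value costs one covering set per
  clump.

  \<open>Exp\<close> is constructed as a limit of powers, since uniqueness of such limits yields
  additivity and the uniqueness of one-parameter subgroups. \<open>mean\<close> is the common limit
  of averages over finitely many translates and takes the place of the Haar integral. Nearly every
  uniform constant comes from \<open>compactin_ev\<close>, applied to K or to a compact set that
  meets every coset of H.\<close>

abbreviation "FD f x == frechet_derivative f (at x)"
no_notation matrix_matrix_mult (infixl "**" 70)
notation scaleR (infixr "*." 75)
notation tendsto (infixr "--->" 55)
notation LIMSEQ ("((_)/ ----> (_))" [60, 60] 60)

section \<open>Finite-dimensional normed spaces\<close>

text \<open>The condition that \<open>smooth_manifold\<close> puts on the model space, as a
  predicate on types, because dimension 0 has to be included.\<close>

definition findim :: "'a::real_vector itself => bool" where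
 "findim _ \<longleftrightarrow> (EX B::'a set. finite B & span B = UNIV)"

lemma findim_basis:
 assumes "findim TYPE('a::real_vector)"
 obtains B :: "'a::real_vector set" where "finite B" "independent B" "span B = UNIV"
proof -
 obtain A :: "'a set" where A: "finite A" "span A = UNIV"
  using assms by (auto simp: findim_def)
 obtain B where "B \<subseteq> A" "independent B" "A \<subseteq> span B"
  using maximal_independent_subset[of A] by blast
 moreover from this A have "span B = UNIV" by (metis span_mono span_span subset_antisym top_greatest)
 ultimately show ?thesis using that A(1) finite_subset by blast
qed

lemma findim_real: "findim TYPE(real)"
proof -
 have "x : span {1::real}" for x
  using span_mul[of "1::real" "{1}" x] span_base[of "1::real" "{1}"] by (metis insertI1 mult.right_neutral real_scaleR_def)
 then show ?thesis unfolding findim_def by (intro exI[of _ "{1}"]) auto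
qed

lemma findim_prod:
 assumes "findim TYPE('a::real_vector)" "findim TYPE('b::real_vector)"
 shows "findim TYPE('a \<times> 'b)"
proof -
 obtain A :: "'a set" where A: "finite A" "span A = UNIV" using assms by (auto simp: findim_def)
 obtain B :: "'b set" where B: "finite B" "span B = UNIV" using assms by (auto simp: findim_def)
 let ?C = "(%a. (a,0::'b)) ` A Un (%b. (0::'a,b)) ` B"
 have 1: "(a,0::'b) : span ?C" for a
 proof -
  have "(%a. (a,0::'b)) ` span A = span ((%a. (a,0::'b)) ` A)"
   by (rule linear_span_image[symmetric]) (auto intro!: linearI)
  moreover have "(a,0::'b) : (%a. (a,0::'b)) ` span A" using A(2) by simp
  ultimately have "(a,0::'b) : span ((%a. (a,0::'b)) ` A)" by (simp only:)
  then show ?thesis using span_mono[of "(%a. (a,0::'b)) ` A" ?C] by blast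
 qed
 have 2: "(0::'a,b) : span ?C" for b
 proof -
  have "(%b. (0::'a,b)) ` span B = span ((%b. (0::'a,b)) ` B)"
   by (rule linear_span_image[symmetric]) (auto intro!: linearI)
  moreover have "(0::'a,b) : (%b. (0::'a,b)) ` span B" using B(2) by simp
  ultimately have "(0::'a,b) : span ((%b. (0::'a,b)) ` B)" by (simp only:)
  then show ?thesis using span_mono[of "(%b. (0::'a,b)) ` B" ?C] by blast
 qed
 have "(a,b) : span ?C" for a b
  using span_add[OF 1[of a] 2[of b]] by simp
 then have "span ?C = UNIV" by auto
 then show ?thesis using A B unfolding findim_def by (intro exI[of _ ?C]) simp
qed

definition basis_of :: "'a::real_vector set => bool" where
 "basis_of B \<longleftrightarrow> finite B & independent B & span B = UNIV"

lemma basis_sum: "basis_of B ==> (\<Sum>b\<in>B. representation B v b *. b) = v"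
 by (rule sum_representation_eq) (auto simp: basis_of_def)

lemma linear_rep: "basis_of B ==> linear (%v. representation B v b)"
 by (auto simp: basis_of_def representation_add representation_scale intro!: linearI)

lemma linear_basis_sum:
 assumes "basis_of B" "linear f"
 shows "f v = (\<Sum>b\<in>B. representation B v b *. f b)"
proof -
 have "f v = f (\<Sum>b\<in>B. representation B v b *. b)" by (simp add: basis_sum assms)
 then show ?thesis by (simp add: linear_sum[OF assms(2)] linear_scale[OF assms(2)])
qed

text \<open>Bolzano-Weierstrass for finitely many coordinates at once: the subsequence is refined
  once per element of B.\<close>

lemma coefficient_subseq:
 fixes c :: "nat => 'a => real"
 assumes "finite B" "!!n b. b : B ==> \<bar>c n b\<bar> \<le> M"
 obtains l r where "strict_mono (r::nat=>nat)" "!!b. b : B ==> (%n. c (r n) b) ----> l b"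
proof -
 have "EX l r. strict_mono (r::nat=>nat) & (ALL b:B. (%n. c (r n) b) ----> l b)"
  using assms
 proof (induction B rule: finite_induct)
  case empty
  then show ?case by (auto intro: exI[of _ id] simp: strict_mono_def)
 next
  case (insert b B)
  obtain l r where r: "strict_mono (r::nat=>nat)" "ALL b:B. (%n. c (r n) b) ----> l b"
   using insert by blast
  have "bounded (range (%n. c (r n) b))"
   using insert.prems by (auto intro!: boundedI[of _ M])
  then obtain l' r' where r': "strict_mono (r'::nat=>nat)" "((%n. c (r n) b) o r') ----> l'"
   using bounded_imp_convergent_subsequence[of "%n. c (r n) b"] by auto
  have "(%n. c ((r o r') n) x) ----> (l(b := l')) x" if "x : insert b B" for x
  proof (cases "x = b")
   case True then show ?thesis using r' by (simp add: o_def)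
  next
   case False
   then have "(%n. c (r n) x) ----> l x" using that r by auto
   from LIMSEQ_subseq_LIMSEQ[OF this r'(1)] show ?thesis using False by (simp add: o_def)
  qed
  then show ?case using r(1) r'(1) strict_mono_o by blast
 qed
 then show ?thesis using that by blast
qed

text \<open>Equivalence of norms by compactness. Counterexamples are rescaled so that their largest
  coefficient is one; a subsequence then converges to a vanishing combination of basis vectors whose
  coefficients do not all vanish. Continuity of linear maps and compactness of balls rest on
  this.\<close>

lemma coefficient_bound:
 fixes B :: "'a::real_normed_vector set"
 assumes "basis_of B"
 obtains C where "C > 0" "!!v b. \<bar>representation B v b\<bar> \<le> C * norm v"
proof -
 let ?R = "representation B"
 have fin: "finite B" using assms by (simp add: basis_of_def)
 have "EX C>0. ALL v. ALL b:B. \<bar>?R v b\<bar> \<le> C * norm v"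
 proof (rule ccontr)
  assume neg: "\<not> ?thesis"
  have "EX v. EX b:B. \<bar>?R v b\<bar> > (real n + 1) * norm v" for n
   using neg[unfolded not_ex, rule_format, of "real n + 1"] by (auto simp: not_le)
  then obtain v where v: "!!n. EX b:B. \<bar>?R (v n) b\<bar> > (real n + 1) * norm (v n)" by metis
  define s where "s n = (MAX b\<in>B. \<bar>?R (v n) b\<bar>)" for n
  have s: "\<bar>?R (v n) b\<bar> \<le> s n" if "b : B" for n b
   unfolding s_def using fin that by auto
  have spos: "s n > (real n + 1) * norm (v n)" for n
   using v[of n] s[of _ n] by (meson less_le_trans)
  have spos0: "s n > 0" for n using spos[of n] by (smt (verit) mult_nonneg_nonneg norm_ge_zero of_nat_0_le_iff)
  define w where "w n = (1 / s n) *. v n" for n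
  have Rw: "?R (w n) b = ?R (v n) b / s n" for n b
   unfolding w_def using assms by (simp add: basis_of_def representation_scale)
  have w1: "\<bar>?R (w n) b\<bar> \<le> 1" if "b : B" for n b
   using s[OF that, of n] spos0[of n] by (simp add: Rw)
  have wn: "norm (w n) \<le> 1 / (real n + 1)" for n
   using spos[of n] spos0[of n] by (simp add: w_def field_simps)
  have wmax: "EX b:B. \<bar>?R (w n) b\<bar> = 1" for n
  proof -
   have "B ~= {}" using v by blast
   then have "s n : (%b. \<bar>?R (v n) b\<bar>) ` B" unfolding s_def using fin by (intro Max_in) auto
   then show ?thesis using spos0[of n] by (auto simp: Rw)
  qed
  obtain l r where r: "strict_mono (r::nat=>nat)"
   and l: "!!b. b : B ==> (%n. ?R (w (r n)) b) ----> l b"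
   by (rule coefficient_subseq[OF fin, of "%n. ?R (w n)" 1]) (use w1 in auto)
  have "(%n. \<Sum>b\<in>B. ?R (w (r n)) b *. b) ----> (\<Sum>b\<in>B. l b *. b)"
   by (intro tendsto_intros l)
  then have lim: "(%n. w (r n)) ----> (\<Sum>b\<in>B. l b *. b)"
   by (simp add: basis_sum[OF assms])
  have "w ----> 0"
  proof (rule Lim_null_comparison)
   show "\<forall>\<^sub>F n in sequentially. norm (w n) \<le> 1 / (real n + 1)" using wn by simp
   show "(%n. 1 / (real n + 1)) ----> 0"
    using LIMSEQ_inverse_real_of_nat by (simp add: field_simps inverse_eq_divide)
  qed
  then have "(%n. w (r n)) ----> 0" using LIMSEQ_subseq_LIMSEQ[OF _ r] by (simp add: o_def)
  then have "(\<Sum>b\<in>B. l b *. b) = 0" using lim LIMSEQ_unique by blast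
  then have l0: "l b = 0" if "b : B" for b
   using that assms unfolding basis_of_def independent_explicit_module by (metis order_refl)
  have "(%n. \<Sum>b\<in>B. \<bar>?R (w (r n)) b\<bar>) ----> (\<Sum>b\<in>B. \<bar>l b\<bar>)"
   by (intro tendsto_intros l)
  then have lim0: "(%n. \<Sum>b\<in>B. \<bar>?R (w (r n)) b\<bar>) ----> 0" using l0 by simp
  have "1 \<le> (\<Sum>b\<in>B. \<bar>?R (w (r n)) b\<bar>)" for n
  proof -
   obtain b where b: "b : B" "\<bar>?R (w (r n)) b\<bar> = 1" using wmax by blast
   then show ?thesis using member_le_sum[of b B "%b. \<bar>?R (w (r n)) b\<bar>"] fin by auto
  qed
  then have "1 \<le> (0::real)" using LIMSEQ_le_const[OF lim0] by blast
  then show False by simp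
 qed
 then obtain C where C: "C > 0" "ALL v. ALL b:B. \<bar>?R v b\<bar> \<le> C * norm v" by blast
 have "\<bar>?R v b\<bar> \<le> C * norm v" for v b
  using C representation_ne_zero[of B v b] by (cases "b : B") (force)+
 then show ?thesis using that C by blast
qed

lemma fd_bounded_linear:
 fixes f :: "'a::real_normed_vector => 'b::real_normed_vector"
 assumes "findim TYPE('a)" "linear f"
 shows "bounded_linear f"
proof -
 obtain B :: "'a set" where B: "basis_of B"
  using findim_basis[OF assms(1)] unfolding basis_of_def by metis
 obtain C where C: "C > 0" "!!v b. \<bar>representation B v b\<bar> \<le> C * norm v"
  using coefficient_bound[OF B] by blast
 have "norm (f v) \<le> norm v * (C * (\<Sum>b\<in>B. norm (f b)))" for v
 proof -
  have "norm (f v) \<le> (\<Sum>b\<in>B. norm (representation B v b *. f b))"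
   unfolding linear_basis_sum[OF B assms(2), of v] by (rule norm_sum)
  also have "... \<le> (\<Sum>b\<in>B. C * norm v * norm (f b))"
   by (intro sum_mono) (simp add: C mult_right_mono)
  finally show ?thesis by (simp add: sum_distrib_left mult_ac)
 qed
 then show ?thesis using assms(2) unfolding bounded_linear_def bounded_linear_axioms_def by blast
qed

lemma compact_cball_fd:
 fixes x :: "'a::real_normed_vector"
 assumes "findim TYPE('a)"
 shows "compact (cball x r)"
proof -
 obtain B :: "'a set" where B: "basis_of B"
  using findim_basis[OF assms(1)] unfolding basis_of_def by metis
 then have fin: "finite B" by (simp add: basis_of_def)
 obtain C where C: "C > 0" "!!v b. \<bar>representation B v b\<bar> \<le> C * norm v"
  using coefficient_bound[OF B] by blast
 show ?thesis unfolding compact_eq_seq_compact_metric seq_compact_def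
 proof (intro allI impI)
  fix f :: "nat => 'a" assume f: "ALL n. f n : cball x r"
  have "\<bar>representation B (f n) b\<bar> \<le> C * (norm x + r)" for n b
  proof -
   have "norm (f n) \<le> norm x + r"
    using f[rule_format, of n] norm_triangle_sub[of "f n" x] by (simp add: dist_norm norm_minus_commute)
   then show ?thesis using C by (meson mult_left_mono order_trans less_imp_le)
  qed
  then obtain l q where q: "strict_mono (q::nat=>nat)"
   and l: "!!b. b : B ==> (%n. representation B (f (q n)) b) ----> l b"
   by (rule coefficient_subseq[OF fin, of "%n. representation B (f n)" "C * (norm x + r)"]) auto
  have "(%n. \<Sum>b\<in>B. representation B (f (q n)) b *. b) ----> (\<Sum>b\<in>B. l b *. b)"
   by (intro tendsto_intros l)
  then have lim: "(f o q) ----> (\<Sum>b\<in>B. l b *. b)"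
   by (simp add: basis_sum[OF B] o_def)
  moreover have "(\<Sum>b\<in>B. l b *. b) : cball x r"
   by (rule closed_sequentially[OF closed_cball _ lim]) (use f in auto)
  ultimately show "EX l:cball x r. EX q. strict_mono (q::nat=>nat) & (f o q) ----> l" using q by blast
 qed
qed

lemma finite_dim_injective_inverse:
 fixes f :: "'a::real_vector => 'a"
 assumes "findim TYPE('a)" "linear f" "!!x. f x = 0 ==> x = 0"
 obtains g where "linear g" "!!x. g (f x) = x" "!!x. f (g x) = x"
proof -
 obtain B :: "'a set" where B: "finite B" "independent B" "span B = UNIV"
  using findim_basis[OF assms(1)] by metis
 \<comment> \<open>The explicit basis makes the library theory of finite-dimensional spaces
   available, in particular that an injective endomorphism is surjective.\<close>
 interpret fd: finite_dimensional_vector_space "(*\<^sub>R)" B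
  by unfold_locales (use B in \<open>auto simp: dependent_raw_def span_raw_def\<close>)
 have inj: "inj f" using assms(2,3) linear_injective_0 by blast
 have surj: "surj f"
  using fd.linear_inj_imp_surj[of f] inj assms(2) by (simp add: linear_def)
 obtain g where g: "linear g" "g o f = id"
  using linear_injective_left_inverse[OF assms(2) inj] by blast
 then have gf: "g (f x) = x" for x by (metis comp_eq_dest_lhs id_apply)
 then have "f (g x) = x" for x using surj by (metis surjD)
 then show ?thesis using that g gf by blast
qed

lemma finite_dim_closed_subspace:
 fixes S :: "'a::real_normed_vector set"
 assumes "findim TYPE('a)" "linear p" "!!x. x : S \<longleftrightarrow> p x = (0::'b::real_normed_vector)"
 shows "closed S"
proof -
 have "continuous_on UNIV p"
  using fd_bounded_linear[OF assms(1,2)] by (simp add: linear_continuous_on)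
 moreover have "S = p -` {0}" using assms(3) by auto
 ultimately show ?thesis by (simp add: closed_vimage)
qed

text \<open>Addition is injective on A \<times> B because the intersection is trivial. A linear left
  inverse, extended to the whole space, has the projection as its first component.\<close>

lemma exists_projection:
 fixes A B :: "'a::real_vector set"
 assumes "subspace A" "subspace B" "A Int B \<subseteq> {0}"
 obtains p where "linear p" "range p \<subseteq> A" "!!x. x : A ==> p x = x" "!!x. x : B ==> p x = 0"
proof -
 let ?s = "%(a, b). a + b :: 'a"
 have lin: "linear ?s" by (auto intro!: linearI simp: scaleR_add_right)
 have inj: "inj_on ?s (A \<times> B)"
 proof (rule inj_onI)
  fix x y assume xy: "x : A \<times> B" "y : A \<times> B" "?s x = ?s y"
  then have "fst x - fst y = snd y - snd x" by (auto simp: algebra_simps split: prod.splits)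
  moreover have "fst x - fst y : A" "snd y - snd x : B"
   using xy assms subspace_diff by auto
  ultimately have "fst x - fst y = 0" "snd y - snd x = 0" using assms(3) by auto
  then show "x = y" by (simp add: prod_eq_iff)
 qed
 obtain g where g: "range g \<subseteq> A \<times> B" "linear g" "ALL v:A \<times> B. g (?s v) = v"
  using linear_exists_left_inverse_on[OF lin subspace_Times[OF assms(1,2)] inj] by blast
 show ?thesis
 proof
  show "linear (fst o g)" using linear_compose[OF g(2) linear_fst] .
  show "range (fst o g) \<subseteq> A" using g(1) by (auto simp: mem_Times_iff)
  show "(fst o g) x = x" if "x : A" for x
   using g(3)[rule_format, of "(x, 0)"] that assms(2) by (simp add: subspace_0)
  show "(fst o g) x = 0" if "x : B" for x
   using g(3)[rule_format, of "(0, x)"] that assms(1) by (simp add: subspace_0)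
 qed
qed


section \<open>Iterated derivatives\<close>

lemma Ck_on_subset: "Ck_on k S f ==> T \<subseteq> S ==> Ck_on k T f"
 by (induction k arbitrary: f) (auto intro: continuous_on_subset)

lemma Ck_on_cong:
 assumes "open S" "!!x. x : S ==> f x = g x" "Ck_on k S f"
 shows "Ck_on k S g"
 using assms(2,3)
proof (induction k arbitrary: f g)
 case 0
 then show ?case by (metis Ck_on.simps(1) continuous_on_cong)
next
 case (Suc k)
 have fd: "f differentiable (at x)" if "x : S" for x using Suc.prems that by simp
 have gd: "g differentiable (at x)" if "x : S" for x
  unfolding differentiable_def
  by (meson has_derivative_transform_within_open assms(1) that Suc.prems(1) fd differentiable_def)
 have eq: "FD f x = FD g x" if "x : S" for x
  by (rule frechet_derivative_transform_within_open[OF fd[OF that] assms(1) that Suc.prems(1)])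
 have "Ck_on k S (%x. FD g x v)" for v
  by (rule Suc.IH[of "%x. FD f x v"]) (use eq Suc.prems in auto)
 then show ?case using gd by simp
qed

lemma Ck_on_SucD: "Ck_on (Suc k) S f ==> Ck_on k S f"
proof (induction k arbitrary: f)
 case 0
 then show ?case
  by (simp add: continuous_at_imp_continuous_on differentiable_imp_continuous_within)
next
 case (Suc k)
 then show ?case by (metis Ck_on.simps(2))
qed

lemma Ck_on_mono: "Ck_on k S f ==> j \<le> k ==> Ck_on j S f"
 by (induction k) (auto simp: le_Suc_eq dest: Ck_on_SucD simp del: Ck_on.simps)

lemma Ck_on_continuous: "Ck_on k S f ==> continuous_on S f"
 using Ck_on_mono[of k S f 0] by simp

text \<open>The induction step of the C^k proofs below: any explicit formula for the derivative may
  stand in for \<open>frechet_derivative\<close>.\<close>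

lemma Ck_on_SucI:
 assumes "open S" "!!x. x : S ==> (f has_derivative f' x) (at x)" "!!v. Ck_on k S (%x. f' x v)"
 shows "Ck_on (Suc k) S f"
proof -
 have eq: "FD f x = f' x" if "x : S" for x
  using frechet_derivative_at[OF assms(2)[OF that]] by simp
 have "Ck_on k S (%x. FD f x v)" for v
  by (rule Ck_on_cong[OF assms(1) _ assms(3)[of v]]) (simp add: eq)
 moreover have "ALL x:S. f differentiable (at x)" using assms(2) differentiable_def by blast
 ultimately show ?thesis by simp
qed

lemma Ck_has_deriv:
 "Ck_on (Suc k) S f ==> x : S ==> (f has_derivative FD f x) (at x)"
 by (simp add: frechet_derivative_works)

lemma Ck_on_const: "open S ==> Ck_on k S (%x. c)"
proof (induction k arbitrary: c)
 case (Suc k)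
 show ?case by (rule Ck_on_SucI[where f' = "%x v. 0"]) (use Suc in auto)
qed simp

lemma Ck_bounded_linear: "open S ==> bounded_linear L ==> Ck_on k S L"
proof (induction k)
 case 0 then show ?case by (simp add: linear_continuous_on)
next
 case (Suc k)
 show ?case
  by (rule Ck_on_SucI[where f' = "%x. L"])
   (use Suc in \<open>auto intro: bounded_linear_imp_has_derivative Ck_on_const\<close>)
qed

lemma Ck_on_linear_compose:
 assumes "open S" "bounded_linear L" "Ck_on k S f"
 shows "Ck_on k S (%x. L (f x))"
 using assms(3)
proof (induction k arbitrary: f)
 case 0 then show ?case
  using bounded_linear.continuous_on[OF assms(2), of S f] by simp
next
 case (Suc k)
 show ?case
 proof (rule Ck_on_SucI[OF assms(1)])
  show "((%x. L (f x)) has_derivative (%v. L (FD f x v))) (at x)" if "x : S" for x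
   by (rule bounded_linear.has_derivative[OF assms(2) Ck_has_deriv[OF Suc.prems that]])
  show "Ck_on k S (%x. L (FD f x v))" for v
   using Suc by simp
 qed
qed

lemma Ck_on_add:
 assumes "open S" "Ck_on k S f" "Ck_on k S g"
 shows "Ck_on k S (%x. f x + g x)"
 using assms(2,3)
proof (induction k arbitrary: f g)
 case 0 then show ?case by (simp add: continuous_on_add)
next
 case (Suc k)
 show ?case
 proof (rule Ck_on_SucI[OF assms(1)])
  show "((%x. f x + g x) has_derivative (%v. FD f x v + FD g x v)) (at x)"
   if "x : S" for x
   using Suc.prems that by (intro has_derivative_add Ck_has_deriv)
  show "Ck_on k S (%x. FD f x v + FD g x v)" for v
   using Suc by simp
 qed
qed

lemma Ck_on_sum:
 assumes "open S" "!!i. i : I ==> Ck_on k S (f i)"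
 shows "Ck_on k S (%x. \<Sum>i\<in>I. f i x)"
 using assms(2)
 by (induction I rule: infinite_finite_induct) (auto simp: Ck_on_const Ck_on_add assms(1) simp del: Ck_on.simps)

lemma Ck_on_bilinear:
 assumes "open S" "bounded_bilinear B" "Ck_on k S f" "Ck_on k S g"
 shows "Ck_on k S (%x. B (f x) (g x))"
 using assms(3,4)
proof (induction k arbitrary: f g)
 case 0 then show ?case
  using bounded_bilinear.continuous_on[OF assms(2), of S f g] by simp
next
 case (Suc k)
 let ?f = "%x. FD f x" and ?g = "%x. FD g x"
 show ?case
 proof (rule Ck_on_SucI[OF assms(1)])
  show "((%x. B (f x) (g x)) has_derivative (%v. B (f x) (?g x v) + B (?f x v) (g x))) (at x)" if "x : S" for x
   by (rule bounded_bilinear.FDERIV[OF assms(2)]) (use Suc.prems that in \<open>auto simp: frechet_derivative_works\<close>)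
  have "Ck_on k S (%x. B (f x) (?g x v))" "Ck_on k S (%x. B (?f x v) (g x))" for v
   using Suc.prems by (auto intro!: Suc.IH dest: Ck_on_SucD simp del: Ck_on.simps) auto
  then show "Ck_on k S (%x. B (f x) (?g x v) + B (?f x v) (g x))" for v
   using Ck_on_add[OF assms(1)] by blast
 qed
qed

lemma Ck_on_Pair:
 assumes "open S" "Ck_on k S f" "Ck_on k S g"
 shows "Ck_on k S (%x. (f x, g x))"
proof -
 have "Ck_on k S (%x. (f x, 0) + (0, g x))"
  by (intro Ck_on_add assms Ck_on_linear_compose[of S "%a. (a, 0)"] Ck_on_linear_compose[of S "%a. (0, a)"]
    bounded_linear_Pair bounded_linear_zero bounded_linear_ident)
 then show ?thesis by simp
qed

text \<open>\<open>Ck_on\<close> controls derivatives only in fixed directions, whereas the chain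
  rule evaluates the outer derivative in the moving direction given by the inner one. Expanding that
  direction in a basis of the middle space turns the chain rule into a finite sum of products to
  which the induction applies; hence finite dimension is asked of the middle space.\<close>

lemma Ck_on_compose:
 fixes f :: "'a::real_normed_vector => 'b::real_normed_vector" and g :: "'b => 'c::real_normed_vector"
 assumes fd: "findim TYPE('b)" and S: "open S" and "Ck_on k T g" "Ck_on k S f" "f ` S \<subseteq> T"
 shows "Ck_on k S (%x. g (f x))"
 using assms(3,4)
proof (induction k arbitrary: g)
 case 0
 then show ?case using assms(5) continuous_on_compose2[of T g S f] by simp
next
 case (Suc k)
 obtain B :: "'b set" where B: "basis_of B"
  using findim_basis[OF fd] unfolding basis_of_def by metis
 let ?f = "%x. FD f x" and ?g = "%y. FD g y"
 have lin: "bounded_linear (%v. representation B v b)" for b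
  by (rule fd_bounded_linear[OF fd linear_rep[OF B]])
 show ?case
 proof (rule Ck_on_SucI[OF S])
  fix x assume x: "x : S"
  have f: "(f has_derivative ?f x) (at x)" using Suc.prems x Ck_has_deriv by blast
  have g: "(g has_derivative ?g (f x)) (at (f x))"
   using Suc.prems x assms(5) Ck_has_deriv by blast
  have "linear (?g (f x))" using g has_derivative_linear by blast
  then have "(%v. ?g (f x) (?f x v)) = (%v. \<Sum>b\<in>B. representation B (?f x v) b *. ?g (f x) b)"
   using linear_basis_sum[OF B] by blast
  then show "((%x. g (f x)) has_derivative (%v. \<Sum>b\<in>B. representation B (?f x v) b *. ?g (f x) b)) (at x)"
   using has_derivative_compose[OF f g] by simp
 next
  fix v
  show "Ck_on k S (%x. \<Sum>b\<in>B. representation B (?f x v) b *. ?g (f x) b)"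
  proof (intro Ck_on_sum[OF S] Ck_on_bilinear[OF S bounded_bilinear_scaleR])
   fix b
   show "Ck_on k S (%x. representation B (?f x v) b)"
    using Suc.prems(2) by (intro Ck_on_linear_compose[OF S lin]) simp
   show "Ck_on k S (%x. ?g (f x) b)"
    using Suc.IH[of "%y. ?g y b"] Suc.prems Ck_on_SucD by auto
  qed
 qed
qed

lemma Ck_on_local:
 assumes "!!x. x : S ==> EX T. open T & x : T & Ck_on k T f"
 shows "Ck_on k S f"
 using assms
proof (induction k arbitrary: f)
 case 0
 show ?case unfolding Ck_on.simps
 proof (rule continuous_at_imp_continuous_on, rule ballI)
  fix x assume "x : S"
  then obtain T where "open T" "x : T" "continuous_on T f" using 0 by auto
  then show "continuous (at x) f" using continuous_on_eq_continuous_at by blast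
 qed
next
 case (Suc k)
 have "Ck_on k S (%x. FD f x v)" for v
  by (rule Suc.IH) (use Suc.prems in \<open>metis Ck_on.simps(2)\<close>)
 moreover have "f differentiable (at x)" if "x : S" for x
  using Suc.prems[OF that] by auto
 ultimately show ?case by simp
qed


section \<open>Neighbourhood filters in abstract topologies\<close>

lemma ev_nhdsinI:
 "openin X S ==> a : S ==> (!!x. x : S ==> P x) ==> eventually P (nhdsin X a)"
 unfolding eventually_nhdsin by blast

lemma ev_nhdsinE:
 assumes "eventually P (nhdsin X a)" "a : topspace X"
 obtains S where "openin X S" "a : S" "!!x. x : S ==> P x"
 using assms unfolding eventually_nhdsin by blast

lemma nhdsin_euclidean [simp]: "nhdsin euclidean a = nhds a"
 by (rule filter_eqI) (simp add: eventually_nhdsin eventually_nhds)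

lemma nhdsin_prod:
 assumes "a : topspace X" "b : topspace Y"
 shows "nhdsin (prod_topology X Y) (a, b) = nhdsin X a \<times>\<^sub>F nhdsin Y b"
proof (rule filter_eqI)
 fix P
 show "eventually P (nhdsin (prod_topology X Y) (a, b)) \<longleftrightarrow> eventually P (nhdsin X a \<times>\<^sub>F nhdsin Y b)"
 proof
  assume "eventually P (nhdsin (prod_topology X Y) (a, b))"
  then obtain S where S: "openin (prod_topology X Y) S" "(a,b) : S" "!!x. x : S ==> P x"
   by (rule ev_nhdsinE) (use assms that in auto)
  then obtain U V where "openin X U" "openin Y V" "a : U" "b : V" "U \<times> V \<subseteq> S"
   unfolding openin_prod_topology_alt by metis
  then show "eventually P (nhdsin X a \<times>\<^sub>F nhdsin Y b)"
   unfolding eventually_prod_filter using S(3)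
   by (intro exI[of _ "%x. x : U"] exI[of _ "%x. x : V"]) (auto intro: ev_nhdsinI)
 next
  assume "eventually P (nhdsin X a \<times>\<^sub>F nhdsin Y b)"
  then obtain Pf Pg where Pf: "eventually Pf (nhdsin X a)" and Pg: "eventually Pg (nhdsin Y b)"
   and PP: "!!x y. Pf x ==> Pg y ==> P (x, y)"
   unfolding eventually_prod_filter by metis
  obtain U where U: "openin X U" "a : U" "!!x. x : U ==> Pf x" by (rule ev_nhdsinE[OF Pf assms(1)]) (rule that)
  obtain V where V: "openin Y V" "b : V" "!!x. x : V ==> Pg x" by (rule ev_nhdsinE[OF Pg assms(2)]) (rule that)
  show "eventually P (nhdsin (prod_topology X Y) (a, b))"
   using U V PP by (intro ev_nhdsinI[of _ "U \<times> V"]) (auto simp: openin_prod_Times_iff)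
 qed
qed

lemma nhdsin_subtop:
 assumes "openin X U" "a : U"
 shows "nhdsin (subtopology X U) a = nhdsin X a"
proof (rule filter_eqI)
 fix P
 have "a : topspace X" "a : topspace (subtopology X U)"
  using assms openin_subset[OF assms(1)] by (auto simp: topspace_subtopology)
 then show "eventually P (nhdsin (subtopology X U) a) \<longleftrightarrow> eventually P (nhdsin X a)"
  using assms unfolding eventually_nhdsin openin_open_subtopology[OF assms(1)]
  by (metis (no_types, lifting) Int_iff inf_le2 openin_Int)
qed

lemma ev_nhdsin:
 "openin X U ==> a : U ==> eventually (%x. x : U) (nhdsin X a)"
 by (rule ev_nhdsinI)

lemma ev_topspace: "eventually (%x. x : topspace X) (nhdsin X a)"
 by (auto simp: eventually_nhdsin)

lemma cont_filterlim:
 assumes "continuous_map X Y f" "a : topspace X"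
 shows "filterlim f (nhdsin Y (f a)) (nhdsin X a)"
 unfolding filterlim_iff
proof (intro allI impI)
 fix P assume "eventually P (nhdsin Y (f a))"
 moreover have "f a : topspace Y" using assms continuous_map_image_subset_topspace by blast
 ultimately obtain S where S: "openin Y S" "f a : S" "!!y. y : S ==> P y"
  by (rule ev_nhdsinE) (rule that)
 have "openin X {x : topspace X. f x : S}" using assms S openin_continuous_map_preimage by blast
 then show "eventually (%x. P (f x)) (nhdsin X a)"
  by (rule ev_nhdsinI) (use assms S in auto)
qed

lemma cont_iff_filterlim:
 "continuous_map X Y f \<longleftrightarrow>
  f ` topspace X \<subseteq> topspace Y & (ALL a:topspace X. filterlim f (nhdsin Y (f a)) (nhdsin X a))"
proof
 assume R: "f ` topspace X \<subseteq> topspace Y & (ALL a:topspace X. filterlim f (nhdsin Y (f a)) (nhdsin X a))"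
 show "continuous_map X Y f"
  unfolding continuous_map_eq_topcontinuous_at topcontinuous_at_def
 proof (intro ballI conjI allI impI)
  fix a V assume a: "a : topspace X" and V: "openin Y V & f a : V"
  then have "eventually (%x. f x : V) (nhdsin X a)"
   using R ev_nhdsin[of Y V "f a"] by (auto simp: filterlim_iff)
  then show "EX U. openin X U & a : U & (ALL y:U. f y : V)"
   using a unfolding eventually_nhdsin by blast
 next
  show "f : topspace X \<rightarrow> topspace Y" if "a : topspace X" for a using R by blast
 qed (use R in blast)
next
 assume "continuous_map X Y f"
 from cont_filterlim[OF this] continuous_map_image_subset_topspace[OF this]
 show "f ` topspace X \<subseteq> topspace Y & (ALL a:topspace X. filterlim f (nhdsin Y (f a)) (nhdsin X a))"
  by simp
qed

lemma continuous_map_euclidean_iff_tendsto: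
 "continuous_map X euclidean f \<longleftrightarrow> (ALL a:topspace X. (f ---> f a) (nhdsin X a))"
 by (simp add: cont_iff_filterlim)

text \<open>The tube lemma in filter form. A property that holds eventually near each point of a
  compact set holds eventually for all of its points simultaneously.\<close>

lemma compactin_ev:
 assumes "compactin X K" "!!k. k : K ==> eventually (%(x, y). P x y) (nhdsin X k \<times>\<^sub>F F)"
 shows "eventually (%y. ALL k:K. P k y) F"
proof -
 have "EX U Q. openin X U & k : U & eventually Q F & (ALL x y. x : U --> Q y --> P x y)" if k: "k : K" for k
 proof -
  have kX: "k : topspace X" using k assms(1) compactin_subset_topspace by blast
  obtain R Q where R: "eventually R (nhdsin X k)" and Q: "eventually Q F"
   and PP: "!!x y. R x ==> Q y ==> P x y"
   using assms(2)[OF k] unfolding eventually_prod_filter by auto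
  obtain U where "openin X U" "k : U" "!!x. x : U ==> R x"
   by (rule ev_nhdsinE[OF R kX]) (rule that)
  then show ?thesis using Q PP by blast
 qed
 then obtain U Q where U: "!!k. k : K ==> openin X (U k)" "!!k. k : K ==> k : U k"
  and Q: "!!k. k : K ==> eventually (Q k) F"
  and P: "!!k x y. k : K ==> x : U k ==> Q k y ==> P x y" by metis
 obtain \<F> where "finite \<F>" "\<F> \<subseteq> U ` K" "K \<subseteq> \<Union>\<F>"
  using compactinD[OF assms(1), of "U ` K"] U by blast
 then obtain K' where K': "finite K'" "K' \<subseteq> K" "K \<subseteq> \<Union>(U ` K')" by (metis finite_subset_image)
 have "eventually (%y. ALL k:K'. Q k y) F"
  using K' Q by (subst eventually_ball_finite_distrib) auto
 then show ?thesis
  by (rule eventually_mono) (use K' P in blast)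
qed

text \<open>Pointwise convergence on the finitely many basis vectors already controls the operator
  norm.\<close>

lemma linear_family_uniform:
 fixes L :: "'z => 'a::real_normed_vector => 'b::real_normed_vector"
 assumes "findim TYPE('a)" "eventually (%z. linear (L z)) F" "linear L0"
  and "!!v. ((%z. L z v) ---> L0 v) F" "e > 0"
 shows "eventually (%z. ALL v. norm (L z v - L0 v) \<le> e * norm v) F"
proof -
 obtain B :: "'a set" where B: "basis_of B"
  using findim_basis[OF assms(1)] unfolding basis_of_def by metis
 obtain C where C: "C > 0" "!!v b. \<bar>representation B v b\<bar> \<le> C * norm v"
  using coefficient_bound[OF B] by blast
 \<comment> \<open>Each basis vector contributes at most C * d * norm v; the 1 avoids division by
   zero for an empty basis.\<close>
 define d where "d = e / (C * (real (card B) + 1))"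
 have d: "d > 0" using assms(5) C by (simp add: d_def)
 have "real (card B) + 1 ~= 0" by linarith
 then have dC: "d * (C * (real (card B) + 1)) = e" using C(1) by (simp add: d_def)
 have "eventually (%z. ALL b:B. norm (L z b - L0 b) < d) F"
 proof (subst eventually_ball_finite_distrib)
  show "finite B" using B by (simp add: basis_of_def)
  show "ALL b:B. eventually (%z. norm (L z b - L0 b) < d) F"
   using assms(4) d tendstoD by (fastforce simp: dist_norm)
 qed
 with assms(2) show ?thesis
 proof eventually_elim
  case (elim z)
  show ?case
  proof
   fix v
   have "linear (%v. L z v - L0 v)" using elim(1) assms(3) by (rule linear_compose_sub)
   from linear_basis_sum[OF B this, of v]
   have "norm (L z v - L0 v) = norm (\<Sum>b\<in>B. representation B v b *. (L z b - L0 b))" by simp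
   also have "... \<le> (\<Sum>b\<in>B. norm (representation B v b *. (L z b - L0 b)))" by (rule norm_sum)
   also have "... \<le> (\<Sum>b\<in>B. (C * norm v) * d)"
    unfolding norm_scaleR using C d elim(2)
    by (intro sum_mono mult_mono) (auto simp: less_imp_le)
   also have "... = real (card B) * (C * norm v) * d" by simp
   also have "... \<le> (real (card B) + 1) * (C * norm v) * d"
    using C d by (intro mult_right_mono) auto
   also have "... = d * (C * (real (card B) + 1)) * norm v" by (simp add: algebra_simps)
   also have "... = e * norm v" by (simp only: dC)
   finally show "norm (L z v - L0 v) \<le> e * norm v" .
  qed
 qed
qed

text \<open>Joint continuity of evaluation: after expanding the moving argument in a basis only
  finitely many pointwise limits remain.\<close>

lemma lin_family_tendsto:
 fixes L :: "'z => 'a::real_normed_vector => 'b::real_normed_vector"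
 assumes "findim TYPE('a)" "eventually (%z. linear (L z)) F" "linear L0"
  and "!!v. ((%z. L z v) ---> L0 v) F" "(w ---> w0) F"
 shows "((%z. L z (w z)) ---> L0 w0) F"
proof -
 obtain B :: "'a set" where B: "basis_of B"
  using findim_basis[OF assms(1)] unfolding basis_of_def by metis
 have lin: "bounded_linear (%v. representation B v b)" for b
  by (rule fd_bounded_linear[OF assms(1) linear_rep[OF B]])
 have "((%z. \<Sum>b\<in>B. representation B (w z) b *. L z b) ---> (\<Sum>b\<in>B. representation B w0 b *. L0 b)) F"
  by (intro tendsto_sum tendsto_scaleR bounded_linear.tendsto[OF lin] assms)
 then have "((%z. \<Sum>b\<in>B. representation B (w z) b *. L z b) ---> L0 w0) F"
  by (simp add: linear_basis_sum[OF B assms(3), of w0])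
 moreover have "eventually (%z. (\<Sum>b\<in>B. representation B (w z) b *. L z b) = L z (w z)) F"
  using assms(2) by (rule eventually_mono) (rule linear_basis_sum[OF B, symmetric])
 ultimately show ?thesis by (rule Lim_transform_eventually)
qed


section \<open>Charts and smooth maps\<close>

definition atlas_ok :: "('a, 'e::real_normed_vector) smooth_space => bool" where
 "atlas_ok M \<longleftrightarrow> findim TYPE('e) & \<Union>(fst ` atlas M) = points M &
   (ALL (U, \<phi>) : atlas M. openin (top_of M) U & open (\<phi> ` U) &
    homeomorphic_map (subtopology (top_of M) U) (top_of_set (\<phi> ` U)) \<phi>) &
   (ALL (U, \<phi>) : atlas M. ALL (V, \<psi>) : atlas M. smooth_on (\<phi> ` (U Int V)) (\<psi> o inv_into U \<phi>))"

lemma smooth_manifold_atlas_ok: "smooth_manifold M ==> atlas_ok M"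
 by (simp add: smooth_manifold_def atlas_ok_def findim_def)

context
 fixes M :: "('a, 'e::real_normed_vector) smooth_space"
 assumes M: "atlas_ok M"
begin

lemma ok_findim: "findim TYPE('e)"
 using M by (simp add: atlas_ok_def)

lemma chart_ex:
 assumes "x : points M"
 obtains U \<phi> where "(U, \<phi>) : atlas M" "x : U"
proof -
 have "x : \<Union>(fst ` atlas M)" using assms M by (simp add: atlas_ok_def)
 then show ?thesis using that by (metis UN_E prod.collapse)
qed

lemma chart_at_atlas:
 assumes "x : points M"
 shows "chart_at M x : atlas M" "x : fst (chart_at M x)"
proof -
 have "EX c. c : atlas M & x : fst c" using chart_ex[OF assms] by (metis fst_conv)
 from someI_ex[OF this] show "chart_at M x : atlas M" "x : fst (chart_at M x)"
  by (simp_all add: chart_at_def)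
qed

context
 fixes U \<phi>
 assumes U: "(U, \<phi>) : atlas M"
begin

lemma chart_openin: "openin (top_of M) U" and chart_open_image_dom: "open (\<phi> ` U)"
 and chart_homeomorphic: "homeomorphic_map (subtopology (top_of M) U) (top_of_set (\<phi> ` U)) \<phi>"
 using M U by (auto simp: atlas_ok_def)

lemma chart_subset: "U \<subseteq> points M"
 using chart_openin openin_subset by blast

lemma chart_inj: "inj_on \<phi> U"
 using chart_homeomorphic homeomorphic_imp_injective_map chart_subset
 by (metis inf.absorb_iff2 topspace_subtopology)

lemma chart_inv [simp]: "x : U ==> inv_into U \<phi> (\<phi> x) = x"
 using chart_inj by simp

lemma chart_open_image:
 assumes "openin (top_of M) S" "S \<subseteq> U"
 shows "open (\<phi> ` S)"
proof -
 have "openin (subtopology (top_of M) U) S" using assms chart_openin openin_open_subtopology by blast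
 then have "openin (top_of_set (\<phi> ` U)) (\<phi> ` S)"
  using chart_homeomorphic homeomorphic_map_openness_eq by blast
 then show ?thesis using chart_open_image_dom openin_open_trans by blast
qed

lemma chart_tendsto:
 assumes "x : U"
 shows "(\<phi> ---> \<phi> x) (nhdsin (top_of M) x)"
proof -
 have "continuous_map (subtopology (top_of M) U) euclidean \<phi>"
  using chart_homeomorphic homeomorphic_imp_continuous_map continuous_map_in_subtopology by blast
 then have "(\<phi> ---> \<phi> x) (nhdsin (subtopology (top_of M) U) x)"
  unfolding continuous_map_euclidean_iff_tendsto using assms chart_subset by auto
 then show ?thesis using nhdsin_subtop[OF chart_openin assms] by simp
qed

lemma chart_inv_filterlim:
 assumes "x : U"
 shows "filterlim (inv_into U \<phi>) (nhdsin (top_of M) x) (nhds (\<phi> x))"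
 unfolding filterlim_iff
proof (intro allI impI)
 fix P assume P: "eventually P (nhdsin (top_of M) x)"
 have x: "x : points M" using assms chart_subset by blast
 obtain S where S: "openin (top_of M) S" "x : S" "!!y. y : S ==> P y"
  by (rule ev_nhdsinE[OF P x]) (rule that)
 have "open (\<phi> ` (S Int U))" using S chart_openin by (intro chart_open_image) auto
 moreover have "\<phi> x : \<phi> ` (S Int U)" using S assms by blast
 moreover have "P (inv_into U \<phi> y)" if "y : \<phi> ` (S Int U)" for y using that S(3) by auto
 ultimately show "eventually (%y. P (inv_into U \<phi> y)) (nhds (\<phi> x))"
  unfolding eventually_nhds by blast
qed

end

lemma chart_transition:
 assumes "(U, \<phi>) : atlas M" "(V, \<psi>) : atlas M"
 shows "Ck_on k (\<phi> ` (U Int V)) (\<psi> o inv_into U \<phi>)"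
 using M assms by (fastforce simp: atlas_ok_def smooth_on_def)

end

lemma smooth_cont: "smooth_map M N f ==> continuous_map (top_of M) (top_of N) f"
 by (simp add: smooth_map_def)

lemma smooth_map_chart:
 "smooth_map M N f ==> (U, \<phi>) : atlas M ==> (V, \<psi>) : atlas N ==>
  Ck_on k (\<phi> ` (U Int f -` V)) (\<psi> o f o inv_into U \<phi>)"
 by (fastforce simp: smooth_map_def smooth_on_def)

definition local_Ck ::
 "nat => ('a, 'e::real_normed_vector) smooth_space => ('b, 'f::real_normed_vector) smooth_space => ('a => 'b) => 'a => bool" where
 "local_Ck k M N f x \<longleftrightarrow> (EX U \<phi> V \<psi> T. (U, \<phi>) : atlas M & (V, \<psi>) : atlas N &
   openin (top_of M) T & x : T & T \<subseteq> U & f ` T \<subseteq> V & Ck_on k (\<phi> ` T) (\<psi> o f o inv_into U \<phi>))"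

lemma local_CkI:
 "(U, \<phi>) : atlas M ==> (V, \<psi>) : atlas N ==> openin (top_of M) T ==> Ck_on k (\<phi> ` T) (\<psi> o f o inv_into U \<phi>) ==>
  x : T & T \<subseteq> U & f ` T \<subseteq> V ==> local_Ck k M N f x"
 unfolding local_Ck_def by blast

text \<open>Smoothness in one pair of charts around each point spreads to all pairs by inserting
  transition maps on both sides.\<close>

lemma smooth_mapI:
 fixes M :: "('a, 'e::real_normed_vector) smooth_space" and N :: "('b, 'f::real_normed_vector) smooth_space"
 assumes M: "atlas_ok M" and N: "atlas_ok N" and f: "continuous_map (top_of M) (top_of N) f"
  and loc: "!!x k. x : points M ==> local_Ck k M N f x"
 shows "smooth_map M N f"
proof -
 have "Ck_on k (\<phi>' ` (U' Int f -` V')) (\<psi>' o f o inv_into U' \<phi>')"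
  if U': "(U', \<phi>') : atlas M" and V': "(V', \<psi>') : atlas N" for U' \<phi>' V' \<psi>' k
 proof (rule Ck_on_local)
  fix y assume "y : \<phi>' ` (U' Int f -` V')"
  then obtain x where x: "y = \<phi>' x" "x : U'" "f x : V'" by auto
  have xM: "x : points M" using x chart_subset[OF M U'] by blast
  obtain U \<phi> V \<psi> T where U: "(U, \<phi>) : atlas M" and V: "(V, \<psi>) : atlas N"
   and T: "openin (top_of M) T" "x : T" "T \<subseteq> U" "f ` T \<subseteq> V"
   and C: "Ck_on k (\<phi> ` T) (\<psi> o f o inv_into U \<phi>)"
   using loc[OF xM, of k] unfolding local_Ck_def by blast
  define S where "S = T Int U' Int {x : points M. f x : V'}"
  have "openin (top_of M) {x : points M. f x : V'}"
   using openin_continuous_map_preimage[OF f chart_openin[OF N V']] .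
  then have S: "openin (top_of M) S" unfolding S_def using T(1) chart_openin[OF M U'] by blast
  have SU: "S \<subseteq> U'" "S \<subseteq> U" "S \<subseteq> T" using T by (auto simp: S_def)
  have oS: "open (\<phi>' ` S)" by (rule chart_open_image[OF M U' S SU(1)])
  have inv: "inv_into U' \<phi>' (\<phi>' z) = z" "inv_into U \<phi> (\<phi> z) = z" "inv_into V \<psi> (\<psi> (f z)) = f z"
   "z : T" "f z : V" "f z : V'" if "z : S" for z
   using that SU T(4) by (auto simp: chart_inv[OF M U'] chart_inv[OF M U] chart_inv[OF N V] S_def)
  let ?a = "\<phi> o inv_into U' \<phi>'" and ?b = "\<psi> o f o inv_into U \<phi>" and ?c = "\<psi>' o inv_into V \<psi>"
  have 1: "Ck_on k (\<phi>' ` S) ?a"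
   by (rule Ck_on_subset[OF chart_transition[OF M U' U]]) (use SU in auto)
  have 2: "Ck_on k (\<phi>' ` S) (%y. ?b (?a y))"
   by (rule Ck_on_compose[OF ok_findim[OF M] oS C 1])
    (auto simp: inv)
  have 3: "Ck_on k (\<phi>' ` S) (%y. ?c (?b (?a y)))"
   apply (rule Ck_on_compose[OF ok_findim[OF N] oS chart_transition[OF N V V', of k] 2])
   by (auto simp: inv)
  have "Ck_on k (\<phi>' ` S) (\<psi>' o f o inv_into U' \<phi>')"
   apply (rule Ck_on_cong[OF oS _ 3])
   by (auto simp: inv)
  moreover have "y : \<phi>' ` S" using x T xM by (auto simp: S_def)
  ultimately show "EX T. open T & y : T & Ck_on k T (\<psi>' o f o inv_into U' \<phi>')" using oS by blast
 qed
 then show ?thesis using f by (auto simp: smooth_map_def smooth_on_def)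
qed

lemma smooth_map_compose:
 assumes M: "atlas_ok M" and N: "atlas_ok N" and P: "atlas_ok P"
  and f: "smooth_map M N f" and g: "smooth_map N P g"
 shows "smooth_map M P (g o f)"
proof (rule smooth_mapI[OF M P])
 note fc = smooth_cont[OF f] and gc = smooth_cont[OF g]
 show "continuous_map (top_of M) (top_of P) (g o f)" using fc gc continuous_map_compose by blast
 fix x k assume x: "x : points M"
 then have fx: "f x : points N" and gfx: "g (f x) : points P"
  using continuous_map_image_subset_topspace[OF fc] continuous_map_image_subset_topspace[OF gc] by blast+
 obtain U \<phi> where U: "(U, \<phi>) : atlas M" "x : U" using chart_ex[OF M x] .
 obtain V \<psi> where V: "(V, \<psi>) : atlas N" "f x : V" using chart_ex[OF N fx] .
 obtain W \<theta> where W: "(W, \<theta>) : atlas P" "g (f x) : W" using chart_ex[OF P gfx] .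
 let ?T = "U Int {x : points M. f x : V} Int {x : points M. (g o f) x : W}"
 have T: "openin (top_of M) ?T"
  using openin_continuous_map_preimage[OF fc chart_openin[OF N V(1)]] chart_openin[OF M U(1)]
   openin_continuous_map_preimage[OF continuous_map_compose[OF fc gc] chart_openin[OF P W(1)]] by blast
 have o: "open (\<phi> ` ?T)" by (rule chart_open_image[OF M U(1) T]) auto
 let ?a = "\<psi> o f o inv_into U \<phi>" and ?b = "\<theta> o g o inv_into V \<psi>"
 have 1: "Ck_on k (\<phi> ` ?T) ?a"
  by (rule Ck_on_subset[OF smooth_map_chart[OF f U(1) V(1)]]) auto
 have 2: "Ck_on k (\<phi> ` ?T) (%y. ?b (?a y))"
  apply (rule Ck_on_compose[OF ok_findim[OF N] o smooth_map_chart[OF g V(1) W(1), of k] 1])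
  by (auto simp: chart_inv[OF M U(1)])
 have "Ck_on k (\<phi> ` ?T) (\<theta> o (g o f) o inv_into U \<phi>)"
  by (rule Ck_on_cong[OF o _ 2]) (auto simp: chart_inv[OF M U(1)] chart_inv[OF N V(1)])
 from local_CkI[OF U(1) W(1) T this] show "local_Ck k M P (g o f) x" using U V W x by auto
qed

lemma inv_into_map_prod:
 assumes "inj_on \<phi> U" "inj_on \<psi> V" "a : \<phi> ` U" "b : \<psi> ` V"
 shows "inv_into (U \<times> V) (map_prod \<phi> \<psi>) (a, b) = (inv_into U \<phi> a, inv_into V \<psi> b)"
proof -
 obtain x y where xy: "a = \<phi> x" "b = \<psi> y" "x : U" "y : V" using assms by auto
 have "inv_into (U \<times> V) (map_prod \<phi> \<psi>) (map_prod \<phi> \<psi> (x, y)) = (x, y)"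
  by (rule inv_into_f_f) (use assms xy in \<open>auto intro: map_prod_inj_on\<close>)
 then show ?thesis using assms xy by simp
qed

lemma top_of_product_space [simp]: "top_of (product_space M N) = prod_topology (top_of M) (top_of N)"
 by (simp add: product_space_def)

lemma atlas_product:
 "c : atlas (product_space M N) \<longleftrightarrow>
  (EX U \<phi> V \<psi>. c = (U \<times> V, map_prod \<phi> \<psi>) & (U, \<phi>) : atlas M & (V, \<psi>) : atlas N)"
 by (auto simp: product_space_def)

lemma Ck_on_fst: "open S ==> Ck_on k S fst" and Ck_on_snd: "open S ==> Ck_on k S snd"
 by (auto intro: Ck_bounded_linear bounded_linear_fst bounded_linear_snd)

lemma ok_product:
 fixes M :: "('a, 'e::real_normed_vector) smooth_space" and N :: "('b, 'f::real_normed_vector) smooth_space"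
 assumes M: "atlas_ok M" and N: "atlas_ok N"
 shows "atlas_ok (product_space M N)"
 unfolding atlas_ok_def
proof (intro conjI)
 show "findim TYPE('e \<times> 'f)"
  using findim_prod ok_findim[OF M] ok_findim[OF N] by blast
 show "\<Union> (fst ` atlas (product_space M N)) = points (product_space M N)"
 proof
  show "\<Union> (fst ` atlas (product_space M N)) \<subseteq> points (product_space M N)"
   using chart_subset[OF M] chart_subset[OF N] by (fastforce simp: atlas_product)
  show "points (product_space M N) \<subseteq> \<Union> (fst ` atlas (product_space M N))"
  proof
   fix z assume "z : points (product_space M N)"
   then obtain x y where z: "z = (x, y)" "x : points M" "y : points N" by auto
   obtain U \<phi> where U: "(U, \<phi>) : atlas M" "x : U" using chart_ex[OF M z(2)] .
   obtain V \<psi> where V: "(V, \<psi>) : atlas N" "y : V" using chart_ex[OF N z(3)] .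
   have "(U \<times> V, map_prod \<phi> \<psi>) : atlas (product_space M N)" using U V by (auto simp: atlas_product)
   then show "z : \<Union> (fst ` atlas (product_space M N))" using U V z by force
  qed
 qed
 show "ALL (U, \<phi>) : atlas (product_space M N). openin (top_of (product_space M N)) U & open (\<phi> ` U) &
    homeomorphic_map (subtopology (top_of (product_space M N)) U) (top_of_set (\<phi> ` U)) \<phi>"
 proof safe
  fix W \<theta> assume "(W, \<theta>) : atlas (product_space M N)"
  then obtain U \<phi> V \<psi> where W: "W = U \<times> V" "\<theta> = map_prod \<phi> \<psi>"
   and U: "(U, \<phi>) : atlas M" and V: "(V, \<psi>) : atlas N"
   by (auto simp: atlas_product)
  show "openin (top_of (product_space M N)) W"
   using chart_openin[OF M U] chart_openin[OF N V] by (simp add: W openin_prod_Times_iff)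
  have im: "\<theta> ` W = \<phi> ` U \<times> \<psi> ` V" by (auto simp: W)
  show "open (\<theta> ` W)"
   unfolding im using chart_open_image_dom[OF M U] chart_open_image_dom[OF N V] by (rule open_Times)
  obtain f' g' where "homeomorphic_maps (subtopology (top_of M) U) (top_of_set (\<phi> ` U)) \<phi> f'"
   "homeomorphic_maps (subtopology (top_of N) V) (top_of_set (\<psi> ` V)) \<psi> g'"
   using chart_homeomorphic[OF M U] chart_homeomorphic[OF N V] by (auto simp: homeomorphic_map_maps)
  then have "homeomorphic_maps (prod_topology (subtopology (top_of M) U) (subtopology (top_of N) V))
   (prod_topology (top_of_set (\<phi> ` U)) (top_of_set (\<psi> ` V))) (%(x, y). (\<phi> x, \<psi> y)) (%(x, y). (f' x, g' y))"
   unfolding homeomorphic_maps_prod by blast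
  from homeomorphic_maps_imp_map[OF this]
  show "homeomorphic_map (subtopology (top_of (product_space M N)) W) (top_of_set (\<theta> ` W)) \<theta>"
   unfolding im unfolding W map_prod_def by (simp add: subtopology_Times)
 qed
 show "ALL (U, \<phi>) : atlas (product_space M N). ALL (V, \<psi>) : atlas (product_space M N).
   smooth_on (\<phi> ` (U Int V)) (\<psi> o inv_into U \<phi>)"
 proof (clarsimp simp: atlas_product smooth_on_def)
  fix U \<phi> V \<psi> U' \<phi>' V' \<psi>' k
  assume U: "(U, \<phi>) : atlas M" and V: "(V, \<psi>) : atlas N"
   and U': "(U', \<phi>') : atlas M" and V': "(V', \<psi>') : atlas N"
  let ?S = "map_prod \<phi> \<psi> ` (U \<times> V Int U' \<times> V')"
  have im: "?S = \<phi> ` (U Int U') \<times> \<psi> ` (V Int V')" by auto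
  have oU: "open (\<phi> ` (U Int U'))" "open (\<psi> ` (V Int V'))"
   using chart_openin[OF M U] chart_openin[OF N V] chart_openin[OF M U'] chart_openin[OF N V']
   by (auto intro!: chart_open_image[OF M U] chart_open_image[OF N V])
  then have o: "open ?S" unfolding im by (intro open_Times)
  have "Ck_on k ?S (%z. ((\<phi>' o inv_into U \<phi>) (fst z), (\<psi>' o inv_into V \<psi>) (snd z)))"
   using im by (intro Ck_on_Pair o Ck_on_compose[OF ok_findim[OF M] o chart_transition[OF M U U'] Ck_on_fst[OF o]]
    Ck_on_compose[OF ok_findim[OF N] o chart_transition[OF N V V'] Ck_on_snd[OF o]]) auto
  then show "Ck_on k ?S (map_prod \<phi>' \<psi>' o inv_into (U \<times> V) (map_prod \<phi> \<psi>))"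
   by (rule Ck_on_cong[OF o, rotated]) (auto simp: inv_into_map_prod chart_inj[OF M U] chart_inj[OF N V])
 qed
qed

lemma top_of_standard_space [simp]: "top_of standard_space = euclidean"
 and atlas_standard_space [simp]: "atlas standard_space = {(UNIV, id)}"
 by (simp_all add: standard_space_def)

lemma atlas_ok_open_subspace_standard:
 fixes S :: "'e::real_normed_vector set"
 assumes "findim TYPE('e)" "open S"
 shows "atlas_ok (open_subspace standard_space S)"
proof -
 have "Ck_on k S (%x. inv_into S id x)" for k
  by (rule Ck_on_cong[OF assms(2) _ Ck_bounded_linear[OF assms(2) bounded_linear_ident]]) simp
 then show ?thesis using assms
  by (auto simp: atlas_ok_def open_subspace_def smooth_on_def comp_def subtopology_subtopology)
qed

lemma atlas_ok_standard: "findim TYPE('e::real_normed_vector) ==> atlas_ok (standard_space :: ('e,'e) smooth_space)"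
 using Ck_bounded_linear[OF open_UNIV bounded_linear_ident, folded id_def]
 by (auto simp: atlas_ok_def smooth_on_def comp_def)

lemma smooth_map_fst:
 assumes M: "atlas_ok M" and N: "atlas_ok N"
 shows "smooth_map (product_space M N) M fst"
proof (rule smooth_mapI[OF ok_product[OF M N] M])
 show "continuous_map (top_of (product_space M N)) (top_of M) fst" by (simp add: continuous_map_fst)
 fix z k assume "z : points (product_space M N)"
 then obtain x y where z: "z = (x, y)" "x : points M" "y : points N" by auto
 obtain U \<phi> where U: "(U, \<phi>) : atlas M" "x : U" using chart_ex[OF M z(2)] .
 obtain V \<psi> where V: "(V, \<psi>) : atlas N" "y : V" using chart_ex[OF N z(3)] .
 have c: "(U \<times> V, map_prod \<phi> \<psi>) : atlas (product_space M N)" using U V by (auto simp: atlas_product)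
 have o: "open (map_prod \<phi> \<psi> ` (U \<times> V))" by (rule chart_open_image_dom[OF ok_product[OF M N] c])
 have "Ck_on k (map_prod \<phi> \<psi> ` (U \<times> V)) (\<phi> o fst o inv_into (U \<times> V) (map_prod \<phi> \<psi>))"
  by (rule Ck_on_cong[OF o _ Ck_on_fst[OF o]])
   (auto simp: inv_into_map_prod chart_inj[OF M U(1)] chart_inj[OF N V(1)] chart_inv[OF M U(1)])
 from local_CkI[OF c U(1) chart_openin[OF ok_product[OF M N] c] this]
 show "local_Ck k (product_space M N) M fst z" using U V z by auto
qed

lemma smooth_map_snd:
 assumes M: "atlas_ok M" and N: "atlas_ok N"
 shows "smooth_map (product_space M N) N snd"
proof (rule smooth_mapI[OF ok_product[OF M N] N])
 show "continuous_map (top_of (product_space M N)) (top_of N) snd" by (simp add: continuous_map_snd)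
 fix z k assume "z : points (product_space M N)"
 then obtain x y where z: "z = (x, y)" "x : points M" "y : points N" by auto
 obtain U \<phi> where U: "(U, \<phi>) : atlas M" "x : U" using chart_ex[OF M z(2)] .
 obtain V \<psi> where V: "(V, \<psi>) : atlas N" "y : V" using chart_ex[OF N z(3)] .
 have c: "(U \<times> V, map_prod \<phi> \<psi>) : atlas (product_space M N)" using U V by (auto simp: atlas_product)
 have o: "open (map_prod \<phi> \<psi> ` (U \<times> V))" by (rule chart_open_image_dom[OF ok_product[OF M N] c])
 have "Ck_on k (map_prod \<phi> \<psi> ` (U \<times> V)) (\<psi> o snd o inv_into (U \<times> V) (map_prod \<phi> \<psi>))"
  by (rule Ck_on_cong[OF o _ Ck_on_snd[OF o]])
   (auto simp: inv_into_map_prod chart_inj[OF M U(1)] chart_inj[OF N V(1)] chart_inv[OF N V(1)])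
 from local_CkI[OF c V(1) chart_openin[OF ok_product[OF M N] c] this]
 show "local_Ck k (product_space M N) N snd z" using U V z by auto
qed

lemma smooth_map_Pair:
 assumes L: "atlas_ok L" and M: "atlas_ok M" and N: "atlas_ok N"
  and f: "smooth_map L M f" and g: "smooth_map L N g"
 shows "smooth_map L (product_space M N) (%x. (f x, g x))"
proof (rule smooth_mapI[OF L ok_product[OF M N]])
 note fc = smooth_cont[OF f] and gc = smooth_cont[OF g]
 show "continuous_map (top_of L) (top_of (product_space M N)) (%x. (f x, g x))"
  using fc gc by (simp add: continuous_map_pairedI)
 fix x k assume x: "x : points L"
 then have fx: "f x : points M" and gx: "g x : points N"
  using continuous_map_image_subset_topspace[OF fc] continuous_map_image_subset_topspace[OF gc] by blast+
 obtain U \<phi> where U: "(U, \<phi>) : atlas L" "x : U" using chart_ex[OF L x] .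
 obtain V \<psi> where V: "(V, \<psi>) : atlas M" "f x : V" using chart_ex[OF M fx] .
 obtain W \<theta> where W: "(W, \<theta>) : atlas N" "g x : W" using chart_ex[OF N gx] .
 have c: "(V \<times> W, map_prod \<psi> \<theta>) : atlas (product_space M N)" using V W by (auto simp: atlas_product)
 let ?T = "U Int {x : points L. f x : V} Int {x : points L. g x : W}"
 have T: "openin (top_of L) ?T"
  using openin_continuous_map_preimage[OF fc chart_openin[OF M V(1)]] chart_openin[OF L U(1)]
   openin_continuous_map_preimage[OF gc chart_openin[OF N W(1)]] by blast
 have o: "open (\<phi> ` ?T)" by (rule chart_open_image[OF L U(1) T]) auto
 have "Ck_on k (\<phi> ` ?T) (%y. ((\<psi> o f o inv_into U \<phi>) y, (\<theta> o g o inv_into U \<phi>) y))"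
  by (intro Ck_on_Pair o Ck_on_subset[OF smooth_map_chart[OF f U(1) V(1)]] Ck_on_subset[OF smooth_map_chart[OF g U(1) W(1)]]) auto
 then have "Ck_on k (\<phi> ` ?T) (map_prod \<psi> \<theta> o (%x. (f x, g x)) o inv_into U \<phi>)"
  by (simp add: comp_def)
 from local_CkI[OF U(1) c T this] show "local_Ck k L (product_space M N) (%x. (f x, g x)) x"
  using U V W x by auto
qed


section \<open>Differentiation with a parameter\<close>

definition param_cont ::
 "'p topology => ('p \<times> 'a::real_normed_vector) set => ('p => 'a => 'b::real_normed_vector) => bool" where
 "param_cont P W F \<longleftrightarrow>
   (ALL (p, x) : W. ((%(p, x). F p x) ---> F p x) (nhdsin P p \<times>\<^sub>F nhds x))"

text \<open>Derivatives are taken in the second variable only, but jointly with the parameter they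
  must be continuous. The parameter lives in an abstract topology, so that the group or a product
  with it can serve as parameter space without charts.\<close>

fun pCk_on ::
 "nat => 'p topology => ('p \<times> 'a::real_normed_vector) set => ('p => 'a => 'b::real_normed_vector) => bool" where
 "pCk_on 0 P W F \<longleftrightarrow> param_cont P W F"
| "pCk_on (Suc k) P W F \<longleftrightarrow> param_cont P W F & (ALL (p, x) : W. F p differentiable (at x)) &
   (ALL v. pCk_on k P W (%p x. FD (F p) x v))"

lemma param_contD:
 "param_cont P W F ==> (p, x) : W ==> ((%z. F (fst z) (snd z)) ---> F p x) (nhdsin P p \<times>\<^sub>F nhds x)"
 unfolding param_cont_def split_beta by fastforce

lemma param_contI:
 "(!!p x. (p, x) : W ==> ((%z. F (fst z) (snd z)) ---> F p x) (nhdsin P p \<times>\<^sub>F nhds x)) ==> param_cont P W F"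
 unfolding param_cont_def split_beta by fastforce

lemma pCk_param_cont: "pCk_on k P W F ==> param_cont P W F"
 by (cases k) auto

lemma pCk_on_SucD: "pCk_on (Suc k) P W F ==> pCk_on k P W F"
 by (induction k arbitrary: F) auto

lemma pCk_on_mono: "pCk_on k P W F ==> j \<le> k ==> pCk_on j P W F"
 by (induction k) (auto simp: le_Suc_eq dest: pCk_on_SucD simp del: pCk_on.simps)

lemma pCk_on_subset: "pCk_on k P W F ==> W' \<subseteq> W ==> pCk_on k P W' F"
 by (induction k arbitrary: F) (fastforce simp: param_cont_def)+

lemma pCk_has_deriv:
 "pCk_on (Suc k) P W F ==> (p, x) : W ==> (F p has_derivative FD (F p) x) (at x)"
 by (auto simp: frechet_derivative_works)

definition param_open :: "'p topology => ('p \<times> 'a::real_normed_vector) set => bool" where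
 "param_open P W \<longleftrightarrow> (ALL z:W. fst z : topspace P &
   (EX U r. openin P U & fst z : U & r > 0 & U \<times> ball (snd z) r \<subseteq> W))"

lemma param_openE:
 assumes "param_open P W" "(p, x) : W"
 obtains U r where "openin P U" "p : U" "r > 0" "U \<times> ball x r \<subseteq> W"
 using assms unfolding param_open_def by fastforce

lemma ev_param_nhds:
 assumes "p : topspace P"
 shows "eventually Q (nhdsin P p \<times>\<^sub>F nhds x) \<longleftrightarrow>
  (EX U r. openin P U & p : U & r > 0 & (ALL q:U. ALL y:ball x r. Q (q, y)))"
proof
 assume "eventually Q (nhdsin P p \<times>\<^sub>F nhds x)"
 then obtain A B where A: "eventually A (nhdsin P p)" and B: "eventually B (nhds x)"
  and Q: "!!a b. A a ==> B b ==> Q (a, b)" unfolding eventually_prod_filter by auto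
 obtain U where U: "openin P U" "p : U" "!!q. q : U ==> A q"
  by (rule ev_nhdsinE[OF A assms]) (rule that)
 obtain r where r: "r > 0" "!!y. dist y x < r ==> B y" using B unfolding eventually_nhds_metric by auto
 then have "ALL q:U. ALL y:ball x r. Q (q, y)" using U Q by (auto simp: dist_commute)
 then show "EX U r. openin P U & p : U & r > 0 & (ALL q:U. ALL y:ball x r. Q (q, y))" using U r by blast
next
 assume "EX U r. openin P U & p : U & r > 0 & (ALL q:U. ALL y:ball x r. Q (q, y))"
 then obtain U r where U: "openin P U" "p : U" and r: "r > 0" and Q: "!!q y. q : U ==> y : ball x r ==> Q (q, y)" by blast
 have "eventually (%y. y : ball x r) (nhds x)" using r by (intro eventually_nhds_in_open) auto
 with ev_nhdsin[OF U] show "eventually Q (nhdsin P p \<times>\<^sub>F nhds x)"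
  unfolding eventually_prod_filter using Q by blast
qed

lemma param_open_ev:
 "param_open P W ==> (p, x) : W ==> eventually (%z. z : W) (nhdsin P p \<times>\<^sub>F nhds x)"
 unfolding param_open_def by (subst ev_param_nhds) fastforce+

text \<open>The function q is a local coordinate of the parameter. A partial derivative in x of G (q
  p, x) is again of this form with the same q, so the representation passes through the
  induction.\<close>

lemma pCk_on_of_Ck_on:
 fixes F :: "'p => 'a::real_normed_vector => 'c::real_normed_vector"
 assumes "!!p0 x0. (p0, x0) : W ==> EX (q :: 'p => 'b::real_normed_vector) S G U r.
   openin P U & p0 : U & r > 0 & open S & Ck_on k S G & (q ---> q p0) (nhdsin P p0) &
   (ALL p:U. ALL x:ball x0 r. (q p, x) : S & F p x = G (q p, x))"
 shows "pCk_on k P W F"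
proof -
 have pc: "param_cont P W F"
  if rep: "!!p0 x0. (p0, x0) : W ==> EX (q :: 'p => 'b::real_normed_vector) S G U r.
   openin P U & p0 : U & r > 0 & open S & Ck_on k S G & (q ---> q p0) (nhdsin P p0) &
   (ALL p:U. ALL x:ball x0 r. (q p, x) : S & F p x = G (q p, x))" for k and F :: "'p => 'a => 'c"
 proof (rule param_contI)
  fix p0 x0 assume "(p0, x0) : W"
  obtain q :: "'p => 'b" and S G U r where *: "openin P U" "p0 : U" "r > 0" "open S" "Ck_on k S G"
   "(q ---> q p0) (nhdsin P p0)" and eq: "ALL p:U. ALL x:ball x0 r. (q p, x) : S & F p x = G (q p, x)"
   using rep[OF \<open>(p0, x0) : W\<close>] by (elim exE conjE) (rule that)
  have pU: "p0 : topspace P" using * openin_subset by blast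
  let ?N = "nhdsin P p0 \<times>\<^sub>F nhds x0"
  have S0: "(q p0, x0) : S" using eq * by auto
  have "continuous_on S G" using * Ck_on_continuous by blast
  then have "(G ---> G (q p0, x0)) (nhds (q p0, x0))"
   using S0 *(4) continuous_on_eq_continuous_at by (metis continuous_at tendsto_at_iff_tendsto_nhds)
  moreover have "((%z. (q (fst z), snd z)) ---> (q p0, x0)) ?N"
   by (intro tendsto_Pair filterlim_compose[OF *(6) filterlim_fst] filterlim_snd)
  ultimately have lim: "((%z. G (q (fst z), snd z)) ---> G (q p0, x0)) ?N"
   by (rule filterlim_compose)
  have "eventually (%z. G (q (fst z), snd z) = F (fst z) (snd z)) ?N"
   unfolding ev_param_nhds[OF pU] using eq * by (intro exI[of _ U] exI[of _ r]) auto
  from Lim_transform_eventually[OF lim this]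
  show "((%z. F (fst z) (snd z)) ---> F p0 x0) ?N" using eq * by auto
 qed
 have der: "(F p has_derivative (%v. FD G (q p, x) (0, v))) (at x)"
  if "open S" "Ck_on (Suc k) S G" "p : U" "x : ball x0 r"
   and eq: "ALL p:U. ALL x:ball x0 r. (q p, x) : S & F p x = G (q p, x)"
  for k and F :: "'p => 'a => 'c" and q :: "'p => 'b" and S G U r p x x0
 proof -
  have "(G has_derivative FD G (q p, x)) (at (q p, x))"
   using that Ck_has_deriv by blast
  then have "((%x. G (q p, x)) has_derivative (%v. FD G (q p, x) (0, v))) (at x)"
   by (rule has_derivative_compose[rotated]) (auto intro!: derivative_eq_intros)
  then show ?thesis
   by (rule has_derivative_transform_within_open[OF _ open_ball that(4)]) (use eq that in auto)
 qed
 show ?thesis using assms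
 proof (induction k arbitrary: F)
  case 0
  from pc[OF 0] show ?case by simp
 next
  case (Suc k)
  show ?case unfolding pCk_on.simps
  proof (intro conjI allI)
   show "param_cont P W F" by (rule pc[OF Suc.prems])
   show "ALL (p, x):W. F p differentiable (at x)"
   proof safe
    fix p x assume "(p, x) : W"
    obtain q :: "'p => 'b" and S G U r where *: "openin P U" "p : U" "r > 0" "open S" "Ck_on (Suc k) S G"
     and eq: "ALL p:U. ALL y:ball x r. (q p, y) : S & F p y = G (q p, y)"
     using Suc.prems[OF \<open>(p, x) : W\<close>] by (elim exE conjE) (rule that)
    have "x : ball x r" using * by simp
    from der[OF *(4,5,2) this eq] show "F p differentiable (at x)" unfolding differentiable_def by blast
   qed
   fix v
   show "pCk_on k P W (%p x. FD (F p) x v)"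
   proof (rule Suc.IH)
    fix p0 x0 assume "(p0, x0) : W"
    obtain q :: "'p => 'b" and S G U r where *: "openin P U" "p0 : U" "r > 0" "open S" "Ck_on (Suc k) S G"
     "(q ---> q p0) (nhdsin P p0)" and eq: "ALL p:U. ALL x:ball x0 r. (q p, x) : S & F p x = G (q p, x)"
     using Suc.prems[OF \<open>(p0, x0) : W\<close>] by (elim exE conjE) (rule that)
    have "FD (F p) x v = FD G (q p, x) (0, v)"
     if "p : U" "x : ball x0 r" for p x
     using frechet_derivative_at[OF der[OF *(4,5) that eq]] by metis
    then show "EX (q :: 'p => 'b) S G U r. openin P U & p0 : U & r > 0 & open S & Ck_on k S G &
      (q ---> q p0) (nhdsin P p0) &
      (ALL p:U. ALL x:ball x0 r. (q p, x) : S & FD (F p) x v = G (q p, x))"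
     using * eq by (intro exI[of _ q] exI[of _ S] exI[of _ "%z. FD G z (0, v)"]
      exI[of _ U] exI[of _ r]) auto
   qed
  qed
 qed
qed

lemma smooth_map_pCk_on:
 fixes P :: "('p, 'd::real_normed_vector) smooth_space" and M :: "('a, 'e::real_normed_vector) smooth_space"
  and N :: "('b, 'f::real_normed_vector) smooth_space"
 assumes P: "atlas_ok P" and M: "atlas_ok M" and N: "atlas_ok N" and f: "smooth_map (product_space P M) N f"
  and V: "(V, \<psi>) : atlas M" and Y: "(Y, \<theta>) : atlas N"
 defines "W \<equiv> {(p, x). p : points P & x : \<psi> ` V & f (p, inv_into V \<psi> x) : Y}"
 shows "pCk_on k (top_of P) W (%p x. \<theta> (f (p, inv_into V \<psi> x)))" and "param_open (top_of P) W"
proof -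
 have main: "EX (q :: 'p => 'd) S G U r. openin (top_of P) U & p0 : U & r > 0 & open S & Ck_on k S G &
   (q ---> q p0) (nhdsin (top_of P) p0) &
   (ALL p:U. ALL x:ball x0 r. (q p, x) : S & \<theta> (f (p, inv_into V \<psi> x)) = G (q p, x) & (p, x) : W)"
  if "(p0, x0) : W" for p0 x0
 proof -
  from that have p0: "p0 : points P" and x0: "x0 : \<psi> ` V" and fY: "f (p0, inv_into V \<psi> x0) : Y"
   by (auto simp: W_def)
  obtain U \<phi> where U: "(U, \<phi>) : atlas P" "p0 : U" using chart_ex[OF P p0] .
  let ?c = "map_prod \<phi> \<psi>"
  have c: "(U \<times> V, ?c) : atlas (product_space P M)" using U V by (auto simp: atlas_product)
  note PM = ok_product[OF P M]
  let ?T = "(U \<times> V) Int {z : points (product_space P M). f z : Y}"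
  have T: "openin (top_of (product_space P M)) ?T"
   using chart_openin[OF PM c] openin_continuous_map_preimage[OF smooth_cont[OF f] chart_openin[OF N Y]] by blast
  have oS: "open (?c ` ?T)" by (rule chart_open_image[OF PM c T]) auto
  have Teq: "?T = (U \<times> V) Int f -` Y" using chart_subset[OF PM c] by auto
  have C: "Ck_on k (?c ` ?T) (\<theta> o f o inv_into (U \<times> V) ?c)"
   unfolding Teq by (rule smooth_map_chart[OF f c Y])
  obtain y0 where y0: "y0 : V" "x0 = \<psi> y0" using x0 by auto
  then have "f (p0, y0) : Y" using fY by (simp add: chart_inv[OF M V])
  moreover have "y0 : points M" using y0 chart_subset[OF M V] by blast
  ultimately have "(p0, y0) : ?T" using U p0 y0 by simp
  then have "?c (p0, y0) : ?c ` ?T" by (rule imageI)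
  then have "(\<phi> p0, x0) : ?c ` ?T" using y0 by simp
  with oS obtain A B where AB': "open A" "open B" "(\<phi> p0, x0) : A \<times> B" "A \<times> B \<subseteq> ?c ` ?T"
   by (rule open_prod_elim) (rule that)
  then have AB: "open A" "open B" "\<phi> p0 : A" "x0 : B" "A \<times> B \<subseteq> ?c ` ?T" by auto
  obtain r where r: "r > 0" "ball x0 r \<subseteq> B" by (rule openE[OF AB(2,4)]) (rule that)
  have "eventually (%p. \<phi> p : A) (nhdsin (top_of P) p0)"
   using chart_tendsto[OF P U] AB(1,3) by (simp add: tendsto_def)
  then obtain U1 where U1: "openin (top_of P) U1" "p0 : U1" "!!p. p : U1 ==> \<phi> p : A"
   by (rule ev_nhdsinE[OF _ p0]) (rule that)
  have fact: "(\<phi> p, x) : ?c ` ?T & \<theta> (f (p, inv_into V \<psi> x)) = (\<theta> o f o inv_into (U \<times> V) ?c) (\<phi> p, x) & (p, x) : W"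
   if "p : U Int U1" "x : ball x0 r" for p x
  proof -
   have in': "(\<phi> p, x) : ?c ` ?T" using that U1(3) r AB(5) by blast
   then have x: "x : \<psi> ` V" by auto
   have pU: "p : U" using that by simp
   have inv: "inv_into (U \<times> V) ?c (\<phi> p, x) = (p, inv_into V \<psi> x)"
    using x pU by (subst inv_into_map_prod) (auto simp: chart_inj[OF P U(1)] chart_inj[OF M V])
   obtain z where z: "z : ?T" "(\<phi> p, x) = ?c z" using in' by auto
   then have "z = (p, inv_into V \<psi> x)" using inv inv_into_f_f[OF chart_inj[OF PM c], of z] by auto
   then have "f (p, inv_into V \<psi> x) : Y" using z by auto
   then have "(p, x) : W" using x pU chart_subset[OF P U(1)] by (auto simp: W_def)
   then show ?thesis using in' inv by simp
  qed
  show ?thesis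
   apply (rule exI[of _ \<phi>], rule exI[of _ "?c ` ?T"], rule exI[of _ "\<theta> o f o inv_into (U \<times> V) ?c"],
     rule exI[of _ "U Int U1"], rule exI[of _ r])
   using chart_openin[OF P U(1)] U1 U r oS C chart_tendsto[OF P U] fact by blast
 qed
 show "pCk_on k (top_of P) W (%p x. \<theta> (f (p, inv_into V \<psi> x)))"
 proof (rule pCk_on_of_Ck_on)
  fix p0 x0 assume "(p0, x0) : W"
  from main[OF this]
  show "EX (q :: 'p => 'd) S G U r. openin (top_of P) U & p0 : U & r > 0 & open S & Ck_on k S G &
   (q ---> q p0) (nhdsin (top_of P) p0) &
   (ALL p:U. ALL x:ball x0 r. (q p, x) : S & \<theta> (f (p, inv_into V \<psi> x)) = G (q p, x))"
   by (elim exE conjE) (intro exI conjI, assumption+, blast)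
 qed
 show "param_open (top_of P) W"
  unfolding param_open_def
 proof
  fix z assume "z : W"
  then have z: "(fst z, snd z) : W" by simp
  from main[OF z] obtain U r where "openin (top_of P) U" "fst z : U" "r > 0" "ALL p:U. ALL x:ball (snd z) r. (p, x) : W"
   by blast
  moreover have "fst z : topspace (top_of P)" using z by (auto simp: W_def)
  ultimately show "fst z : topspace (top_of P) & (EX U r. openin (top_of P) U & fst z : U & 0 < r & U \<times> ball (snd z) r \<subseteq> W)"
   by blast
 qed
qed

text \<open>Strict differentiability, uniform in the parameter: all nearby derivatives are within e
  of one fixed linear map, and the mean value inequality is applied to F p minus that map. The
  contraction arguments rest on the second estimate.\<close>

lemma pCk_on_derivative_close:
 fixes F :: "'p => 'a::real_normed_vector => 'b::real_normed_vector"
 assumes fd: "findim TYPE('a)" and F: "pCk_on (Suc 0) P W F" and W: "param_open P W"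
  and px: "(p0, x0) : W" and e: "e > 0"
 obtains U r where "openin P U" "p0 : U" "r > 0" "U \<times> ball x0 r \<subseteq> W"
  "!!p x v. p : U ==> x : ball x0 r ==>
    norm (FD (F p) x v - FD (F p0) x0 v) \<le> e * norm v"
  "!!p x y. p : U ==> x : ball x0 r ==> y : ball x0 r ==>
    norm (F p x - F p y - FD (F p0) x0 (x - y)) \<le> e * norm (x - y)"
proof -
 let ?D = "%z. FD (F (fst z)) (snd z)"
 let ?N = "nhdsin P p0 \<times>\<^sub>F nhds x0"
 let ?E = "FD (F p0) x0"
 have p0: "p0 : topspace P" using W px by (fastforce simp: param_open_def)
 have der: "(F p has_derivative ?D (p, x)) (at x)" if "(p, x) : W" for p x
  using pCk_has_deriv[OF F that] by simp
 have "eventually (%z. ALL v. norm (?D z v - ?E v) \<le> e * norm v) ?N"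
 proof (rule linear_family_uniform[OF fd _ _ _ e])
  show "eventually (%z. linear (?D z)) ?N"
   using param_open_ev[OF W px]
  proof (rule eventually_mono)
   fix z assume "z : W"
   then have "(F (fst z) has_derivative ?D z) (at (snd z))" using der[of "fst z" "snd z"] by simp
   then show "linear (?D z)" by (rule has_derivative_linear)
  qed
  show "linear ?E" using has_derivative_linear[OF der[OF px]] by simp
  show "((%z. ?D z v) ---> ?E v) ?N" for v
   by (rule param_contD[OF _ px]) (use F in simp)
 qed
 with param_open_ev[OF W px] have "eventually (%z. z : W & (ALL v. norm (?D z v - ?E v) \<le> e * norm v)) ?N"
  by (rule eventually_conj)
 then obtain U r where U: "openin P U" "p0 : U" "r > 0"
  and b: "ALL p:U. ALL x:ball x0 r. (p, x) : W & (ALL v. norm (?D (p, x) v - ?E v) \<le> e * norm v)"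
  unfolding ev_param_nhds[OF p0] by blast
 have bl: "bounded_linear ?E" using has_derivative_bounded_linear[OF der[OF px]] by (simp only: fst_conv snd_conv)
 have "norm (F p x - F p y - ?E (x - y)) \<le> e * norm (x - y)" if p: "p : U" and xy: "x : ball x0 r" "y : ball x0 r" for p x y
 proof -
  have "norm ((F p x - ?E x) - (F p y - ?E y)) \<le> e * norm (x - y)"
  proof (rule differentiable_bound[OF convex_ball _ _ xy])
   fix z assume z: "z : ball x0 r"
   have pz: "(p, z) : W" and le: "!!v. norm (?D (p, z) v - ?E v) \<le> e * norm v" using b p z by blast+
   show "((%x. F p x - ?E x) has_derivative (%v. ?D (p, z) v - ?E v)) (at z within ball x0 r)"
    by (rule has_derivative_diff[OF has_derivative_at_withinI[OF der[OF pz]] bounded_linear_imp_has_derivative[OF bl]])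
   show "onorm (%v. ?D (p, z) v - ?E v) \<le> e"
    by (rule onorm_bound[OF less_imp_le[OF e] le])
  qed
  moreover have "?E (x - y) = ?E x - ?E y" by (rule linear_diff[OF bounded_linear.linear[OF bl]])
  ultimately show ?thesis by (metis (no_types, lifting) add_diff_eq diff_diff_eq diff_diff_eq2 diff_add_eq)
 qed
 moreover have "U \<times> ball x0 r \<subseteq> W" using b by auto
 moreover have "norm (FD (F p) x v - ?E v) \<le> e * norm v" if "p : U" "x : ball x0 r" for p x v
  using b that by simp
 ultimately show ?thesis using that U by blast
qed

lemma param_open_trivial:
 assumes "open S"
 shows "param_open (discrete_topology {()}) ({()} \<times> S)"
 unfolding param_open_def
proof
 fix z assume "z : {()} \<times> S"
 then have z: "snd z : S" by auto
 obtain r where "r > 0" "ball (snd z) r \<subseteq> S" by (rule openE[OF assms z]) (rule that)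
 then show "fst z : topspace (discrete_topology {()}) &
   (EX U r. openin (discrete_topology {()}) U & fst z : U & 0 < r & U \<times> ball (snd z) r \<subseteq> {()} \<times> S)"
  by (intro conjI exI[of _ "{()}"] exI[of _ r]) auto
qed

lemma Ck_on_pCk_on:
 fixes f :: "'a::real_normed_vector => 'b::real_normed_vector" and P :: "'p topology"
 assumes "open S" "Ck_on k S f" "!!p x. (p, x) : W ==> x : S & p : topspace P"
 shows "pCk_on k P W (%_. f)"
proof (rule pCk_on_of_Ck_on)
 fix p0 x0 assume "(p0, x0) : W"
 then have *: "x0 : S" "p0 : topspace P" using assms(3) by auto
 obtain r where r: "r > 0" "ball x0 r \<subseteq> S" by (rule openE[OF assms(1) *(1)]) (rule that)
 \<comment> \<open>A dummy real coordinate plays the part of q, since the function does not depend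
   on the parameter.\<close>
 have "open ((UNIV::real set) \<times> S)" using assms(1) by (simp add: open_Times)
 moreover from this have "Ck_on k (UNIV \<times> S) (%z::real \<times> 'a. f (snd z))"
  using assms(1,2)
 proof (induction k arbitrary: f)
  case 0
  then show ?case by (auto intro: continuous_on_compose2[OF _ continuous_on_snd[OF continuous_on_id]])
 next
  case (Suc k)
  show ?case
  proof (rule Ck_on_SucI[OF Suc.prems(1)])
   fix z :: "real \<times> 'a" assume "z : UNIV \<times> S"
   then have "(f has_derivative FD f (snd z)) (at (snd z))"
    using Suc.prems Ck_has_deriv by (metis mem_Times_iff)
   then show "((%z. f (snd z)) has_derivative (%v. FD f (snd z) (snd v))) (at z)"
    by (rule has_derivative_compose[rotated]) (auto intro!: derivative_eq_intros)
  next
   fix v :: "real \<times> 'a"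
   show "Ck_on k (UNIV \<times> S) (%z::real \<times> 'a. FD f (snd z) (snd v))"
    using Suc.IH[of "%x. FD f x (snd v)"] Suc.prems by simp
  qed
 qed
 ultimately show "EX (q :: 'p => real) S G U r. openin P U & p0 : U & r > 0 & open S & Ck_on k S G &
   (q ---> q p0) (nhdsin P p0) & (ALL p:U. ALL x:ball x0 r. (q p, x) : S & f x = G (q p, x))"
  using r * by (intro exI[of _ "%_. 0"] exI[of _ "UNIV \<times> S"] exI[of _ "%z. f (snd z)"] exI[of _ "topspace P"] exI[of _ r]) auto
qed

text \<open>Differentiability at a single point that controls differences of any two nearby values.
  It is stable under composition and gives local invertibility by contraction, also for
  \<open>Exp\<close>, for which it is established at 0.\<close>

definition strict_deriv :: "('a::real_normed_vector => 'b::real_normed_vector) => ('a => 'b) => 'a => bool" where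
 "strict_deriv f L a \<longleftrightarrow> bounded_linear L &
   (ALL e>0. EX r>0. ALL x:ball a r. ALL y:ball a r. norm (f x - f y - L (x - y)) \<le> e * norm (x - y))"

lemma strict_derivE:
 assumes "strict_deriv f L a" "e > 0"
 obtains r where "r > 0"
  "!!x y. dist a x < r ==> dist a y < r ==> norm (f x - f y - L (x - y)) \<le> e * norm (x - y)"
 using assms unfolding strict_deriv_def by (metis mem_ball)

lemma strict_has_deriv:
 assumes "strict_deriv f L a"
 shows "(f has_derivative L) (at a)"
 unfolding has_derivative_within_alt
proof (intro conjI allI impI)
 show "bounded_linear L" using assms by (simp add: strict_deriv_def)
 fix e :: real assume "e > 0"
 then obtain r where "r > 0"
  "!!x y. dist a x < r ==> dist a y < r ==> norm (f x - f y - L (x - y)) \<le> e * norm (x - y)"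
  by (rule strict_derivE[OF assms]) (rule that)
 then show "EX d>0. ALL y:UNIV. norm (y - a) < d --> norm (f y - f a - L (y - a)) \<le> e * norm (y - a)"
  by (intro exI[of _ r]) (auto simp: dist_norm norm_minus_commute)
qed

lemma strict_deriv_compose:
 assumes f: "strict_deriv f L a" and g: "strict_deriv g M (f a)"
 shows "strict_deriv (%x. g (f x)) (%v. M (L v)) a"
 unfolding strict_deriv_def
proof (intro conjI allI impI)
 have bl: "bounded_linear L" "bounded_linear M" using assms by (auto simp: strict_deriv_def)
 then show "bounded_linear (%v. M (L v))" using bounded_linear_compose by blast
 fix e :: real assume e: "e > 0"
 obtain A where A: "A > 0" "!!x. norm (L x) \<le> norm x * A" using bounded_linear.pos_bounded[OF bl(1)] by blast
 obtain B where B: "B > 0" "!!x. norm (M x) \<le> norm x * B" using bounded_linear.pos_bounded[OF bl(2)] by blast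
 \<comment> \<open>The bound 1 makes f Lipschitz with constant A + 1; the other bound keeps the
   error of f, after passing through M, below one half of e. The error of g uses the other
   half.\<close>
 define c where "c = min 1 (e / (2 * B))"
 have c: "c > 0" "c \<le> 1" "c * B \<le> e / 2" using e B by (auto simp: c_def min_def field_simps)
 obtain r where r: "r > 0"
  "!!x y. dist a x < r ==> dist a y < r ==> norm (f x - f y - L (x - y)) \<le> c * norm (x - y)"
  by (rule strict_derivE[OF f c(1)]) (rule that)
 have lip: "norm (f x - f y) \<le> (A + 1) * norm (x - y)" if "dist a x < r" "dist a y < r" for x y
  using r(2)[OF that] A(2)[of "x - y"] norm_triangle_sub[of "f x - f y" "L (x - y)"]
   mult_right_mono[OF c(2) norm_ge_zero[of "x - y"]] by (simp add: algebra_simps)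
 have "e / (2 * (A + 1)) > 0" using e A by simp
 then obtain s where s: "s > 0"
  "!!x y. dist (f a) x < s ==> dist (f a) y < s ==> norm (g x - g y - M (x - y)) \<le> e / (2 * (A + 1)) * norm (x - y)"
  by (rule strict_derivE[OF g]) (rule that)
 define t where "t = min r (s / (A + 1))"
 have t: "t > 0" "t \<le> r" "t \<le> s / (A + 1)" using r s A by (auto simp: t_def)
 have fs: "dist (f a) (f x) < s" if "dist a x < t" for x
 proof -
  have "norm (f x - f a) \<le> (A + 1) * norm (x - a)" by (rule lip) (use that t r in auto)
  also have "... < (A + 1) * t" using that A by (simp add: dist_norm norm_minus_commute)
  also have "... \<le> s" using t(3) A by (simp add: field_simps)
  finally show ?thesis by (simp add: dist_norm norm_minus_commute)
 qed
 have "norm (g (f x) - g (f y) - M (L (x - y))) \<le> e * norm (x - y)" if xy: "dist a x < t" "dist a y < t" for x y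
 proof -
  let ?n = "norm (x - y)"
  have "norm (g (f x) - g (f y) - M (f x - f y)) \<le> e / (2 * (A + 1)) * norm (f x - f y)"
   by (rule s(2)) (use fs xy in auto)
  also have "... \<le> e / (2 * (A + 1)) * ((A + 1) * ?n)"
   by (rule mult_left_mono[OF lip]) (use xy t e A in auto)
  also have "... = e / 2 * ?n" using A by (simp add: field_simps)
  finally have 1: "norm (g (f x) - g (f y) - M (f x - f y)) \<le> e / 2 * ?n" .
  have "norm (M (f x - f y - L (x - y))) \<le> (c * ?n) * B"
   by (rule order_trans[OF B(2) mult_right_mono[OF r(2)]]) (use xy t B in auto)
  also have "... \<le> e / 2 * ?n" using mult_right_mono[OF c(3), of ?n] by (simp add: mult_ac)
  finally have 2: "norm (M (f x - f y - L (x - y))) \<le> e / 2 * ?n" .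
  have "g (f x) - g (f y) - M (L (x - y)) = (g (f x) - g (f y) - M (f x - f y)) + M (f x - f y - L (x - y))"
   by (simp add: linear_diff[OF bounded_linear.linear[OF bl(2)]])
  from norm_triangle_mono[OF 1 2, folded this] show ?thesis by (simp add: field_simps)
 qed
 then show "EX r>0. ALL x:ball a r. ALL y:ball a r. norm (g (f x) - g (f y) - M (L (x - y))) \<le> e * norm (x - y)"
  using t(1) by (intro exI[of _ t]) auto
qed

lemma strict_deriv_Pair:
 assumes "strict_deriv f L a" "strict_deriv g M a"
 shows "strict_deriv (%x. (f x, g x)) (%v. (L v, M v)) a"
 unfolding strict_deriv_def
proof (intro conjI allI impI)
 show "bounded_linear (%v. (L v, M v))" using assms by (auto simp: strict_deriv_def intro: bounded_linear_Pair)
 fix e :: real assume "e > 0"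
 then have e: "e / 2 > 0" by simp
 obtain r where r: "r > 0" "!!x y. dist a x < r ==> dist a y < r ==> norm (f x - f y - L (x - y)) \<le> e / 2 * norm (x - y)"
  by (rule strict_derivE[OF assms(1) e]) (rule that)
 obtain s where s: "s > 0" "!!x y. dist a x < s ==> dist a y < s ==> norm (g x - g y - M (x - y)) \<le> e / 2 * norm (x - y)"
  by (rule strict_derivE[OF assms(2) e]) (rule that)
 have "norm ((f x, g x) - (f y, g y) - (L (x - y), M (x - y))) \<le> e * norm (x - y)"
  if "dist a x < min r s" "dist a y < min r s" for x y
  using r(2)[of x y] s(2)[of x y] that norm_Pair_le[of "f x - f y - L (x - y)" "g x - g y - M (x - y)"] by simp
 then show "EX r>0. ALL x:ball a r. ALL y:ball a r. norm ((f x, g x) - (f y, g y) - (L (x - y), M (x - y))) \<le> e * norm (x - y)"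
  using r(1) s(1) by (intro exI[of _ "min r s"]) auto
qed

lemma strict_deriv_cong:
 assumes f: "strict_deriv f L a" and eq: "eventually (%x. f x = g x) (nhds a)"
 shows "strict_deriv g L a"
 unfolding strict_deriv_def
proof (intro conjI allI impI)
 show "bounded_linear L" using f by (simp add: strict_deriv_def)
 fix e :: real assume "e > 0"
 then obtain r where r: "r > 0" "!!x y. dist a x < r ==> dist a y < r ==> norm (f x - f y - L (x - y)) \<le> e * norm (x - y)"
  by (rule strict_derivE[OF f]) (rule that)
 obtain s where s: "s > 0" "!!x. dist x a < s ==> f x = g x" using eq unfolding eventually_nhds_metric by auto
 show "EX r>0. ALL x:ball a r. ALL y:ball a r. norm (g x - g y - L (x - y)) \<le> e * norm (x - y)"
  using r s(1) by (intro exI[of _ "min r s"]) (auto simp: dist_commute s(2)[symmetric])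
qed

lemma strict_deriv_linear: "bounded_linear L ==> strict_deriv L L a"
 unfolding strict_deriv_def by (auto simp: linear_diff[OF bounded_linear.linear] intro: exI[of _ 1])

lemma Ck_on_strict_deriv:
 assumes "findim TYPE('a::real_normed_vector)" "Ck_on (Suc 0) S f" "open S" "(x0::'a) : S"
 shows "strict_deriv f (FD f x0) x0"
 unfolding strict_deriv_def
proof (intro conjI allI impI)
 show "bounded_linear (FD f x0)"
  using Ck_has_deriv[OF assms(2,4)] has_derivative_bounded_linear by blast
 fix e :: real assume e: "e > 0"
 \<comment> \<open>A one-point parameter space reduces the claim to the parametrized
   estimate.\<close>
 have "pCk_on (Suc 0) (discrete_topology {()}) ({()} \<times> S) (%_. f)"
  by (rule Ck_on_pCk_on[OF assms(3,2)]) auto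
 moreover have "((), x0) : {()} \<times> S" using assms(4) by simp
 ultimately obtain U r where "() : U" "r > 0" "!!p x y. p : U ==> x : ball x0 r ==> y : ball x0 r ==>
    norm (f x - f y - FD f x0 (x - y)) \<le> e * norm (x - y)"
  by (rule pCk_on_derivative_close[OF assms(1) _ param_open_trivial[OF assms(3)] _ e]) (rule that)
 then show "EX r>0. ALL x:ball x0 r. ALL y:ball x0 r. norm (f x - f y - FD f x0 (x - y)) \<le> e * norm (x - y)"
  by blast
qed


section \<open>The exponential map of a Lie group\<close>

lemma Hausdorff_limit_unique:
 assumes "Hausdorff_space X" "a : topspace X" "b : topspace X" "F ~= bot"
  and "filterlim f (nhdsin X a) F" "filterlim f (nhdsin X b) F"
 shows "a = b"
proof (rule ccontr)
 assume "a ~= b"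
 then obtain U V where UV: "openin X U" "openin X V" "a : U" "b : V" "disjnt U V"
  using assms(1-3) unfolding Hausdorff_space_def by metis
 have "eventually (%x. f x : U) F" "eventually (%x. f x : V) F"
  using assms(5,6) ev_nhdsin[OF UV(1,3)] ev_nhdsin[OF UV(2,4)]
  by (auto simp: filterlim_iff)
 then have "eventually (%x. False) F"
  by eventually_elim (use UV(5) in \<open>auto simp: disjnt_iff\<close>)
 then show False using assms(4) by (simp add: trivial_limit_def)
qed

locale lie_grp =
 fixes G :: "'g monoid" (structure) and GM :: "('g, 'f::real_normed_vector) smooth_space"
 assumes lie: "lie_group G GM"
begin
abbreviation mul (infixl "**" 70) where "a ** b == a \<otimes> b"
abbreviation "CG == carrier G"

lemma is_grp: "group G" and points_eq [simp]: "points GM = CG"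
 and manifold: "smooth_manifold GM"
 and mult_smooth: "smooth_map (product_space GM GM) GM (%(a, b). a ** b)"
 and inv_smooth: "smooth_map GM GM (%a. inv a)"
 using lie by (auto simp: lie_group_def)

end

sublocale lie_grp \<subseteq> group G
 by (rule is_grp)

context lie_grp
begin

lemma GM_ok: "atlas_ok GM" by (rule smooth_manifold_atlas_ok[OF manifold])

lemma fd: "findim TYPE('f)" by (rule ok_findim[OF GM_ok])

abbreviation "T \<equiv> top_of GM"

lemma Hausdorff: "Hausdorff_space T" using manifold by (simp add: smooth_manifold_def)

lemma mult_lim:
 assumes "filterlim f (nhdsin T a) F" "filterlim g (nhdsin T b) F" "a : CG" "b : CG"
 shows "filterlim (%x. f x ** g x) (nhdsin T (a ** b)) F"
proof -
 have "filterlim (%(a, b). a ** b) (nhdsin T (a ** b)) (nhdsin (prod_topology T T) (a, b))"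
  using cont_filterlim[OF smooth_cont[OF mult_smooth], of "(a, b)"] assms by simp
 then have "filterlim (%(a, b). a ** b) (nhdsin T (a ** b)) (nhdsin T a \<times>\<^sub>F nhdsin T b)"
  using assms by (simp add: nhdsin_prod)
 from filterlim_compose[OF this filterlim_Pair[OF assms(1,2)]] show ?thesis by simp
qed

lemma inv_lim:
 assumes "filterlim f (nhdsin T a) F" "a : CG"
 shows "filterlim (%x. inv (f x)) (nhdsin T (inv a)) F"
 by (rule filterlim_compose[OF cont_filterlim[OF smooth_cont[OF inv_smooth]] assms(1)])
  (use assms in auto)

lemma const_lim:
 assumes "a : CG"
 shows "filterlim (%_. a) (nhdsin T a) F"
 unfolding filterlim_iff
proof (intro allI impI)
 fix P assume "eventually P (nhdsin T a)"
 then have "P a" by (rule ev_nhdsinE) (use assms in auto)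
 then show "eventually (%_. P a) F" by simp
qed

lemma pow_lim:
 assumes "filterlim f (nhdsin T a) F" "a : CG"
 shows "filterlim (%x. f x [^] (n::nat)) (nhdsin T (a [^] n)) F"
proof (induction n)
 case 0
 show ?case using const_lim[of \<one> F] by simp
next
 case (Suc n)
 then show ?case using mult_lim[OF Suc assms(1)] assms by simp
qed

definition "U0 = fst (chart_at GM \<one>)"
text \<open>Coordinates centred at the identity, in which multiplication is addition to first
  order.\<close>

definition "kap x = snd (chart_at GM \<one>) x - snd (chart_at GM \<one>) \<one>"
definition "kinv v = inv_into U0 (snd (chart_at GM \<one>)) (v + snd (chart_at GM \<one>) \<one>)"
definition "D0 = kap ` U0"

lemma chart_one: "(U0, snd (chart_at GM \<one>)) : atlas GM" "\<one> : U0"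
 using chart_at_atlas[OF GM_ok, of \<one>] by (simp_all add: U0_def)

lemma U0_open: "openin T U0" and U0_carrier: "U0 \<subseteq> CG"
 using chart_openin[OF GM_ok chart_one(1)] chart_subset[OF GM_ok chart_one(1)] by simp_all

lemma kap_one [simp]: "kap \<one> = 0" by (simp add: kap_def)

lemma kinv_kap: "x : U0 ==> kinv (kap x) = x"
 by (simp add: kinv_def kap_def chart_inv[OF GM_ok chart_one(1)])

lemma kinv_in: "v : D0 ==> kinv v : U0" and kap_kinv: "v : D0 ==> kap (kinv v) = v"
 by (auto simp: D0_def kinv_kap)

lemma zero_D0: "0 : D0" unfolding D0_def by (rule image_eqI[of _ _ \<one>]) (use chart_one in auto)

lemma kinv_zero [simp]: "kinv 0 = \<one>" using kinv_kap[OF chart_one(2)] by simp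

lemma kinv_carrier: "v : D0 ==> kinv v : CG" using kinv_in U0_carrier by blast

lemma D0_eq: "D0 = (%y. y - snd (chart_at GM \<one>) \<one>) ` (snd (chart_at GM \<one>) ` U0)"
 by (auto simp: D0_def kap_def)

lemma D0_open: "open D0"
 unfolding D0_eq using open_translation_subtract[OF chart_open_image_dom[OF GM_ok chart_one(1)]] by simp

lemma kap_tendsto: "x : U0 ==> (kap ---> kap x) (nhdsin T x)"
 unfolding kap_def by (intro tendsto_intros chart_tendsto[OF GM_ok chart_one(1)])

lemma kinv_filterlim:
 assumes "v : D0"
 shows "filterlim kinv (nhdsin T (kinv v)) (nhds v)"
proof -
 let ?e = "snd (chart_at GM \<one>) \<one>"
 obtain x where x: "x : U0" "v = kap x" using assms by (auto simp: D0_def)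
 have "filterlim (%v. v + ?e) (nhds (v + ?e)) (nhds v)"
  by (intro tendsto_add filterlim_ident tendsto_const)
 then have "filterlim (%v. v + ?e) (nhds (snd (chart_at GM \<one>) x)) (nhds v)"
  using x by (simp add: kap_def)
 from filterlim_compose[OF chart_inv_filterlim[OF GM_ok chart_one(1) x(1)] this]
 have "filterlim (%v. kinv v) (nhdsin T x) (nhds v)" by (simp only: kinv_def)
 then show ?thesis using x kinv_kap[OF x(1)] by simp
qed

lemma kap_lim:
 assumes "x : U0" "eventually (%z. f z : U0) F" "((%z. kap (f z)) ---> kap x) F"
 shows "filterlim f (nhdsin T x) F"
proof -
 have l: "filterlim (%z. kinv (kap (f z))) (nhdsin T x) F"
  using filterlim_compose[OF kinv_filterlim assms(3)] assms(1) by (simp add: D0_def kinv_kap)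
 have "eventually (%z. kinv (kap (f z)) = f z) F"
  using assms(2) by (rule eventually_mono) (rule kinv_kap)
 from filterlim_cong[OF refl refl this] l show ?thesis by simp
qed

definition "mdom = {(x, y). x : D0 & y : D0 & kinv x ** kinv y : U0}"

lemma mult_Ck: "Ck_on k mdom (%(x, y). kap (kinv x ** kinv y))" and mdom_open: "open mdom"
proof -
 let ?c = "snd (chart_at GM \<one>)" and ?m = "%(a, b). a ** b"
 let ?e = "?c \<one>"
 let ?p = "map_prod ?c ?c"
 note PM = ok_product[OF GM_ok GM_ok]
 have c: "(U0 \<times> U0, ?p) : atlas (product_space GM GM)"
  using chart_one by (auto simp: atlas_product)
 let ?T = "(U0 \<times> U0) Int {z : points (product_space GM GM). ?m z : U0}"
 have T: "openin (top_of (product_space GM GM)) ?T"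
  using chart_openin[OF PM c] openin_continuous_map_preimage[OF smooth_cont[OF mult_smooth] U0_open] by blast
 have oS: "open (?p ` ?T)" by (rule chart_open_image[OF PM c T]) auto
 have Teq: "?T = (U0 \<times> U0) Int ?m -` U0" using U0_carrier by auto
 have C: "Ck_on k (?p ` ?T) (?c o ?m o inv_into (U0 \<times> U0) ?p)"
  unfolding Teq by (rule smooth_map_chart[OF mult_smooth c chart_one(1)])
 have md: "z : mdom \<longleftrightarrow> z + (?e, ?e) : ?p ` ?T" for z
 proof
  assume "z : mdom"
  then have z: "fst z : D0" "snd z : D0" "kinv (fst z) ** kinv (snd z) : U0" by (auto simp: mdom_def)
  then have "z + (?e, ?e) = ?p (kinv (fst z), kinv (snd z))"
   using kap_kinv[OF z(1)] kap_kinv[OF z(2)] by (auto simp: kap_def algebra_simps prod_eq_iff)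
  moreover have "(kinv (fst z), kinv (snd z)) : ?T" using z kinv_in kinv_carrier by auto
  ultimately show "z + (?e, ?e) : ?p ` ?T" by (rule image_eqI)
 next
  assume "z + (?e, ?e) : ?p ` ?T"
  then obtain a b where ab: "a : U0" "b : U0" "a ** b : U0" "z + (?e, ?e) = (?c a, ?c b)" by auto
  then have "z = (kap a, kap b)" by (auto simp: kap_def prod_eq_iff eq_diff_eq)
  then show "z : mdom" using ab by (auto simp: mdom_def D0_def kinv_kap)
 qed
 have "mdom = (%z. z + (?e, ?e)) -` (?p ` ?T)" using md by auto
 then show o: "open mdom"
  using continuous_open_vimage[OF oS, of "%z. z + (?e, ?e)"] by (simp add: continuous_intros)
 have "Ck_on k mdom (%z. (?c o ?m o inv_into (U0 \<times> U0) ?p) (z + (?e, ?e)))"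
  by (rule Ck_on_compose[OF findim_prod[OF fd fd] o C
     Ck_on_add[OF o Ck_bounded_linear[OF o bounded_linear_ident] Ck_on_const[OF o]]])
   (use md in blast)
 then have 1: "Ck_on k mdom (%z. (?c o ?m o inv_into (U0 \<times> U0) ?p) (z + (?e, ?e)) + (- ?e))"
  by (intro Ck_on_add Ck_on_const o)
 show "Ck_on k mdom (%(x, y). kap (kinv x ** kinv y))"
 proof (rule Ck_on_cong[OF o _ 1])
  fix z assume "z : mdom"
  then have z: "fst z : D0" "snd z : D0" by (auto simp: mdom_def)
  then have "z + (?e, ?e) = ?p (kinv (fst z), kinv (snd z))"
   using kap_kinv[OF z(1)] kap_kinv[OF z(2)] by (auto simp: kap_def algebra_simps prod_eq_iff)
  moreover have "inv_into (U0 \<times> U0) ?p (?p (kinv (fst z), kinv (snd z))) = (kinv (fst z), kinv (snd z))"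
   by (rule inv_into_f_f[OF chart_inj[OF PM c]]) (use z kinv_in in auto)
  ultimately show "(?c o ?m o inv_into (U0 \<times> U0) ?p) (z + (?e, ?e)) + (- ?e) = (%(x, y). kap (kinv x ** kinv y)) z"
   by (simp add: kap_def split_beta)
 qed
qed

lemma zero_mdom: "(0, 0) : mdom" using zero_D0 chart_one by (simp add: mdom_def)

lemma mdom_axis: "(0, y) : mdom \<longleftrightarrow> y : D0" "(y, 0) : mdom \<longleftrightarrow> y : D0"
 using zero_D0 kinv_in kinv_carrier by (auto simp: mdom_def)

section \<open>Powers of group elements near the identity\<close>

definition near :: "real => 'g set" where "near r = {a : U0. norm (kap a) < r}"

lemma near_carrier: "a : near r ==> a : CG" using U0_carrier by (auto simp: near_def)

text \<open>On each coordinate axis the product with the identity is the identity map, so the two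
  partial derivatives are identities and the total derivative is their sum.\<close>

lemma mult_strict: "strict_deriv (%(x, y). kap (kinv x ** kinv y)) (%(v, w). v + w) (0, 0)"
proof -
 let ?f = "%(x, y). kap (kinv x ** kinv y)"
 let ?D = "FD ?f (0, 0)"
 have sd: "strict_deriv ?f ?D (0, 0)"
  by (rule Ck_on_strict_deriv[OF findim_prod[OF fd fd] mult_Ck mdom_open zero_mdom])
 note D = strict_has_deriv[OF sd]
 have D1: "?D (v, 0) = v" for v
 proof -
  have "((%x. ?f (x, 0)) has_derivative (%v. ?D (v, 0))) (at 0)"
   by (rule has_derivative_compose[where g = ?f and f = "%x. (x, 0)", OF _ D]) (auto intro!: derivative_eq_intros)
  moreover have "((%x. ?f (x, 0)) has_derivative (%v. v)) (at 0)"
   by (rule has_derivative_transform_within_open[OF has_derivative_ident D0_open zero_D0])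
    (simp add: kap_kinv kinv_carrier)
  ultimately show ?thesis using has_derivative_unique by metis
 qed
 have D2: "?D (0, v) = v" for v
 proof -
  have "((%x. ?f (0, x)) has_derivative (%v. ?D (0, v))) (at 0)"
   by (rule has_derivative_compose[where g = ?f and f = "%x. (0, x)", OF _ D]) (auto intro!: derivative_eq_intros)
  moreover have "((%x. ?f (0, x)) has_derivative (%v. v)) (at 0)"
   by (rule has_derivative_transform_within_open[OF has_derivative_ident D0_open zero_D0])
    (simp add: kap_kinv kinv_carrier)
  ultimately show ?thesis using has_derivative_unique by metis
 qed
 have "?D z = fst z + snd z" for z
  using linear_add[OF has_derivative_linear[OF D], of "(fst z, 0)" "(0, snd z)"] D1 D2 by simp
 then have "?D = (%(v, w). v + w)" by auto
 then show ?thesis using sd by metis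
qed

text \<open>The source of the power estimates: changes of the factors add up in the product, up to a
  relative error e.\<close>

lemma mult_estimate:
 assumes "e > 0"
 obtains R where "R > 0"
  "!!a b c d. a : near R ==> b : near R ==> c : near R ==> d : near R ==> a ** b : U0 &
   norm (kap (a ** b) - kap (c ** d) - (kap a - kap c) - (kap b - kap d)) \<le> e * (norm (kap a - kap c) + norm (kap b - kap d))"
proof -
 obtain r where r: "r > 0" "!!z z'. dist (0, 0) z < r ==> dist (0, 0) z' < r ==>
   norm ((%(x, y). kap (kinv x ** kinv y)) z - (%(x, y). kap (kinv x ** kinv y)) z' - (%(v, w). v + w) (z - z')) \<le> e * norm (z - z')"
  by (rule strict_derivE[OF mult_strict assms]) (rule that)
 obtain s where s: "s > 0" "ball (0, 0) s \<subseteq> mdom" by (rule openE[OF mdom_open zero_mdom]) (rule that)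
 \<comment> \<open>The norm of a pair is at most the sum of the norms, hence half the radius for
   each factor.\<close>
 have d: "dist (0, 0) (kap a, kap b) < min r s" if "a : near (min r s / 2)" "b : near (min r s / 2)" for a b
  using that norm_Pair_le[of "kap a" "kap b"] by (simp add: near_def dist_Pair_Pair norm_Pair)
 show ?thesis
 proof (rule that[of "min r s / 2"], goal_cases)
  case (2 a b c d)
  have "(kap a, kap b) : mdom" using d[OF 2(1,2)] s(2) by auto
  then have "a ** b : U0" using 2 by (simp add: mdom_def near_def kinv_kap)
  moreover have "e * norm (kap a - kap c, kap b - kap d) \<le> e * (norm (kap a - kap c) + norm (kap b - kap d))"
   using assms norm_Pair_le by (intro mult_left_mono) auto
  ultimately show ?case
   using r(2)[of "(kap a, kap b)" "(kap c, kap d)"] d[OF 2(1,2)] d[OF 2(3,4)] 2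
   by (simp add: near_def kinv_kap algebra_simps)
 qed (use r s in simp)
qed

lemma one_near: "r > 0 ==> \<one> : near r"
 using chart_one by (simp add: near_def)

text \<open>As long as the k-fold coordinate stays within d, taking k-th powers acts like
  multiplication by k up to relative error e. The radius does not depend on k, which is what makes
  limits of powers converge.\<close>

definition "pow_radius e d \<longleftrightarrow> d > 0 & cball 0 d \<subseteq> D0 &
 (ALL a:U0. ALL b:U0. ALL k. real k * norm (kap a) \<le> d --> real k * norm (kap b) \<le> d -->
   a [^] k : U0 & norm (kap (a [^] k)) \<le> 2 * (real k * norm (kap a)) &
   norm (kap (a [^] k) - kap (b [^] k) - real k *. (kap a - kap b)) \<le> e * (real k * norm (kap a - kap b)))"

lemma pow_radiusD:
 assumes "pow_radius e d" "a : U0" "real k * norm (kap a) \<le> d"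
 shows "a [^] k : U0" "norm (kap (a [^] k)) \<le> 2 * (real k * norm (kap a))"
  "b : U0 ==> real k * norm (kap b) \<le> d ==>
   norm (kap (a [^] k) - kap (b [^] k) - real k *. (kap a - kap b)) \<le> e * (real k * norm (kap a - kap b))"
 using assms unfolding pow_radius_def by blast+

text \<open>The difference of \<open>a\<^sup>k\<close> and \<open>b\<^sup>k\<close> telescopes into the differences of
 \<open>a\<^sup>i a b\<^sup>j\<close> and \<open>a\<^sup>i b b\<^sup>j\<close>, to each of which strict differentiability of the multiplication applies.\<close>

lemma pow_radius_ex:
 assumes e: "0 < e" "e \<le> 1"
 obtains d where "pow_radius e d"
proof -
 \<comment> \<open>Replacing a by b inside a product costs e / 3 for the factor on the left and at
   most twice e / 3 for the factor on the right.\<close>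
 obtain R where R: "R > 0" and est: "!!a b c d. a : near R ==> b : near R ==> c : near R ==> d : near R ==> a ** b : U0 &
   norm (kap (a ** b) - kap (c ** d) - (kap a - kap c) - (kap b - kap d)) \<le> e / 3 * (norm (kap a - kap c) + norm (kap b - kap d))"
  by (rule mult_estimate[of "e / 3"]) (use e in \<open>auto intro: that\<close>)
 obtain r where r: "r > 0" "cball 0 r \<subseteq> D0" using D0_open zero_D0 open_contains_cball by blast
 \<comment> \<open>A power has norm at most 2 * d and one further factor adds at most 2 * d, so 4 *
   d has to remain strictly below R.\<close>
 define d where "d = min r (R / 5)"
 have d: "d > 0" "5 * d \<le> R" "cball 0 d \<subseteq> D0" using R r by (auto simp: d_def)
 have near: "x : near R" if "x : U0" "norm (kap x) \<le> 4 * d" for x using that d by (simp add: near_def)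
 have right: "p ** x : U0 & norm (kap (p ** x)) \<le> norm (kap p) + 2 * norm (kap x)"
  if "p : near R" "x : near R" for p x
 proof -
  have pG: "p : CG" using that near_carrier by blast
  have "e / 3 * norm (kap x) \<le> 1 * norm (kap x)" using e by (intro mult_right_mono) auto
  then show ?thesis
   using est[OF that that(1) one_near[OF R]] norm_triangle_ineq[of "kap (p ** x) - kap p - kap x" "kap p + kap x"]
    norm_triangle_ineq[of "kap p" "kap x"] pG by (simp add: algebra_simps)
 qed
 have pow: "a [^] k : U0 & norm (kap (a [^] k)) \<le> 2 * (real k * norm (kap a))"
  if a: "a : U0" "real k * norm (kap a) \<le> d" for a k
  using a(2)
 proof (induction k)
  case 0
  then show ?case using chart_one by simp
 next
  case (Suc k)
  have le: "real k * norm (kap a) \<le> d" "norm (kap a) \<le> d"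
   using Suc.prems mult_nonneg_nonneg[of "real k" "norm (kap a)"] by (auto simp: algebra_simps intro: order_trans[rotated])
  have n: "a [^] k : near R" "a : near R" using Suc.IH[OF le(1)] le a(1) d(1) by (auto intro!: near)
  show ?case using right[OF n] Suc.IH[OF le(1)] by (simp add: algebra_simps)
 qed
 \<comment> \<open>The trailing power of b has to be arbitrary: each induction step moves one factor
   from the power of a to it.\<close>
 have diff: "norm (kap (a [^] k ** b [^] m) - kap (b [^] (k + m)) - real k *. (kap a - kap b)) \<le> e * (real k * norm (kap a - kap b))"
  if a: "a : U0" "b : U0" "real (k + m) * norm (kap a) \<le> d" "real (k + m) * norm (kap b) \<le> d" for a b k m
  using a(3,4)
 proof (induction k arbitrary: m)
  case 0
  then show ?case using U0_carrier a by (simp add: subset_iff)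
 next
  case (Suc k)
  have G: "a : CG" "b : CG" using a U0_carrier by auto
  let ?w = "kap a - kap b" and ?p = "a [^] k" and ?q = "b [^] m"
  have mono: "real j * norm v \<le> d" if "real (Suc k + m) * norm v \<le> d" "j \<le> Suc k + m" for j and v :: 'f
   by (rule order_trans[OF mult_right_mono that(1)]) (use that in auto)
  have p: "?p : U0" "norm (kap ?p) \<le> 2 * d" and q: "?q : U0" "norm (kap ?q) \<le> 2 * d"
   using pow[OF a(1), of k] pow[OF a(2), of m] mono[OF Suc.prems(1), of k] mono[OF Suc.prems(2), of m] by auto
  have ab: "norm (kap a) \<le> d" "norm (kap b) \<le> d"
   using mono[OF Suc.prems(1), of 1] mono[OF Suc.prems(2), of 1] by auto
  have n: "?p : near R" "?q : near R" "a : near R" "b : near R" using p q ab a d(1) by (auto intro: near)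
  have n': "?p ** a : near R" "?p ** b : near R"
   using right[OF n(1,3)] right[OF n(1,4)] p ab by (auto intro!: near)
  let ?u = "kap (?p ** a) - kap (?p ** b)"
  have 1: "norm (?u - ?w) \<le> e / 3 * norm ?w" using est[OF n(1,3,1,4)] by simp
  have 2: "norm (kap (?p ** a ** ?q) - kap (?p ** b ** ?q) - ?u) \<le> e / 3 * norm ?u"
   using est[OF n'(1) n(2) n'(2) n(2)] by simp
  have "e / 3 * norm ?w \<le> 1 * norm ?w" using e by (intro mult_right_mono) auto
  then have "norm ?u \<le> 2 * norm ?w" using 1 norm_triangle_sub[of ?u ?w] by linarith
  then have "e / 3 * norm ?u \<le> e / 3 * (2 * norm ?w)" using e by (intro mult_left_mono) auto
  then have 3: "norm (kap (?p ** a ** ?q) - kap (?p ** b ** ?q) - ?w) \<le> e * norm ?w"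
   using norm_diff_triangle_le[OF 2 1] by (simp add: field_simps)
  have 4: "norm (kap (?p ** b [^] Suc m) - kap (b [^] (k + Suc m)) - real k *. ?w) \<le> e * (real k * norm ?w)"
   by (rule Suc.IH) (use Suc.prems in simp_all)
  have eq: "?p ** b ** ?q = ?p ** b [^] Suc m" 
   using G nat_pow_Suc2[OF G(2), of m] by (metis m_assoc nat_pow_closed)
  have "kap (?p ** a ** ?q) - kap (b [^] (k + Suc m)) - (?w + real k *. ?w) =
   (kap (?p ** a ** ?q) - kap (?p ** b ** ?q) - ?w) + (kap (?p ** b [^] Suc m) - kap (b [^] (k + Suc m)) - real k *. ?w)"
   unfolding eq by (simp add: algebra_simps)
  then have "norm (kap (?p ** a ** ?q) - kap (b [^] (k + Suc m)) - (?w + real k *. ?w)) \<le> e * norm ?w + e * (real k * norm ?w)"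
   using 3 4 norm_triangle_mono by metis
  then show ?case by (simp add: algebra_simps)
 qed
 have "pow_radius e d" unfolding pow_radius_def
  using d pow diff[of _ _ _ 0] U0_carrier by (auto simp: subset_iff)
 then show ?thesis by (rule that)
qed

section \<open>Euler approximations and the exponential map\<close>

definition "del = (SOME d. pow_radius 1 d)"

lemma del_radius: "pow_radius 1 del"
 unfolding del_def by (rule pow_radius_ex[of 1]) (auto intro: someI)

lemma del: "del > 0" "norm v \<le> del ==> v : D0"
 using del_radius by (auto simp: pow_radius_def subset_iff)

lemma pow_difference_le:
 assumes "a : U0" "real k * norm (kap a) \<le> del" "b : U0" "real k * norm (kap b) \<le> del"
 shows "norm (kap (a [^] k) - kap (b [^] k)) \<le> 2 * norm (real k *. kap a - real k *. kap b)"
 using pow_radiusD(3)[OF del_radius assms]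
  norm_triangle_sub[of "kap (a [^] k) - kap (b [^] k)" "real k *. (kap a - kap b)"]
 unfolding scaleR_diff_right[symmetric] by simp

text \<open>Euler's approximation (1 + v / n)^n, with \<open>kinv\<close> in place of adding
  1.\<close>

definition "esq v n = kinv ((1 / real n) *. v) [^] n"

lemma esq_base:
 assumes "norm v \<le> real n * del" "n > 0"
 shows "kinv ((1 / real n) *. v) : U0" "kap (kinv ((1 / real n) *. v)) = (1 / real n) *. v"
  "real n * norm (kap (kinv ((1 / real n) *. v))) = norm v"
proof -
 have D: "(1 / real n) *. v : D0" by (rule del) (use assms in \<open>simp add: divide_le_eq mult.commute\<close>)
 show "kinv ((1 / real n) *. v) : U0" by (rule kinv_in[OF D])
 show k: "kap (kinv ((1 / real n) *. v)) = (1 / real n) *. v" by (rule kap_kinv[OF D])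
 show "real n * norm (kap (kinv ((1 / real n) *. v))) = norm v" using assms unfolding k by simp
qed

lemma esq_base':
 assumes "norm v \<le> del" "n > 0"
 shows "norm v \<le> real n * del"
proof -
 have "1 * del \<le> real n * del" using assms(2) del(1) by (intro mult_right_mono) auto
 then show ?thesis using assms(1) by simp
qed

text \<open>Refinement from n to n * m. The m-th power of the finer base is close to the coarser
  base with the small error e, because norm v / n is within d; the n-th power then at most doubles
  the scaled difference. The bound del / 2 leaves room for the factor 2 in the norm of that m-th
  power.\<close>

lemma esq_compare:
 assumes v: "norm v \<le> del / 2" and d: "pow_radius e d" and n: "n > 0" "norm v \<le> real n * d" and m: "m > 0"
 shows "norm (kap (esq v (n * m)) - kap (esq v n)) \<le> 2 * (e * norm v)"
proof -
 have v': "norm v \<le> del" using v del(1) by linarith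
 let ?x = "kinv ((1 / real (n * m)) *. v)" and ?b = "kinv ((1 / real n) *. v)"
 let ?a = "?x [^] m"
 have nm: "n * m > 0" using n m by simp
 note x = esq_base[OF esq_base'[OF v' nm] nm] and b = esq_base[OF esq_base'[OF v' n(1)] n(1)]
 have mx: "real m * norm (kap ?x) = norm v / real n" unfolding x(2) using n m by simp
 have vd: "real m * norm (kap ?x) \<le> d" unfolding mx using n by (simp add: divide_le_eq mult.commute)
 have aU: "?a : U0" and an: "norm (kap ?a) \<le> 2 * (norm v / real n)"
  using pow_radiusD(1,2)[OF d x(1) vd] unfolding mx by auto
 have "real m *. kap ?x = (1 / real n) *. v" unfolding x(2) using n m by simp
 then have ad: "norm (kap ?a - (1 / real n) *. v) \<le> e * (norm v / real n)"
  using pow_radiusD(3)[OF d x(1) vd chart_one(2)] d mx by (simp add: pow_radius_def)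
 have "real n * norm (kap ?a) \<le> real n * (2 * (norm v / real n))" using an by (intro mult_left_mono) auto
 also have "... = 2 * norm v" using n by simp
 finally have na: "real n * norm (kap ?a) \<le> del" using v by linarith
 have "norm (kap (?a [^] n) - kap (?b [^] n)) \<le> 2 * norm (real n *. kap ?a - real n *. kap ?b)"
  by (rule pow_difference_le[OF aU na b(1)]) (use b(3) v' in simp)
 also have "... = 2 * (real n * norm (kap ?a - kap ?b))" by (simp flip: scaleR_diff_right)
 also have "... \<le> 2 * (real n * (e * (norm v / real n)))"
  using ad unfolding b(2) by (intro mult_left_mono) auto
 also have "... = 2 * (e * norm v)" using n by simp
 moreover have "?a [^] n = esq v (n * m)"
  using x(1) U0_carrier by (simp add: esq_def nat_pow_pow mult.commute subset_iff)
 ultimately show ?thesis by (simp add: esq_def)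
qed

lemma esq_convergent:
 assumes v: "norm v \<le> del / 2"
 obtains g where "g : U0" "(%n. kap (esq v (Suc n))) ----> kap g"
proof -
 have v': "norm v \<le> del" using v del(1) by linarith
 have C: "Cauchy (%n. kap (esq v (Suc n)))"
 proof (rule metric_CauchyI)
  fix e :: real assume e: "e > 0"
  \<comment> \<open>Two indices are compared with their product, at a cost of 2 * (c * norm v) each,
    hence the 4 in c. The 1 in B keeps the division meaningful for v = 0.\<close>
  define B where "B = norm v + 1"
  have B: "B > 0" "norm v < B" by (auto simp: B_def add_nonneg_pos)
  define c where "c = min 1 (e / (4 * B))"
  have c: "0 < c" "c \<le> 1" "4 * (c * B) \<le> e" using e B by (auto simp: c_def min_def field_simps)
  have "c * norm v < c * B" using c(1) B(2) by simp
  then have ce: "4 * (c * norm v) < e" using c(3) by linarith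
  obtain d where d: "pow_radius c d" by (rule pow_radius_ex[OF c(1,2)]) (rule that)
  then have d0: "d > 0" by (simp add: pow_radius_def)
  obtain N where N: "norm v / d < real N" using reals_Archimedean2 by blast
  have cmp: "norm (kap (esq v (Suc n * Suc m)) - kap (esq v (Suc n))) \<le> 2 * (c * norm v)" if "n \<ge> N" for n m
  proof (rule esq_compare[OF v d])
   have "norm v < real N * d" using N d0 by (simp add: divide_less_eq)
   also have "... \<le> real (Suc n) * d" using that d0 by (intro mult_right_mono) auto
   finally show "norm v \<le> real (Suc n) * d" by simp
  qed auto
  have "dist (kap (esq v (Suc m))) (kap (esq v (Suc n))) < e" if "m \<ge> N" "n \<ge> N" for m n
   using cmp[OF that(1), of n] cmp[OF that(2), of m] ce
    norm_triangle_ineq4[of "kap (esq v (Suc m * Suc n)) - kap (esq v (Suc n))" "kap (esq v (Suc m * Suc n)) - kap (esq v (Suc m))"]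
   unfolding mult.commute[of "Suc n" "Suc m"] dist_norm by simp
  then show "EX M. ALL m>=M. ALL n>=M. dist (kap (esq v (Suc m))) (kap (esq v (Suc n))) < e" by blast
 qed
 have c: "complete (cball 0 (2 * norm v) :: 'f set)"
  using compact_cball_fd[OF fd] compact_imp_complete by blast
 have "norm (kap (esq v (Suc n))) \<le> 2 * norm v" for n
  using pow_radiusD(2)[OF del_radius esq_base(1)[OF esq_base'[OF v']], of "Suc n" "Suc n"] esq_base(3)[OF esq_base'[OF v'], of "Suc n"] v'
  unfolding esq_def by (simp del: of_nat_Suc nat_pow_Suc)
 then have n: "ALL n. kap (esq v (Suc n)) : cball 0 (2 * norm v)" by simp
 obtain l where l: "l : cball 0 (2 * norm v)" "(%n. kap (esq v (Suc n))) ----> l"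
  by (rule completeE[OF c n C]) (rule that)
 then have "l : D0" using v by (intro del) auto
 then show ?thesis using that[of "kinv l"] l(2) kap_kinv kinv_in by simp
qed

text \<open>The limit depends on v alone. The power with exponent k n is compared with the Euler
  approximation of v for the same exponent, and the difference is at most twice the distance of k n
  times the coordinate of the base from v.\<close>

lemma pow_limit_small:
 assumes v: "norm v < del / 2" and g: "g : U0" "(%n. kap (esq v (Suc n))) ----> kap g"
  and k: "filterlim k at_top sequentially"
  and a: "eventually (%n. a n : U0) sequentially" "(%n. real (k n) *. kap (a n)) ----> v"
 shows "filterlim (%n. a n [^] k n) (nhdsin T g) sequentially"
proof -
 have v': "norm v \<le> del" using v del(1) by linarith
 have "(%n. norm (real (k n) *. kap (a n))) ----> norm v" using a(2) by (rule tendsto_norm)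
 then have "eventually (%n. norm (real (k n) *. kap (a n)) < del) sequentially"
  by (rule order_tendstoD) (use v del(1) in linarith)
 moreover have "eventually (%n. k n > 0) sequentially"
  using k eventually_gt_at_top[of "0::nat"] unfolding filterlim_iff by blast
 ultimately have ev: "eventually (%n. a n : U0 & real (k n) * norm (kap (a n)) \<le> del & k n > 0) sequentially"
  using a(1) by eventually_elim (auto simp: less_imp_le)
 show ?thesis
 proof (rule kap_lim[OF g(1)])
  show "eventually (%n. a n [^] k n : U0) sequentially"
   using ev by eventually_elim (auto intro: pow_radiusD[OF del_radius])
  have "(%n. kap (a n [^] k n) - kap (esq v (k n))) ----> 0"
  proof (rule Lim_null_comparison)
   show "eventually (%n. norm (kap (a n [^] k n) - kap (esq v (k n))) \<le> 2 * norm (real (k n) *. kap (a n) - v)) sequentially"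
    using ev
   proof eventually_elim
    case (elim n)
    then show ?case
     using pow_difference_le[of "a n" "k n" "kinv ((1 / real (k n)) *. v)"]
      esq_base[OF esq_base'[OF v'], of "k n"] v' by (simp add: esq_def)
   qed
   have "(%n. 2 * norm (real (k n) *. kap (a n) - v)) ----> 2 * norm (v - v)"
    by (intro tendsto_intros a)
   then show "(%n. 2 * norm (real (k n) *. kap (a n) - v)) ----> 0" by simp
  qed
  from tendsto_add[OF this filterlim_compose[OF LIMSEQ_imp_Suc[OF g(2)] k]]
  show "(%n. kap (a n [^] k n)) ----> kap g" by simp
 qed
qed

text \<open>A large v is divided by N to reach the range of the local result. Splitting the exponent
  as k = q * N + r, the q-th powers converge to the limit g for v / N, their N-th powers converge to
  g [^] N, and the fewer than N remaining factors tend to the identity.\<close>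

lemma pow_limit_ex:
 "EX g:CG. ALL a k. filterlim k at_top sequentially --> eventually (%n. a n : U0) sequentially -->
   (%n. real (k n) *. kap (a n)) ----> v --> filterlim (%n. a n [^] k n) (nhdsin T g) sequentially"
proof -
 obtain N0 where "2 * norm v / del < real N0" using reals_Archimedean2 by blast
 moreover define N where "N = Suc N0"
 ultimately have N: "N > 0" "2 * norm v / del < real N" by auto
 define u where "u = (1 / real N) *. v"
 have u: "norm u < del / 2" using N del(1) by (simp add: u_def field_simps)
 obtain g where g: "g : U0" "(%n. kap (esq u (Suc n))) ----> kap g"
  by (rule esq_convergent[OF less_imp_le[OF u]]) (rule that)
 have gG: "g : CG" using g(1) U0_carrier by blast
 have "filterlim (%n. a n [^] k n) (nhdsin T (g [^] N)) sequentially"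
  if k: "filterlim k at_top sequentially" and a: "eventually (%n. a n : U0) sequentially"
   and lim: "(%n. real (k n) *. kap (a n)) ----> v" for a k
 proof -
  let ?q = "%n. k n div N" and ?r = "%n. k n mod N"
  have "(%n. (1 / real (k n)) *. (real (k n) *. kap (a n))) ----> 0 *. v"
   by (intro tendsto_scaleR lim) (use filterlim_compose[OF lim_1_over_n k] in simp)
  moreover have "eventually (%n. k n > 0) sequentially"
   using k eventually_gt_at_top[of "0::nat"] unfolding filterlim_iff by blast
  then have "eventually (%n. (1 / real (k n)) *. (real (k n) *. kap (a n)) = kap (a n)) sequentially"
   by eventually_elim simp
  ultimately have a0: "(%n. kap (a n)) ----> 0" using Lim_transform_eventually by fastforce
  have N0: "(%n. real N * norm (kap (a n))) ----> 0" using tendsto_mult_left[OF tendsto_norm[OF a0], of "real N"] by simp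
  have rN: "real (?r n) * norm (kap (a n)) \<le> real N * norm (kap (a n))" for n
   using N by (intro mult_right_mono) auto
  have "(%n. real (?r n) *. kap (a n)) ----> 0"
   by (rule Lim_null_comparison[OF _ N0]) (use rN in simp)
  from tendsto_scaleR[OF tendsto_const[of "1 / real N"] tendsto_diff[OF lim this]]
  have "(%n. (1 / real N) *. (real (k n) *. kap (a n) - real (?r n) *. kap (a n))) ----> u" by (simp add: u_def)
  moreover have "(1 / real N) *. (real (k n) *. x - real (?r n) *. x) = real (?q n) *. x" for n and x :: 'f
  proof -
   have "real (k n) = real (?q n) * real N + real (?r n)" by (metis div_mult_mod_eq of_nat_add of_nat_mult)
   then show ?thesis using N by (simp flip: scaleR_diff_left)
  qed
  ultimately have "(%n. real (?q n) *. kap (a n)) ----> u" by simp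
  from pow_limit_small[OF u g filterlim_compose[OF filterlim_at_top_div_const_nat[OF N(1)] k] a this]
  have 1: "filterlim (%n. (a n [^] ?q n) [^] N) (nhdsin T (g [^] N)) sequentially" by (rule pow_lim[OF _ gG])
  have evd: "eventually (%n. real N * norm (kap (a n)) < del) sequentially"
   by (rule order_tendstoD(2)[OF N0 del(1)])
  have ev: "eventually (%n. a n [^] ?r n : U0 & norm (kap (a n [^] ?r n)) \<le> 2 * (real N * norm (kap (a n)))) sequentially"
   using evd a
  proof eventually_elim
   case (elim n)
   then have "real (?r n) * norm (kap (a n)) \<le> del" using rN[of n] by linarith
   from pow_radiusD(1,2)[OF del_radius elim(2) this] show ?case using rN[of n] by simp
  qed
  have 2: "filterlim (%n. a n [^] ?r n) (nhdsin T \<one>) sequentially"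
  proof (rule kap_lim[OF chart_one(2)])
   show "eventually (%n. a n [^] ?r n : U0) sequentially" using ev by eventually_elim simp
   have "(%n. kap (a n [^] ?r n)) ----> 0"
   proof (rule Lim_null_comparison)
    show "eventually (%n. norm (kap (a n [^] ?r n)) \<le> 2 * (real N * norm (kap (a n)))) sequentially"
     using ev by eventually_elim simp
    show "(%n. 2 * (real N * norm (kap (a n)))) ----> 0" using tendsto_mult_left[OF N0, of 2] by simp
   qed
   then show "(%n. kap (a n [^] ?r n)) ----> kap \<one>" by simp
  qed
  have eq: "eventually (%n. a n [^] k n = (a n [^] ?q n) [^] N ** a n [^] ?r n) sequentially"
   using a
  proof eventually_elim
   case (elim n)
   then have "a n : CG" using U0_carrier by blast
   then show ?case by (simp add: nat_pow_pow nat_pow_mult)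
  qed
  show ?thesis
   unfolding filterlim_cong[OF refl refl eq] using mult_lim[OF 1 2] gG by simp
 qed
 then show ?thesis using gG by (intro bexI[of _ "g [^] N"]) auto
qed

text \<open>Selected by its limit property for all admissible sequences. Identities for
  \<open>Exp\<close> are then proved by exhibiting one sequence of powers with the required limit,
  as in \<open>ExpI\<close>.\<close>

definition "Exp v = (SOME g. g : CG & (ALL a k. filterlim k at_top sequentially -->
 eventually (%n. a n : U0) sequentially --> (%n. real (k n) *. kap (a n)) ----> v -->
 filterlim (%n. a n [^] k n) (nhdsin T g) sequentially))"

lemma Exp_carrier [simp]: "Exp v : CG"
 and pow_limit: "filterlim k at_top sequentially ==> eventually (%n. a n : U0) sequentially ==>
   (%n. real (k n) *. kap (a n)) ----> v ==> filterlim (%n. a n [^] k n) (nhdsin T (Exp v)) sequentially"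
proof -
 have "Exp v : CG & (ALL a k. filterlim k at_top sequentially -->
  eventually (%n. a n : U0) sequentially --> (%n. real (k n) *. kap (a n)) ----> v -->
  filterlim (%n. a n [^] k n) (nhdsin T (Exp v)) sequentially)"
  unfolding Exp_def by (rule someI_ex) (use pow_limit_ex[of v] in blast)
 then show "Exp v : CG" "filterlim k at_top sequentially ==> eventually (%n. a n : U0) sequentially ==>
   (%n. real (k n) *. kap (a n)) ----> v ==> filterlim (%n. a n [^] k n) (nhdsin T (Exp v)) sequentially"
  by blast+
qed

lemma ExpI:
 assumes "g : CG" "filterlim (%n. a n [^] k n) (nhdsin T g) sequentially"
  and "filterlim k at_top sequentially" "eventually (%n. a n : U0) sequentially" "(%n. real (k n) *. kap (a n)) ----> v"
 shows "Exp v = g"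
 by (rule Hausdorff_limit_unique[OF Hausdorff _ _ sequentially_bot pow_limit[OF assms(3-5)] assms(2)]) (use assms(1) in auto)

definition "xn v n = kinv ((1 / real (Suc n)) *. v)"

lemma xn:
 shows "eventually (%n. xn v n : U0 & real (Suc n) *. kap (xn v n) = v) sequentially"
proof -
 have "(%n. norm ((1 / real (Suc n)) *. v)) ----> 0"
  using tendsto_mult[OF LIMSEQ_inverse_real_of_nat tendsto_const, of "norm v"] by (simp add: inverse_eq_divide)
 then have "eventually (%n. norm ((1 / real (Suc n)) *. v) < del) sequentially" by (rule order_tendstoD(2)) (rule del)
 then show ?thesis
 proof eventually_elim
  case (elim n)
  then have "(1 / real (Suc n)) *. v : D0" by (intro del) simp
  then show ?case using kinv_in kap_kinv by (simp add: xn_def del: of_nat_Suc)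
 qed
qed

lemma xn_U0: "eventually (%n. xn v n : U0) sequentially"
 using xn[of v] by eventually_elim simp

lemma xn_lim:
 assumes "(%n. real (k n) / real (Suc n)) ----> t"
 shows "(%n. real (k n) *. kap (xn v n)) ----> t *. v"
proof (rule Lim_transform_eventually)
 show "(%n. (real (k n) / real (Suc n)) *. v) ----> t *. v" by (intro tendsto_scaleR assms tendsto_const)
 show "eventually (%n. (real (k n) / real (Suc n)) *. v = real (k n) *. kap (xn v n)) sequentially"
  using xn[of v]
 proof eventually_elim
  case (elim n)
  then have "(real (k n) / real (Suc n)) *. v = (real (k n) / real (Suc n)) *. (real (Suc n) *. kap (xn v n))" by simp
  then show ?case by (simp del: of_nat_Suc)
 qed
qed

lemma Exp_xn: "filterlim (%n. xn v n [^] Suc n) (nhdsin T (Exp v)) sequentially"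
 by (rule pow_limit[OF filterlim_Suc xn_U0]) (use xn_lim[of Suc 1 v] in \<open>simp del: of_nat_Suc\<close>)

lemma Exp_zero [simp]: "Exp 0 = \<one>"
 by (rule ExpI[where a = "%_. \<one>" and k = Suc]) (use chart_one const_lim in \<open>auto simp: filterlim_Suc\<close>)

lemma Exp_pow: "Exp (real j *. v) = Exp v [^] j"
proof (cases "j = 0")
 case False
 have 1: "filterlim (%n. xn v n [^] (Suc n * j)) (nhdsin T (Exp v [^] j)) sequentially"
 proof -
  have "eventually (%n. xn v n [^] (Suc n * j) = (xn v n [^] Suc n) [^] j) sequentially"
   using xn_U0[of v] by eventually_elim (metis U0_carrier nat_pow_pow subsetD)
  then show ?thesis using pow_lim[OF Exp_xn[of v] Exp_carrier, of j] by (simp only: filterlim_cong[OF refl refl])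
 qed
 have k: "filterlim (%n. Suc n * j) at_top sequentially"
  using False by (intro filterlim_at_top_mono[OF filterlim_Suc] always_eventually allI) (cases j, auto)
 have "(%n. real (Suc n * j) / real (Suc n)) ----> real j" by (simp add: of_nat_mult del: of_nat_Suc mult_Suc)
 from ExpI[OF _ 1 k xn_U0 xn_lim[OF this]] show ?thesis by simp
qed simp

lemma Exp_small:
 assumes "norm v < del / 2"
 shows "Exp v : U0" "(%n. kap (esq v (Suc n))) ----> kap (Exp v)"
proof -
 obtain g where g: "g : U0" "(%n. kap (esq v (Suc n))) ----> kap g"
  by (rule esq_convergent[OF less_imp_le[OF assms]]) (rule that)
 have "(%n. real (Suc n) *. kap (xn v n)) ----> v"
  using xn_lim[of Suc 1 v] by (simp del: of_nat_Suc)
 from ExpI[OF _ pow_limit_small[OF assms g filterlim_Suc xn_U0 this] filterlim_Suc xn_U0 this]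
 have "Exp v = g" using g(1) U0_carrier by blast
 then show "Exp v : U0" "(%n. kap (esq v (Suc n))) ----> kap (Exp v)" using g by auto
qed

text \<open>The power estimate is uniform in the exponent and therefore survives the passage to the
  limit of the Euler approximations.\<close>

lemma Exp_close:
 assumes d: "pow_radius e d" and v: "norm v < del / 2" "norm v \<le> d" and w: "norm w < del / 2" "norm w \<le> d"
 shows "norm (kap (Exp v) - kap (Exp w) - (v - w)) \<le> e * norm (v - w)"
proof (rule tendsto_upperbound)
 show "(%n. norm (kap (esq v (Suc n)) - kap (esq w (Suc n)) - (v - w))) ----> norm (kap (Exp v) - kap (Exp w) - (v - w))"
  by (intro tendsto_intros Exp_small v w)
 show "eventually (%n. norm (kap (esq v (Suc n)) - kap (esq w (Suc n)) - (v - w)) \<le> e * norm (v - w)) sequentially"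
 proof (intro always_eventually allI)
  fix n
  let ?k = "Suc n"
  have del': "norm v \<le> del" "norm w \<le> del" using v w del(1) by linarith+
  note a = esq_base[OF esq_base'[OF del'(1) zero_less_Suc[of n]] zero_less_Suc]
   and b = esq_base[OF esq_base'[OF del'(2) zero_less_Suc[of n]] zero_less_Suc]
  have "real ?k *. ((1 / real ?k) *. v - (1 / real ?k) *. w) = v - w"
   by (simp only: scaleR_diff_right scaleR_scaleR) simp
  moreover from this have "real ?k * norm ((1 / real ?k) *. v - (1 / real ?k) *. w) = norm (v - w)"
   by (metis abs_of_nat norm_scaleR)
  ultimately show "norm (kap (esq v ?k) - kap (esq w ?k) - (v - w)) \<le> e * norm (v - w)"
   using pow_radiusD(3)[OF d a(1) _ b(1), of ?k] v w unfolding a(3) b(3) esq_def a(2) b(2) by simp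
 qed
qed simp

lemma Exp_strict: "strict_deriv (%v. kap (Exp v)) (%v. v) 0"
 unfolding strict_deriv_def
proof (intro conjI bounded_linear_ident allI impI)
 fix e :: real assume e: "e > 0"
 obtain d where d: "pow_radius (min e 1) d" by (rule pow_radius_ex[of "min e 1"]) (use e in \<open>auto intro: that\<close>)
 have "norm (kap (Exp v) - kap (Exp w) - (v - w)) \<le> e * norm (v - w)"
  if "v : ball 0 (min d (del / 2))" "w : ball 0 (min d (del / 2))" for v w
  by (rule order_trans[OF Exp_close[OF d] mult_right_mono]) (use that in auto)
 then show "EX r>0. ALL x:ball 0 r. ALL y:ball 0 r. norm (kap (Exp x) - kap (Exp y) - (x - y)) \<le> e * norm (x - y)"
  using d del(1) by (intro exI[of _ "min d (del / 2)"]) (auto simp: pow_radius_def)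
qed

end


lemma smooth_map_const:
 assumes M: "atlas_ok M" and N: "atlas_ok N" and b: "b : points N"
 shows "smooth_map M N (%_. b)"
proof (rule smooth_mapI[OF M N])
 show "continuous_map (top_of M) (top_of N) (%_. b)" using b by simp
 fix x k assume x: "x : points M"
 obtain U \<phi> where U: "(U, \<phi>) : atlas M" "x : U" using chart_ex[OF M x] .
 obtain V \<psi> where V: "(V, \<psi>) : atlas N" "b : V" using chart_ex[OF N b] .
 have "Ck_on k (\<phi> ` U) (\<psi> o (%_. b) o inv_into U \<phi>)"
  unfolding comp_def by (rule Ck_on_const[OF chart_open_image_dom[OF M U(1)]])
 from local_CkI[OF U(1) V(1) chart_openin[OF M U(1)] this] show "local_Ck k M N (%_. b) x" using U V by auto
qed

lemma quotient_tendsto: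
 fixes f :: "real => 'a::real_normed_vector"
 assumes "(f has_vector_derivative v) (at 0)" "f 0 = 0"
 shows "((%h. (1 / h) *. f h) ---> v) (at 0)"
proof -
 have "((%y. norm (f y - f 0 - (y - 0) *. v) / norm (y - 0)) ---> 0) (at 0)"
  using assms(1) unfolding has_vector_derivative_def has_derivative_iff_norm by blast
 then have lim: "((%h. norm (f h - h *. v) / norm h) ---> 0) (at 0)" by (simp add: assms(2))
 have "((%h. (1 / h) *. f h - v) ---> 0) (at 0)"
 proof (rule Lim_null_comparison[OF _ lim])
  have "norm ((1 / h) *. f h - v) \<le> norm (f h - h *. v) / norm h" if "h ~= 0" for h
  proof -
   have "(1 / h) *. f h - v = (1 / h) *. (f h - h *. v)" using that by (simp add: scaleR_diff_right)
   then show ?thesis by (simp add: divide_inverse mult.commute)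
  qed
  then show "eventually (%h. norm ((1 / h) *. f h - v) \<le> norm (f h - h *. v) / norm h) (at 0)"
   unfolding eventually_at_filter by (intro always_eventually) blast
 qed
 then show ?thesis using Lim_null by blast
qed

lemma smooth_map_ident:
 assumes M: "atlas_ok M"
 shows "smooth_map M M (%x. x)"
 unfolding smooth_map_def smooth_on_def
proof (intro conjI ballI)
 show "continuous_map (top_of M) (top_of M) (%x. x)" by simp
 fix c d assume "c : atlas M" "d : atlas M"
 then show "case c of (U, \<phi>) => ALL (V, \<psi>):atlas M. ALL k. Ck_on k (\<phi> ` (U Int (%x. x) -` V)) (\<psi> o (%x. x) o inv_into U \<phi>)"
  using chart_transition[OF M] by (auto simp: comp_def)
qed

lemma floor_quotient_tendsto:
 assumes "s \<ge> 0"
 shows "(%n. real (nat \<lfloor>s * real (Suc n)\<rfloor>) / real (Suc n)) ----> s"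
proof -
 have "(%n. real (nat \<lfloor>s * real (Suc n)\<rfloor>) / real (Suc n) - s) ----> 0"
 proof (rule Lim_null_comparison[OF always_eventually LIMSEQ_inverse_real_of_nat], rule allI)
  fix n
  define N where "N = real (Suc n)"
  have N: "N > 0" by (simp add: N_def)
  have "\<bar>of_int \<lfloor>s * N\<rfloor> - s * N\<bar> \<le> 1" by linarith
  then have "\<bar>of_int \<lfloor>s * N\<rfloor> - s * N\<bar> / N \<le> 1 / N" using N by (intro divide_right_mono) auto
  moreover have "of_int \<lfloor>s * N\<rfloor> / N - s = (of_int \<lfloor>s * N\<rfloor> - s * N) / N" using N by (simp add: diff_divide_distrib)
  moreover have "real (nat \<lfloor>s * N\<rfloor>) = of_int \<lfloor>s * N\<rfloor>" using assms N by simp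
  ultimately show "norm (real (nat \<lfloor>s * real (Suc n)\<rfloor>) / real (Suc n) - s) \<le> inverse (real (Suc n))"
   unfolding N_def[symmetric] using N by (simp add: inverse_eq_divide)
 qed
 then show ?thesis using Lim_null by blast
qed

section \<open>Continuity, additivity and smoothness of one-parameter subgroups; the adjoint
  representation\<close>

context lie_grp
begin

text \<open>Near 0 this is the Lipschitz bound from \<open>Exp_close\<close>. A general v is scaled
  down by some n and recovered by the n-th power.\<close>

lemma Exp_lim:
 assumes "(f ---> v) F"
 shows "filterlim (%x. Exp (f x)) (nhdsin T (Exp v)) F"
proof -
 have small: "filterlim Exp (nhdsin T (Exp v)) (nhds v)" if v: "norm v < del / 2" for v
 proof -
  have o: "eventually (%w. norm w < del / 2) (nhds v)"
   using eventually_nhds_in_open[of "ball 0 (del / 2)" v] v by simp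
  show ?thesis
  proof (rule kap_lim[OF Exp_small(1)[OF v]])
   show "eventually (%w. Exp w : U0) (nhds v)" using o by eventually_elim (rule Exp_small)
   have "((%w. kap (Exp w) - kap (Exp v)) ---> 0) (nhds v)"
   proof (rule Lim_null_comparison)
    show "eventually (%w. norm (kap (Exp w) - kap (Exp v)) \<le> 2 * norm (w - v)) (nhds v)"
     using o
    proof eventually_elim
     case (elim w)
     have "norm w \<le> del" "norm v \<le> del" using elim v del(1) by linarith+
     then show ?case using Exp_close[OF del_radius elim _ v]
       norm_triangle_sub[of "kap (Exp w) - kap (Exp v)" "w - v"] by simp
    qed
    have "((%w. 2 * norm (w - v)) ---> 2 * norm (v - v)) (nhds v)"
     by (intro tendsto_mult_left tendsto_norm tendsto_diff filterlim_ident tendsto_const)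
    then show "((%w. 2 * norm (w - v)) ---> 0) (nhds v)" by simp
   qed
   then show "((%w. kap (Exp w)) ---> kap (Exp v)) (nhds v)" using Lim_null by blast
  qed
 qed
 obtain n where "norm v < real n * (del / 2)" using ex_less_of_nat_mult[of "del / 2"] del(1) by auto
 moreover from this have n: "n > 0" by (cases n) auto
 ultimately have "norm ((1 / real n) *. v) < del / 2" by (simp add: field_simps)
 from small[OF this]
 have "filterlim (%x. Exp ((1 / real n) *. f x)) (nhdsin T (Exp ((1 / real n) *. v))) F"
  by (rule filterlim_compose) (intro tendsto_intros assms)
 from pow_lim[OF this Exp_carrier, of n] show ?thesis
  unfolding Exp_pow[symmetric] using n by simp
qed

text \<open>For times with a common denominator this is the power law; floor approximations and
  continuity give real times.\<close>

lemma Exp_add_nonneg: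
 assumes "s \<ge> 0" "t \<ge> 0"
 shows "Exp ((s + t) *. v) = Exp (s *. v) ** Exp (t *. v)"
proof -
 define k where "k r n = nat \<lfloor>r * real (Suc n)\<rfloor>" for r n
 define a where "a r n = real (k r n) / real (Suc n)" for r n
 have a: "a s ----> s" "a t ----> t" using floor_quotient_tendsto assms unfolding a_def k_def by auto
 have ea: "Exp (a r n *. v) = Exp ((1 / real (Suc n)) *. v) [^] k r n" for r n
  using Exp_pow[of "k r n" "(1 / real (Suc n)) *. v"] by (simp add: a_def)
 have "Exp ((a s n + a t n) *. v) = Exp (a s n *. v) ** Exp (a t n *. v)" for n
  using Exp_pow[of "k s n + k t n" "(1 / real (Suc n)) *. v"] unfolding ea
  by (simp add: a_def nat_pow_mult add_divide_distrib)
 moreover have "filterlim (%n. Exp ((a s n + a t n) *. v)) (nhdsin T (Exp ((s + t) *. v))) sequentially"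
  by (intro Exp_lim tendsto_intros a)
 moreover have "filterlim (%n. Exp (a s n *. v) ** Exp (a t n *. v)) (nhdsin T (Exp (s *. v) ** Exp (t *. v))) sequentially"
  by (intro mult_lim Exp_lim tendsto_intros a Exp_carrier)
 ultimately show ?thesis
  using Hausdorff_limit_unique[OF Hausdorff _ _ sequentially_bot] by simp
qed

lemma near_nhds: "r > 0 ==> eventually (%x. x : near r) (nhdsin T \<one>)"
 using eventually_conj[OF ev_nhdsin[OF U0_open chart_one(2)]
   order_tendstoD(2)[OF tendsto_norm[OF kap_tendsto[OF chart_one(2)]], of r]]
 by (simp add: near_def)

text \<open>Comparing x ** inv x with \<one> ** \<one> shows that the coordinate of inv x is minus
  that of x up to a small relative error. Hence the inverses of a sequence for v form a sequence for
  - v.\<close>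

lemma Exp_minus: "Exp (- v) = inv (Exp v)"
proof (rule ExpI)
 let ?x = "xn v"
 have k0: "(%n. kap (?x n)) ----> 0"
  using xn_lim[of "%_. 1" 0 v] LIMSEQ_inverse_real_of_nat by (simp add: inverse_eq_divide)
 then have "filterlim ?x (nhdsin T \<one>) sequentially" by (intro kap_lim chart_one xn_U0) simp
 then have lim: "filterlim ?x (nhdsin T \<one>) sequentially" "filterlim (%n. inv (?x n)) (nhdsin T \<one>) sequentially"
  using inv_lim[of ?x \<one>] by auto
 have near: "eventually (%n. ?x n : near R & inv (?x n) : near R) sequentially" if "R > 0" for R
  using eventually_compose_filterlim[OF near_nhds[OF that] lim(1)]
   eventually_compose_filterlim[OF near_nhds[OF that] lim(2)] by (rule eventually_conj)
 show U: "eventually (%n. inv (?x n) : U0) sequentially"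
  using near[OF zero_less_one] by eventually_elim (simp add: near_def)
 have "(%n. real (Suc n) *. kap (inv (?x n)) - (- v)) ----> 0"
 proof (rule tendstoI)
  fix e :: real assume e: "e > 0"
  define B where "B = norm v + 1"
  have B: "B > 0" "norm v < B" by (auto simp: B_def add_nonneg_pos)
  \<comment> \<open>The bound 1/2 gives norm ?w \<le> 3 * norm ?u for the coordinates of the inverse
    and of the element, so the error is at most c * (4 * norm ?u); the second bound makes this small
    after multiplication by Suc n.\<close>
  define c where "c = min (1/2) (e / (4 * B))"
  have c: "0 < c" "c \<le> 1/2" "4 * (c * B) \<le> e" using e B by (auto simp: c_def min_def field_simps)
  have "c * norm v < c * B" using c(1) B(2) by simp
  then have ce: "4 * (c * norm v) < e" using c(3) by linarith
  obtain R where R: "R > 0"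
   "!!a b x y. a : near R ==> b : near R ==> x : near R ==> y : near R ==> a ** b : U0 &
   norm (kap (a ** b) - kap (x ** y) - (kap a - kap x) - (kap b - kap y)) \<le> c * (norm (kap a - kap x) + norm (kap b - kap y))"
   by (rule mult_estimate[OF c(1)]) (rule that)
  show "eventually (%n. dist (real (Suc n) *. kap (inv (?x n)) - (- v)) 0 < e) sequentially"
   using near[OF R(1)] xn[of v]
  proof eventually_elim
   case (elim n)
   let ?u = "kap (?x n)" and ?w = "kap (inv (?x n))"
   have "?x n : CG" using elim near_carrier by blast
   then have "norm (- (?u + ?w)) \<le> c * (norm ?u + norm ?w)"
    using R(2)[of "?x n" "inv (?x n)" \<one> \<one>] elim one_near[OF R(1)] by (simp add: algebra_simps)
   note le = this[unfolded norm_minus_cancel]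
   have "c * (norm ?u + norm ?w) \<le> 1/2 * (norm ?u + norm ?w)" using c by (intro mult_right_mono) auto
   then have "norm ?w \<le> 3 * norm ?u" using le norm_triangle_ineq4[of "?u + ?w" ?u] by simp
   then have "c * (norm ?u + norm ?w) \<le> c * (4 * norm ?u)" using c(1) by (intro mult_left_mono) auto
   then have "real (Suc n) * norm (?u + ?w) \<le> real (Suc n) * (c * (4 * norm ?u))"
    using le by (intro mult_left_mono) auto
   also have "... = 4 * (c * norm (real (Suc n) *. ?u))" by simp
   also have "... < e" using ce elim by simp
   finally have "norm (real (Suc n) *. (?u + ?w)) < e" by (simp only: norm_scaleR abs_of_nat)
   then show ?case using elim by (simp add: scaleR_add_right add.commute)
  qed
 qed
 then show "(%n. real (Suc n) *. kap (inv (?x n))) ----> - v" using Lim_null by blast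
 have "eventually (%n. inv (?x n) [^] Suc n = inv (?x n [^] Suc n)) sequentially"
  using xn_U0[of v] by eventually_elim (metis U0_carrier nat_pow_inv subsetD)
 then show "filterlim (%n. inv (?x n) [^] Suc n) (nhdsin T (inv (Exp v))) sequentially"
  using inv_lim[OF Exp_xn Exp_carrier, of v] by (simp only: filterlim_cong[OF refl refl])
qed (auto simp: filterlim_Suc)

text \<open>Mixed signs are reduced to nonnegative times by moving the negative term to the other
  side; a negative sum is the inverse of the case of a positive one.\<close>

lemma Exp_add: "Exp ((s + t) *. v) = Exp (s *. v) ** Exp (t *. v)"
proof -
 have neg: "Exp ((- r) *. v) = inv (Exp (r *. v))" for r using Exp_minus[of "r *. v"] by simp
 have A: "Exp ((s + t) *. v) = Exp (s *. v) ** Exp (t *. v)" if st: "s + t \<ge> 0" for s t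
 proof -
  consider "s \<ge> 0" "t \<ge> 0" | "s \<ge> 0" "t < 0" | "s < 0" "t \<ge> 0" using st by linarith
  then show ?thesis
  proof cases
   case 1 then show ?thesis by (rule Exp_add_nonneg)
  next
   case 2
   have "Exp (s *. v) = Exp ((s + t) *. v) ** Exp ((- t) *. v)"
    using Exp_add_nonneg[of "s + t" "- t" v] 2 st by simp
   then have "Exp (s *. v) ** Exp (t *. v) = Exp ((s + t) *. v) ** (inv (Exp (t *. v)) ** Exp (t *. v))"
    unfolding neg by (simp add: m_assoc)
   then show ?thesis by simp
  next
   case 3
   have "Exp (t *. v) = Exp ((- s) *. v) ** Exp ((s + t) *. v)"
    using Exp_add_nonneg[of "- s" "s + t" v] 3 st by simp
   then have "Exp (s *. v) ** Exp (t *. v) = Exp (s *. v) ** (inv (Exp (s *. v)) ** Exp ((s + t) *. v))"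
    by (simp only: neg)
   also have "... = Exp ((s + t) *. v)" by (simp add: m_assoc[symmetric])
   finally show ?thesis by (rule sym)
  qed
 qed
 show ?thesis
 proof (cases "s + t \<ge> 0")
  case True then show ?thesis by (rule A)
 next
  case False
  then have "Exp ((- t + - s) *. v) = Exp ((- t) *. v) ** Exp ((- s) *. v)" by (intro A) simp
  moreover have "- t + - s = - (s + t)" by simp
  ultimately have "inv (Exp ((s + t) *. v)) = inv (Exp (t *. v)) ** inv (Exp (s *. v))" by (simp only: neg)
  also have "... = inv (Exp (s *. v) ** Exp (t *. v))" by (simp add: inv_mult_group)
  finally show ?thesis by (metis Exp_carrier inv_inv m_closed)
 qed
qed

lemma Exp_line_derivative: "((%t. kap (Exp (t *. v))) has_vector_derivative v) (at 0)"
proof -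
 have 1: "((%t. t *. v) has_derivative (%t. t *. v)) (at 0)" by (auto intro!: derivative_eq_intros)
 have 2: "((%v. kap (Exp v)) has_derivative (%v. v)) (at (0 *. v))" using strict_has_deriv[OF Exp_strict] by simp
 show ?thesis unfolding has_vector_derivative_def using has_derivative_compose[OF 1 2] by simp
qed

text \<open>The value at t is the n-th power of the value at t / n, and n times the coordinate of
  the latter tends to t times v. The limit property of \<open>Exp\<close> therefore identifies the
  whole curve.\<close>

lemma one_param_unique:
 assumes G: "!!t. \<gamma> t : CG" and hom: "!!s t. \<gamma> (s + t) = \<gamma> s ** \<gamma> t"
  and U: "eventually (%t. \<gamma> t : U0) (nhds 0)"
  and der: "((%t. kap (\<gamma> t)) has_vector_derivative v) (at 0)"
 shows "\<gamma> t = Exp (t *. v)"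
proof -
 have "\<gamma> 0 ** \<gamma> 0 = \<gamma> 0" using hom[of 0 0] by simp
 then have g0: "\<gamma> 0 = \<one>" using G r_cancel_one by blast
 have pow: "\<gamma> (real n * t) = \<gamma> t [^] n" for n t
 proof (induction n)
  case (Suc n)
  have "real (Suc n) * t = real n * t + t" by (simp add: algebra_simps)
  then show ?case by (simp only: hom Suc.IH nat_pow_Suc)
 qed (simp add: g0)
 let ?s = "%n. t * (1 / real (Suc n))"
 have s: "?s ----> 0"
  using tendsto_mult_left[OF LIMSEQ_inverse_real_of_nat, of t] by (simp add: inverse_eq_divide)
 have ev: "eventually (%n. \<gamma> (?s n) : U0) sequentially"
  using filterlim_iff[THEN iffD1, OF s] U by blast
 have lim: "(%n. real (Suc n) *. kap (\<gamma> (?s n))) ----> t *. v"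
 proof (cases "t = 0")
  case True then show ?thesis by (simp add: g0)
 next
  case False
  have "((%h. (1 / h) *. kap (\<gamma> h)) ---> v) (at 0)"
   by (rule quotient_tendsto[OF der]) (simp add: g0)
  moreover have "filterlim ?s (at 0) sequentially"
   unfolding filterlim_at using s False by auto
  ultimately have "(%n. (1 / ?s n) *. kap (\<gamma> (?s n))) ----> v" by (rule filterlim_compose)
  then have "(%n. t *. (1 / ?s n) *. kap (\<gamma> (?s n))) ----> t *. v" by (intro tendsto_intros)
  then show ?thesis using False by (simp del: of_nat_Suc)
 qed
 have "\<gamma> (?s n) [^] Suc n = \<gamma> t" for n
  unfolding pow[symmetric] by (simp del: of_nat_Suc)
 then have "filterlim (%n. \<gamma> (?s n) [^] Suc n) (nhdsin T (\<gamma> t)) sequentially" using const_lim[OF G] by simp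
 from ExpI[OF G this filterlim_Suc ev lim] show ?thesis by simp
qed

lemma smooth_mult:
 assumes "atlas_ok M" "smooth_map M GM f" "smooth_map M GM g"
 shows "smooth_map M GM (%x. f x ** g x)"
 using smooth_map_compose[OF assms(1) ok_product[OF GM_ok GM_ok] GM_ok
   smooth_map_Pair[OF assms(1) GM_ok GM_ok assms(2,3)] mult_smooth]
 by (simp add: comp_def)

lemma smooth_inv:
 assumes "atlas_ok M" "smooth_map M GM f"
 shows "smooth_map M GM (%x. inv (f x))"
 using smooth_map_compose[OF assms(1) GM_ok GM_ok assms(2) inv_smooth] by (simp add: comp_def)

lemma left_translation_smooth: "a : CG ==> smooth_map GM GM (%x. a ** x)"
 by (intro smooth_mult GM_ok smooth_map_const smooth_map_ident) auto

text \<open>By additivity the curve is obtained near t from its germ at 0 by a left translation, so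
  it satisfies an autonomous differential equation with smooth right-hand side. If the curve is of
  class C^k then so is its derivative, and regularity climbs.\<close>

lemma Exp_line_chart_Ck: "Ck_on k {t. norm (t *. v) < del / 2} (%t. kap (Exp (t *. v)))"
proof -
 let ?I = "{t. norm (t *. v) < del / 2}" and ?y = "%t. kap (Exp (t *. v))"
 let ?f = "%(x, y). kap (kinv x ** kinv y)"
 \<comment> \<open>The left-invariant vector field of v in centred coordinates.\<close>
 define X where "X p = FD ?f (p, 0) (0, v)" for p
 have oI: "open ?I" by (intro open_Collect_less continuous_intros)
 have f: "Ck_on (Suc k) mdom ?f" for k by (rule mult_Ck)
 have XC: "Ck_on k D0 X" for k
  unfolding X_def
  by (rule Ck_on_compose[OF findim_prod[OF fd fd] D0_open, of k mdom "%z. FD ?f z (0, v)"])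
   (use f[of k] in \<open>auto simp: mdom_axis intro!: Ck_on_Pair Ck_on_const D0_open
     Ck_bounded_linear[OF D0_open bounded_linear_ident]\<close>)
 have yD: "?y t : D0" "kinv (?y t) = Exp (t *. v)" if "t : ?I" for t
  using Exp_small[of "t *. v"] that by (auto simp: D0_def kinv_kap)
 have der: "(?y has_derivative (%h. h *. X (?y t))) (at t)" if t: "t : ?I" for t
 proof -
  let ?p = "?y t"
  have pm: "(?p, 0) : mdom" using yD[OF t] by (simp add: mdom_axis)
  have 1: "((%s. s - t) has_derivative (%h. h)) (at t)" by (auto intro!: derivative_eq_intros)
  have 2: "(?y has_derivative (%h. h *. v)) (at (t - t))"
   using Exp_line_derivative[of v] by (simp add: has_vector_derivative_def)
  have 3: "((%s. (?p, ?y (s - t))) has_derivative (%h. (0, h *. v))) (at t)"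
   using has_derivative_compose[OF 1 2] by (intro has_derivative_Pair has_derivative_const)
  have 4: "(?f has_derivative FD ?f (?p, ?y (t - t))) (at (?p, ?y (t - t)))"
   using Ck_has_deriv[OF f[of 0] pm] by simp
  have lin: "linear (FD ?f (?p, 0))"
   using Ck_has_deriv[OF f[of 0] pm] has_derivative_linear by blast
  have "FD ?f (?p, 0) (0, h *. v) = h *. X ?p" for h
   using linear_scale[OF lin, of h "(0, v)"] by (simp add: X_def)
  then have 5: "((%s. ?f (?p, ?y (s - t))) has_derivative (%h. h *. X ?p)) (at t)"
   using has_derivative_compose[OF 3 4] by simp
  define J where "J = {s. norm ((s - t) *. v) < del / 2}"
  have "open J" unfolding J_def by (intro open_Collect_less continuous_intros)
  moreover have "t : J" using del by (simp add: J_def)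
  moreover have "?f (?p, ?y (s - t)) = ?y s" if "s : J" for s
  proof -
   have "s - t : ?I" using that by (simp add: J_def)
   from yD(2)[OF this] yD(2)[OF t] show ?thesis
    using Exp_add[of t "s - t" v] by simp
  qed
  ultimately show ?thesis by (rule has_derivative_transform_within_open[OF 5])
 qed
 show ?thesis
 proof (induction k)
  case 0
  have "continuous (at t) ?y" if "t : ?I" for t using der[OF that] has_derivative_continuous by blast
  then show ?case by (simp add: continuous_at_imp_continuous_on)
 next
  case (Suc k)
  show ?case
  proof (rule Ck_on_SucI[OF oI der])
   fix h :: real
   have "Ck_on k ?I (%t. X (?y t))"
    by (rule Ck_on_compose[OF fd oI XC Suc]) (use yD(1) in blast)
   then show "Ck_on k ?I (%t. h *. X (?y t))"
    by (rule Ck_on_linear_compose[OF oI bounded_linear_scaleR_right])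
  qed
 qed
qed

text \<open>The chart at the identity covers only small times; around t0 the curve is the left
  translate by its value at t0 of the part near time 0.\<close>

lemma Exp_line_smooth: "smooth_map standard_space GM (%t. Exp (t *. v))"
proof (rule smooth_mapI[OF atlas_ok_standard[OF findim_real] GM_ok])
 let ?\<gamma> = "%t. Exp (t *. v)" and ?c = "snd (chart_at GM \<one>)"
 have lim: "filterlim ?\<gamma> (nhdsin T (?\<gamma> t)) (nhds t)" for t
  by (intro Exp_lim tendsto_scaleR filterlim_ident tendsto_const)
 show cont: "continuous_map (top_of standard_space) T ?\<gamma>"
  unfolding cont_iff_filterlim using lim by auto
 fix t0 :: real and k
 have "?\<gamma> t0 : points GM" by simp
 then obtain V \<psi> where V: "(V, \<psi>) : atlas GM" "?\<gamma> t0 : V" using chart_ex[OF GM_ok] by metis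
 define S where "S = {t. norm ((t - t0) *. v) < del / 2} Int {t. ?\<gamma> t : V}"
 have "open {t. ?\<gamma> t : V}"
  using openin_continuous_map_preimage[OF cont chart_openin[OF GM_ok V(1)]] by simp
 then have oS: "open S" unfolding S_def by (intro open_Int open_Collect_less continuous_intros)
 let ?g = "\<psi> o (%x. ?\<gamma> t0 ** x) o inv_into U0 ?c"
 have g: "Ck_on k (?c ` (U0 Int (%x. ?\<gamma> t0 ** x) -` V)) ?g"
  by (rule smooth_map_chart[OF left_translation_smooth chart_one(1) V(1)]) simp
 have shift: "Ck_on k S (%t. t + - t0)"
  by (intro Ck_on_add Ck_on_const oS Ck_bounded_linear[OF oS bounded_linear_ident])
 have "Ck_on k S (%t. kap (?\<gamma> (t + - t0)))"
  by (rule Ck_on_compose[OF findim_real oS Exp_line_chart_Ck shift]) (auto simp: S_def)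
 then have y: "Ck_on k S (%t. kap (?\<gamma> (t + - t0)) + ?c \<one>)"
  by (intro Ck_on_add Ck_on_const oS)
 have eq: "?\<gamma> t0 ** ?\<gamma> (t + - t0) = ?\<gamma> t" for t using Exp_add[of t0 "t + - t0" v] by simp
 have U: "?\<gamma> (t + - t0) : U0" if "t : S" for t using that by (intro Exp_small) (simp add: S_def)
 have ck: "kap x + ?c \<one> = ?c x" for x by (simp add: kap_def)
 have C: "Ck_on k S (%t. ?g (kap (?\<gamma> (t + - t0)) + ?c \<one>))"
 proof (rule Ck_on_compose[OF fd oS g y])
  show "(%t. kap (?\<gamma> (t + - t0)) + ?c \<one>) ` S \<subseteq> ?c ` (U0 Int (%x. ?\<gamma> t0 ** x) -` V)"
   unfolding ck using U eq by (auto simp: S_def simp del: add_uminus_conv_diff)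
 qed
 have eqg: "?g (kap (?\<gamma> (t + - t0)) + ?c \<one>) = (\<psi> o ?\<gamma> o inv_into UNIV id) t" if "t : S" for t
  unfolding ck comp_def chart_inv[OF GM_ok chart_one(1) U[OF that]] eq by simp
 have "Ck_on k (id ` S) (\<psi> o ?\<gamma> o inv_into UNIV id)"
  using Ck_on_cong[OF oS eqg C] by (simp only: image_id id_apply)
 then show "local_Ck k standard_space GM ?\<gamma> t0"
  by (rule local_CkI[rotated 3, OF _ _ _ V(1)]) (use V oS del in \<open>auto simp: S_def\<close>)
qed

lemma coord_one: "coord GM \<one> x = kap x + snd (chart_at GM \<one>) \<one>"
 by (simp add: coord_def kap_def)

text \<open>The definite description in \<open>lie_exp\<close> is well posed: existence is
  \<open>Exp_line_smooth\<close> and uniqueness is \<open>one_param_unique\<close>. From here on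
  infinitesimal generators can be computed with \<open>Exp\<close>.\<close>

lemma lie_exp_eq: "lie_exp G GM v = Exp v"
proof -
 have vel: "velocity GM \<gamma> 0 = x" if "\<gamma> 0 = \<one>" "((%t. kap (\<gamma> t)) has_vector_derivative x) (at 0)" for \<gamma> x
 proof -
  have "((%t. kap (\<gamma> t) + snd (chart_at GM \<one>) \<one>) has_vector_derivative x + 0) (at 0)"
   by (intro has_vector_derivative_add that has_vector_derivative_const)
  then have "(coord GM (\<gamma> 0) o \<gamma> has_vector_derivative x) (at 0)"
   by (simp add: that(1) comp_def coord_one)
  then show ?thesis unfolding velocity_def by (rule vector_derivative_at)
 qed
 have "(THE \<gamma>. one_parameter_subgroup G GM \<gamma> & velocity GM \<gamma> 0 = v) = (%t. Exp (t *. v))"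
 proof (rule the_equality)
  show "one_parameter_subgroup G GM (%t. Exp (t *. v)) & velocity GM (%t. Exp (t *. v)) 0 = v"
   using Exp_line_smooth Exp_add vel[OF _ Exp_line_derivative] by (simp add: one_parameter_subgroup_def)
  fix \<gamma> assume "one_parameter_subgroup G GM \<gamma> & velocity GM \<gamma> 0 = v"
  then have sm: "smooth_map standard_space GM \<gamma>" and hom: "!!s t. \<gamma> (s + t) = \<gamma> s ** \<gamma> t" and v: "velocity GM \<gamma> 0 = v"
   by (auto simp: one_parameter_subgroup_def)
  note cont = smooth_cont[OF sm]
  have G: "\<gamma> t : CG" for t using continuous_map_image_subset_topspace[OF cont] by auto
  have "\<gamma> 0 ** \<gamma> 0 = \<gamma> 0" using hom[of 0 0] by simp
  then have g0: "\<gamma> 0 = \<one>" using G r_cancel_one by blast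
  have oU: "open {t. \<gamma> t : U0}"
   using openin_continuous_map_preimage[OF cont U0_open] by simp
  have "Ck_on (Suc 0) (id ` (UNIV Int \<gamma> -` U0)) (snd (chart_at GM \<one>) o \<gamma> o inv_into UNIV id)"
   by (rule smooth_map_chart[OF sm _ chart_one(1)]) simp
  moreover have "inv_into UNIV id = (%t::real. t)" by (auto simp: fun_eq_iff)
  ultimately have "(%t. snd (chart_at GM \<one>) (\<gamma> t)) differentiable (at 0)"
   using g0 chart_one(2) by (simp add: comp_def)
  then have "((%t. snd (chart_at GM \<one>) (\<gamma> t)) has_vector_derivative vector_derivative (%t. snd (chart_at GM \<one>) (\<gamma> t)) (at 0)) (at 0)"
   using vector_derivative_works by blast
  then have d: "((%t. snd (chart_at GM \<one>) (\<gamma> t)) has_vector_derivative v) (at 0)"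
   using v by (simp add: velocity_def coord_def g0 comp_def)
  have "((%t. kap (\<gamma> t)) has_vector_derivative v - 0) (at 0)"
   unfolding kap_def by (intro has_vector_derivative_diff d has_vector_derivative_const)
  then have d0: "((%t. kap (\<gamma> t)) has_vector_derivative v) (at 0)" by simp
  have ev: "eventually (%t. \<gamma> t : U0) (nhds 0)"
   using eventually_nhds_in_open[OF oU, of 0] g0 chart_one(2) by simp
  show "\<gamma> = (%t. Exp (t *. v))"
  proof
   show "\<gamma> t = Exp (t *. v)" for t
    by (rule one_param_unique[where \<gamma> = \<gamma> and t = t, OF _ _ ev d0]) (rule G hom)+
  qed
 qed
 then show ?thesis by (simp add: lie_exp_def)
qed

subsection \<open>The adjoint representation\<close>

definition "conj_dom = {(p, x). p : CG & x : snd (chart_at GM \<one>) ` U0 &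
  (p ** inv_into U0 (snd (chart_at GM \<one>)) x) ** inv p : U0}"

definition "conj_chart p x = snd (chart_at GM \<one>) ((p ** inv_into U0 (snd (chart_at GM \<one>)) x) ** inv p)"

definition "Ad p v = FD (conj_chart p) (snd (chart_at GM \<one>) \<one>) v"

lemma conj_chart_pCk: "pCk_on k T conj_dom conj_chart"
proof -
 note PM = ok_product[OF GM_ok GM_ok]
 have "smooth_map (product_space GM GM) GM (%z. (fst z ** snd z) ** inv (fst z))"
  by (intro smooth_mult smooth_inv PM smooth_map_fst smooth_map_snd GM_ok)
 from smooth_map_pCk_on[OF GM_ok GM_ok GM_ok this chart_one(1) chart_one(1)]
 show "pCk_on k T conj_dom conj_chart"
  by (simp add: conj_dom_def conj_chart_def[abs_def])
qed

lemma conj_dom_one: "p : CG ==> (p, snd (chart_at GM \<one>) \<one>) : conj_dom"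
 using chart_one by (auto simp: conj_dom_def chart_inv[OF GM_ok chart_one(1)])

lemma conj_chart_derivative:
 assumes "p : CG"
 shows "(conj_chart p has_derivative Ad p) (at (snd (chart_at GM \<one>) \<one>))"
 using pCk_has_deriv[OF conj_chart_pCk[of "Suc 0"] conj_dom_one[OF assms]]
 unfolding Ad_def .

lemma Ad_linear: "p : CG ==> linear (Ad p)"
 using conj_chart_derivative has_derivative_linear by blast

lemma Ad_tendsto:
 assumes "p : CG"
 shows "((%q. Ad q v) ---> Ad p v) (nhdsin T p)"
proof -
 let ?e = "snd (chart_at GM \<one>) \<one>"
 have "param_cont T conj_dom (%p x. FD (conj_chart p) x v)"
  using conj_chart_pCk[of "Suc 0"] by simp
 from param_contD[OF this conj_dom_one[OF assms]]
 have 1: "((%z. FD (conj_chart (fst z)) (snd z) v) ---> Ad p v) (nhdsin T p \<times>\<^sub>F nhds ?e)"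
  by (simp add: Ad_def)
 have "filterlim (%q. (q, ?e)) (nhdsin T p \<times>\<^sub>F nhds ?e) (nhdsin T p)"
  by (intro filterlim_Pair filterlim_ident tendsto_const)
 from filterlim_compose[OF 1 this] show ?thesis by (simp add: Ad_def)
qed

lemma Ad_tendsto2:
 assumes "p : CG" "filterlim f (nhdsin T p) F" "(w ---> v) F"
 shows "((%x. Ad (f x) (w x)) ---> Ad p v) F"
proof (rule lin_family_tendsto[OF fd _ Ad_linear[OF assms(1)] _ assms(3)])
 have "eventually (%x. f x : CG) F"
  using eventually_compose_filterlim[OF ev_topspace assms(2)] by simp
 then show "eventually (%z. linear (Ad (f z))) F" by (rule eventually_mono) (rule Ad_linear)
 show "((%z. Ad (f z) v) ---> Ad p v) F" for v
  by (rule filterlim_compose[OF Ad_tendsto[OF assms(1)] assms(2)])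
qed

text \<open>The conjugated curve is again a one-parameter subgroup, and by the chain rule its
  velocity is \<open>Ad p v\<close>.\<close>

lemma Exp_conj:
 assumes p: "p : CG"
 shows "p ** Exp v ** inv p = Exp (Ad p v)"
proof -
 let ?\<gamma> = "%t. p ** Exp (t *. v) ** inv p" and ?c = "snd (chart_at GM \<one>)"
 have lim: "filterlim ?\<gamma> (nhdsin T (p ** Exp (0 *. v) ** inv p)) (nhds 0)"
  by (intro mult_lim const_lim Exp_lim tendsto_scaleR filterlim_ident tendsto_const)
   (use p in auto)
 have ev: "eventually (%t. ?\<gamma> t : U0) (nhds 0)"
  using eventually_compose_filterlim[OF ev_nhdsin[OF U0_open chart_one(2)], of ?\<gamma> "nhds 0"] lim p by simp
 have der: "((%t. kap (?\<gamma> t)) has_vector_derivative Ad p v) (at 0)"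
 proof -
  have "((%t. kap (Exp (t *. v)) + ?c \<one>) has_derivative (%t. t *. v + 0)) (at 0)"
   using Exp_line_derivative by (intro has_derivative_add has_derivative_const) (simp add: has_vector_derivative_def)
  then have 1: "((%t. kap (Exp (t *. v)) + ?c \<one>) has_derivative (%t. t *. v)) (at 0)" by simp
  have 2: "(conj_chart p has_derivative Ad p) (at (kap (Exp (0 *. v)) + ?c \<one>))"
   using conj_chart_derivative[OF p] by simp
  have 3: "((%t. conj_chart p (kap (Exp (t *. v)) + ?c \<one>)) has_derivative (%t. t *. Ad p v)) (at 0)"
   using has_derivative_compose[OF 1 2] by (simp add: linear_scale[OF Ad_linear[OF p]])
  have "open {t. norm (t *. v) < del / 2}" by (intro open_Collect_less continuous_intros)
  then have "((%t. ?c (?\<gamma> t)) has_derivative (%t. t *. Ad p v)) (at 0)"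
  proof (rule has_derivative_transform_within_open[OF 3])
   show "0 : {t. norm (t *. v) < del / 2}" using del by simp
   fix t assume "t : {t. norm (t *. v) < del / 2}"
   then have "Exp (t *. v) : U0" by (simp add: Exp_small)
   then show "conj_chart p (kap (Exp (t *. v)) + ?c \<one>) = ?c (?\<gamma> t)"
    by (simp add: conj_chart_def kap_def chart_inv[OF GM_ok chart_one(1)])
  qed
  then have "((%t. ?c (?\<gamma> t)) has_vector_derivative Ad p v) (at 0)" by (simp add: has_vector_derivative_def)
  then have "((%t. ?c (?\<gamma> t) - ?c \<one>) has_vector_derivative Ad p v - 0) (at 0)"
   by (intro has_vector_derivative_diff has_vector_derivative_const)
  then show ?thesis by (simp add: kap_def)
 qed
 have hom: "?\<gamma> (s + t) = ?\<gamma> s ** ?\<gamma> t" for s t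
 proof -
  have "?\<gamma> s ** ?\<gamma> t = p ** Exp (s *. v) ** (inv p ** p) ** Exp (t *. v) ** inv p"
   using p by (simp only: m_assoc m_closed inv_closed Exp_carrier)
  then show ?thesis using p by (simp add: Exp_add m_assoc)
 qed
 have G: "?\<gamma> t : CG" for t using p by simp
 have "?\<gamma> 1 = Exp (1 *. Ad p v)"
  by (rule one_param_unique[where \<gamma> = ?\<gamma> and t = 1, OF _ _ ev der]) (rule G hom)+
 then show ?thesis by simp
qed

lemma Exp_line_inject:
 assumes "!!t. Exp (t *. v) = Exp (t *. w)"
 shows "v = w"
 using Exp_line_derivative[of v] Exp_line_derivative[of w]
 unfolding assms by (rule vector_derivative_unique_at)

text \<open>Read off from conjugation: two vectors generating the same one-parameter subgroup are
  equal.\<close>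

lemma Ad_mult:
 assumes "p : CG" "q : CG"
 shows "Ad (p ** q) v = Ad p (Ad q v)"
proof (rule Exp_line_inject)
 fix t
 have "Exp (t *. Ad (p ** q) v) = (p ** q) ** Exp (t *. v) ** inv (p ** q)"
  using assms by (simp add: Exp_conj linear_scale[OF Ad_linear])
 also have "... = p ** (q ** Exp (t *. v) ** inv q) ** inv p"
  using assms by (simp add: inv_mult_group m_assoc)
 also have "... = Exp (t *. Ad p (Ad q v))"
  using assms by (simp add: Exp_conj linear_scale[OF Ad_linear])
 finally show "Exp (t *. Ad (p ** q) v) = Exp (t *. Ad p (Ad q v))" .
qed

lemma Ad_one: "Ad \<one> v = v"
proof (rule Exp_line_inject)
 fix t
 have "Exp (t *. Ad \<one> v) = \<one> ** Exp (t *. v) ** inv \<one>"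
  by (simp only: Exp_conj[OF one_closed] linear_scale[OF Ad_linear[OF one_closed]])
 then show "Exp (t *. Ad \<one> v) = Exp (t *. v)" by simp
qed

end


section \<open>Invariant means on compact subgroups\<close>

locale compact_subgrp = lie_grp +
 fixes K :: "'a set"
 assumes K_subgroup: "subgroup K G" and K_compact: "compactin T K"
begin

lemma K_carrier: "k : K ==> k : CG" using K_subgroup subgroup.subset by blast
lemma K_mult: "k : K ==> l : K ==> k ** l : K" by (rule subgroup.m_closed[OF K_subgroup])
lemma K_inv: "k : K ==> inv k : K" by (rule subgroup.m_inv_closed[OF K_subgroup])
lemma K_one: "\<one> : K" by (rule subgroup.one_closed[OF K_subgroup])

text \<open>Continuity at the points of K along neighbourhoods in the whole group, since the
  integrands considered later are defined on a neighbourhood of K.\<close>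

definition contK :: "('a => 'v::real_normed_vector) => bool" where
 "contK F \<longleftrightarrow> (ALL k:K. (F ---> F k) (nhdsin T k))"

lemma contK_left: "contK F ==> l : K ==> contK (%x. F (l ** x))"
 unfolding contK_def
proof
 fix k assume F: "ALL k:K. (F ---> F k) (nhdsin T k)" and k: "l : K" "k : K"
 show "((%x. F (l ** x)) ---> F (l ** k)) (nhdsin T k)"
  by (rule filterlim_compose[OF F[rule_format, OF K_mult[OF k]]
     mult_lim[OF const_lim filterlim_ident]]) (use k K_carrier in auto)
qed

lemma contK_right: "contK F ==> l : K ==> contK (%x. F (x ** l))"
 unfolding contK_def
proof
 fix k assume F: "ALL k:K. (F ---> F k) (nhdsin T k)" and k: "l : K" "k : K"
 show "((%x. F (x ** l)) ---> F (k ** l)) (nhdsin T k)"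
  by (rule filterlim_compose[OF F[rule_format, OF K_mult[OF k(2,1)]]
     mult_lim[OF filterlim_ident const_lim]]) (use k K_carrier in auto)
qed

lemma contK_inv: "contK F ==> contK (%x. F (inv x))"
 unfolding contK_def
proof
 fix k assume F: "ALL k:K. (F ---> F k) (nhdsin T k)" and k: "k : K"
 show "((%x. F (inv x)) ---> F (inv k)) (nhdsin T k)"
  by (rule filterlim_compose[OF F[rule_format, OF K_inv[OF k]] inv_lim[OF filterlim_ident]])
   (use k K_carrier in auto)
qed

lemma contK_add: "contK F ==> contK F' ==> contK (%x. F x + F' x)"
 by (auto simp: contK_def intro: tendsto_add)

lemma contK_mult: "contK F ==> contK (%x. c * F x :: real)"
 by (auto simp: contK_def intro: tendsto_mult_left)

lemma contK_const: "contK (%x. c)"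
 by (auto simp: contK_def)

lemma contK_linear: "bounded_linear l ==> contK F ==> contK (%x. l (F x))"
 by (auto simp: contK_def intro: bounded_linear.tendsto)

lemma contK_bounded:
 fixes F :: "'a => 'v::real_normed_vector"
 assumes "contK F"
 obtains b where "!!k. k : K ==> norm (F k) \<le> b"
proof -
 have "eventually (%b. ALL k:K. norm (F k) \<le> b) at_top"
 proof (rule compactin_ev[OF K_compact])
  fix k assume k: "k : K"
  have "eventually (%x. norm (F x) < norm (F k) + 1) (nhdsin T k)"
   using assms k by (intro order_tendstoD(2)[OF tendsto_norm]) (auto simp: contK_def)
  with eventually_ge_at_top[of "norm (F k) + 1"]
  show "eventually (%(x, y). norm (F x) \<le> y) (nhdsin T k \<times>\<^sub>F at_top)"
   unfolding eventually_prod_filter by (intro exI conjI) (assumption+, fastforce)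
 qed
 then show ?thesis using that eventually_happens trivial_limit_at_top_linorder by blast
qed

lemma contK_uniform:
 fixes F :: "'a => real"
 assumes F: "contK F" and e: "e > 0"
 obtains V where "openin T V" "\<one> : V" "!!x y. x : K ==> y : V ==> \<bar>F (x ** y) - F x\<bar> \<le> e"
proof -
 have "eventually (%y. ALL x:K. \<bar>F (x ** y) - F x\<bar> \<le> e) (nhdsin T \<one>)"
 proof (rule compactin_ev[OF K_compact])
  fix k assume k: "k : K"
  then have kG: "k : CG" by (rule K_carrier)
  let ?N = "nhdsin T k \<times>\<^sub>F nhdsin T \<one>"
  have Fk: "(F ---> F k) (nhdsin T k)" using F k by (simp add: contK_def)
  have "filterlim (%z. fst z ** snd z) (nhdsin T (k ** \<one>)) ?N"
   by (rule mult_lim[OF filterlim_fst filterlim_snd]) (use kG in auto)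
  then have "filterlim (%z. fst z ** snd z) (nhdsin T k) ?N" using kG by simp
  from tendsto_diff[OF filterlim_compose[OF Fk this] filterlim_compose[OF Fk filterlim_fst]]
  have "((%z. F (fst z ** snd z) - F (fst z)) ---> 0) ?N" by simp
  from tendstoD[OF this e] show "eventually (%(x, y). \<bar>F (x ** y) - F x\<bar> \<le> e) ?N"
   by (rule eventually_mono) auto
 qed
 then show ?thesis by (rule ev_nhdsinE) (auto intro: that)
qed

lemma translate_cover:
 assumes V: "openin T V" "\<one> : V"
 obtains cs where "cs ~= []" "set cs \<subseteq> K" "!!x. x : K ==> EX c:set cs. inv c ** x : V"
proof -
 let ?U = "%c. {x : topspace T. inv c ** x : V}"
 have "openin T (?U c)" if "c : K" for c
  by (rule openin_continuous_map_preimage[OF smooth_cont[OF left_translation_smooth] V(1)])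
   (use that K_carrier in auto)
 moreover have "x : ?U x" if "x : K" for x using that K_carrier[OF that] V(2) by simp
 ultimately obtain \<F> where F: "finite \<F>" "\<F> \<subseteq> ?U ` K" "K \<subseteq> \<Union>\<F>"
  using compactinD[OF K_compact, of "?U ` K"] by blast
 then obtain C where C: "finite C" "C \<subseteq> K" "\<F> = ?U ` C" by (meson finite_subset_image)
 obtain cs where cs: "set cs = C" using finite_list[OF C(1)] by blast
 have "C ~= {}" using F(3) C(3) K_one by auto
 then have "cs ~= []" using cs by auto
 moreover have "EX c:set cs. inv c ** x : V" if "x : K" for x using F(3) C(3) cs that by blast
 ultimately show ?thesis using that cs C(2) by blast
qed

text \<open>Convex combinations of left translates with dyadic weights. The mean of F is the
  constant that suitable averages of F approach uniformly on K.\<close>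

inductive avg :: "(('a => real) => 'a => real) => bool" where
 shift: "a : K ==> avg (%F x. F (a ** x))"
| mix: "avg A ==> avg B ==> avg (%F x. A F x / 2 + B F x / 2)"
| comp: "avg A ==> avg B ==> avg (%F. A (B F))"

lemma avg_le: "avg A ==> (!!x. x : K ==> F x \<le> c) ==> x : K ==> A F x \<le> c"
proof (induction arbitrary: F x rule: avg.induct)
 case (mix A B)
 have "A F x \<le> c" "B F x \<le> c" by (rule mix.IH; use mix.prems in simp)+
 then show ?case by simp
qed (auto simp: K_mult)

lemma avg_linear: "avg A ==> A (%x. F x + t * H x) = (%x. A F x + t * A H x)"
 by (induction arbitrary: F H rule: avg.induct) (auto simp: field_simps)

lemma avg_half: "avg A ==> A (%x. F x / 2 + H x / 2) = (%x. A F x / 2 + A H x / 2)"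
 by (induction arbitrary: F H rule: avg.induct) (auto simp: field_simps)

lemma avg_0: "avg A ==> A (%_. 0) = (%_. 0)"
 by (induction rule: avg.induct) auto

lemma avg_scale: "avg A ==> A (%x. t * F x) = (%x. t * A F x)"
 using avg_linear[of A "%_. 0" t F] by (simp add: avg_0)

lemma avg_ge: "avg A ==> (!!x. x : K ==> c \<le> F x) ==> x : K ==> c \<le> A F x"
 using avg_le[of A "%x. -1 * F x" "-c" x] by (simp only: avg_scale) simp

lemma avg_close:
 assumes "avg A" "!!x. x : K ==> \<bar>F x - c\<bar> \<le> e" "x : K"
 shows "\<bar>A F x - c\<bar> \<le> e"
proof -
 have "A F x \<le> c + e" "c - e \<le> A F x"
  by (intro avg_le[OF assms(1) _ assms(3)] avg_ge[OF assms(1) _ assms(3)]; use assms(2) in \<open>force simp: abs_le_iff\<close>)+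
 then show ?thesis by linarith
qed

lemma avg_cong: "avg A ==> (!!x. x : K ==> F x = H x) ==> x : K ==> A F x = A H x"
 using avg_close[of A "%x. F x + -1 * H x" 0 0 x] by (simp only: avg_linear) simp

lemma avg_contK: "avg A ==> contK F ==> contK (A F)"
proof (induction arbitrary: F rule: avg.induct)
 case (mix A B)
 from contK_add[OF contK_mult[OF mix.IH(1), of F "1/2"] contK_mult[OF mix.IH(2), of F "1/2"]] mix.prems
 show ?case by simp
qed (auto intro: contK_left)

lemma avg_right:
 "avg A ==> x : K ==> l : CG ==> A (%x. F (x ** l)) x = A F (x ** l)"
proof (induction arbitrary: F x rule: avg.induct)
 case (comp A B)
 have "A (B (%x. F (x ** l))) x = A (%x. B F (x ** l)) x"
  by (rule avg_cong[OF comp.hyps(1)]) (use comp in auto)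
 then show ?case using comp by simp
qed (simp_all add: m_assoc K_carrier)

text \<open>Fubini for averages in two separate variables.\<close>

lemma avg_swap: "avg A ==> avg B ==> A (%x. B (H x) y) x = B (%y. A (%x. H x y) x) y"
proof (induction arbitrary: H x rule: avg.induct)
 case (mix A1 A2)
 then show ?case by (simp add: avg_half[OF mix.prems])
next
 case (comp A1 A2)
 have "A2 (%x. B (H x) y) = (%x. B (%y. A2 (%x. H x y) x) y)" using comp by (intro ext) simp
 then show ?case using comp.IH(1)[OF comp.prems, of "%x y. A2 (%x. H x y) x"] by simp
qed simp

definition lmean :: "('a => real) => real => bool" where
 "lmean F c \<longleftrightarrow> (ALL e>0. EX A. avg A & (ALL x:K. \<bar>A F x - c\<bar> \<le> e))"

lemma lmeanE:
 assumes "lmean F c" "e > 0"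
 obtains A where "avg A" "!!x. x : K ==> \<bar>A F x - c\<bar> \<le> e"
 using assms unfolding lmean_def by blast

lemma lmeanI:
 "(!!e. e > 0 ==> EX A. avg A & (ALL x:K. \<bar>A F x - c\<bar> \<le> e)) ==> lmean F c"
 by (simp add: lmean_def)

text \<open>A single operator can give weight at least \<theta> to each of finitely many translates.
  It then lowers an upper bound v of F by \<theta> times any deficit that one of the translates
  finds. Adding a translate halves the weights obtained so far.\<close>

lemma avg_strict:
 assumes "finite C" "C \<subseteq> K"
 shows "EX B \<theta>. avg B & 0 < \<theta> & \<theta> \<le> 1 &
  (ALL F v. (ALL x:K. F x \<le> v) --> (ALL x:K. ALL c:C. B F x \<le> v - \<theta> * (v - F (c ** x))))"
 using assms
proof (induction C rule: finite_induct)
 case empty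
 then show ?case using shift[OF K_one] by (intro exI[of _ "%F x. F (\<one> ** x)"] exI[of _ 1]) auto
next
 case (insert c C)
 then obtain B \<theta> where B: "avg B" "0 < \<theta>" "\<theta> \<le> 1" and
  le: "!!F v x d. (ALL x:K. F x \<le> v) ==> x : K ==> d : C ==> B F x \<le> v - \<theta> * (v - F (d ** x))"
  by (simp) blast
 have c: "c : K" using insert by simp
 have "F (c ** x) / 2 + B F x / 2 \<le> v - \<theta> / 2 * (v - F (d ** x))"
  if F: "ALL x:K. F x \<le> v" and x: "x : K" and d: "d : insert c C" for F v x d
 proof (cases "d = c")
  case True
  have "\<theta> * (v - F (c ** x)) \<le> 1 * (v - F (c ** x))"
   by (rule mult_right_mono) (use F K_mult[OF c x] B in auto)
  then show ?thesis using avg_le[OF B(1), of F v x] F x True by simp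
 next
  case False
  then show ?thesis using le[OF F x, of d] d F K_mult[OF c x] by force
 qed
 then show ?case using mix[OF shift[OF c] B(1)] B
  by (intro exI[of _ "%F x. F (c ** x) / 2 + B F x / 2"] exI[of _ "\<theta>/2"]) auto
qed

text \<open>Averages with almost minimal supremum are almost constant: averaging further over a finite
 net of translates would otherwise lower the supremum.\<close>

lemma lmean_ex:
 assumes F: "contK F"
 shows "EX c. lmean F c"
proof -
 define S where "S = {u. EX A. avg A & (ALL x:K. A F x \<le> u)}"
 obtain b where b: "!!k. k : K ==> norm (F k) \<le> b" by (rule contK_bounded[OF F]) (rule that)
 have S0: "b : S" unfolding S_def using shift[OF K_one] b K_carrier by (force simp: abs_le_iff)
 have "- b \<le> u" if uS: "u : S" for u
 proof -
  obtain A where A: "avg A" "ALL x:K. A F x \<le> u" using uS unfolding S_def by blast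
  have "- b \<le> A F \<one>" by (rule avg_ge[OF A(1) _ K_one]) (use b in \<open>force simp: abs_le_iff\<close>)
  then show ?thesis using A(2) K_one by force
 qed
 then have low: "Inf S \<le> u" if "u : S" for u using that by (intro cInf_lower bdd_belowI) auto
 have "lmean F (Inf S)"
 proof (rule lmeanI)
  fix e :: real assume "e > 0"
  then have e: "e / 2 > 0" by simp
  obtain V where V: "openin T V" "\<one> : V" and unif: "!!x y. x : K ==> y : V ==> \<bar>F (x ** y) - F x\<bar> \<le> e / 2"
   by (rule contK_uniform[OF F e]) (rule that)
  obtain cs where cs: "cs ~= []" "set cs \<subseteq> K" "!!x. x : K ==> EX c:set cs. inv c ** x : V"
   by (rule translate_cover[OF V]) (rule that)
  obtain B \<theta> where B: "avg B" "0 < \<theta>" "\<theta> \<le> 1" and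
   le: "!!F v x c. (ALL x:K. F x \<le> v) ==> x : K ==> c : set cs ==> B F x \<le> v - \<theta> * (v - F (inv c ** x))"
   using avg_strict[of "(%c. inv c) ` set cs"] cs(2) K_inv by (simp add: image_subset_iff subset_iff) blast
  \<comment> \<open>The bound u exceeds the infimum by less than another averaging would gain from a
    dip of size e / 2.\<close>
  obtain u where u: "u : S" "u < Inf S + \<theta> * (e / 2)"
   using cInf_lessD[of S "Inf S + \<theta> * (e / 2)"] S0 B(2) e by auto
  obtain A where A: "avg A" "ALL x:K. A F x \<le> u" using u(1) unfolding S_def by blast
  have t: "\<theta> * (e / 2) \<le> e / 2" using mult_right_mono[OF B(3), of "e / 2"] e by simp
  have "\<bar>A F p - Inf S\<bar> \<le> e" if p: "p : K" for p
  proof -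
   \<comment> \<open>Some translate of the net carries x close to the identity, where the shifted
     function is at most A F p + e / 2. Averaging over the net therefore improves the bound u by
     \<theta> times the gap at p.\<close>
   have "u - \<theta> * (u - (A F p + e / 2)) : S" unfolding S_def
   proof (intro CollectI exI conjI ballI)
    show "avg (%F. B (%x. A F (p ** x)))" by (rule comp[OF B(1) comp[OF shift[OF p] A(1)]])
    fix x assume x: "x : K"
    obtain c where c: "c : set cs" "inv c ** x : V" using cs(3)[OF x] by blast
    have cx: "inv c ** x : K" using c cs(2) x K_mult K_inv by blast
    \<comment> \<open>The name x' stands for the outer x, which the bound variable of the function
      shadows.\<close>
    have "\<bar>A (%x. F (x ** (inv c ** x')) + -1 * F x) p - 0\<bar> \<le> e / 2" if "x' = x" for x'
     by (rule avg_close[OF A(1) _ p]) (use unif c that in simp)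
    then have "\<bar>A F (p ** (inv c ** x)) - A F p\<bar> \<le> e / 2"
     by (simp only: avg_linear[OF A(1)] avg_right[OF A(1) p K_carrier[OF cx]]) simp
    then have "\<theta> * (u - (A F p + e / 2)) \<le> \<theta> * (u - A F (p ** (inv c ** x)))"
     using B(2) by (intro mult_left_mono) linarith+
    then show "B (%x. A F (p ** x)) x \<le> u - \<theta> * (u - (A F p + e / 2))"
     using le[of "%x. A F (p ** x)" u x c] A(2) K_mult[OF p] x c(1) by fastforce
   qed
   from low[OF this] u(2) have "\<theta> * (u - (A F p + e / 2)) < \<theta> * (e / 2)" by linarith
   then have "u - (A F p + e / 2) < e / 2" using B(2) by simp
   moreover have "A F p \<le> u" using A(2) p by blast
   ultimately show ?thesis using low[OF u(1)] u(2) t e by linarith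
  qed
  then show "EX A. avg A & (ALL x:K. \<bar>A F x - Inf S\<bar> \<le> e)" using A(1) by blast
 qed
 then show ?thesis by blast
qed

text \<open>The function F (x ** inv y) is averaged in both variables: averaging in x first leads to
  c, in y first leads to c', and the averages commute. Uniqueness of c follows too, since c' can be
  held fixed while c varies.\<close>

lemma lmean_inv_eq:
 assumes "lmean F c" "lmean (%x. F (inv x)) c'"
 shows "c = c'"
proof -
 have "\<bar>c - c'\<bar> \<le> 0 + e" if "e > 0" for e
 proof -
  have e: "e / 2 > 0" using that by simp
  obtain A where A: "avg A" "!!x. x : K ==> \<bar>A F x - c\<bar> \<le> e / 2" by (rule lmeanE[OF assms(1) e]) (rule that)
  obtain B where B: "avg B" "!!x. x : K ==> \<bar>B (%x. F (inv x)) x - c'\<bar> \<le> e / 2"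
   by (rule lmeanE[OF assms(2) e]) (rule that)
  have "\<bar>B (%y. A (%x. F (x ** inv y)) \<one>) \<one> - c\<bar> \<le> e / 2"
   by (rule avg_close[OF B(1) _ K_one]) (use A(2)[OF K_inv] in \<open>simp add: avg_right[OF A(1) K_one] K_carrier\<close>)
  moreover have "\<bar>A (%x. B (%y. F (x ** inv y)) \<one>) \<one> - c'\<bar> \<le> e / 2"
  proof (rule avg_close[OF A(1) _ K_one])
   fix x assume x: "x : K"
   have "B (%y. F (x ** inv y)) \<one> = B (%y. F (inv (y ** inv x))) \<one>"
    by (rule avg_cong[OF B(1) _ K_one]) (simp add: inv_mult_group K_carrier x)
   also have "... = B (%y. F (inv y)) (\<one> ** inv x)"
    using avg_right[OF B(1) K_one, of "inv x" "%y. F (inv y)"] x K_carrier by simp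
   finally show "\<bar>B (%y. F (x ** inv y)) \<one> - c'\<bar> \<le> e / 2" using B(2)[OF K_inv[OF x]] x K_carrier by simp
  qed
  ultimately show ?thesis unfolding avg_swap[OF A(1) B(1)] by linarith
 qed
 then have "\<bar>c - c'\<bar> \<le> 0" by (rule field_le_epsilon)
 then show ?thesis by simp
qed

definition "mean F = (THE c. lmean F c)"

lemma mean_eqI: "contK F ==> lmean F c ==> mean F = c"
 unfolding mean_def using lmean_ex[OF contK_inv] lmean_inv_eq by (metis (no_types, lifting) the_equality)

lemma mean_lmean: "contK F ==> lmean F (mean F)"
 using lmean_ex mean_eqI by blast

lemma mean_cong: "(!!k. k : K ==> F k = F' k) ==> mean F = mean F'"
 unfolding mean_def lmean_def using avg_cong[of _ F F'] by (metis (no_types, lifting))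

lemma mean_avg:
 assumes "contK F" "avg A"
 shows "mean (A F) = mean F"
proof (rule mean_eqI[symmetric, OF assms(1) lmeanI])
 fix e :: real assume "e > 0"
 then obtain B where "avg B" "!!x. x : K ==> \<bar>B (A F) x - mean (A F)\<bar> \<le> e"
  by (rule lmeanE[OF mean_lmean[OF avg_contK[OF assms(2,1)]]]) (rule that)
 then show "EX B. avg B & (ALL x:K. \<bar>B F x - mean (A F)\<bar> \<le> e)"
  using comp[OF _ assms(2)] by blast
qed

lemma mean_left: "contK F ==> l : K ==> mean (%x. F (l ** x)) = mean F"
 by (rule mean_avg[OF _ shift])

lemma mean_right:
 assumes "contK F" "l : K"
 shows "mean (%x. F (x ** l)) = mean F"
proof (rule mean_eqI[OF contK_right[OF assms] lmeanI])
 fix e :: real assume "e > 0"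
 then obtain A where A: "avg A" "!!x. x : K ==> \<bar>A F x - mean F\<bar> \<le> e"
  by (rule lmeanE[OF mean_lmean[OF assms(1)]]) (rule that)
 then show "EX A. avg A & (ALL x:K. \<bar>A (%x. F (x ** l)) x - mean F\<bar> \<le> e)"
  using A K_mult[OF _ assms(2)] by (intro exI[of _ A]) (simp add: avg_right[OF A(1) _ K_carrier[OF assms(2)]])
qed

lemma mean_add:
 assumes F: "contK F" and F': "contK F'"
 shows "mean (%x. F x + F' x) = mean F + mean F'"
proof (rule mean_eqI[OF contK_add[OF F F'] lmeanI])
 fix e :: real assume "e > 0"
 then have e: "e / 2 > 0" by simp
 obtain A where A: "avg A" "!!x. x : K ==> \<bar>A F x - mean F\<bar> \<le> e / 2" by (rule lmeanE[OF mean_lmean[OF F] e]) (rule that)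
 obtain B where B: "avg B" "!!x. x : K ==> \<bar>B (A F') x - mean (A F')\<bar> \<le> e / 2"
  by (rule lmeanE[OF mean_lmean[OF avg_contK[OF A(1) F']] e]) (rule that)
 have "\<bar>B (A (%x. F x + F' x)) x - (mean F + mean F')\<bar> \<le> e" if x: "x : K" for x
 proof -
  have "B (A (%x. F x + 1 * F' x)) x = B (A F) x + 1 * B (A F') x"
   by (simp only: avg_linear[OF A(1)] avg_linear[OF B(1)])
  moreover have "\<bar>B (A F) x - mean F\<bar> \<le> e / 2" by (rule avg_close[OF B(1) A(2) x])
  ultimately show ?thesis using B(2)[OF x] unfolding mean_avg[OF F' A(1)] mult_1 by linarith
 qed
 then show "EX A. avg A & (ALL x:K. \<bar>A (%x. F x + F' x) x - (mean F + mean F')\<bar> \<le> e)"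
  using comp[OF B(1) A(1)] by blast
qed

lemma mean_le:
 assumes "contK F" "!!k. k : K ==> F k \<le> c"
 shows "mean F \<le> c"
proof (rule field_le_epsilon)
 fix e :: real assume "e > 0"
 then obtain A where A: "avg A" "!!x. x : K ==> \<bar>A F x - mean F\<bar> \<le> e"
  by (rule lmeanE[OF mean_lmean[OF assms(1)]]) (rule that)
 have "A F \<one> \<le> c" by (rule avg_le[OF A(1) assms(2) K_one])
 then show "mean F \<le> c + e" using A(2)[OF K_one] by linarith
qed

lemma mean_scale:
 assumes F: "contK F"
 shows "mean (%x. t * F x) = t * mean F"
proof (rule mean_eqI[OF contK_mult[OF F] lmeanI])
 fix e :: real assume e: "e > 0"
 then have "e / (\<bar>t\<bar> + 1) > 0" by (simp add: add_nonneg_pos)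
 then obtain A where A: "avg A" "!!x. x : K ==> \<bar>A F x - mean F\<bar> \<le> e / (\<bar>t\<bar> + 1)"
  by (rule lmeanE[OF mean_lmean[OF F]]) (rule that)
 have "\<bar>A (%x. t * F x) x - t * mean F\<bar> \<le> e" if "x : K" for x
 proof -
  have "\<bar>A (%x. t * F x) x - t * mean F\<bar> = \<bar>t\<bar> * \<bar>A F x - mean F\<bar>"
   by (simp add: avg_scale[OF A(1)] abs_mult flip: right_diff_distrib)
  also have "... \<le> (\<bar>t\<bar> + 1) * (e / (\<bar>t\<bar> + 1))" using A(2)[OF that] by (intro mult_mono) auto
  finally show ?thesis by (simp add: add_nonneg_eq_0_iff)
 qed
 then show "EX A. avg A & (ALL x:K. \<bar>A (%x. t * F x) x - t * mean F\<bar> \<le> e)" using A(1) by blast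
qed

lemma mean_const: "mean (%_. c) = c"
 using shift[OF K_one] by (intro mean_eqI contK_const lmeanI exI[of _ "%F x. F (\<one> ** x)"]) simp

end


section \<open>Means of vector-valued functions and differentiation under the mean\<close>

definition some_basis :: "'v::real_vector set" where
 "some_basis = (SOME B. basis_of B)"

lemma some_basis: "findim TYPE('v::real_vector) ==> basis_of (some_basis :: 'v set)"
proof -
 assume "findim TYPE('v)"
 then obtain B :: "'v set" where "basis_of B"
  using findim_basis unfolding basis_of_def by metis
 then show ?thesis unfolding some_basis_def by (rule someI)
qed

context compact_subgrp
begin

lemma mean_sum:
 assumes "finite I" "!!i. i : I ==> contK (F i)"
 shows "contK (%x. \<Sum>i\<in>I. F i x)" "mean (%x. \<Sum>i\<in>I. F i x) = (\<Sum>i\<in>I. mean (F i))"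
proof -
 have "contK (%x. \<Sum>i\<in>I. F i x) & mean (%x. \<Sum>i\<in>I. F i x) = (\<Sum>i\<in>I. mean (F i))"
  using assms by (induction I rule: finite_induct) (auto simp: contK_const mean_const contK_add mean_add)
 then show "contK (%x. \<Sum>i\<in>I. F i x)" "mean (%x. \<Sum>i\<in>I. F i x) = (\<Sum>i\<in>I. mean (F i))" by auto
qed

lemma mean_abs_le:
 assumes "contK F" "!!k. k : K ==> \<bar>F k\<bar> \<le> c"
 shows "\<bar>mean F\<bar> \<le> c"
proof -
 have "mean F \<le> c" by (rule mean_le[OF assms(1)]) (use assms(2) in \<open>auto simp: abs_le_iff\<close>)
 moreover have "mean (%x. (-1) * F x) \<le> c"
  by (rule mean_le[OF contK_mult[OF assms(1)]]) (use assms(2) in \<open>auto simp: abs_le_iff\<close>)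
 ultimately show ?thesis unfolding mean_scale[OF assms(1)] by linarith
qed

lemma mean_nonneg:
 assumes "contK F" "!!k. k : K ==> 0 \<le> F k"
 shows "0 \<le> mean F"
proof -
 have "mean (%x. (-1) * F x) \<le> 0"
  by (rule mean_le[OF contK_mult[OF assms(1)]]) (use assms(2) in auto)
 then show ?thesis unfolding mean_scale[OF assms(1)] by linarith
qed

text \<open>Finitely many left translates of F sum to at least F k0 / 2 everywhere on K, and all of
  them have the same mean as F.\<close>

lemma mean_pos:
 assumes F: "contK F" "!!k. k : K ==> 0 \<le> F k" and k0: "k0 : K" "F k0 > 0"
 shows "0 < mean F"
proof -
 define d where "d = F k0 / 2"
 have d: "d > 0" using k0 by (simp add: d_def)
 obtain V where V: "openin T V" "\<one> : V" "!!x y. x : K ==> y : V ==> \<bar>F (x ** y) - F x\<bar> \<le> d"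
  by (rule contK_uniform[OF F(1) d]) (rule that)
 obtain cs where cs: "cs ~= []" "set cs \<subseteq> K" "!!x. x : K ==> EX c:set cs. inv c ** x : V"
  by (rule translate_cover[OF V(1,2)]) (rule that)
 let ?S = "%x. \<Sum>c\<in>set cs. F ((k0 ** inv c) ** x)"
 have kc: "k0 ** inv c : K" if "c : set cs" for c using that cs(2) k0 K_mult K_inv by blast
 have S: "contK ?S" "mean ?S = (\<Sum>c\<in>set cs. mean (%x. F ((k0 ** inv c) ** x)))"
  using mean_sum[of "set cs" "%c x. F ((k0 ** inv c) ** x)"] contK_left[OF F(1) kc] by auto
 then have S2: "mean ?S = real (card (set cs)) * mean F" using mean_left[OF F(1) kc] by simp
 have "d \<le> ?S x" if x: "x : K" for x
 proof -
  obtain c where c: "c : set cs" "inv c ** x : V" using cs(3)[OF x] by blast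
  have "(k0 ** inv c) ** x = k0 ** (inv c ** x)" using c(1) cs(2) k0 x K_carrier by (simp add: m_assoc subset_iff)
  then have "d \<le> F ((k0 ** inv c) ** x)" using V(3)[OF k0(1) c(2)] unfolding d_def by (simp only:)
  also have "... \<le> ?S x"
   by (rule member_le_sum[OF c(1)]) (use F(2) kc x K_mult in auto)
  finally show ?thesis .
 qed
 then have "mean (%x. ?S x + (- d)) \<ge> 0"
  by (intro mean_nonneg contK_add S contK_const) auto
 then have "mean ?S \<ge> d" unfolding mean_add[OF S(1) contK_const] mean_const by linarith
 then have "real (card (set cs)) * mean F > 0" using d S2 by linarith
 then show ?thesis by (simp add: zero_less_mult_iff)
qed

text \<open>Taken coordinatewise in a fixed basis; that it commutes with linear functionals, shown
  next, makes it independent of this choice.\<close>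

definition vmean :: "('a => 'v::real_normed_vector) => 'v" where
 "vmean F = (\<Sum>b\<in>some_basis. mean (%k. representation some_basis (F k) b) *. b)"

lemma mean_linear_sum:
 assumes fd: "findim TYPE('v::real_normed_vector)" and F: "contK (F :: 'a => 'v)" and l: "linear (l :: 'v => real)"
 shows "l (vmean F) = mean (%k. l (F k))"
proof -
 let ?B = "some_basis :: 'v set"
 have B: "basis_of ?B" by (rule some_basis[OF fd])
 have rc: "contK (%k. representation ?B (F k) b)" for b
  by (rule contK_linear[OF fd_bounded_linear[OF fd linear_rep[OF B]] F])
 have "mean (%k. l (F k)) = mean (%k. \<Sum>b\<in>?B. l b * representation ?B (F k) b)"
  by (rule mean_cong) (subst linear_basis_sum[OF B l], simp add: mult.commute)
 also have "... = (\<Sum>b\<in>?B. mean (%k. l b * representation ?B (F k) b))"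
  using B by (intro mean_sum contK_mult rc) (auto simp: basis_of_def)
 also have "... = (\<Sum>b\<in>?B. l b * mean (%k. representation ?B (F k) b))"
  by (intro sum.cong refl mean_scale rc)
 also have "... = l (vmean F)"
  unfolding vmean_def by (simp add: linear_sum[OF l] linear_scale[OF l] mult.commute)
 finally show ?thesis by simp
qed

lemma vmean_eqI:
 assumes fd: "findim TYPE('v::real_normed_vector)" and F: "contK (F :: 'a => 'v)"
  and "!!l :: 'v => real. linear l ==> l c = mean (%k. l (F k))"
 shows "vmean F = c"
proof -
 have B: "basis_of (some_basis :: 'v set)" by (rule some_basis[OF fd])
 have eq: "representation some_basis (vmean F) b = representation some_basis c b" for b
  using mean_linear_sum[OF fd F linear_rep[OF B]] assms(3)[OF linear_rep[OF B]] by simp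
 have "vmean F = (\<Sum>b\<in>some_basis. representation some_basis (vmean F) b *. b)" by (rule basis_sum[OF B, symmetric])
 also have "... = (\<Sum>b\<in>some_basis. representation some_basis c b *. b)" by (simp only: eq)
 also have "... = c" by (rule basis_sum[OF B])
 finally show ?thesis .
qed

lemma vmean_linear:
 assumes "findim TYPE('v::real_normed_vector)" "findim TYPE('w::real_normed_vector)"
  and F: "contK (F :: 'a => 'v)" and L: "linear (L :: 'v => 'w)"
 shows "L (vmean F) = vmean (%k. L (F k))"
proof (rule sym, rule vmean_eqI[OF assms(2) contK_linear[OF fd_bounded_linear[OF assms(1) L] F]])
 fix l :: "'w => real" assume "linear l"
 from linear_compose[OF L this] show "l (L (vmean F)) = mean (%k. l (L (F k)))"
  using mean_linear_sum[OF assms(1) F] by (simp add: comp_def)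
qed

lemma vmean_cong: "(!!k. k : K ==> F k = F' k) ==> vmean F = vmean F'"
 unfolding vmean_def by (intro sum.cong refl arg_cong2[of _ _ _ _ "(*\<^sub>R)"] mean_cong) simp

lemma vmean_left:
 assumes "findim TYPE('v::real_normed_vector)" "contK (F :: 'a => 'v)" "l : K"
 shows "vmean (%x. F (l ** x)) = vmean F"
proof (rule vmean_eqI[OF assms(1) contK_left[OF assms(2,3)]])
 fix f :: "'v => real" assume f: "linear f"
 show "f (vmean F) = mean (%k. f (F (l ** k)))"
  using mean_linear_sum[OF assms(1,2) f]
   mean_left[OF contK_linear[OF fd_bounded_linear[OF assms(1) f] assms(2)] assms(3)] by simp
qed

lemma vmean_right:
 assumes "findim TYPE('v::real_normed_vector)" "contK (F :: 'a => 'v)" "l : K"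
 shows "vmean (%x. F (x ** l)) = vmean F"
proof (rule vmean_eqI[OF assms(1) contK_right[OF assms(2,3)]])
 fix f :: "'v => real" assume f: "linear f"
 show "f (vmean F) = mean (%k. f (F (k ** l)))"
  using mean_linear_sum[OF assms(1,2) f]
   mean_right[OF contK_linear[OF fd_bounded_linear[OF assms(1) f] assms(2)] assms(3)] by simp
qed

lemma vmean_const:
 assumes "findim TYPE('v::real_normed_vector)"
 shows "vmean (%_. c :: 'v) = c"
 by (rule vmean_eqI[OF assms contK_const]) (simp add: mean_const)

lemma vmean_add:
 assumes fd: "findim TYPE('v::real_normed_vector)" and "contK (F :: 'a => 'v)" "contK F'"
 shows "vmean (%k. F k + F' k) = vmean F + vmean F'"
proof (rule vmean_eqI[OF fd contK_add[OF assms(2,3)]])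
 fix l :: "'v => real" assume l: "linear l"
 note c = contK_linear[OF fd_bounded_linear[OF fd l]]
 show "l (vmean F + vmean F') = mean (%k. l (F k + F' k))"
  using mean_add[OF c[OF assms(2)] c[OF assms(3)]]
  by (simp add: linear_add[OF l] mean_linear_sum[OF fd assms(2) l] mean_linear_sum[OF fd assms(3) l])
qed

lemma vmean_scale:
 assumes fd: "findim TYPE('v::real_normed_vector)" and "contK (F :: 'a => 'v)"
 shows "vmean (%k. t *. F k) = t *. vmean F"
 by (rule vmean_linear[OF fd fd assms(2), of "%v. t *. v", symmetric])
  (auto intro!: linearI simp: scaleR_add_right)

lemma contK_scaleR: "contK F ==> contK (%x. t *. F x)"
 by (auto simp: contK_def intro: tendsto_intros)

lemma contK_diff: "contK F ==> contK F' ==> contK (%x. F x - F' x)"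
 by (auto simp: contK_def intro: tendsto_diff)

lemma vmean_diff:
 assumes fd: "findim TYPE('v::real_normed_vector)" and "contK (F :: 'a => 'v)" "contK F'"
 shows "vmean (%k. F k - F' k) = vmean F - vmean F'"
proof -
 have "vmean (%k. F k + (-1) *. F' k) = vmean F + (-1) *. vmean F'"
  by (simp only: vmean_add[OF fd assms(2) contK_scaleR[OF assms(3)]] vmean_scale[OF fd assms(3)])
 then show ?thesis by simp
qed

lemma vmean_bound:
 assumes fd: "findim TYPE('v::real_normed_vector)"
 obtains C where "C > 0" "!!(F :: 'a => 'v) e. contK F ==> (!!k. k : K ==> norm (F k) \<le> e) ==> norm (vmean F) \<le> C * e"
proof -
 let ?B = "some_basis :: 'v set"
 have B: "basis_of ?B" by (rule some_basis[OF fd])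
 obtain c where c: "c > 0" "!!v b. \<bar>representation ?B v b\<bar> \<le> c * norm v"
  using coefficient_bound[OF B] by blast
 define C where "C = c * (\<Sum>b\<in>?B. norm b) + 1"
 have "C > 0" using c by (auto simp: C_def intro!: add_nonneg_pos mult_nonneg_nonneg sum_nonneg)
 moreover have "norm (vmean F) \<le> C * e" if F: "contK F" and e: "!!k. k : K ==> norm (F k) \<le> e" for F :: "'a => 'v" and e
 proof -
  have e0: "e \<ge> 0" using e[OF K_one] norm_ge_zero order_trans by blast
  have m: "\<bar>mean (%k. representation ?B (F k) b)\<bar> \<le> c * e" for b
  proof (rule mean_abs_le)
   show "contK (%k. representation ?B (F k) b)"
    by (rule contK_linear[OF fd_bounded_linear[OF fd linear_rep[OF B]] F])
   fix k assume "k : K"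
   then have "c * norm (F k) \<le> c * e" using c e by simp
   then show "\<bar>representation ?B (F k) b\<bar> \<le> c * e" using c(2)[of "F k" b] by linarith
  qed
  have "norm (vmean F) \<le> (\<Sum>b\<in>?B. norm (mean (%k. representation ?B (F k) b) *. b))"
   unfolding vmean_def by (rule norm_sum)
  also have "... \<le> (\<Sum>b\<in>?B. (c * e) * norm b)" unfolding norm_scaleR by (intro sum_mono mult_right_mono m) auto
  also have "... = (c * (\<Sum>b\<in>?B. norm b)) * e" by (simp add: sum_distrib_left sum_distrib_right mult_ac)
  also have "... \<le> C * e" using e0 by (intro mult_right_mono) (auto simp: C_def)
  finally show ?thesis .
 qed
 ultimately show ?thesis by (rule that)
qed

text \<open>Compactness of K makes the convergence of the integrands uniform, and
  \<open>vmean_bound\<close> carries a uniform bound over to the means.\<close>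

lemma vmean_tendsto:
 fixes F :: "'z => 'a => 'v::real_normed_vector"
 assumes fd: "findim TYPE('v)" and c: "eventually (%z. contK (F z)) \<Z>" "contK F0"
  and lim: "!!k. k : K ==> ((%(x, z). F z x) ---> F0 k) (nhdsin T k \<times>\<^sub>F \<Z>)"
 shows "((%z. vmean (F z)) ---> vmean F0) \<Z>"
proof (rule tendstoI)
 fix e :: real assume e: "e > 0"
 obtain C where C: "C > 0" "!!(F :: 'a => 'v) e. contK F ==> (!!k. k : K ==> norm (F k) \<le> e) ==> norm (vmean F) \<le> C * e"
  using vmean_bound[OF fd] by blast
 define d where "d = e / (2 * C)"
 have d: "d > 0" "C * d < e" using e C by (auto simp: d_def)
 have "eventually (%z. ALL k:K. norm (F z k - F0 k) < d) \<Z>"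
 proof (rule compactin_ev[OF K_compact])
  fix k assume k: "k : K"
  have "((%x. F0 (fst x)) ---> F0 k) (nhdsin T k \<times>\<^sub>F \<Z>)"
   using c(2) k filterlim_compose[OF _ filterlim_fst, of F0] by (auto simp: contK_def)
  from tendsto_diff[OF lim[OF k] this]
  have "((%x. F (snd x) (fst x) - F0 (fst x)) ---> 0) (nhdsin T k \<times>\<^sub>F \<Z>)" by (simp add: case_prod_unfold)
  from tendstoD[OF this d(1)] show "eventually (%(x, y). norm (F y x - F0 x) < d) (nhdsin T k \<times>\<^sub>F \<Z>)"
   by (simp add: case_prod_unfold)
 qed
 with c(1) show "eventually (%z. dist (vmean (F z)) (vmean F0) < e) \<Z>"
 proof eventually_elim
  case (elim z)
  have "norm (vmean (%k. F z k - F0 k)) \<le> C * d"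
   using elim by (intro C(2) contK_diff c(2)) (auto simp: less_imp_le)
  then show ?case using d(2) by (simp add: dist_norm vmean_diff[OF fd elim(1) c(2)])
 qed
qed

lemma vmean_param_contK:
 fixes F :: "'a => 'e::real_normed_vector => 'v::real_normed_vector"
 assumes F: "param_cont T W F" and W: "K \<times> S \<subseteq> W" and x: "x : S"
 shows "contK (%k. F k x)"
 unfolding contK_def
proof
 fix k assume k: "k : K"
 have kx: "(k, x) : W" using k x W by blast
 show "((%k. F k x) ---> F k x) (nhdsin T k)"
  using filterlim_compose[OF param_contD[OF F kx] filterlim_Pair[OF filterlim_ident tendsto_const]] by simp
qed

text \<open>Differentiation under the integral sign: the first-order error of the integrands is
  small uniformly on the compact group.\<close>

lemma vmean_has_derivative:
 fixes F :: "'a => 'e::real_normed_vector => 'v::real_normed_vector"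
 assumes fde: "findim TYPE('e)" and fdv: "findim TYPE('v)"
  and F1: "pCk_on (Suc 0) T W F" and W: "param_open T W" and S: "open S" "K \<times> S \<subseteq> W" and x: "x : S"
 shows "((%x. vmean (%k. F k x)) has_derivative (%v. vmean (%k. FD (F k) x v))) (at x)"
proof -
 let ?D = "%k x v. FD (F k) x v"
 note cK = vmean_param_contK[OF _ S(2)]
 have pc: "param_cont T W F" using F1 by simp
 have pD: "param_cont T W (%k x. ?D k x v)" for v using F1 by simp
 have der: "(F p has_derivative ?D p x) (at x)" if "(p, x) : W" for p x
  using pCk_has_deriv[OF F1 that] .
 obtain C where C: "C > 0" "!!(F :: 'a => 'v) e. contK F ==> (!!k. k : K ==> norm (F k) \<le> e) ==> norm (vmean F) \<le> C * e"
  using vmean_bound[OF fdv] by blast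
 have lin: "linear (%v. vmean (%k. ?D k x v))"
 proof (rule linearI)
  have l: "linear (?D k x)" if "k : K" for k
   using der[of k x] that x S(2) has_derivative_linear by blast
  show "vmean (%k. ?D k x (u + v)) = vmean (%k. ?D k x u) + vmean (%k. ?D k x v)" for u v
   unfolding vmean_add[OF fdv cK[OF pD x] cK[OF pD x], symmetric]
   by (rule vmean_cong) (rule linear_add[OF l])
  show "vmean (%k. ?D k x (t *. u)) = t *. vmean (%k. ?D k x u)" for t u
   unfolding vmean_scale[OF fdv cK[OF pD x], symmetric]
   by (rule vmean_cong) (rule linear_scale[OF l])
 qed
 show ?thesis
  unfolding has_derivative_within_alt
 proof (intro conjI fd_bounded_linear[OF fde lin] allI impI)
  fix e :: real assume e: "e > 0"
  \<comment> \<open>One d is spent on linearizing at k0 in place of p and one on exchanging the two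
    derivatives; C is the constant of \<open>vmean_bound\<close>.\<close>
  define d where "d = e / (2 * C)"
  have d: "d > 0" "C * (2 * d) = e" using e C by (auto simp: d_def)
  have "eventually (%y. ALL k:K. norm (F k y - F k x - ?D k x (y - x)) \<le> 2 * d * norm (y - x)) (nhds x)"
  proof (rule compactin_ev[OF K_compact])
   fix k0 assume k0: "k0 : K"
   have kx: "(k0, x) : W" using k0 x S by blast
   obtain U r where U: "openin T U" "k0 : U" "r > 0" "U \<times> ball x r \<subseteq> W"
    and c1: "!!p y v. p : U ==> y : ball x r ==> norm (?D p y v - ?D k0 x v) \<le> d * norm v"
    and c2: "!!p y z. p : U ==> y : ball x r ==> z : ball x r ==>
     norm (F p y - F p z - ?D k0 x (y - z)) \<le> d * norm (y - z)"
    by (rule pCk_on_derivative_close[OF fde F1 W kx d(1)]) (rule that)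
   have "norm (F p y - F p x - ?D p x (y - x)) \<le> 2 * d * norm (y - x)" if "p : U" "y : ball x r" for p y
   proof -
    have "norm (F p y - F p x - ?D k0 x (y - x)) \<le> d * norm (y - x)"
     by (rule c2[OF that]) (use U in simp)
    moreover have "norm (?D p x (y - x) - ?D k0 x (y - x)) \<le> d * norm (y - x)"
     by (rule c1[OF that(1)]) (use U in simp)
    moreover have "F p y - F p x - ?D p x (y - x) = (F p y - F p x - ?D k0 x (y - x)) - (?D p x (y - x) - ?D k0 x (y - x))" by simp
    ultimately show ?thesis using norm_triangle_ineq4[of "F p y - F p x - ?D k0 x (y - x)" "?D p x (y - x) - ?D k0 x (y - x)"]
     by (simp only:)
   qed
   then have ex: "EX U r. openin T U & k0 : U & r > 0 & (ALL q:U. ALL y:ball x r.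
     (case (q, y) of (k, y) => norm (F k y - F k x - ?D k x (y - x)) \<le> 2 * d * norm (y - x)))"
    unfolding prod.case using U(1-3) by blast
   have "k0 : topspace T" using k0 K_carrier by simp
   from ev_param_nhds[OF this] ex show "eventually (%(k, y). norm (F k y - F k x - ?D k x (y - x)) \<le> 2 * d * norm (y - x)) (nhdsin T k0 \<times>\<^sub>F nhds x)"
    by blast
  qed
  with eventually_nhds_in_open[OF S(1) x]
  have "eventually (%y. norm (vmean (%k. F k y) - vmean (%k. F k x) - vmean (%k. ?D k x (y - x))) \<le> e * norm (y - x)) (nhds x)"
  proof eventually_elim
   case (elim y)
   have "vmean (%k. F k y) - vmean (%k. F k x) - vmean (%k. ?D k x (y - x)) = vmean (%k. F k y - F k x - ?D k x (y - x))"
    by (simp only: vmean_diff[OF fdv] contK_diff cK[OF pc elim(1)] cK[OF pc x] cK[OF pD x])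
   moreover have "norm (vmean (%k. F k y - F k x - ?D k x (y - x))) \<le> C * (2 * d * norm (y - x))"
    using elim(2) by (intro C(2) contK_diff cK[OF pc elim(1)] cK[OF pc x] cK[OF pD x]) auto
   moreover have "C * (2 * d * norm (y - x)) = e * norm (y - x)" by (simp add: d(2)[symmetric])
   ultimately show ?case by simp
  qed
  then show "EX d>0. ALL y:UNIV. norm (y - x) < d -->
    norm (vmean (%k. F k y) - vmean (%k. F k x) - vmean (%k. ?D k x (y - x))) \<le> e * norm (y - x)"
   unfolding eventually_nhds_metric dist_norm by blast
 qed
qed

lemma vmean_Ck:
 fixes F :: "'a => 'e::real_normed_vector => 'v::real_normed_vector"
 assumes fde: "findim TYPE('e)" and fdv: "findim TYPE('v)"
  and F: "pCk_on k T W F" and W: "param_open T W" and S: "open S" "K \<times> S \<subseteq> W"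
 shows "Ck_on k S (%x. vmean (%k. F k x))"
 using F
proof (induction k arbitrary: F)
 case 0
 show ?case unfolding Ck_on.simps
 proof (rule continuous_at_imp_continuous_on, rule ballI)
  fix x assume x: "x : S"
  have pc: "param_cont T W F" using 0 by simp
  have "((%y. vmean (%k. F k y)) ---> vmean (%k. F k x)) (nhds x)"
  proof (rule vmean_tendsto[OF fdv _ vmean_param_contK[OF pc S(2) x]])
   show "eventually (%z. contK (%k. F k z)) (nhds x)"
    using eventually_nhds_in_open[OF S(1) x] by eventually_elim (rule vmean_param_contK[OF pc S(2)])
   show "((%(x, z). F x z) ---> F k x) (nhdsin T k \<times>\<^sub>F nhds x)" if "k : K" for k
    using param_contD[OF pc, of k x] that x S(2) by (auto simp: case_prod_unfold)
  qed
  then show "continuous (at x) (%x. vmean (%k. F k x))"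
   unfolding continuous_at by (rule tendsto_mono[OF at_within_le_nhds])
 qed
next
 case (Suc k)
 show ?case
 proof (rule Ck_on_SucI[OF S(1)])
  show "((%x. vmean (%k. F k x)) has_derivative (%v. vmean (%k. FD (F k) x v))) (at x)" if "x : S" for x
   by (rule vmean_has_derivative[OF fde fdv pCk_on_mono[OF Suc.prems] W S that]) simp
  show "Ck_on k S (%x. vmean (%k. FD (F k) x v))" for v
   by (rule Suc.IH) (use Suc.prems in simp)
 qed
qed

end


text \<open>A representation of K given by maps that are defined, linear and convergent near K but
  multiplicative on K alone. The isotropy action at m is of this kind, since in a chart it makes
  sense only for group elements close to the stabilizer.\<close>

locale compact_rep = compact_subgrp +
 fixes rho :: "'a => 'v::real_normed_vector => 'v"
 assumes fdv: "findim TYPE('v)"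
  and rep_linear_near: "k : K ==> eventually (%z. linear (rho z)) (nhdsin T k)"
  and rep_tendsto: "k : K ==> ((%z. rho z v) ---> rho k v) (nhdsin T k)"
  and rep_mult: "k : K ==> l : K ==> rho (k ** l) v = rho k (rho l v)"
  and rep_one: "rho \<one> v = v"
begin

lemma rep_linear: "k : K ==> linear (rho k)"
 by (rule ev_nhdsinE[OF rep_linear_near]) (auto dest: K_carrier)

lemma rep_inv: "k : K ==> rho (inv k) (rho k v) = v" "k : K ==> rho k (rho (inv k) v) = v"
 using rep_mult[of "inv k" k v] rep_mult[of k "inv k" v] K_inv[of k] K_carrier[of k] rep_one by auto

lemma rep_tendsto2:
 assumes k: "k : K" and f: "filterlim f (nhdsin T k) F" and w: "(w ---> v) F"
 shows "((%x. rho (f x) (w x)) ---> rho k v) F"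
proof (rule lin_family_tendsto[OF fdv _ rep_linear[OF k] _ w])
 show "eventually (%z. linear (rho (f z))) F"
  by (rule eventually_compose_filterlim[OF rep_linear_near[OF k] f])
 show "((%z. rho (f z) v) ---> rho k v) F" for v
  by (rule filterlim_compose[OF rep_tendsto[OF k] f])
qed

lemma invariant_projection_contK:
 assumes "linear P0"
 shows "contK (%k. rho (inv k) (P0 (rho k v)))"
 unfolding contK_def
proof
 fix k assume k: "k : K"
 show "((%k. rho (inv k) (P0 (rho k v))) ---> rho (inv k) (P0 (rho k v))) (nhdsin T k)"
  by (intro rep_tendsto2 K_inv k inv_lim filterlim_ident K_carrier
    bounded_linear.tendsto[OF fd_bounded_linear[OF fdv assms]] rep_tendsto)
qed

text \<open>Averaging a projection over its conjugates keeps the image V, because each conjugate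
  maps into V and is the identity there, and makes the projection equivariant by right invariance of
  the mean.\<close>

lemma invariant_projection:
 assumes V: "subspace V" "!!k v. k : K ==> v : V ==> rho k v : V"
  and P0: "linear P0" "range P0 \<subseteq> V" "!!v. v : V ==> P0 v = v"
 defines "P \<equiv> %v. vmean (%k. rho (inv k) (P0 (rho k v)))"
 shows "linear P" "range P \<subseteq> V" "v : V ==> P v = v" "l : K ==> P (rho l v) = rho l (P v)"
proof -
 note c = invariant_projection_contK[OF P0(1)]
 show "linear P"
 proof (rule linearI)
  show "P (u + v) = P u + P v" for u v
   unfolding P_def vmean_add[OF fdv c c, symmetric]
   by (rule vmean_cong) (simp add: linear_add[OF rep_linear] linear_add[OF P0(1)] K_inv)
  show "P (t *. u) = t *. P u" for t u
   unfolding P_def vmean_scale[OF fdv c, symmetric]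
   by (rule vmean_cong) (simp add: linear_scale[OF rep_linear] linear_scale[OF P0(1)] K_inv)
 qed
 show "range P \<subseteq> V"
 proof
  fix x assume "x : range P"
  then obtain v where x: "x = P v" by auto
  have lin: "linear (%v. v - P0 v)" by (intro linear_compose_sub linear_ident P0)
  have "P v - P0 (P v) = vmean (%k. rho (inv k) (P0 (rho k v)) - P0 (rho (inv k) (P0 (rho k v))))"
   unfolding P_def by (rule vmean_linear[OF fdv fdv c lin])
  also have "... = vmean (%k. 0)"
  proof (rule vmean_cong)
   fix k assume k: "k : K"
   have "P0 (rho k v) : V" using P0(2) by blast
   then have "rho (inv k) (P0 (rho k v)) : V" by (rule V(2)[OF K_inv[OF k]])
   then show "rho (inv k) (P0 (rho k v)) - P0 (rho (inv k) (P0 (rho k v))) = 0" by (simp add: P0(3))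
  qed
  also have "... = 0" by (rule vmean_const[OF fdv])
  finally have "P v = P0 (P v)" by simp
  then show "x : V" unfolding x using P0(2) by (metis rangeI subsetD)
 qed
 show "P v = v" if "v : V"
 proof -
  have "P v = vmean (%k. v)" unfolding P_def
   by (rule vmean_cong) (use V(2) that P0(3) rep_inv in auto)
  then show ?thesis using vmean_const[OF fdv] by metis
 qed
 show "P (rho l v) = rho l (P v)" if l: "l : K"
 proof -
  have il: "inv l : K" using K_inv l .
  have "P (rho l v) = vmean (%k. rho (inv (k ** inv l)) (P0 (rho (k ** inv l) (rho l v))))"
   unfolding P_def by (rule vmean_right[OF fdv c il, symmetric])
  also have "... = vmean (%k. rho l (rho (inv k) (P0 (rho k v))))"
  proof (rule vmean_cong)
   fix k assume k: "k : K"
   have "rho (k ** inv l) (rho l v) = rho k v" using rep_mult[OF k il] rep_inv(1)[OF l] by simp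
   moreover have "inv (k ** inv l) = l ** inv k" using k l K_carrier by (simp add: inv_mult_group)
   ultimately show "rho (inv (k ** inv l)) (P0 (rho (k ** inv l) (rho l v))) = rho l (rho (inv k) (P0 (rho k v)))"
    using rep_mult[OF l K_inv[OF k]] by simp
  qed
  also have "... = rho l (P v)"
   unfolding P_def by (rule vmean_linear[OF fdv fdv c rep_linear[OF l], symmetric])
  finally show ?thesis .
 qed
qed

text \<open>The invariant complement is the kernel of P, which is more convenient to carry around as
  an equivariant projection.\<close>

lemma invariant_complement:
 assumes V: "subspace V" "!!k v. k : K ==> v : V ==> rho k v : V"
 obtains P where "linear P" "range P \<subseteq> V" "!!v. v : V ==> P v = v" "!!l v. l : K ==> P (rho l v) = rho l (P v)"
proof -
 obtain P0 where P0: "linear P0" "range P0 \<subseteq> V" "!!v. v : V ==> P0 v = v"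
  by (rule exists_projection[OF V(1) subspace_single_0]) (auto intro: that)
 show ?thesis
  by (rule that[OF invariant_projection(1)[OF V P0] invariant_projection(2)[OF V P0]
     invariant_projection(3)[OF V P0] invariant_projection(4)[OF V P0]])
qed

text \<open>The inner product for which the fixed basis is orthonormal; its average is the invariant
  inner product \<open>inv_form\<close>.\<close>

definition basis_form :: "'v => 'v => real" where
 "basis_form u v = (\<Sum>b\<in>some_basis. representation some_basis u b * representation some_basis v b)"

definition inv_form :: "'v => 'v => real" where
 "inv_form u v = mean (%k. basis_form (rho k u) (rho k v))"

lemma basis_form_linear: "linear (%u. basis_form u v)"
proof (rule linearI)
 note l = linear_rep[OF some_basis[OF fdv]]
 show "basis_form (u + u') v = basis_form u v + basis_form u' v" for u u'
  by (simp add: basis_form_def linear_add[OF l] distrib_right sum.distrib)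
 show "basis_form (t *. u) v = t *. basis_form u v" for t u
  by (simp add: basis_form_def linear_scale[OF l] sum_distrib_left mult_ac)
qed

lemma basis_form_sym: "basis_form u v = basis_form v u"
 by (simp add: basis_form_def mult.commute)

lemma basis_form_pos: "u ~= 0 ==> basis_form u u > 0"
proof -
 assume u: "u ~= 0"
 have B: "basis_of (some_basis :: 'v set)" by (rule some_basis[OF fdv])
 then have fin: "finite (some_basis :: 'v set)" by (simp add: basis_of_def)
 have "EX b:some_basis. representation some_basis u b ~= 0"
 proof (rule ccontr)
  assume "\<not> ?thesis"
  then have "(\<Sum>b\<in>some_basis. representation some_basis u b *. b) = 0" by (intro sum.neutral) auto
  then show False using basis_sum[OF B, of u] u by simp
 qed
 then obtain b where b: "b : some_basis" "representation some_basis u b ~= 0" by blast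
 then have "0 < representation some_basis u b * representation some_basis u b"
  by (auto simp: zero_less_mult_iff linorder_neq_iff)
 then show ?thesis unfolding basis_form_def by (intro sum_pos2[OF fin b(1)]) auto
qed

lemma basis_form_nonneg: "basis_form u u \<ge> 0"
 by (simp add: basis_form_def sum_nonneg)

lemma inv_form_contK: "contK (%k. basis_form (rho k u) (rho k v))"
 unfolding contK_def basis_form_def
 by (intro ballI tendsto_sum tendsto_mult bounded_linear.tendsto[OF fd_bounded_linear[OF fdv linear_rep[OF some_basis[OF fdv]]]] rep_tendsto)

lemma inv_form_linear: "linear (%u. inv_form u v)"
proof (rule linearI)
 note l = basis_form_linear
 show "inv_form (u + u') v = inv_form u v + inv_form u' v" for u u'
  unfolding inv_form_def mean_add[OF inv_form_contK inv_form_contK, symmetric]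
  by (rule mean_cong) (simp add: linear_add[OF rep_linear] linear_add[OF l])
 show "inv_form (t *. u) v = t *. inv_form u v" for t u
  unfolding inv_form_def real_scaleR_def mean_scale[OF inv_form_contK, symmetric]
  by (rule mean_cong) (simp add: linear_scale[OF rep_linear] linear_scale[OF l])
qed

lemma inv_form_sym: "inv_form u v = inv_form v u"
 unfolding inv_form_def by (simp add: basis_form_sym)

lemma inv_form_pos:
 assumes "u ~= 0" shows "inv_form u u > 0"
 unfolding inv_form_def
 by (rule mean_pos[OF inv_form_contK basis_form_nonneg K_one]) (simp add: rep_one basis_form_pos assms)

lemma inv_form_invariant:
 assumes l: "l : K" shows "inv_form (rho l u) (rho l v) = inv_form u v"
proof -
 have "inv_form (rho l u) (rho l v) = mean (%k. basis_form (rho (k ** l) u) (rho (k ** l) v))"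
  unfolding inv_form_def by (rule mean_cong) (simp add: rep_mult l)
 also have "... = inv_form u v" unfolding inv_form_def by (rule mean_right[OF inv_form_contK l])
 finally show ?thesis .
qed

text \<open>An equivariant substitute for the gradient of a functional: f takes on it the sum over
  the basis of the means of the squares of f (rho k b). This is positive unless f vanishes, and
  continuity in f is inherited from \<open>vmean_tendsto\<close>.\<close>

definition dual_vec :: "('v => real) => 'v" where
 "dual_vec f = (\<Sum>b\<in>some_basis. vmean (%k. f (rho k b) *. rho k b))"

lemma dual_vec_contK:
 assumes f: "linear f"
 shows "contK (%k. f (rho k b) *. rho k b)"
 unfolding contK_def
 by (intro ballI tendsto_scaleR bounded_linear.tendsto[OF fd_bounded_linear[OF fdv f]] rep_tendsto)

lemma dual_vec_value:
 assumes f: "linear f"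
 shows "f (dual_vec f) = (\<Sum>b\<in>some_basis. mean (%k. (f (rho k b))\<^sup>2))"
 unfolding dual_vec_def linear_sum[OF f] mean_linear_sum[OF fdv dual_vec_contK[OF f] f]
 by (simp add: linear_scale[OF f] power2_eq_square)

lemma dual_vec_sq_contK:
 assumes f: "linear (f :: 'v => real)"
 shows "contK (%k. (f (rho k b))\<^sup>2)"
 unfolding contK_def power2_eq_square
 by (intro ballI tendsto_mult bounded_linear.tendsto[OF fd_bounded_linear[OF fdv f]] rep_tendsto)

lemma dual_vec_pos:
 assumes f: "linear f" and v: "f v ~= 0"
 shows "f (dual_vec f) > 0"
proof -
 have B: "basis_of (some_basis :: 'v set)" by (rule some_basis[OF fdv])
 then have fin: "finite (some_basis :: 'v set)" by (simp add: basis_of_def)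
 have "EX b:some_basis. f b ~= 0"
 proof (rule ccontr)
  assume "\<not> ?thesis"
  then have "f v = 0" by (subst linear_basis_sum[OF B f]) simp
  then show False using v by simp
 qed
 then obtain b where b: "b : some_basis" "f b ~= 0" by blast
 have "0 < mean (%k. (f (rho k b))\<^sup>2)"
  by (rule mean_pos[OF dual_vec_sq_contK[OF f] _ K_one]) (auto simp: rep_one b)
 then show ?thesis unfolding dual_vec_value[OF f]
  by (intro sum_pos2[OF fin b(1)] mean_nonneg dual_vec_sq_contK f) auto
qed

lemma dual_vec_equivariant:
 assumes f: "linear f" and p: "p : K"
 shows "dual_vec (%v. f (rho p v)) = rho (inv p) (dual_vec f)"
proof -
 have ip: "inv p : K" using K_inv p .
 have fp: "linear (%v. f (rho p v))" using linear_compose[OF rep_linear[OF p] f] by (simp add: comp_def)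
 have "vmean (%k. f (rho p (rho k b)) *. rho k b) = rho (inv p) (vmean (%k. f (rho k b) *. rho k b))" for b
 proof -
  have "vmean (%k. f (rho p (rho k b)) *. rho k b) = vmean (%k. f (rho p (rho (inv p ** k) b)) *. rho (inv p ** k) b)"
   by (rule vmean_left[OF fdv dual_vec_contK[OF fp] ip, symmetric])
  also have "... = vmean (%k. rho (inv p) (f (rho k b) *. rho k b))"
   by (rule vmean_cong) (simp add: rep_mult[OF ip] rep_inv(2)[OF p] linear_scale[OF rep_linear[OF ip]])
  also have "... = rho (inv p) (vmean (%k. f (rho k b) *. rho k b))"
   by (rule vmean_linear[OF fdv fdv dual_vec_contK[OF f] rep_linear[OF ip], symmetric])
  finally show ?thesis .
 qed
 then show ?thesis unfolding dual_vec_def linear_sum[OF rep_linear[OF ip]] by simp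
qed

lemma dual_vec_tendsto:
 assumes f: "eventually (%z. linear (f z)) F" "linear f0" and lim: "!!v. ((%z. f z v) ---> f0 v) F"
 shows "((%z. dual_vec (f z)) ---> dual_vec f0) F"
 unfolding dual_vec_def
proof (intro tendsto_sum vmean_tendsto[OF fdv _ dual_vec_contK[OF f(2)]])
 fix b :: 'v
 show "eventually (%z. contK (%k. f z (rho k b) *. rho k b)) F"
  using f(1) by (rule eventually_mono) (rule dual_vec_contK)
 fix k assume k: "k : K"
 have fs: "filterlim fst (nhdsin T k) (nhdsin T k \<times>\<^sub>F F)" by (rule filterlim_fst)
 have r: "((%x. rho (fst x) b) ---> rho k b) (nhdsin T k \<times>\<^sub>F F)"
  by (rule filterlim_compose[OF rep_tendsto[OF k] fs])
 have "((%x. f (snd x) (rho (fst x) b)) ---> f0 (rho k b)) (nhdsin T k \<times>\<^sub>F F)"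
 proof (rule lin_family_tendsto[OF fdv _ f(2) _ r])
  show "eventually (%z. linear (f (snd z))) (nhdsin T k \<times>\<^sub>F F)"
   by (rule eventually_compose_filterlim[OF f(1) filterlim_snd])
  show "((%z. f (snd z) v) ---> f0 v) (nhdsin T k \<times>\<^sub>F F)" for v
   by (rule filterlim_compose[OF lim filterlim_snd])
 qed
 from tendsto_scaleR[OF this r]
 show "((%(x, z). f z (rho x b) *. rho x b) ---> f0 (rho k b) *. rho k b) (nhdsin T k \<times>\<^sub>F F)"
  by (simp add: case_prod_unfold)
qed

end

sublocale compact_subgrp \<subseteq> Adj: compact_rep G GM K Ad
proof
 show "findim TYPE('b)" by (rule fd)
 show "eventually (%z. linear (Ad z)) (nhdsin T k)" if "k : K" for k
  using ev_topspace[of T k] by (rule eventually_mono) (simp add: Ad_linear)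
 show "((%z. Ad z v) ---> Ad k v) (nhdsin T k)" if "k : K" for k v
  by (rule Ad_tendsto[OF K_carrier[OF that]])
 show "Ad (k ** l) v = Ad k (Ad l v)" if "k : K" "l : K" for k l v
  using that K_carrier by (intro Ad_mult) auto
 show "Ad \<one> v = v" for v by (rule Ad_one)
qed


section \<open>Tubes around orbits of a closed subgroup\<close>

text \<open>Since f is close to the identity, x - (f x - z) is a contraction with factor 1/2, and a
  target within s / 2 of f x0 keeps the ball of radius s invariant. This one lemma serves both for
  local coordinates on the group and for solving the critical point equation.\<close>

lemma strict_identity_open:
 fixes f :: "'a::real_normed_vector => 'a"
 assumes fd: "findim TYPE('a)" and s: "s > 0" "cball x0 s \<subseteq> S"
  and f: "!!x y. x : S ==> y : S ==> norm (f x - f y - (x - y)) \<le> norm (x - y) / 2"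
  and z: "norm (z - f x0) \<le> s / 2"
 obtains x where "x : cball x0 s" "f x = z"
proof -
 let ?T = "%x. x - (f x - z)"
 have c: "complete (cball x0 s)" using compact_cball_fd[OF fd] compact_imp_complete by blast
 have con: "dist (?T x) (?T y) \<le> (1/2) * dist x y" if "x : cball x0 s" "y : cball x0 s" for x y
 proof -
  have "?T x - ?T y = - (f x - f y - (x - y))" by simp
  then have "norm (?T x - ?T y) = norm (f x - f y - (x - y))" by (metis norm_minus_cancel)
  moreover have "x : S" "y : S" using that s(2) by blast+
  ultimately show ?thesis using f[of x y] unfolding dist_norm by simp
 qed
 have self: "?T ` cball x0 s \<subseteq> cball x0 s"
 proof
  fix w assume "w : ?T ` cball x0 s"
  then obtain x where x: "x : cball x0 s" "w = ?T x" by auto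
  have x0: "x0 : cball x0 s" using s(1) by simp
  have "dist (?T x) (?T x0) \<le> (1/2) * s" using con[OF x(1) x0] x(1) by (simp add: dist_commute)
  moreover have "dist (?T x0) x0 \<le> s / 2" using z by (simp add: dist_norm norm_minus_commute)
  ultimately have "dist (?T x) x0 \<le> s" using dist_triangle[of "?T x" x0 "?T x0"] by linarith
  then show "w : cball x0 s" using x(2) by (simp add: dist_commute)
 qed
 have ne: "cball x0 s ~= {}" using s(1) by simp
 have "EX! x:cball x0 s. ?T x = x"
  by (rule Banach_fix[OF c ne _ _ self con]) auto
 then obtain x where "x : cball x0 s" "?T x = x" by blast
 then show ?thesis using that[of x] by simp
qed

section \<open>Closed subgroups near the identity\<close>

context lie_grp
begin

text \<open>Germs at 0 of maps into the group with value the identity and strict derivative L.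
  Products of such germs add their derivatives, so product coordinates need no further
  computation.\<close>

definition strict0 :: "('z::real_normed_vector => 'g) => ('z => 'f) => bool" where
 "strict0 \<Psi> L \<longleftrightarrow> \<Psi> 0 = \<one> & eventually (%x. \<Psi> x : U0) (nhds 0) & strict_deriv (%x. kap (\<Psi> x)) L 0"

lemma strict0E:
 assumes "strict0 \<Psi> L" "e > 0"
 obtains r where "r > 0" "!!x. norm x < r ==> \<Psi> x : U0"
  "!!x y. norm x < r ==> norm y < r ==> norm (kap (\<Psi> x) - kap (\<Psi> y) - L (x - y)) \<le> e * norm (x - y)"
proof -
 have "eventually (%x. \<Psi> x : U0) (nhds 0)" using assms by (simp add: strict0_def)
 then obtain s where s: "s > 0" "!!x. dist x 0 < s ==> \<Psi> x : U0" unfolding eventually_nhds_metric by auto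
 have "strict_deriv (%x. kap (\<Psi> x)) L 0" using assms by (simp add: strict0_def)
 then obtain r where r: "r > 0"
  "!!x y. dist 0 x < r ==> dist 0 y < r ==> norm (kap (\<Psi> x) - kap (\<Psi> y) - L (x - y)) \<le> e * norm (x - y)"
  by (rule strict_derivE[OF _ assms(2)]) (rule that)
 show ?thesis by (rule that[of "min r s"]) (use r s in auto)
qed

lemma strict0_tendsto:
 assumes "strict0 \<Psi> L"
 shows "((%x. kap (\<Psi> x)) ---> 0) (nhds 0)"
proof -
 have "continuous (at 0) (%x. kap (\<Psi> x))"
  using assms has_derivative_continuous[OF strict_has_deriv] unfolding strict0_def by blast
 then have "((%x. kap (\<Psi> x)) ---> kap (\<Psi> 0)) (nhds 0)"
  using tendsto_at_iff_tendsto_nhds[of "%x. kap (\<Psi> x)" 0] by (simp add: continuous_at)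
 then show ?thesis using assms by (simp add: strict0_def)
qed

lemma strict0_Exp:
 fixes L :: "'z::real_normed_vector => 'f"
 assumes "bounded_linear L"
 shows "strict0 (%x. Exp (L x)) L"
proof -
 have L0: "L 0 = 0" using linear_0[OF bounded_linear.linear[OF assms]] .
 have "((%x. norm (L x)) ---> norm (L 0)) (nhds 0)"
  by (intro tendsto_norm bounded_linear.tendsto[OF assms] filterlim_ident)
 then have "eventually (%x. norm (L x) < del / 2) (nhds 0)" by (rule order_tendstoD(2)) (use del(1) L0 in simp)
 then have "eventually (%x. Exp (L x) : U0) (nhds 0)" by eventually_elim (rule Exp_small)
 moreover have "strict_deriv (%x. kap (Exp (L x))) L 0"
  by (rule strict_deriv_compose[OF strict_deriv_linear[OF assms]]) (use Exp_strict L0 in simp)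
 ultimately show ?thesis using L0 by (simp add: strict0_def)
qed

lemma strict0_mult:
 fixes L L' :: "'z::real_normed_vector => 'f"
 assumes \<Psi>: "strict0 \<Psi> L" and \<Phi>: "strict0 \<Phi> L'"
 shows "strict0 (%x. \<Psi> x ** \<Phi> x) (%x. L x + L' x)"
proof -
 let ?f = "%(x, y). kap (kinv x ** kinv y)"
 have U: "eventually (%x. \<Psi> x : U0 & \<Phi> x : U0) (nhds 0)"
  using \<Psi> \<Phi> by (auto simp: strict0_def eventually_conj_iff)
 have "((%x. (kap (\<Psi> x), kap (\<Phi> x))) ---> (0, 0)) (nhds 0)"
  by (intro tendsto_Pair strict0_tendsto[OF \<Psi>] strict0_tendsto[OF \<Phi>])
 from topological_tendstoD[OF this mdom_open zero_mdom] U
 have "eventually (%x. \<Psi> x ** \<Phi> x : U0) (nhds 0)"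
  by eventually_elim (auto simp: mdom_def kinv_kap)
 moreover have "strict_deriv (%x. kap (\<Psi> x ** \<Phi> x)) (%x. L x + L' x) 0"
 proof (rule strict_deriv_cong)
  have "strict_deriv (%x. (kap (\<Psi> x), kap (\<Phi> x))) (%v. (L v, L' v)) 0"
   by (rule strict_deriv_Pair) (use \<Psi> \<Phi> in \<open>auto simp: strict0_def\<close>)
  from strict_deriv_compose[OF this, of ?f "%(v, w). v + w"] mult_strict \<Psi> \<Phi>
  show "strict_deriv (%x. ?f (kap (\<Psi> x), kap (\<Phi> x))) (%x. L x + L' x) 0" by (simp add: strict0_def)
  show "eventually (%x. ?f (kap (\<Psi> x), kap (\<Phi> x)) = kap (\<Psi> x ** \<Phi> x)) (nhds 0)"
   using U by eventually_elim (simp add: kinv_kap)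
 qed
 ultimately show ?thesis using \<Psi> \<Phi> by (simp add: strict0_def)
qed

lemma strict0_local_homeo:
 fixes \<Psi> :: "'f => 'g"
 assumes "strict0 \<Psi> (%x. x)"
 obtains r where "r > 0" "!!x y. norm x < r ==> norm y < r ==> \<Psi> x = \<Psi> y ==> x = y"
  "!!x0 s. norm x0 < r ==> s > 0 ==> eventually (%g. EX x:ball x0 s. norm x < r & g = \<Psi> x) (nhdsin T (\<Psi> x0))"
proof -
 obtain r where r: "r > 0" "!!x. norm x < r ==> \<Psi> x : U0"
  "!!x y. norm x < r ==> norm y < r ==> norm (kap (\<Psi> x) - kap (\<Psi> y) - (x - y)) \<le> 1/2 * norm (x - y)"
  by (rule strict0E[OF assms, of "1/2"]) (auto intro: that)
 have f: "norm (kap (\<Psi> x) - kap (\<Psi> y) - (x - y)) \<le> norm (x - y) / 2" if "x : ball 0 r" "y : ball 0 r" for x y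
  using r(3)[of x y] that by simp
 have inj: "x = y" if "norm x < r" "norm y < r" "\<Psi> x = \<Psi> y" for x y
 proof -
  have "norm (x - y) \<le> 1/2 * norm (x - y)" using r(3)[OF that(1,2)] that(3) by (simp add: norm_minus_commute)
  then show ?thesis by simp
 qed
 have op: "eventually (%g. EX x:ball x0 s. norm x < r & g = \<Psi> x) (nhdsin T (\<Psi> x0))"
  if x0: "norm x0 < r" and s: "s > 0" for x0 s
 proof -
  \<comment> \<open>The halves make both bounds strict: the closed ball of radius s' lies in the
    open ball of radius s and inside the domain of radius r.\<close>
  define s' where "s' = min (s / 2) ((r - norm x0) / 2)"
  have "s' \<le> (r - norm x0) / 2" unfolding s'_def by (rule min.cobounded2)
  moreover have "s' \<le> s / 2" unfolding s'_def by (rule min.cobounded1)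
  moreover have "s' > 0" using x0 s by (auto simp: s'_def)
  moreover have "r - norm x0 > 0" using x0 by simp
  ultimately have s': "s' > 0" "s' < s" "s' < r - norm x0" using s by auto
  have sub: "cball x0 s' \<subseteq> ball 0 r"
  proof
   fix y assume "y : cball x0 s'"
   then have "norm (y - x0) \<le> s'" by (simp add: dist_norm norm_minus_commute)
   then show "y : ball 0 r" using s' norm_triangle_sub[of y x0] by simp
  qed
  have U: "\<Psi> x0 : U0" by (rule r(2)[OF x0])
  have "eventually (%g. dist (kap g) (kap (\<Psi> x0)) < s' / 2) (nhdsin T (\<Psi> x0))"
   by (rule tendstoD[OF kap_tendsto[OF U]]) (use s' in simp)
  with ev_nhdsin[OF U0_open U] show ?thesis
  proof eventually_elim
   case (elim g)
   obtain x where x: "x : cball x0 s'" "kap (\<Psi> x) = kap g"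
    by (rule strict_identity_open[OF fd s'(1) sub f, of "kap g"])
     (use elim in \<open>auto simp: dist_norm intro: that\<close>)
   have xr: "norm x < r" using x(1) sub by auto
   have "g = \<Psi> x" using x(2) kinv_kap[OF elim(1)] kinv_kap[OF r(2)[OF xr]] by metis
   moreover have "x : ball x0 s" using x(1) s' by auto
   ultimately show ?case using xr by blast
  qed
 qed
 show ?thesis by (rule that[OF r(1) inj op])
qed

definition lie_alg :: "'g set => 'f set" where
 "lie_alg S = {v. ALL t. Exp (t *. v) : S}"

lemma closed_limit:
 assumes "closedin T S" "filterlim f (nhdsin T a) F" "F ~= bot" "eventually (%x. f x : S) F" "a : CG"
 shows "a : S"
proof (rule ccontr)
 assume "a \<notin> S"
 then have "a : topspace T - S" using assms(5) by simp
 moreover have "openin T (topspace T - S)" using assms(1) by (simp add: closedin_def)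
 ultimately have "eventually (%x. x : topspace T - S) (nhdsin T a)" by (intro ev_nhdsin)
 from eventually_compose_filterlim[OF this assms(2)] assms(4)
 have "eventually (%x. False) F" by eventually_elim auto
 then show False using assms(3) by simp
qed

lemma subgroup_pow: "subgroup S G ==> a : S ==> a [^] (n::nat) : S"
 by (induction n) (auto simp: subgroup.one_closed subgroup.m_closed)

context
 fixes S
 assumes S: "subgroup S G" "closedin T S"
begin

text \<open>Closure under sums is the Lie product formula: powers of Exp (v / n) ** Exp (w / n) stay
  in S and converge to Exp (v + w), and S is closed.\<close>

lemma lie_alg_subspace: "subspace (lie_alg S)"
proof (rule subspaceI)
 show "0 : lie_alg S" using subgroup.one_closed[OF S(1)] by (simp add: lie_alg_def)
 show "c *. v : lie_alg S" if "v : lie_alg S" for c v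
  using that by (simp add: lie_alg_def)
 show "v + w : lie_alg S" if vw: "v : lie_alg S" "w : lie_alg S" for v w
 proof -
  have "Exp (t *. (v + w)) : S" for t
  proof -
   let ?\<Psi> = "%s::real. Exp (s *. (t *. v)) ** Exp (s *. (t *. w))"
   have "strict0 ?\<Psi> (%s. s *. (t *. v) + s *. (t *. w))"
    by (intro strict0_mult strict0_Exp bounded_linear_scaleR_left)
   then have st: "strict0 ?\<Psi> (%s. s *. (t *. (v + w)))" by (simp add: scaleR_add_right)
   let ?s = "%n. 1 / real (Suc n)"
   have s0: "?s ----> 0" using LIMSEQ_inverse_real_of_nat by (simp add: inverse_eq_divide)
   have "((%s. kap (?\<Psi> s)) has_vector_derivative t *. (v + w)) (at 0)"
    unfolding has_vector_derivative_def
    by (rule strict_has_deriv) (use st in \<open>simp only: strict0_def\<close>)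
   then have q: "((%h. (1 / h) *. kap (?\<Psi> h)) ---> t *. (v + w)) (at 0)"
    by (rule quotient_tendsto) simp
   have "filterlim ?s (at 0) sequentially" unfolding filterlim_at using s0 by auto
   from filterlim_compose[OF q this]
   have lim: "(%n. real (Suc n) *. kap (?\<Psi> (?s n))) ----> t *. (v + w)" by (simp del: of_nat_Suc)
   have "eventually (%s. ?\<Psi> s : U0) (nhds 0)" using st unfolding strict0_def by (elim conjE)
   from eventually_compose_filterlim[OF this s0]
   have ev: "eventually (%n. ?\<Psi> (?s n) : U0) sequentially" .
   have "?\<Psi> s : S" for s
    using vw subgroup.m_closed[OF S(1)] by (simp add: lie_alg_def)
   then have "eventually (%n. ?\<Psi> (?s n) [^] Suc n : S) sequentially"
    by (intro always_eventually allI subgroup_pow[OF S(1)])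
   then show ?thesis
    by (rule closed_limit[OF S(2) pow_limit[OF filterlim_Suc ev lim] sequentially_bot]) simp
  qed
  then show ?thesis by (simp add: lie_alg_def)
 qed
qed

lemma lie_alg_Ad: "s : S ==> v : lie_alg S ==> Ad s v : lie_alg S"
proof -
 assume s: "s : S" and v: "v : lie_alg S"
 then have sG: "s : CG" using subgroup.subset[OF S(1)] by blast
 have "Exp (t *. Ad s v) = s ** Exp (t *. v) ** inv s" for t
  by (simp add: Exp_conj[OF sG] linear_scale[OF Ad_linear[OF sG]])
 then show ?thesis using v s subgroup.m_closed[OF S(1)] subgroup.m_inv_closed[OF S(1)]
  by (simp add: lie_alg_def)
qed

text \<open>The limit direction argument for closed subgroups. If small nonzero v in the kernel of q
  had exponentials in S, a limit l of their directions would have norm 1 and lie in the kernel.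
  Every Exp (t *. l) with t \<ge> 0 is a limit of powers of these elements, and negative t follow by
  inversion, so l belongs to the Lie algebra, contradicting transversality.\<close>

lemma lie_alg_transverse:
 assumes q: "linear (q :: 'f => 'f)" and tr: "!!v. v : lie_alg S ==> q v = 0 ==> v = 0"
 obtains e where "e > 0" "!!v. q v = 0 ==> norm v < e ==> Exp v : S ==> v = 0"
proof -
 have "EX e>0. ALL v. q v = 0 --> norm v < e --> Exp v : S --> v = 0"
 proof (rule ccontr)
  assume neg: "\<not> ?thesis"
  have "EX v. q v = 0 & norm v < 1 / real (Suc n) & Exp v : S & v ~= 0" for n
  proof -
   have "1 / real (Suc n) > 0" by simp
   then show ?thesis using neg by blast
  qed
  then obtain x where x: "!!n. q (x n) = 0" "!!n. norm (x n) < 1 / real (Suc n)" "!!n. Exp (x n) : S" "!!n. x n ~= 0"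
   by metis
  define u where "u n = (1 / norm (x n)) *. x n" for n
  have un: "norm (u n) = 1" for n using x(4)[of n] by (simp add: u_def)
  have "compact (cball 0 1 :: 'f set)" by (rule compact_cball_fd[OF fd])
  moreover have "ALL n. u n : cball 0 1" using un by simp
  ultimately obtain l p where p: "strict_mono (p :: nat => nat)" and l: "(u o p) ----> l"
   unfolding compact_eq_seq_compact_metric seq_compact_def by blast
  have "(%n. norm ((u o p) n)) ----> norm l" by (rule tendsto_norm[OF l])
  then have nl: "norm l = 1" using un LIMSEQ_unique[OF _ tendsto_const[of 1]] by (simp add: comp_def LIMSEQ_const_iff)
  have "(%n. q ((u o p) n)) ----> q l"
   by (rule bounded_linear.tendsto[OF fd_bounded_linear[OF fd q] l])
  moreover have "q ((u o p) n) = 0" for n using x(1) by (simp add: u_def linear_scale[OF q])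
  ultimately have ql: "q l = 0" by (simp add: LIMSEQ_const_iff)
  have xn0: "(%n. norm (x (p n))) ----> 0"
  proof (rule Lim_null_comparison)
   have "norm (norm (x (p n))) \<le> inverse (real (Suc n))" for n
   proof -
    have "1 / real (Suc (p n)) \<le> 1 / real (Suc n)" using seq_suble[OF p, of n] by (intro divide_left_mono) auto
    then show ?thesis using x(2)[of "p n"] by (simp add: inverse_eq_divide)
   qed
   then show "eventually (%n. norm (norm (x (p n))) \<le> inverse (real (Suc n))) sequentially" by simp
  qed (rule LIMSEQ_inverse_real_of_nat)
  have pos: "Exp (t *. l) : S" if t: "t \<ge> 0" for t
  proof -
   \<comment> \<open>As many steps of length norm (x (p n)) as fit into t; the remaining length is
     below one step and tends to 0.\<close>
   define k where "k n = nat \<lfloor>t / norm (x (p n))\<rfloor>" for n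
   have "(%n. real (k n) * norm (x (p n)) - t) ----> 0"
   proof (rule Lim_null_comparison[OF _ xn0], intro always_eventually allI)
    fix n
    let ?c = "norm (x (p n))"
    have c: "?c > 0" using x(4) by simp
    have "real (k n) = of_int \<lfloor>t / ?c\<rfloor>" using t c by (simp add: k_def)
    moreover have "t / ?c - 1 \<le> of_int \<lfloor>t / ?c\<rfloor>" "of_int \<lfloor>t / ?c\<rfloor> \<le> t / ?c" by linarith+
    ultimately have "t / ?c - 1 \<le> real (k n)" "real (k n) \<le> t / ?c" by auto
    then have "t - ?c \<le> real (k n) * ?c" "real (k n) * ?c \<le> t" using c by (simp_all add: field_simps)
    then show "norm (real (k n) * ?c - t) \<le> ?c" by simp
   qed
   then have kt: "(%n. real (k n) * norm (x (p n))) ----> t" using Lim_null by blast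
   have "(%n. (real (k n) * norm (x (p n))) *. u (p n)) ----> t *. l"
    using tendsto_scaleR[OF kt l] by (simp add: comp_def)
   then have "(%n. real (k n) *. x (p n)) ----> t *. l" using x(4) by (simp add: u_def)
   from Exp_lim[OF this] have "filterlim (%n. Exp (x (p n)) [^] k n) (nhdsin T (Exp (t *. l))) sequentially"
    by (simp only: Exp_pow)
   then show ?thesis
    by (rule closed_limit[OF S(2) _ sequentially_bot]) (use subgroup_pow[OF S(1) x(3)] in auto)
  qed
  have "Exp (t *. l) : S" for t
  proof (cases "t \<ge> 0")
   case False
   then have "inv (Exp ((- t) *. l)) : S" using pos[of "- t"] subgroup.m_inv_closed[OF S(1)] by simp
   then show ?thesis using Exp_minus[of "(- t) *. l"] by simp
  qed (rule pos)
  then have "l : lie_alg S" by (simp add: lie_alg_def)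
  then have "l = 0" using tr ql by blast
  then show False using nl by simp
 qed
 then show ?thesis using that by blast
qed

text \<open>Near the identity a closed subgroup is the image of its Lie algebra under the exponential
 map; the factorization through \<open>\<sigma>\<close> allows the Lie algebra to be split into two summands.\<close>

lemma closed_subgroup_local:
 assumes p: "linear p" "range p \<subseteq> lie_alg S" "!!v. v : lie_alg S ==> p v = v"
  and \<sigma>: "linear \<sigma>" "!!v. v : lie_alg S ==> \<sigma> v : lie_alg S" and d: "d > 0"
 shows "eventually (%g. g : S --> (EX v:lie_alg S. norm v < d & norm (\<sigma> v) < d & norm (v - \<sigma> v) < d &
  g = Exp (\<sigma> v) ** Exp (v - \<sigma> v))) (nhdsin T \<one>)"
proof -
 let ?\<sigma> = "%x. \<sigma> (p x)" and ?\<tau> = "%x. p x - \<sigma> (p x)" and ?q = "%x. x - p x"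
 \<comment> \<open>Local coordinates with derivative the identity: two factors in S and one
   transverse factor. For an element of S the transverse factor lies in S as well and is trivial by
   \<open>lie_alg_transverse\<close>.\<close>
 let ?\<Psi> = "%x. Exp (?\<sigma> x) ** Exp (?\<tau> x) ** Exp (?q x)"
 have l\<sigma>: "linear ?\<sigma>" using linear_compose[OF p(1) \<sigma>(1)] by (simp add: comp_def)
 have l\<tau>: "linear ?\<tau>" by (rule linear_compose_sub[OF p(1) l\<sigma>])
 have lq: "linear ?q" by (rule linear_compose_sub[OF linear_ident p(1)])
 note bl = fd_bounded_linear[OF fd]
 have "strict0 ?\<Psi> (%x. (?\<sigma> x + ?\<tau> x) + ?q x)"
  by (intro strict0_mult strict0_Exp bl l\<sigma> l\<tau> lq)
 then have st: "strict0 ?\<Psi> (%x. x)" by simp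
 obtain r where r: "r > 0"
  "!!x0 s. norm x0 < r ==> s > 0 ==> eventually (%g. EX x:ball x0 s. norm x < r & g = ?\<Psi> x) (nhdsin T (?\<Psi> x0))"
  by (rule strict0_local_homeo[OF st]) (rule that)
 have tr: "v = 0" if "v : lie_alg S" "p v = 0" for v using p(3)[OF that(1)] that(2) by simp
 obtain e where e: "e > 0" "!!v. p v = 0 ==> norm v < e ==> Exp v : S ==> v = 0"
  by (rule lie_alg_transverse[OF p(1)]) (rule tr, assumption+, rule that)
 have small: "EX s>0. ALL x. norm x < s --> norm (f x) < c" if lf: "linear f" and c: "c > 0" for f :: "'f => 'f" and c
 proof -
  obtain K where K: "K > 0" "!!x. norm (f x) \<le> norm x * K" using bounded_linear.pos_bounded[OF bl[OF lf]] by blast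
  have "norm (f x) < c" if "norm x < c / K" for x
   using K(2)[of x] that K(1) by (simp add: field_simps)
  then show ?thesis using K c by (intro exI[of _ "c / K"]) auto
 qed
 obtain s1 where s1: "s1 > 0" "!!x. norm x < s1 ==> norm (p x) < d" using small[OF p(1) d] by blast
 obtain s2 where s2: "s2 > 0" "!!x. norm x < s2 ==> norm (?\<sigma> x) < d" using small[OF l\<sigma> d] by blast
 obtain s3 where s3: "s3 > 0" "!!x. norm x < s3 ==> norm (?\<tau> x) < d" using small[OF l\<tau> d] by blast
 obtain s4 where s4: "s4 > 0" "!!x. norm x < s4 ==> norm (?q x) < e" using small[OF lq e(1)] by blast
 define s where "s = Min {s1, s2, s3, s4}"
 have s: "s > 0" "s \<le> s1" "s \<le> s2" "s \<le> s3" "s \<le> s4" using s1 s2 s3 s4 by (auto simp: s_def)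
 have "?\<Psi> 0 = \<one>" using st by (simp add: strict0_def)
 moreover have "eventually (%g. EX x:ball 0 s. norm x < r & g = ?\<Psi> x) (nhdsin T (?\<Psi> 0))"
  by (rule r(2)) (use r s in auto)
 ultimately have "eventually (%g. EX x:ball 0 s. norm x < r & g = ?\<Psi> x) (nhdsin T \<one>)" by simp
 then show ?thesis
 proof (rule eventually_mono, intro impI)
  fix g assume "EX x:ball 0 s. norm x < r & g = ?\<Psi> x" and g: "g : S"
  then obtain x where x: "norm x < s" "g = ?\<Psi> x" by auto
  have px: "p x : lie_alg S" using p(2) by blast
  have in1: "Exp (?\<sigma> x) : S" using \<sigma>(2)[OF px] unfolding lie_alg_def by (metis (mono_tags) mem_Collect_eq scaleR_one)
  have "?\<tau> x : lie_alg S" by (rule subspace_diff[OF lie_alg_subspace px \<sigma>(2)[OF px]])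
  then have in2: "Exp (?\<tau> x) : S" unfolding lie_alg_def by (metis (mono_tags) mem_Collect_eq scaleR_one)
  have "inv (Exp (?\<sigma> x) ** Exp (?\<tau> x)) ** g : S"
   using in1 in2 g S(1) by (simp add: subgroup.m_closed subgroup.m_inv_closed)
  moreover have "inv (Exp (?\<sigma> x) ** Exp (?\<tau> x)) ** g = Exp (?q x)"
   unfolding x(2) by (subst m_assoc[symmetric]) simp_all
  ultimately have "Exp (?q x) : S" by simp
  moreover have pq: "p (?q x) = 0" using p(3)[OF px] by (simp add: linear_diff[OF p(1)])
  moreover have nq: "norm (?q x) < e" using s4(2)[of x] x(1) s by simp
  ultimately have "?q x = 0" using e(2)[OF pq nq] by simp
  then have "g = Exp (?\<sigma> x) ** Exp (?\<tau> x)" unfolding x(2) by simp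
  then show "EX v:lie_alg S. norm v < d & norm (\<sigma> v) < d & norm (v - \<sigma> v) < d & g = Exp (\<sigma> v) ** Exp (v - \<sigma> v)"
   using px s1(2)[of x] s2(2)[of x] s3(2)[of x] x(1) s by (intro bexI[of _ "p x"]) auto
 qed
qed

end

end


lemma eventually_prodE:
 assumes "eventually P (F \<times>\<^sub>F G)"
 obtains Pf Pg where "eventually Pf F" "eventually Pg G" "!!x y. Pf x ==> Pg y ==> P (x, y)"
 using assms unfolding eventually_prod_filter by (elim exE conjE) (rule that, assumption, assumption, blast)

section \<open>A slice for the two-sided action of H and K\<close>

locale closed_pair = compact_subgrp +
 fixes H
 assumes H_subgroup: "subgroup H G" and H_closed: "closedin T H"
begin

lemma H_carrier: "a : H ==> a : CG"
 using subgroup.subset[OF H_subgroup] by blast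

lemma H_mult: "a : H ==> b : H ==> a ** b : H"
 by (rule subgroup.m_closed[OF H_subgroup])

lemma H_inv: "a : H ==> inv a : H"
 by (rule subgroup.m_inv_closed[OF H_subgroup])

lemma H_one: "\<one> : H"
 by (rule subgroup.one_closed[OF H_subgroup])

lemma K_closed: "closedin T K"
 by (rule compactin_imp_closedin[OF Hausdorff K_compact])

lemma inv_cancel:
 assumes "x : CG" "y : CG"
 shows "inv x ** (x ** y) = y" "x ** (inv x ** y) = y"
 using assms by (simp_all flip: m_assoc)

lemma lie_alg_Exp: "v : lie_alg S ==> Exp v : S"
 unfolding lie_alg_def by (metis (mono_tags) mem_Collect_eq scaleR_one)

text \<open>The Lie algebras of H and K may overlap, so their sum is written as that of H plus the
  kernel of pl in that of K. The kernel of P is the slice direction. Equivariance under H Int K is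
  obtained for P; \<pi>1 and \<pi>3 merely split the image of P.\<close>

lemma splitting:
 obtains P \<pi>1 \<pi>3 pl where "linear P" "!!v. P (P v) = P v" "!!l v. l : H Int K ==> P (Ad l v) = Ad l (P v)"
  "linear \<pi>1" "linear \<pi>3" "range \<pi>1 \<subseteq> lie_alg H" "range \<pi>3 \<subseteq> lie_alg K" "!!x. P x = \<pi>1 x + \<pi>3 x"
  "!!x. P x = 0 ==> \<pi>1 x = 0"
  "!!u. u : lie_alg H ==> P u = u & \<pi>1 u = u"
  "linear pl" "range pl \<subseteq> lie_alg H Int lie_alg K" "!!v. v : lie_alg K ==> P (v - pl v) = v - pl v & \<pi>1 (v - pl v) = 0"
proof -
 let ?h = "lie_alg H" and ?k = "lie_alg K"
 have sh: "subspace ?h" by (rule lie_alg_subspace[OF H_subgroup H_closed])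
 have sk: "subspace ?k" by (rule lie_alg_subspace[OF K_subgroup K_closed])
 define V where "V = {u + w |u w. u : ?h & w : ?k}"
 have sV: "subspace V" unfolding V_def by (rule subspace_sums[OF sh sk])
 have Lc: "compactin T (H Int K)" by (rule closed_Int_compactin[OF H_closed K_compact])
 interpret L: compact_subgrp G GM "H Int K" by unfold_locales (use H_carrier H_mult H_inv H_one K_mult K_inv K_one Lc in auto)
 have inv: "Ad l v : V" if l: "l : H Int K" and v: "v : V" for l v
 proof -
  obtain u w where uw: "u : ?h" "w : ?k" "v = u + w" using v by (auto simp: V_def)
  have "Ad l v = Ad l u + Ad l w" using linear_add[OF Ad_linear[OF K_carrier]] l uw(3) by simp
  moreover have "Ad l u : ?h" by (rule lie_alg_Ad[OF H_subgroup H_closed _ uw(1)]) (use l in simp)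
  moreover have "Ad l w : ?k" by (rule lie_alg_Ad[OF K_subgroup K_closed _ uw(2)]) (use l in simp)
  ultimately show ?thesis unfolding V_def by blast
 qed
 obtain P where P: "linear P" "range P \<subseteq> V" "!!v. v : V ==> P v = v"
  "!!l v. l : H Int K ==> P (Ad l v) = Ad l (P v)"
  by (rule L.Adj.invariant_complement[OF sV inv]) (assumption+, rule that)
 obtain pl where pl: "linear pl" "range pl \<subseteq> ?h Int ?k" "!!v. v : ?h Int ?k ==> pl v = v"
  by (rule exists_projection[OF subspace_inter[OF sh sk] subspace_single_0]) (auto intro: that)
 have sk1: "subspace {w : ?k. pl w = 0}"
  using sk pl(1) by (auto simp: subspace_def linear_add linear_scale linear_0)
 obtain ph where ph: "linear ph" "range ph \<subseteq> ?h" "!!v. v : ?h ==> ph v = v" "!!v. v : {w : ?k. pl w = 0} ==> ph v = 0"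
  by (rule exists_projection[OF sh sk1]) (use pl(3) in \<open>auto intro: that\<close>)
 have red: "v - pl v : ?k" "pl (v - pl v) = 0" if "v : ?k" for v
 proof -
  have "pl v : ?h Int ?k" using pl(2) by blast
  then show "v - pl v : ?k" "pl (v - pl v) = 0"
   using subspace_diff[OF sk that] pl(3)[of "pl v"] by (auto simp: linear_diff[OF pl(1)])
 qed
 have kV: "w : V" if "w : ?k" for w
  unfolding V_def using that subspace_0[OF sh] by (intro CollectI exI[of _ 0] exI[of _ w]) simp
 have hV: "u : V" if "u : ?h" for u
  unfolding V_def using that subspace_0[OF sk] by (intro CollectI exI[of _ u] exI[of _ 0]) simp
 show ?thesis
 proof (rule that[of P "%x. ph (P x)" "%x. P x - ph (P x)" pl])
  show "linear (%x. ph (P x))" using linear_compose[OF P(1) ph(1)] by (simp add: comp_def)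
  then show "linear (%x. P x - ph (P x))" by (rule linear_compose_sub[OF P(1)])
  show "range (%x. ph (P x)) \<subseteq> ?h" using ph(2) by auto
  show "range (%x. P x - ph (P x)) \<subseteq> ?k"
  proof clarify
   fix x
   obtain u v where uv: "u : ?h" "v : ?k" "P x = u + v" using P(2) unfolding V_def by blast
   have "pl v : ?h" using pl(2) by blast
   have "P x = (u + pl v) + (v - pl v)" using uv(3) by simp
   then have "ph (P x) = ph (u + pl v) + ph (v - pl v)" by (simp only: linear_add[OF ph(1)])
   moreover have "ph (u + pl v) = u + pl v" using subspace_add[OF sh uv(1) \<open>pl v : ?h\<close>] by (rule ph(3))
   moreover have "ph (v - pl v) = 0" using red[OF uv(2)] by (intro ph(4)) simp
   ultimately have "P x - ph (P x) = v - pl v" using uv(3) by simp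
   then show "P x - ph (P x) : ?k" using red(1)[OF uv(2)] by simp
  qed
  show "P (P v) = P v" for v using P(2,3) by blast
  show "ph (P x) = 0" if "P x = 0" for x using that linear_0[OF ph(1)] by simp
  show "P u = u & ph (P u) = u" if "u : ?h" for u using P(3)[OF hV[OF that]] ph(3)[OF that] by simp
  show "P (v - pl v) = v - pl v & ph (P (v - pl v)) = 0" if "v : ?k" for v
   using P(3)[OF kV[OF red(1)[OF that]]] ph(4)[of "v - pl v"] red[OF that] by simp
 qed (use P pl in auto)
qed

text \<open>Formulated on the group, on a set saturated under H and K, with a deformation commuting
  with both actions; passing to G/K then requires only the quotient map. At time 1 everything lies
  in the double coset of g0.\<close>

definition tube :: "'a => 'a set => (real => 'a => 'a) => bool" where
 "tube g0 W R \<longleftrightarrow> openin T W & g0 : W &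
   (ALL a:H. ALL g:W. ALL k:K. a ** g ** k : W & (ALL t. R t (a ** g ** k) = a ** R t g ** k)) &
   (ALL t. ALL g:W. R t g : CG &
    filterlim (%(t, g). R t g) (nhdsin T (R t g)) (nhds t \<times>\<^sub>F nhdsin T g)) &
   (ALL g:W. R 0 g = g & (EX a:H. EX k:K. R 1 g = a ** g0 ** k))"

context
 fixes P \<pi>1 \<pi>3 pl
 assumes S: "linear P" "!!v. P (P v) = P v" "!!l v. l : H Int K ==> P (Ad l v) = Ad l (P v)"
  "linear \<pi>1" "linear \<pi>3" "range \<pi>1 \<subseteq> lie_alg H" "range \<pi>3 \<subseteq> lie_alg K" "!!x. P x = \<pi>1 x + \<pi>3 x"
  "!!x. P x = 0 ==> \<pi>1 x = 0"
  "!!u. u : lie_alg H ==> P u = u & \<pi>1 u = u"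
  "linear pl" "range pl \<subseteq> lie_alg H Int lie_alg K" "!!v. v : lie_alg K ==> P (v - pl v) = v - pl v & \<pi>1 (v - pl v) = 0"
begin

text \<open>Coordinates given by a factor in H, a slice factor and a factor in K; the three
  exponents sum to x, so the derivative at 0 is the identity.\<close>

definition "slice_map x = Exp (\<pi>1 x) ** Exp (x - P x) ** Exp (\<pi>3 x)"

lemma slice_map_strict: "strict0 slice_map (%x. x)"
proof -
 have lq: "linear (%x. x - P x)" by (rule linear_compose_sub[OF linear_ident S(1)])
 have "strict0 slice_map (%x. (\<pi>1 x + (x - P x)) + \<pi>3 x)"
  unfolding slice_map_def
  by (intro strict0_mult strict0_Exp fd_bounded_linear[OF fd] S(4,5) lq)
 moreover have "(\<pi>1 x + (x - P x)) + \<pi>3 x = x" for x using S(8)[of x] by simp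
 ultimately show ?thesis by simp
qed

lemma slice_map_slice: "P x = 0 ==> slice_map x = Exp x"
 using S(8)[of x] S(9)[of x] by (simp add: slice_map_def)

lemma slice_map_sum:
 assumes u: "u : lie_alg H" and x: "P x = 0" and v: "v : lie_alg K"
 shows "slice_map (u + x + (v - pl v)) = Exp u ** Exp x ** Exp (v - pl v)"
proof -
 let ?w = "v - pl v"
 have p: "P (u + x + ?w) = u + ?w" using S(10)[OF u] S(13)[OF v] x by (simp add: linear_add[OF S(1)])
 have 1: "\<pi>1 (u + x + ?w) = u" using S(10)[OF u] S(13)[OF v] S(9)[OF x] by (simp add: linear_add[OF S(4)])
 have 3: "\<pi>3 (u + x + ?w) = ?w" using S(8)[of "u + x + ?w"] unfolding p 1 by simp
 have 2: "u + x + ?w - P (u + x + ?w) = x" unfolding p by simp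
 show ?thesis unfolding slice_map_def 1 2 3 by simp
qed

text \<open>A slice element is determined up to the action of H Int K: this is injectivity of the
  map from H \<times> N \<times> K to G modulo H Int K.\<close>

definition "slice_unique k x y \<longleftrightarrow> (ALL a:H. k : K --> P x = 0 --> P y = 0 --> a ** Exp x ** k = Exp y -->
 k = inv a & y = Ad a x)"

text \<open>The element k is split as l ** Exp (v - pl v) with l in H Int K, and l is moved to the
  left across the slice factor. Then a ** l is an exponential from the Lie algebra of H, and
  injectivity of \<open>slice_map\<close> forces it and the K-factor to be trivial.\<close>

lemma slice_unique_one:
 "eventually (%(k, x, y). slice_unique k x y) (nhdsin T \<one> \<times>\<^sub>F nhds 0 \<times>\<^sub>F nhds 0)"
proof -
 obtain r where r: "r > 0" "!!x y. norm x < r ==> norm y < r ==> slice_map x = slice_map y ==> x = y"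
  by (rule strict0_local_homeo[OF slice_map_strict]) (rule that)
 let ?F = "nhdsin T \<one> \<times>\<^sub>F nhds (0::'b) \<times>\<^sub>F nhds (0::'b)"
 let ?F' = "?F \<times>\<^sub>F nhds (0::'b)"
 obtain pH where pH: "linear pH" "range pH \<subseteq> lie_alg H" "!!v. v : lie_alg H ==> pH v = v"
  by (rule exists_projection[OF lie_alg_subspace[OF H_subgroup H_closed] subspace_single_0]) (auto intro: that)
 obtain pK where pK: "linear pK" "range pK \<subseteq> lie_alg K" "!!v. v : lie_alg K ==> pK v = v"
  by (rule exists_projection[OF lie_alg_subspace[OF K_subgroup K_closed] subspace_single_0]) (auto intro: that)
 \<comment> \<open>The argument of \<open>slice_map\<close> will be a sum of three terms and must
   stay below r.\<close>
 have "r / 3 > 0" using r(1) by simp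
 have evH: "eventually (%g. g : H --> (EX u:lie_alg H. norm u < r / 3 & g = Exp u)) (nhdsin T \<one>)"
  by (rule eventually_mono[OF closed_subgroup_local[OF H_subgroup H_closed pH linear_ident _ \<open>r / 3 > 0\<close>]])
   (auto simp: Exp_carrier)
 have l1: "filterlim (%p. fst (fst p)) (nhdsin T \<one>) ?F'"
  by (rule filterlim_compose[OF filterlim_fst filterlim_fst])
 have l2: "filterlim (%p. fst (snd (fst p))) (nhds 0) ?F'"
  by (rule filterlim_compose[OF filterlim_fst filterlim_compose[OF filterlim_snd filterlim_fst]])
 have l3: "filterlim (%p. snd (snd (fst p))) (nhds 0) ?F'"
  by (rule filterlim_compose[OF filterlim_snd filterlim_compose[OF filterlim_snd filterlim_fst]])
 have l4: "filterlim snd (nhds 0) ?F'" by (rule filterlim_snd)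
 \<comment> \<open>The element a ** l, solved from the equation in terms of y, k, x and pl v. That
   it is near the identity thus follows from smallness of these, while a is arbitrary in H.\<close>
 let ?Z = "%p. Exp (snd (snd (fst p))) ** inv (fst (fst p)) ** Exp (- fst (snd (fst p))) ** Exp (snd p)"
 have "filterlim ?Z (nhdsin T (Exp 0 ** inv \<one> ** Exp (- 0) ** Exp 0)) ?F'"
  by (intro mult_lim inv_lim Exp_lim tendsto_minus l1 l2 l3 l4) (auto simp: Exp_carrier)
 then have "filterlim ?Z (nhdsin T \<one>) ?F'" by simp
 from eventually_compose_filterlim[OF evH this]
 have ev1: "eventually (%p. ?Z p : H --> (EX u:lie_alg H. norm u < r / 3 & ?Z p = Exp u)) ?F'" .
 have "filterlim (%p. Exp (- snd p)) (nhdsin T (Exp (- 0))) ?F'"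
  by (intro Exp_lim tendsto_minus l4)
 then have "filterlim (%p. Exp (- snd p)) (nhdsin T \<one>) ?F'" by simp
 then have "((%p. Ad (Exp (- snd p)) (fst (snd (fst p)))) ---> Ad \<one> 0) ?F'"
  by (intro Ad_tendsto2 l2) auto
 from tendsto_norm[OF this] have "eventually (%p. norm (Ad (Exp (- snd p)) (fst (snd (fst p)))) < r / 3) ?F'"
  by (rule order_tendstoD) (use r in \<open>simp add: Ad_one\<close>)
 with ev1 have "eventually (%p. (?Z p : H --> (EX u:lie_alg H. norm u < r / 3 & ?Z p = Exp u)) &
   norm (Ad (Exp (- snd p)) (fst (snd (fst p)))) < r / 3) ?F'" (is "eventually (%p. ?W p) _")
  by (rule eventually_conj)
 then obtain Pf Px where Pf: "eventually Pf ?F" and Px: "eventually Px (nhds (0::'b))"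
  and W: "!!q x. Pf q ==> Px x ==> ?W (q, x)"
  by (rule eventually_prodE) (rule that)
 obtain d where d: "d > 0" "!!x. norm x < d ==> Px x"
  using Px unfolding eventually_nhds_metric by (auto simp: dist_norm)
 define d' where "d' = min d (r / 3)"
 have d': "d' > 0" "d' \<le> d" "d' \<le> r / 3" using d r unfolding d'_def by auto
 have "eventually (%k. k : K --> (EX v:lie_alg K. norm v < d' & norm (pl v) < d' & norm (v - pl v) < d' &
   k = Exp (pl v) ** Exp (v - pl v))) (nhdsin T \<one>)"
  by (rule closed_subgroup_local[OF K_subgroup K_closed pK S(11) _ d'(1)]) (use S(12) in auto)
 then have evK: "eventually (%q. fst q : K --> (EX v:lie_alg K. norm v < d' & norm (pl v) < d' & norm (v - pl v) < d' &
   fst q = Exp (pl v) ** Exp (v - pl v))) ?F"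
  by (rule eventually_compose_filterlim[OF _ filterlim_fst])
 have ly: "filterlim (%q. snd (snd q)) (nhds 0) ?F"
  by (rule filterlim_compose[OF filterlim_snd filterlim_snd])
 have evy: "eventually (%q. norm (snd (snd q)) < r) ?F"
  by (rule order_tendstoD(2)[OF tendsto_norm[OF ly]]) (use r in simp)
 have evc: "eventually (%q. fst q : CG) ?F"
  using eventually_compose_filterlim[OF ev_topspace[of T "\<one>"] filterlim_fst] by simp
 from Pf evK evy evc show ?thesis
 proof eventually_elim
  case (elim q)
  obtain k x y where q: "q = (k, x, y)" by (cases q)
  have "k = inv a & y = Ad a x" if a: "a : H" and k: "k : K" and x: "P x = 0" and y: "P y = 0"
   and eq: "a ** Exp x ** k = Exp y" for a
  proof -
   obtain v where v: "v : lie_alg K" "norm (pl v) < d'" "norm (v - pl v) < d'" "k = Exp (pl v) ** Exp (v - pl v)"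
    using elim(2) k q by auto
   let ?l = "Exp (pl v)"
   have plv: "pl v : lie_alg H" "pl v : lie_alg K" using S(12) by auto
   have l: "?l : H Int K" using lie_alg_Exp[OF plv(1)] lie_alg_Exp[OF plv(2)] by simp
   have aG: "a : CG" using H_carrier[OF a] .
   have kG: "k : CG" using K_carrier[OF k] .
   have Wq: "?W (q, pl v)" by (rule W[OF elim(1) d(2)]) (use v d' in linarith)
   have "?Z (q, pl v) = Exp y ** inv k ** inv (Exp x) ** ?l" unfolding q by (simp add: Exp_minus)
   also have "... = a ** ?l" unfolding eq[symmetric] using aG kG by (simp add: m_assoc Exp_carrier)
   finally have Z: "?Z (q, pl v) = a ** ?l" .
   moreover have "a ** ?l : H" using H_mult[OF a] l by simp
   ultimately obtain u where u: "u : lie_alg H" "norm u < r / 3" "a ** ?l = Exp u" using Wq by auto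
   let ?x = "Ad (inv ?l) x"
   have x': "norm ?x < r / 3" using Wq unfolding q by (simp add: Exp_minus)
   have il: "inv ?l : H Int K" using l H_inv K_inv by simp
   have Px': "P ?x = 0" using S(3)[OF il, of x] x linear_0[OF Ad_linear[OF H_carrier]] il by simp
   have ex: "Exp ?x = inv ?l ** Exp x ** ?l" using Exp_conj[of "inv ?l" x] by (simp add: Exp_carrier)
   have "Exp y = a ** ?l ** (inv ?l ** Exp x ** ?l) ** Exp (v - pl v)"
    unfolding eq[symmetric] v(4) using aG by (simp add: m_assoc Exp_carrier inv_cancel)
   then have "slice_map y = slice_map (u + ?x + (v - pl v))"
    using slice_map_slice[OF y] slice_map_sum[OF u(1) Px' v(1)] u(3) ex by simp
   moreover have "norm (u + ?x + (v - pl v)) < r"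
    using norm_triangle_ineq[of "u + ?x" "v - pl v"] norm_triangle_ineq[of u ?x] u(2) x' v(3) d'(3) by linarith
   moreover have "norm y < r" using elim(3) q by simp
   ultimately have yy: "y = u + ?x + (v - pl v)" by (intro r(2))
   have "P y = u + (v - pl v)" unfolding yy using S(10)[OF u(1)] S(13)[OF v(1)] Px' by (simp add: linear_add[OF S(1)])
   then have s0: "u + (v - pl v) = 0" using y by simp
   have "\<pi>1 (u + (v - pl v)) = u" using S(10)[OF u(1)] S(13)[OF v(1)] by (simp add: linear_add[OF S(4)])
   then have u0: "u = 0" unfolding s0 using linear_0[OF S(4)] by simp
   then have w0: "v - pl v = 0" using s0 by simp
   have "a ** ?l = \<one>" using u(3) u0 by simp
   then have al: "a = inv ?l" using aG by (metis Exp_carrier inv_equality inv_inv)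
   moreover have "k = ?l" using v(4) w0 by (simp add: Exp_carrier)
   moreover have "y = Ad a x" unfolding al using yy u0 w0 by simp
   ultimately show ?thesis by (simp add: Exp_carrier)
  qed
  then show ?case unfolding q slice_unique_def by simp
 qed
qed

text \<open>A solution a is close to inv k0. If inv k0 lies outside the closed set H there is no
  solution nearby; otherwise k0 is in H Int K, and translating by it reduces to the neighbourhood of
  the identity.\<close>

lemma slice_unique_K:
 assumes k0: "k0 : K"
 shows "eventually (%(k, x, y). slice_unique k x y) (nhdsin T k0 \<times>\<^sub>F nhds 0 \<times>\<^sub>F nhds 0)"
proof -
 let ?F = "nhdsin T k0 \<times>\<^sub>F nhds (0::'b) \<times>\<^sub>F nhds (0::'b)"
 have k0G: "k0 : CG" by (rule K_carrier[OF k0])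
 have l1: "filterlim (%p. fst p) (nhdsin T k0) ?F" by (rule filterlim_fst)
 have l2: "filterlim (%p. fst (snd p)) (nhds 0) ?F"
  by (rule filterlim_compose[OF filterlim_fst filterlim_snd])
 have l3: "filterlim (%p. snd (snd p)) (nhds 0) ?F"
  by (rule filterlim_compose[OF filterlim_snd filterlim_snd])
 have evc: "eventually (%q. fst q : CG) ?F"
  using eventually_compose_filterlim[OF ev_topspace[of T k0] filterlim_fst] by simp
 show ?thesis
 proof (cases "inv k0 : H")
  case False
  let ?Z = "%p. Exp (snd (snd p)) ** inv (fst p) ** Exp (- fst (snd p))"
  have "filterlim ?Z (nhdsin T (Exp 0 ** inv k0 ** Exp (- 0))) ?F"
   by (intro mult_lim inv_lim Exp_lim tendsto_minus l1 l2 l3) (auto simp: k0G)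
  then have Z: "filterlim ?Z (nhdsin T (inv k0)) ?F" using k0G by simp
  have "eventually (%g. g : topspace T - H) (nhdsin T (inv k0))"
   by (rule ev_nhdsin) (use H_closed False k0G in \<open>auto simp: closedin_def\<close>)
  from eventually_compose_filterlim[OF this Z] have "eventually (%p. ?Z p \<notin> H) ?F" by eventually_elim simp
  with evc show ?thesis
  proof eventually_elim
   case (elim p)
   obtain k x y where p: "p = (k, x, y)" by (cases p)
   have "a ** Exp x ** k ~= Exp y" if a: "a : H" for a
   proof
    assume e: "a ** Exp x ** k = Exp y"
    have "?Z p = a" unfolding p using elim(1) p H_carrier[OF a] e[symmetric] by (simp add: Exp_minus m_assoc)
    then show False using elim(2) a by simp
   qed
   then show ?case unfolding p slice_unique_def by simp
  qed
 next
  case True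
  then have iL: "inv k0 : H Int K" using k0 K_inv by simp
  have k0H: "k0 : H" using H_inv[OF True] k0G by simp
  let ?f = "%p. (inv k0 ** fst p, Ad (inv k0) (fst (snd p)), snd (snd p))"
  have f1: "filterlim (%p. inv k0 ** fst p) (nhdsin T (inv k0 ** k0)) ?F"
   by (intro mult_lim const_lim l1) (auto simp: k0G)
  have f2: "((%p. Ad (inv k0) (fst (snd p))) ---> Ad (inv k0) 0) ?F"
   by (intro Ad_tendsto2 const_lim l2) (auto simp: k0G)
  have "filterlim ?f (nhdsin T \<one> \<times>\<^sub>F nhds 0 \<times>\<^sub>F nhds 0) ?F"
   using f1 f2 l3 k0G linear_0[OF Ad_linear[of "inv k0"]] by (intro filterlim_Pair) auto
  from eventually_compose_filterlim[OF slice_unique_one this] evc show ?thesis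
  proof eventually_elim
   case (elim p)
   obtain k x y where p: "p = (k, x, y)" by (cases p)
   have kG: "k : CG" using elim(2) p by simp
   have su: "slice_unique (inv k0 ** k) (Ad (inv k0) x) y" using elim(1) p by simp
   have "k = inv a & y = Ad a x" if a: "a : H" and k: "k : K" and x: "P x = 0" and y: "P y = 0"
    and eq: "a ** Exp x ** k = Exp y" for a
   proof -
    have aG: "a : CG" using H_carrier[OF a] .
    have 1: "a ** k0 : H" using H_mult[OF a k0H] .
    have 2: "inv k0 ** k : K" using K_mult[OF K_inv[OF k0] k] .
    have 3: "P (Ad (inv k0) x) = 0" using S(3)[OF iL, of x] x linear_0[OF Ad_linear[of "inv k0"]] k0G by simp
    have "Exp (Ad (inv k0) x) = inv k0 ** Exp x ** k0" using Exp_conj[of "inv k0" x] k0G by (simp del: inv_solve_right')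
    then have 4: "(a ** k0) ** Exp (Ad (inv k0) x) ** (inv k0 ** k) = Exp y"
     unfolding eq[symmetric] using aG kG k0G by (simp only:) (simp add: m_assoc inv_cancel)
    have c: "inv k0 ** k = inv (a ** k0) & y = Ad (a ** k0) (Ad (inv k0) x)"
     using su 1 2 3 y 4 unfolding slice_unique_def by blast
    then have "inv k0 ** k = inv k0 ** inv a" using aG k0G by (simp add: inv_mult_group)
    then have "k0 ** (inv k0 ** k) = k0 ** (inv k0 ** inv a)" by (simp only:)
    then have "k = inv a" unfolding inv_cancel(2)[OF k0G kG] inv_cancel(2)[OF k0G inv_closed[OF aG]] .
    moreover have "y = Ad a x" using c Ad_mult[of "a ** k0" "inv k0" x] aG k0G by (simp add: m_assoc)
    ultimately show ?thesis by simp
   qed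
   then show ?case unfolding p slice_unique_def by simp
  qed
 qed
qed

text \<open>Compactness of K turns the local statements around each k0 into a single radius.\<close>

lemma slice_radius:
 obtains r where "r > 0" "!!k a x y. k : K ==> a : H ==> P x = 0 ==> P y = 0 ==> norm x < r ==> norm y < r ==>
  a ** Exp x ** k = Exp y ==> k = inv a & y = Ad a x"
  "!!x0 s. norm x0 < r ==> s > 0 ==> eventually (%g. EX x:ball x0 s. g = slice_map x) (nhdsin T (slice_map x0))"
proof -
 have "eventually (%q. ALL k:K. (%k (x, y). slice_unique k x y) k q) (nhds 0 \<times>\<^sub>F nhds 0)"
  by (rule compactin_ev[OF K_compact]) (use slice_unique_K in \<open>simp add: case_prod_unfold\<close>)
 then obtain Pf Pg where Pf: "eventually Pf (nhds (0::'b))" "eventually Pg (nhds (0::'b))"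
  and PP: "!!x y. Pf x ==> Pg y ==> (ALL k:K. (%k (x, y). slice_unique k x y) k (x, y))"
  by (rule eventually_prodE) (rule that)
 from eventually_conj[OF Pf] obtain d where d: "d > 0" "!!x. norm x < d ==> Pf x & Pg x"
  unfolding eventually_nhds_metric by (auto simp: dist_norm)
 obtain r where r: "r > 0"
  "!!x0 s. norm x0 < r ==> s > 0 ==> eventually (%g. EX x:ball x0 s. norm x < r & g = slice_map x) (nhdsin T (slice_map x0))"
  by (rule strict0_local_homeo[OF slice_map_strict]) (rule that)
 show ?thesis
 proof (rule that[of "min d r"])
  show "min d r > 0" using d r by simp
  show "k = inv a & y = Ad a x" if "k : K" "a : H" "P x = 0" "P y = 0" "norm x < min d r" "norm y < min d r"
   "a ** Exp x ** k = Exp y" for k a x y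
   using PP[of x y] d(2)[of x] d(2)[of y] that unfolding slice_unique_def by auto
  show "eventually (%g. EX x:ball x0 s. g = slice_map x) (nhdsin T (slice_map x0))" if "norm x0 < min d r" "s > 0" for x0 s
   by (rule eventually_mono[OF r(2)[OF _ that(2)]]) (use that(1) in auto)
 qed
qed

text \<open>The tube consists of the products of H, small slice elements and K, and the deformation
  shrinks the slice coordinate linearly. It is well defined because any two factorizations differ by
  H Int K, which acts linearly on the slice.\<close>

lemma tube_one_slice: "EX W R. tube \<one> W R"
proof -
 obtain r where r: "r > 0" "!!k a x y. k : K ==> a : H ==> P x = 0 ==> P y = 0 ==> norm x < r ==> norm y < r ==>
  a ** Exp x ** k = Exp y ==> k = inv a & y = Ad a x"
  and nb: "!!x0 s. norm x0 < r ==> s > 0 ==> eventually (%g. EX x:ball x0 s. g = slice_map x) (nhdsin T (slice_map x0))"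
  by (rule slice_radius) (rule that)
 define W where "W = {a ** Exp x ** k |a x k. a : H & P x = 0 & norm x < r & k : K}"
 have "EX p. fst p : H & P (fst (snd p)) = 0 & norm (fst (snd p)) < r & snd (snd p) : K &
   g = fst p ** Exp (fst (snd p)) ** snd (snd p)" if g: "g : W" for g
 proof -
  obtain a x k where "a : H & P x = 0 & norm x < r & k : K" "g = a ** Exp x ** k" using g unfolding W_def by blast
  then show ?thesis by (intro exI[of _ "(a, x, k)"]) simp
 qed
 then obtain f where f: "!!g. g : W ==> fst (f g) : H & P (fst (snd (f g))) = 0 & norm (fst (snd (f g))) < r &
   snd (snd (f g)) : K & g = fst (f g) ** Exp (fst (snd (f g))) ** snd (snd (f g))" by metis
 \<comment> \<open>The choice function f is arbitrary; the next fact shows that every factorization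
   gives the same value.\<close>
 define R where "R t g = fst (f g) ** Exp ((1 - t) *. fst (snd (f g))) ** snd (snd (f g))" for t :: real and g
 have WI: "a ** Exp x ** k : W" if "a : H" "P x = 0" "norm x < r" "k : K" for a x k
  using that unfolding W_def by blast
 have R: "R t (a ** Exp x ** k) = a ** Exp ((1 - t) *. x) ** k"
  if a: "a : H" and x: "P x = 0" "norm x < r" and k: "k : K" for t a x k
 proof -
  let ?g = "a ** Exp x ** k"
  obtain a' y k' where p: "f ?g = (a', y, k')" by (cases "f ?g")
  have y: "a' : H" "P y = 0" "norm y < r" "k' : K" "?g = a' ** Exp y ** k'" using f[OF WI[OF a x k]] p by auto
  have c: "a : CG" "a' : CG" "k : CG" "k' : CG"
   using H_carrier a y(1) K_carrier k y(4) by auto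
  let ?l = "inv a' ** a"
  have "?l ** Exp x ** (k ** inv k') = inv a' ** ?g ** inv k'" using c by (simp add: m_assoc)
  also have "... = Exp y" unfolding y(5) using c by (simp add: m_assoc inv_cancel)
  finally have "k ** inv k' = inv ?l & y = Ad ?l x"
   by (intro r(2) x y K_mult K_inv k H_mult H_inv a)
  then have l: "inv ?l = k ** inv k'" "y = Ad ?l x" by auto
  have "Exp ((1 - t) *. y) = ?l ** Exp ((1 - t) *. x) ** inv ?l"
   unfolding l(2) using c by (simp add: Exp_conj linear_scale[OF Ad_linear])
  then have "R t ?g = a' ** (?l ** Exp ((1 - t) *. x) ** (k ** inv k')) ** k'" unfolding R_def p l(1) by simp
  also have "... = a ** Exp ((1 - t) *. x) ** k" using c by (simp add: m_assoc inv_cancel)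
  finally show ?thesis .
 qed
 have WE: "EX a x k. a : H & P x = 0 & norm x < r & k : K & g = a ** Exp x ** k" if "g : W" for g
  using that unfolding W_def by blast
 \<comment> \<open>Since f need not be continuous, continuity of R is obtained from a local
   factorization by \<open>slice_map\<close> around x, in which all factors depend continuously on
   z.\<close>
 have near: "eventually (%g. EX z. Q z & P (z - P z) = 0 & norm (z - P z) < r & g = (a ** Exp (\<pi>1 z)) ** Exp (z - P z) ** (Exp (\<pi>3 z) ** k))
   (nhdsin T (a ** Exp x ** k))"
  if a: "a : H" and x: "P x = 0" "norm x < r" and k: "k : K" and Q: "eventually Q (nhds x)" for a x k Q
 proof -
  have c: "a : CG" "k : CG" using H_carrier a K_carrier k by auto
  have "((%z. norm (z - P z)) ---> norm (x - P x)) (nhds x)"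
   by (intro tendsto_norm tendsto_diff filterlim_ident bounded_linear.tendsto[OF fd_bounded_linear[OF fd S(1)]])
  then have "eventually (%z. norm (z - P z) < r) (nhds x)" by (rule order_tendstoD) (use x in simp)
  from eventually_conj[OF Q this] obtain s where s: "s > 0" "!!z. dist z x < s ==> Q z & norm (z - P z) < r"
   unfolding eventually_nhds_metric by blast
  have "filterlim (%g. inv a ** g ** inv k) (nhdsin T (inv a ** (a ** Exp x ** k) ** inv k)) (nhdsin T (a ** Exp x ** k))"
   by (intro mult_lim const_lim filterlim_ident) (auto simp: c)
  moreover have "inv a ** (a ** Exp x ** k) ** inv k = slice_map x"
   unfolding slice_map_slice[OF x(1)] using c by (simp add: m_assoc inv_cancel)
  ultimately have lim: "filterlim (%g. inv a ** g ** inv k) (nhdsin T (slice_map x)) (nhdsin T (a ** Exp x ** k))" by simp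
  from eventually_compose_filterlim[OF nb[OF x(2) s(1)] lim] ev_topspace[of T]
  show ?thesis
  proof eventually_elim
   case (elim g)
   then obtain z where z: "z : ball x s" "inv a ** g ** inv k = slice_map z" by blast
   have "g = a ** (inv a ** g ** inv k) ** k" using c elim(2) by (simp add: m_assoc inv_cancel)
   also have "... = (a ** Exp (\<pi>1 z)) ** Exp (z - P z) ** (Exp (\<pi>3 z) ** k)"
    unfolding z(2) slice_map_def using c by (simp add: m_assoc)
   finally show ?case using s(2)[of z] z(1) S(2)[of z]
    by (intro exI[of _ z]) (simp add: dist_commute linear_diff[OF S(1)])
  qed
 qed
 have in1: "Exp (\<pi>1 z) : H" "Exp (\<pi>3 z) : K" for z using S(6,7) lie_alg_Exp by blast+
 have "openin T W"
 proof (subst openin_subopen, intro ballI)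
  fix g assume "g : W"
  then obtain a x k where g: "a : H" "P x = 0" "norm x < r" "k : K" "g = a ** Exp x ** k" using WE by blast
  have "eventually (%g. g : W) (nhdsin T g)"
   unfolding g(5) by (rule eventually_mono[OF near[OF g(1-4) always_eventually[of "%_. True"]]])
    (auto intro!: WI H_mult K_mult g in1)
  moreover have "g : topspace T" using g H_carrier K_carrier by simp
  ultimately obtain A where "openin T A" "g : A" "!!x. x : A ==> x : W" by (rule ev_nhdsinE) (rule that)
  then show "EX T'. openin T T' & g : T' & T' \<subseteq> W" by blast
 qed
 moreover have "\<one> : W" using WI[of \<one> 0 \<one>] H_one K_one r(1) linear_0[OF S(1)] by simp
 moreover have "b ** g ** l : W & (ALL t. R t (b ** g ** l) = b ** R t g ** l)" if b: "b : H" and "g : W" and l: "l : K" for b g l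
 proof -
  obtain a x k where g: "a : H" "P x = 0" "norm x < r" "k : K" "g = a ** Exp x ** k" using WE \<open>g : W\<close> by blast
  have c: "a : CG" "k : CG" "b : CG" "l : CG" using H_carrier K_carrier g b l by auto
  have e: "b ** g ** l = (b ** a) ** Exp x ** (k ** l)" unfolding g(5) using c by (simp add: m_assoc)
  show ?thesis unfolding e using R[OF H_mult[OF b g(1)] g(2,3) K_mult[OF g(4) l]] R[OF g(1-4)] WI[OF H_mult[OF b g(1)] g(2,3) K_mult[OF g(4) l]]
   by (auto simp: g(5) m_assoc c)
 qed
 moreover have "R t g : CG & filterlim (%(t, g). R t g) (nhdsin T (R t g)) (nhds t \<times>\<^sub>F nhdsin T g)" if "g : W" for t g
 proof
  obtain a x k where g: "a : H" "P x = 0" "norm x < r" "k : K" "g = a ** Exp x ** k" using WE \<open>g : W\<close> by blast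
  have c: "a : CG" "k : CG" using H_carrier K_carrier g by auto
  have Rt: "R t g = a ** Exp ((1 - t) *. x) ** k" unfolding g(5) by (rule R[OF g(1-4)])
  then show "R t g : CG" using c by simp
  let ?F = "%p. (a ** Exp (\<pi>1 (snd p))) ** Exp ((1 - fst p) *. (snd p - P (snd p))) ** (Exp (\<pi>3 (snd p)) ** k)"
  note bl = bounded_linear.tendsto[OF fd_bounded_linear[OF fd]]
  have "filterlim ?F (nhdsin T (?F (t, x))) (nhds t \<times>\<^sub>F nhds x)"
   by (simp only: fst_conv snd_conv)
    (intro mult_lim const_lim Exp_lim tendsto_scaleR tendsto_diff tendsto_const filterlim_fst filterlim_snd
     bl[OF S(1)] bl[OF S(4)] bl[OF S(5)]; simp add: c)
  moreover have "\<pi>3 x = 0" using S(8)[of x] S(9)[OF g(2)] g(2) by simp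
  then have "?F (t, x) = R t g" unfolding Rt using S(9)[OF g(2)] g(2) c by simp
  ultimately have lim: "filterlim ?F (nhdsin T (R t g)) (nhds t \<times>\<^sub>F nhds x)" by simp
  show "filterlim (%(t, g). R t g) (nhdsin T (R t g)) (nhds t \<times>\<^sub>F nhdsin T g)"
   unfolding filterlim_iff
  proof (intro allI impI)
   fix Q assume "eventually Q (nhdsin T (R t g))"
   from eventually_compose_filterlim[OF this lim] obtain Pt Pz where Pt: "eventually Pt (nhds t)" and Pz: "eventually Pz (nhds x)"
    and PP: "!!s z. Pt s ==> Pz z ==> Q (?F (s, z))"
    by (rule eventually_prodE) (rule that)
   show "eventually (%p. Q (case p of (t, g) => R t g)) (nhds t \<times>\<^sub>F nhdsin T g)"
    unfolding eventually_prod_filter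
   proof (intro exI conjI allI impI)
    show "eventually Pt (nhds t)" by (rule Pt)
    show "eventually (%g. EX z. Pz z & P (z - P z) = 0 & norm (z - P z) < r & g = (a ** Exp (\<pi>1 z)) ** Exp (z - P z) ** (Exp (\<pi>3 z) ** k)) (nhdsin T g)"
     unfolding g(5) by (rule near[OF g(1-4) Pz])
    fix s g' assume s: "Pt s" and "EX z. Pz z & P (z - P z) = 0 & norm (z - P z) < r & g' = (a ** Exp (\<pi>1 z)) ** Exp (z - P z) ** (Exp (\<pi>3 z) ** k)"
    then obtain z where z: "Pz z" "P (z - P z) = 0" "norm (z - P z) < r" "g' = (a ** Exp (\<pi>1 z)) ** Exp (z - P z) ** (Exp (\<pi>3 z) ** k)"
     by blast
    have "R s g' = ?F (s, z)" unfolding z(4) by (simp add: R[OF H_mult[OF g(1) in1(1)] z(2,3) K_mult[OF in1(2) g(4)]])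
    then show "Q (case (s, g') of (t, g) => R t g)" using PP[OF s z(1)] by simp
   qed
  qed
 qed
 moreover have "R 0 g = g & (EX a:H. EX k:K. R 1 g = a ** \<one> ** k)" if "g : W" for g
 proof -
  obtain a x k where g: "a : H" "P x = 0" "norm x < r" "k : K" "g = a ** Exp x ** k" using WE \<open>g : W\<close> by blast
  have "R 0 g = g" "R 1 g = a ** \<one> ** k" unfolding g(5) R[OF g(1-4)] by simp_all
  then show ?thesis using g(1,4) by blast
 qed
 ultimately show ?thesis unfolding tube_def by (intro exI[of _ W] exI[of _ R]) blast
qed

end

lemma tube_one: "EX W R. tube \<one> W R"
proof -
 obtain P \<pi>1 \<pi>3 pl where S: "linear P" "!!v. P (P v) = P v" "!!l v. l : H Int K ==> P (Ad l v) = Ad l (P v)"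
  "linear \<pi>1" "linear \<pi>3" "range \<pi>1 \<subseteq> lie_alg H" "range \<pi>3 \<subseteq> lie_alg K" "!!x. P x = \<pi>1 x + \<pi>3 x"
  "!!x. P x = 0 ==> \<pi>1 x = 0"
  "!!u. u : lie_alg H ==> P u = u & \<pi>1 u = u"
  "linear pl" "range pl \<subseteq> lie_alg H Int lie_alg K" "!!v. v : lie_alg K ==> P (v - pl v) = v - pl v & \<pi>1 (v - pl v) = 0"
  by (rule splitting) (rule that)
 show ?thesis by (rule tube_one_slice[OF S])
qed

text \<open>The general orbit reduces to the orbit of the identity: right translation by the inverse of
 \<open>g0\<close> turns \<open>H g0 K\<close> into the orbit of the identity for the conjugate of \<open>K\<close>.\<close>

lemma tube_exists:
 assumes g0: "g0 : CG"
 shows "EX W R. tube g0 W R"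
proof -
 let ?c = "%k. g0 ** k ** inv g0"
 let ?K' = "?c ` K"
 have Ki: "EX k:K. x = ?c k" if "x : ?K'" for x using that by blast
 have mc: "?c k ** ?c l = ?c (k ** l)" if "k : K" "l : K" for k l
  using that K_carrier g0 by (simp add: m_assoc inv_cancel)
 have "subgroup ?K' G"
 proof (rule subgroupI)
  show "?K' \<subseteq> CG" using K_carrier g0 by auto
  show "?K' ~= {}" using K_one by blast
  show "inv x : ?K'" if x: "x : ?K'" for x
  proof -
   obtain k where k: "k : K" "x = ?c k" using Ki[OF x] by blast
   have "inv x = ?c (inv k)" unfolding k(2) using K_carrier[OF k(1)] g0 by (simp add: inv_mult_group m_assoc)
   then show ?thesis using K_inv[OF k(1)] by blast
  qed
  show "x ** y : ?K'" if xy: "x : ?K'" "y : ?K'" for x y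
  proof -
   obtain k l where "k : K" "x = ?c k" "l : K" "y = ?c l" using Ki[OF xy(1)] Ki[OF xy(2)] by blast
   then show ?thesis using mc[of k l] K_mult[of k l] by simp
  qed
 qed
 moreover have "continuous_map T T ?c"
  unfolding cont_iff_filterlim
  by (intro conjI ballI mult_lim const_lim filterlim_ident) (use g0 in auto)
 then have "compactin T ?K'" by (rule image_compactin[OF K_compact])
 ultimately interpret C: closed_pair G GM ?K' H
  by unfold_locales (use H_subgroup H_closed in \<open>auto simp: subgroup.m_closed subgroup.m_inv_closed subgroup.one_closed dest: subgroup.mem_carrier\<close>)
 obtain W R where "C.tube \<one> W R" using C.tube_one by blast
 note tb = this[unfolded C.tube_def]
 have W: "openin T W" "\<one> : W" "!!t g. g : W ==> R t g : CG"
  "!!t g. g : W ==> filterlim (%(t, g). R t g) (nhdsin T (R t g)) (nhds t \<times>\<^sub>F nhdsin T g)"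
  "!!g. g : W ==> R 0 g = g" using tb by blast+
 have eqv: "a ** g ** ?c k : W" "R t (a ** g ** ?c k) = a ** R t g ** ?c k" if "a : H" "g : W" "k : K" for a g k t
  using tb that by blast+
 have R1: "EX a:H. EX k:K. R 1 g = a ** \<one> ** ?c k" if "g : W" for g using tb that by blast
 have WG: "g : CG" if "g : W" for g using openin_subset[OF W(1)] that by auto
 define W' where "W' = {g : topspace T. g ** inv g0 : W}"
 define R' where "R' t g = R t (g ** inv g0) ** g0" for t g
 have ct: "continuous_map T T (%g. g ** inv g0)"
  unfolding cont_iff_filterlim
  by (intro conjI ballI mult_lim const_lim filterlim_ident) (use g0 in auto)
 have "openin T W'" unfolding W'_def by (rule openin_continuous_map_preimage[OF ct W(1)])
 moreover have "g0 : W'" using g0 W(2) by (simp add: W'_def)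
 moreover have "a ** g ** k : W' & (ALL t. R' t (a ** g ** k) = a ** R' t g ** k)" if a: "a : H" and g: "g : W'" and k: "k : K" for a g k
 proof -
  have c: "a : CG" "g : CG" "k : CG" "g ** inv g0 : W"
   using H_carrier K_carrier a g k by (auto simp: W'_def)
  have e: "a ** g ** k ** inv g0 = a ** (g ** inv g0) ** ?c k" using c g0 by (simp add: m_assoc inv_cancel)
  show ?thesis unfolding W'_def R'_def mem_Collect_eq e
   using eqv(1)[OF a c(4) k] eqv(2)[OF a c(4) k] W(3)[OF c(4)] c g0 by (simp add: m_assoc inv_cancel)
 qed
 moreover have "R' t g : CG & filterlim (%(t, g). R' t g) (nhdsin T (R' t g)) (nhds t \<times>\<^sub>F nhdsin T g)" if g: "g : W'" for t g
 proof
  have c: "g : CG" "g ** inv g0 : W" using g by (auto simp: W'_def)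
  show "R' t g : CG" using W(3)[OF c(2)] g0 by (simp add: R'_def)
  have "filterlim (%p. (fst p, snd p ** inv g0)) (nhds t \<times>\<^sub>F nhdsin T (g ** inv g0)) (nhds t \<times>\<^sub>F nhdsin T g)"
   by (intro filterlim_Pair filterlim_fst mult_lim filterlim_snd const_lim) (use c g0 in auto)
  from filterlim_compose[OF W(4)[OF c(2)] this]
  have "filterlim (%p. R (fst p) (snd p ** inv g0)) (nhdsin T (R t (g ** inv g0))) (nhds t \<times>\<^sub>F nhdsin T g)" by simp
  then have "filterlim (%p. R (fst p) (snd p ** inv g0) ** g0) (nhdsin T (R t (g ** inv g0) ** g0)) (nhds t \<times>\<^sub>F nhdsin T g)"
   by (rule mult_lim[OF _ const_lim]) (use W(3)[OF c(2)] g0 in auto)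
  then show "filterlim (%(t, g). R' t g) (nhdsin T (R' t g)) (nhds t \<times>\<^sub>F nhdsin T g)"
   by (simp add: R'_def case_prod_unfold)
 qed
 moreover have "R' 0 g = g & (EX a:H. EX k:K. R' 1 g = a ** g0 ** k)" if g: "g : W'" for g
 proof
  have c: "g : CG" "g ** inv g0 : W" using g by (auto simp: W'_def)
  show "R' 0 g = g" using W(5)[OF c(2)] c g0 by (simp add: R'_def m_assoc)
  obtain a k where ak: "a : H" "k : K" "R 1 (g ** inv g0) = a ** \<one> ** ?c k" using R1[OF c(2)] by blast
  have "R' 1 g = a ** g0 ** k" unfolding R'_def ak(3) using H_carrier[OF ak(1)] K_carrier[OF ak(2)] g0 by (simp add: m_assoc)
  then show "EX a:H. EX k:K. R' 1 g = a ** g0 ** k" using ak by blast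
 qed
 ultimately show ?thesis unfolding tube_def by (intro exI[of _ W'] exI[of _ R']) blast
qed

text \<open>The radius \<open>r\<close> is uniform in \<open>g\<close> because \<open>H\<close> is cocompact.\<close>

lemma tube_uniform:
 assumes C: "compactin T C" "!!g. g : CG ==> EX a:H. a ** g : C"
 obtains r where "r > 0"
  "!!g. g : CG ==> EX g0 W R. g0 : CG & tube g0 W R & (ALL a:H. ALL b:near r. ALL k:K. a ** g ** b ** k : W)"
proof -
 let ?Q = "%g r. EX g0 W R. g0 : CG & tube g0 W R & (ALL b:near r. g ** b : W)"
 \<comment> \<open>The radius is treated as a variable tending to 0 from the right, so that
   \<open>compactin_ev\<close> yields one radius for all of C.\<close>
 have "eventually (%r. ALL g:C. ?Q g r) (at_right 0)"
 proof (rule compactin_ev[OF C(1)])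
  fix g0 assume "g0 : C"
  then have g0: "g0 : CG" using C(1) compactin_subset_topspace by fastforce
  obtain W R where W: "tube g0 W R" using tube_exists[OF g0] by blast
  then have Wo: "openin T W" "g0 : W" by (auto simp: tube_def)
  have lim: "filterlim (%p. fst p ** snd p) (nhdsin T (g0 ** \<one>)) (nhdsin T g0 \<times>\<^sub>F nhdsin T \<one>)"
   by (intro mult_lim filterlim_fst filterlim_snd) (use g0 in auto)
  have "eventually (%g. g : W) (nhdsin T (g0 ** \<one>))"
   using ev_nhdsin[OF Wo] g0 by simp
  from eventually_compose_filterlim[OF this lim] have "eventually (%p. fst p ** snd p : W) (nhdsin T g0 \<times>\<^sub>F nhdsin T \<one>)"
   .
  then obtain Pg Pb where P: "eventually Pg (nhdsin T g0)" "eventually Pb (nhdsin T \<one>)"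
   "!!x y. Pg x ==> Pb y ==> fst (x, y) ** snd (x, y) : W"
   by (rule eventually_prodE) (rule that)
  have "filterlim kinv (nhdsin T (kinv 0)) (nhds 0)" by (rule kinv_filterlim) (rule zero_D0)
  from eventually_compose_filterlim[OF P(2) this[unfolded kinv_zero]]
  obtain d where d: "d > 0" "!!x. norm x < d ==> Pb (kinv x)"
   unfolding eventually_nhds_metric by (auto simp: dist_norm)
  have "eventually (%r. r < d) (at_right 0)" using d(1) by (auto simp: eventually_at_right_field)
  then show "eventually (%(x, y). ?Q x y) (nhdsin T g0 \<times>\<^sub>F at_right 0)"
   unfolding eventually_prod_filter
  proof (intro exI conjI allI impI)
   show "eventually Pg (nhdsin T g0)" by (rule P)
   fix x y assume xy: "Pg x" "y < d"
   have "x ** b : W" if "b : near y" for b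
    using P(3)[OF xy(1) d(2)[of "kap b"]] that xy(2) by (simp add: near_def kinv_kap)
   then show "case (x, y) of (x, y) => ?Q x y" using W g0 by auto
  qed
 qed
 then obtain d where d: "d > 0" "!!r. 0 < r ==> r < d ==> ALL g:C. ?Q g r"
  by (auto simp: eventually_at_right_field)
 show ?thesis
 proof (rule that[of "d / 2"])
  show "d / 2 > 0" using d by simp
  fix g assume g: "g : CG"
  obtain a0 where a0: "a0 : H" "a0 ** g : C" using C(2)[OF g] by blast
  obtain g0 W R where W: "g0 : CG" "tube g0 W R" "ALL b:near (d / 2). a0 ** g ** b : W"
   using d(2)[of "d / 2"] d(1) a0(2) by auto
  have "a ** g ** b ** k : W" if a: "a : H" and b: "b : near (d / 2)" and k: "k : K" for a b k
  proof -
   have "(a ** inv a0) ** (a0 ** g ** b) ** k : W"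
    using W(2,3) b k H_mult[OF a H_inv[OF a0(1)]] unfolding tube_def by blast
   moreover have "(a ** inv a0) ** (a0 ** g ** b) ** k = a ** g ** b ** k"
    using H_carrier[OF a] H_carrier[OF a0(1)] g near_carrier[OF b] K_carrier[OF k] by (simp add: m_assoc inv_cancel)
   ultimately show ?thesis by simp
  qed
  then show "EX g0 W R. g0 : CG & tube g0 W R & (ALL a:H. ALL b:near (d / 2). ALL k:K. a ** g ** b ** k : W)"
   using W by blast
 qed
qed

end


section \<open>Lyusternik--Schnirelmann theory on a coset space\<close>

context closed_pair
begin

abbreviation "X \<equiv> left_coset_space G GM K"
abbreviation "q \<equiv> (%g. g <# K)"
definition "rep C = (SOME g. g : CG & q g = C)"

lemma topspace_X: "topspace X = q ` CG"
 by (simp add: left_coset_space_def topspace_quotient_topology)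

lemma rep: "C : topspace X ==> rep C : CG & q (rep C) = C"
 unfolding rep_def topspace_X by (rule someI_ex) blast

lemma q_mult:
 assumes "g : CG" "k : K"
 shows "q (g ** k) = q g"
proof
 show "q (g ** k) \<subseteq> q g" using assms K_carrier K_mult by (auto simp: l_coset_def m_assoc)
 show "q g \<subseteq> q (g ** k)"
 proof
  fix x assume "x : q g"
  then obtain l where l: "l : K" "x = g ** l" by (auto simp: l_coset_def)
  then have "x = (g ** k) ** (inv k ** l)" using assms K_carrier by (simp add: m_assoc inv_cancel)
  then show "x : q (g ** k)" using l assms K_inv K_mult unfolding l_coset_def by blast
 qed
qed

lemma q_eqE:
 assumes "g : CG" "g' : CG" "q g = q g'"
 obtains k where "k : K" "g' = g ** k"
proof -
 have "g' : q g'" using assms(2) K_one by (force simp: l_coset_def)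
 then show ?thesis using assms(3) that by (auto simp: l_coset_def)
qed

lemma act_q: "a : CG ==> g : CG ==> a <# q g = q (a ** g)"
 by (rule lcos_m_assoc) (use K_carrier in auto)

lemma openin_X_q: "openin T A ==> openin X (q ` A)"
proof -
 assume A: "openin T A"
 then have AG: "A \<subseteq> CG" using openin_subset by fastforce
 have "{x : topspace T. q x : q ` A} = (\<Union>k\<in>K. {x : topspace T. x ** k : A})" (is "?L = ?R")
 proof (intro equalityI subsetI)
  fix x assume "x : ?L"
  then obtain a where a: "x : CG" "a : A" "q x = q a" by auto
  then obtain k where "k : K" "a = x ** k" using AG by (elim q_eqE) auto
  then show "x : ?R" using a by auto
 next
  fix x assume "x : ?R"
  then obtain k where k: "k : K" "x : CG" "x ** k : A" by auto
  then have "q x = q (x ** k)" using q_mult by simp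
  then show "x : ?L" using k by auto
 qed
 moreover have "openin T {x : topspace T. x ** k : A}" if "k : K" for k
 proof (rule openin_continuous_map_preimage[OF _ A])
  show "continuous_map T T (%x. x ** k)" unfolding cont_iff_filterlim
   by (intro conjI ballI mult_lim const_lim filterlim_ident) (use K_carrier that in auto)
 qed
 then have "openin T (\<Union>k\<in>K. {x : topspace T. x ** k : A})" by blast
 ultimately show ?thesis
  unfolding left_coset_space_def openin_quotient_topology using AG by auto
qed

lemma openin_X_iff: "openin X U \<longleftrightarrow> U \<subseteq> q ` CG & openin T {g : CG. q g : U}"
 unfolding left_coset_space_def openin_quotient_topology by simp

text \<open>The quotient map is open, so limits in the coset space can be computed on the
  group.\<close>

lemma nhdsin_X: "g : CG ==> nhdsin X (q g) = filtermap q (nhdsin T g)"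
proof (rule filter_eqI)
 fix P assume g: "g : CG"
 show "eventually P (nhdsin X (q g)) \<longleftrightarrow> eventually P (filtermap q (nhdsin T g))"
  unfolding eventually_filtermap
 proof
  assume "eventually P (nhdsin X (q g))"
  then obtain U where U: "openin X U" "q g : U" "!!x. x : U ==> P x"
   by (rule ev_nhdsinE) (use g topspace_X in auto)
  show "eventually (%x. P (q x)) (nhdsin T g)"
   by (rule ev_nhdsinI[of _ "{g : CG. q g : U}"]) (use U g openin_X_iff in auto)
 next
  assume "eventually (%x. P (q x)) (nhdsin T g)"
  then obtain A where A: "openin T A" "g : A" "!!x. x : A ==> P (q x)"
   by (rule ev_nhdsinE) (use g in auto)
  show "eventually P (nhdsin X (q g))"
   by (rule ev_nhdsinI[OF openin_X_q[OF A(1)]]) (use A in auto)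
 qed
qed

definition equi :: "'a set set => ('a set => 'a set) => bool" where
 "equi U f \<longleftrightarrow> (ALL a:H. ALL y:U. f (a <# y) = a <# f y)"

text \<open>The conditions of \<open>tube\<close> without the target orbit; they also cover
  deformations of the whole group.\<close>

definition "flow W R \<longleftrightarrow> openin T W & (ALL a:H. ALL g:W. ALL k:K. a ** g ** k : W & (ALL t. R t (a ** g ** k) = a ** R t g ** k)) &
   (ALL t::real. ALL g:W. R t g : CG &
    filterlim (%(t, g). R t g) (nhdsin T (R t g)) (nhds t \<times>\<^sub>F nhdsin T g)) & (ALL g:W. R 0 g = g)"

definition "desc R t C = q (R t (rep C))" for R :: "real => 'a => 'a"

lemma flowD:
 assumes "flow W R"
 shows "openin T W" "g : W ==> g : CG" "a : H ==> g : W ==> k : K ==> a ** g ** k : W"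
  "a : H ==> g : W ==> k : K ==> R t (a ** g ** k) = a ** R t g ** k"
  "g : W ==> R t g : CG"
  "g : W ==> filterlim (%(t, g). R t g) (nhdsin T (R t g)) (nhds t \<times>\<^sub>F nhdsin T g)"
  "g : W ==> R 0 g = g"
 using assms openin_subset[of T W] unfolding flow_def by auto

lemma flow_right: "flow W R ==> g : W ==> k : K ==> g ** k : W & R t (g ** k) = R t g ** k"
 using flowD(3,4)[of W R \<one> g k] flowD(2,5)[of W R g] H_one by auto

lemma flow_left: "flow W R ==> g : W ==> a : H ==> a ** g : W & R t (a ** g) = a ** R t g"
 using flowD(3,4)[of W R a g \<one>] flowD(2,5)[of W R g] K_one H_carrier by auto

lemma desc_eq:
 assumes F: "flow W R" and g: "g : W"
 shows "desc R t (q g) = q (R t g)"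
proof -
 have gG: "g : CG" using flowD(2)[OF F g] .
 then have "rep (q g) : CG" "q g = q (rep (q g))" using rep[of "q g"] topspace_X by auto
 then obtain k where k: "k : K" "rep (q g) = g ** k" by (rule q_eqE[OF gG])
 then show ?thesis using flow_right[OF F g k(1)] q_mult[OF flowD(5)[OF F g] k(1)] by (simp add: desc_def)
qed

lemma desc_equi: "flow W R ==> equi (q ` W) (desc R t)"
 unfolding equi_def
proof (intro ballI)
 fix a C assume F: "flow W R" and a: "a : H" and "C : q ` W"
 then obtain g where g: "g : W" "C = q g" by blast
 have gG: "g : CG" using flowD(2)[OF F g(1)] .
 have "a <# C = q (a ** g)" unfolding g(2) by (rule act_q[OF H_carrier[OF a] gG])
 then show "desc R t (a <# C) = a <# desc R t C"
  using desc_eq[OF F, of "a ** g" t] desc_eq[OF F g(1), of t] flow_left[OF F g(1) a] g(2)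
   act_q[OF H_carrier[OF a] flowD(5)[OF F g(1)]] by simp
qed

lemma desc_continuous:
 assumes F: "flow W R"
 shows "continuous_map (prod_topology euclideanreal (subtopology X (q ` W))) X (%p. desc R (fst p) (snd p))"
 unfolding cont_iff_filterlim
proof
 have oW: "openin X (q ` W)" by (rule openin_X_q[OF flowD(1)[OF F]])
 have ts: "topspace (prod_topology euclideanreal (subtopology X (q ` W))) = UNIV \<times> q ` W"
  using openin_subset[OF oW] by auto
 show "(%p. desc R (fst p) (snd p)) ` topspace (prod_topology euclideanreal (subtopology X (q ` W))) \<subseteq> topspace X"
  unfolding ts topspace_X using desc_eq[OF F] flowD(5)[OF F] by auto
 show "ALL a:topspace (prod_topology euclideanreal (subtopology X (q ` W))).
    filterlim (%p. desc R (fst p) (snd p)) (nhdsin X (desc R (fst a) (snd a)))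
    (nhdsin (prod_topology euclideanreal (subtopology X (q ` W))) a)"
  unfolding ts
 proof clarify
  fix t :: real and g assume g: "g : W"
  have gG: "g : CG" using flowD(2)[OF F g] .
  have "nhdsin (prod_topology euclideanreal (subtopology X (q ` W))) (t, q g) = nhds t \<times>\<^sub>F nhdsin (subtopology X (q ` W)) (q g)"
   using nhdsin_prod[of t euclideanreal "q g" "subtopology X (q ` W)"] g openin_subset[OF oW] by auto
  also have "nhdsin (subtopology X (q ` W)) (q g) = nhdsin X (q g)"
   by (rule nhdsin_subtop[OF oW]) (use g in blast)
  also have "... = filtermap q (nhdsin T g)" by (rule nhdsin_X[OF gG])
  also have "nhds t \<times>\<^sub>F filtermap q (nhdsin T g) = filtermap (%p. (fst p, q (snd p))) (nhds t \<times>\<^sub>F nhdsin T g)"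
   unfolding prod_filtermap2 by (simp add: apsnd_def map_prod_def case_prod_unfold)
  finally have nh: "nhdsin (prod_topology euclideanreal (subtopology X (q ` W))) (t, q g) =
   filtermap (%p. (fst p, q (snd p))) (nhds t \<times>\<^sub>F nhdsin T g)" .
  have "filterlim q (nhdsin X (q (R t g))) (nhdsin T (R t g))"
   unfolding nhdsin_X[OF flowD(5)[OF F g]] by (simp add: filterlim_def)
  from filterlim_compose[OF this flowD(6)[OF F g]]
  have lim: "filterlim (%p. q (R (fst p) (snd p))) (nhdsin X (q (R t g))) (nhds t \<times>\<^sub>F nhdsin T g)"
   by (simp add: case_prod_unfold)
  have "eventually (%x. x : W) (nhdsin T g)" by (rule ev_nhdsin[OF flowD(1)[OF F] g])
  then have "eventually (%p. snd p : W) (nhds t \<times>\<^sub>F nhdsin T g)"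
   by (rule eventually_compose_filterlim[OF _ filterlim_snd])
  then have "eventually (%p. q (R (fst p) (snd p)) = desc R (fst p) (q (snd p))) (nhds t \<times>\<^sub>F nhdsin T g)"
   by eventually_elim (simp add: desc_eq[OF F])
  then have "filterlim (%p. desc R (fst p) (q (snd p))) (nhdsin X (q (R t g))) (nhds t \<times>\<^sub>F nhdsin T g)"
   using lim by (subst (asm) filterlim_cong[OF refl refl])
  then show "filterlim (%p. desc R (fst p) (snd p)) (nhdsin X (desc R (fst (t, q g)) (snd (t, q g))))
    (nhdsin (prod_topology euclideanreal (subtopology X (q ` W))) (t, q g))"
   unfolding nh filterlim_filtermap by (simp add: desc_eq[OF F g])
 qed
qed

lemma flow_homotopic:
 assumes F: "flow W R"
 shows "homotopic_with (equi (q ` W)) (subtopology X (q ` W)) X id (desc R 1)"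
proof -
 have WX: "q ` W \<subseteq> topspace X" by (rule openin_subset[OF openin_X_q[OF flowD(1)[OF F]]])
 have "homotopic_with (equi (q ` W)) (subtopology X (q ` W)) X (desc R 0) (desc R 1)"
  unfolding homotopic_with_def
 proof (intro exI[of _ "%p. desc R (fst p) (snd p)"] conjI ballI allI)
  show "continuous_map (prod_topology (top_of_set {0..1}) (subtopology X (q ` W))) X (%p. desc R (fst p) (snd p))"
   unfolding prod_topology_subtopology(1) by (rule continuous_map_from_subtopology[OF desc_continuous[OF F]])
 qed (simp_all add: desc_equi[OF F])
 moreover have "homotopic_with (equi (q ` W)) (subtopology X (q ` W)) X id (desc R 0)"
 proof (rule homotopic_with_equal)
  show "continuous_map (subtopology X (q ` W)) X id" by (rule continuous_map_from_subtopology[OF continuous_map_id])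
  fix x assume "x : topspace (subtopology X (q ` W))"
  then obtain g where "g : W" "x = q g" by auto
  then show "id x = desc R 0 x" using desc_eq[OF F, of g 0] flowD(7)[OF F] by simp
 qed (simp_all add: desc_equi[OF F], simp add: equi_def)
 ultimately show ?thesis by (rule homotopic_with_trans[rotated])
qed

definition "good U \<longleftrightarrow> openin X U & (ALL a:H. (%C. a <# C) ` U = U) &
 equivariantly_contractible_to_orbit (subgroup_as_group G H) X (%a C. a <# C) U"

lemma H_invariant_image:
 assumes W: "W \<subseteq> CG" "!!a g. a : H ==> g : W ==> a ** g : W" and a: "a : H"
 shows "(%C. a <# C) ` (q ` W) = q ` W"
proof
 show "(%C. a <# C) ` (q ` W) \<subseteq> q ` W"
 proof clarify
  fix g assume g: "g : W"
  have "a <# q g = q (a ** g)" by (rule act_q[OF H_carrier[OF a]]) (use g W(1) in blast)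
  then show "a <# q g : q ` W" using W(2)[OF a g] by simp
 qed
 show "q ` W \<subseteq> (%C. a <# C) ` (q ` W)"
 proof clarify
  fix g assume g: "g : W"
  then have gG: "g : CG" using W(1) by blast
  have "a <# q (inv a ** g) = q (a ** (inv a ** g))" by (rule act_q) (use H_carrier[OF a] gG in auto)
  then have e: "q g = a <# q (inv a ** g)" unfolding inv_cancel(2)[OF H_carrier[OF a] gG] by simp
  have "q (inv a ** g) : q ` W" using W(2)[OF H_inv[OF a] g] by (rule imageI)
  then show "q g : (%C. a <# C) ` (q ` W)" by (subst e) (erule imageI)
 qed
qed

text \<open>Mapping into one orbit is enough: by equivariance the image of a nonempty invariant set
  is the whole orbit. The empty set is excluded because its image is not an orbit.\<close>

lemma contractibleI:
 assumes U: "U ~= {}" "!!a C. a : H ==> C : U ==> a <# C : U" and x: "x : topspace X"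
  and r: "equi U r" "r ` U \<subseteq> {a <# x |a. a : H}"
  and hom: "homotopic_with (equi U) (subtopology X U) X id r"
 shows "equivariantly_contractible_to_orbit (subgroup_as_group G H) X (%a C. a <# C) U"
 unfolding equivariantly_contractible_to_orbit_def
proof (intro exI[of _ r] bexI[OF _ x] conjI)
 obtain g0 where g0: "g0 : CG" "x = q g0" using x topspace_X by auto
 have orb: "orbit (subgroup_as_group G H) (%a C. a <# C) x = {a <# x |a. a : H}"
  by (simp add: orbit_def subgroup_as_group_def)
 obtain C where C: "C : U" using U(1) by blast
 then obtain a where a: "a : H" "r C = a <# x" using r(2) by blast
 have "b <# x : r ` U" if b: "b : H" for b
 proof -
  have "(b ** inv a) : H" using H_mult[OF b H_inv[OF a(1)]] .
  then have "r ((b ** inv a) <# C) = (b ** inv a) <# (a <# x)" using r(1) C a(2) by (simp add: equi_def)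
  also have "... = b <# x" unfolding g0(2)
   using act_q[OF H_carrier[OF a(1)] g0(1)] act_q[of "b ** inv a" "a ** g0"] act_q[OF H_carrier[OF b] g0(1)] H_carrier[OF a(1)] H_carrier[OF b] g0(1)
   by (simp add: m_assoc inv_cancel)
  finally have e: "b <# x = r ((b ** inv a) <# C)" by simp
  show ?thesis unfolding e using U(2)[OF \<open>(b ** inv a) : H\<close> C] by (rule imageI)
 qed
 then show "r ` U = orbit (subgroup_as_group G H) (%a C. a <# C) x" unfolding orb using r(2) by blast
 show "homotopic_with (%f. ALL k:carrier (subgroup_as_group G H). ALL y:U. f (k <# y) = k <# f y) (subtopology X U) X id r"
  using hom by (simp add: equi_def[abs_def] subgroup_as_group_def)
qed

lemma tube_good:
 assumes tb: "tube g0 W R" and g0: "g0 : CG"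
 shows "good (q ` W)"
proof -
 have F: "flow W R" and g0W: "g0 : W" and R1: "!!g. g : W ==> EX a:H. EX k:K. R 1 g = a ** g0 ** k"
  using tb unfolding tube_def flow_def by blast+
 have WG: "W \<subseteq> CG" using flowD(2)[OF F] by blast
 have inv: "(%C. a <# C) ` (q ` W) = q ` W" if "a : H" for a
  by (rule H_invariant_image[OF WG _ that]) (use flow_left[OF F] in blast)
 have "equivariantly_contractible_to_orbit (subgroup_as_group G H) X (%a C. a <# C) (q ` W)"
 proof (rule contractibleI[OF _ _ _ desc_equi[OF F] _ flow_homotopic[OF F]])
  show "q ` W ~= {}" using g0W by blast
  show "a <# C : q ` W" if "a : H" "C : q ` W" for a C using inv[OF that(1)] that(2) by blast
  show "q g0 : topspace X" using g0 topspace_X by blast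
  show "desc R 1 ` q ` W \<subseteq> {a <# q g0 |a. a : H}"
  proof clarify
   fix g assume g: "g : W"
   obtain a k where ak: "a : H" "k : K" "R 1 g = a ** g0 ** k" using R1[OF g] by blast
   have "desc R 1 (q g) = q (a ** g0)" unfolding desc_eq[OF F g] ak(3)
    by (rule q_mult) (use g0 H_carrier[OF ak(1)] ak(2) in auto)
   then have "desc R 1 (q g) = a <# q g0" using act_q[OF H_carrier[OF ak(1)] g0] by simp
   then show "EX a. desc R 1 (q g) = a <# q g0 & a : H" using ak(1) by blast
  qed
 qed
 then show ?thesis unfolding good_def using inv openin_X_q[OF flowD(1)[OF F]] by blast
qed

text \<open>The time-one map is equivariantly homotopic to the identity, so a contraction of U,
  composed with it, contracts the preimage.\<close>

lemma good_pullback: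
 assumes F: "flow CG R" and U: "good U" and ne: "{C : topspace X. desc R 1 C : U} ~= {}"
 shows "good {C : topspace X. desc R 1 C : U}" (is "good ?V")
proof -
 have e: "subtopology X (q ` CG) = X" using subtopology_topspace[of X] by (simp only: topspace_X)
 have hom: "homotopic_with (equi (topspace X)) X X id (desc R 1)"
  using flow_homotopic[OF F] e topspace_X by simp
 then have ct: "continuous_map X X (desc R 1)" by (rule homotopic_with_imp_continuous_maps[THEN conjunct2])
 have eq: "equi (topspace X) (desc R 1)" using desc_equi[OF F] topspace_X by simp
 have Uo: "openin X U" and Ui: "!!a. a : H ==> (%C. a <# C) ` U = U"
  and Uc: "equivariantly_contractible_to_orbit (subgroup_as_group G H) X (%a C. a <# C) U"
  using U unfolding good_def by blast+
 have V: "openin X ?V" by (rule openin_continuous_map_preimage[OF ct Uo])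
 have actX: "a <# C : topspace X" if "a : H" "C : topspace X" for a C
  using that topspace_X act_q H_carrier by auto
 have Vc: "a <# C : ?V" if "a : H" "C : ?V" for a C
  using that actX eq Ui[OF that(1)] by (auto simp: equi_def)
 obtain r x where x: "x : topspace X" and r: "r ` U = orbit (subgroup_as_group G H) (%a C. a <# C) x"
  and rh: "homotopic_with (equi U) (subtopology X U) X id r"
  using Uc unfolding equivariantly_contractible_to_orbit_def by (auto simp: equi_def[abs_def] subgroup_as_group_def)
 have "homotopic_with (equi ?V) (subtopology X ?V) X id (desc R 1)"
 proof -
  have "homotopic_with (equi ?V) (subtopology X ?V) X (id o id) (desc R 1 o id)"
   by (rule homotopic_with_compose_continuous_map_right[OF hom])
    (auto simp: equi_def intro: continuous_map_from_subtopology)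
  then show ?thesis by simp
 qed
 moreover have "homotopic_with (equi ?V) (subtopology X ?V) X (id o desc R 1) (r o desc R 1)"
 proof (rule homotopic_with_compose_continuous_map_right[OF rh])
  show "continuous_map (subtopology X ?V) (subtopology X U) (desc R 1)"
   by (rule continuous_map_into_subtopology[OF continuous_map_from_subtopology[OF ct]]) auto
  show "equi ?V (j o desc R 1)" if "equi U j" for j using that eq by (auto simp: equi_def)
 qed
 ultimately have hr: "homotopic_with (equi ?V) (subtopology X ?V) X id (r o desc R 1)"
  using homotopic_with_trans by fastforce
 have "equivariantly_contractible_to_orbit (subgroup_as_group G H) X (%a C. a <# C) ?V"
 proof (rule contractibleI[OF ne _ x _ _ hr])
  show "a <# C : ?V" if "a : H" "C : ?V" for a C by (rule Vc[OF that])
  have "equi U r" using homotopic_with_imp_property[OF rh] by blast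
  then show "equi ?V (r o desc R 1)" using eq by (auto simp: equi_def)
  show "(r o desc R 1) ` ?V \<subseteq> {a <# x |a. a : H}"
  proof clarify
   fix C assume "C : topspace X" "desc R 1 C : U"
   then have "r (desc R 1 C) : r ` U" by (intro imageI)
   then show "EX a. (r o desc R 1) C = a <# x & a : H"
    unfolding r orbit_def subgroup_as_group_def by auto
  qed
 qed
 moreover have "(%C. a <# C) ` ?V = ?V" if a: "a : H" for a
 proof
  show "(%C. a <# C) ` ?V \<subseteq> ?V" using Vc[OF a] by blast
  show "?V \<subseteq> (%C. a <# C) ` ?V"
  proof
   fix C assume C: "C : ?V"
   then obtain g where g: "g : CG" "C = q g" using topspace_X by auto
   have e: "C = a <# (inv a <# C)" unfolding g(2)
    using act_q[of "inv a" g] act_q[of a "inv a ** g"] H_carrier[OF a] g(1) inv_cancel(2)[of a g] by simp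
   show "C : (%C. a <# C) ` ?V" by (subst e) (intro imageI Vc[OF H_inv[OF a] C])
  qed
 qed
 ultimately show ?thesis unfolding good_def using V by blast
qed

end


text \<open>Here D g is the differential of f at g in the left trivialization, given through
  derivatives along one-parameter subgroups. The reduced function of the perturbation problem is of
  this kind.\<close>

locale inv_function = closed_pair +
 fixes f :: "'a => real" and D :: "'a => 'b => real" and C :: "'a set"
 assumes f_left: "a : H ==> g : CG ==> f (a ** g) = f g"
  and f_right: "k : K ==> g : CG ==> f (g ** k) = f g"
  and f_cont: "g : CG ==> (f ---> f g) (nhdsin T g)"
  and D_lin: "g : CG ==> linear (D g)"
  and D_deriv: "g : CG ==> ((%t. f (g ** Exp (t *. v))) has_real_derivative D g v) (at 0)"
  and D_cont: "g : CG ==> ((%x. D x v) ---> D g v) (nhdsin T g)"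
  and C: "compactin T C" "g : CG ==> EX a:H. a ** g : C"
begin

text \<open>Because \<open>dual_vec\<close> is equivariant, xi (g ** k) is Ad (inv k) (xi g), which
  is what lets the deformation commute with right multiplication by K.\<close>

definition "xi g = Adj.dual_vec (D g)"
definition "slope g = D g (xi g)"

lemma D_left: "a : H ==> g : CG ==> D (a ** g) = D g"
proof
 fix v assume a: "a : H" and g: "g : CG"
 have "f (a ** g ** Exp (t *. v)) = f (g ** Exp (t *. v))" for t
  using f_left[OF a, of "g ** Exp (t *. v)"] H_carrier[OF a] g by (simp add: m_assoc)
 then have "((%t. f (g ** Exp (t *. v))) has_real_derivative D (a ** g) v) (at 0)"
  using D_deriv[of "a ** g" v] H_carrier[OF a] g by simp
 then show "D (a ** g) v = D g v" using D_deriv[OF g, of v] by (rule DERIV_unique)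
qed

lemma D_right: "k : K ==> g : CG ==> D (g ** k) = (%v. D g (Ad k v))"
proof
 fix v assume k: "k : K" and g: "g : CG"
 have kG: "k : CG" by (rule K_carrier[OF k])
 have "f (g ** k ** Exp (t *. v)) = f (g ** Exp (t *. Ad k v))" for t
 proof -
  have "Exp (t *. Ad k v) ** k = k ** Exp (t *. v)"
   unfolding linear_scale[OF Ad_linear[OF kG], symmetric] Exp_conj[OF kG, symmetric] using kG by (simp add: m_assoc)
  then have "g ** k ** Exp (t *. v) = (g ** Exp (t *. Ad k v)) ** k" using g kG by (simp add: m_assoc)
  then show ?thesis using f_right[OF k] g by simp
 qed
 then have "((%t. f (g ** Exp (t *. Ad k v))) has_real_derivative D (g ** k) v) (at 0)"
  using D_deriv[of "g ** k" v] kG g by simp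
 then show "D (g ** k) v = D g (Ad k v)" using D_deriv[OF g, of "Ad k v"] by (rule DERIV_unique)
qed

lemma xi_left: "a : H ==> g : CG ==> xi (a ** g) = xi g"
 by (simp add: xi_def D_left)

lemma slope_left: "a : H ==> g : CG ==> slope (a ** g) = slope g"
 by (simp add: slope_def D_left xi_left)

lemma xi_right: "k : K ==> g : CG ==> xi (g ** k) = Ad (inv k) (xi g)"
 unfolding xi_def by (simp add: D_right Adj.dual_vec_equivariant D_lin)

lemma slope_right: "k : K ==> g : CG ==> slope (g ** k) = slope g"
 unfolding slope_def by (simp add: D_right xi_right Adj.rep_inv)

lemma D_lin_ev: "eventually (%x. linear (D x)) (nhdsin T g)"
 using ev_topspace[of T g] by eventually_elim (simp add: D_lin)

lemma xi_cont: "g : CG ==> (xi ---> xi g) (nhdsin T g)"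
 unfolding xi_def by (rule Adj.dual_vec_tendsto[OF D_lin_ev D_lin D_cont])

lemma D_cont2:
 assumes g: "g : CG" and p: "filterlim p (nhdsin T g) F" and w: "(w ---> w0) F"
 shows "((%x. D (p x) (w x)) ---> D g w0) F"
 by (rule lin_family_tendsto[OF fd eventually_compose_filterlim[OF D_lin_ev p] D_lin[OF g] _ w])
  (rule filterlim_compose[OF D_cont[OF g] p])

lemma slope_cont: "g : CG ==> (slope ---> slope g) (nhdsin T g)"
 unfolding slope_def by (intro D_cont2 filterlim_ident xi_cont)

lemma slope_pos: "g : CG ==> D g v ~= 0 ==> slope g > 0"
 unfolding slope_def xi_def by (rule Adj.dual_vec_pos[OF D_lin])

lemma line_derivative:
 assumes g: "g : CG"
 shows "((%s. f (g ** Exp ((- s) *. v))) has_real_derivative - D (g ** Exp ((- s) *. v)) v) (at s)"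
proof -
 let ?p = "g ** Exp ((- s) *. v)"
 have p: "?p : CG" using g by simp
 have "((%x. - (x - s)) has_real_derivative - 1) (at s)" by (auto intro!: derivative_eq_intros)
 moreover have "((%t. f (?p ** Exp (t *. v))) has_real_derivative D ?p v) (at (- (s - s)))"
  using D_deriv[OF p] by simp
 ultimately have "((%x. f (?p ** Exp ((- (x - s)) *. v))) has_real_derivative D ?p v * - 1) (at s)"
  by (intro DERIV_chain2[where f = "%t. f (?p ** Exp (t *. v))" and g = "%x. - (x - s)"])
 moreover have "?p ** Exp ((- (x - s)) *. v) = g ** Exp ((- x) *. v)" for x
  using Exp_add[of "- s" "- (x - s)" v] g by (simp add: m_assoc)
 ultimately show ?thesis by simp
qed

text \<open>Each point is moved along the one-parameter subgroup in its initial direction. Over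
  short times, uniform because C is compact, the rate of decrease stays within c / 2 of its initial
  value \<open>slope g\<close>, so no integral curves of the field are needed. Outside W the slope
  is bounded below, again by compactness.\<close>

lemma deformation:
 assumes W: "openin T W" "!!a g. a : H ==> g : CG ==> a ** g : W ==> g : W"
  and crit: "!!g. g : CG ==> (!!v. D g v = 0) ==> g : W"
 obtains R d where "flow CG R" "d > 0" "!!g. g : CG ==> f (R 1 g) \<le> f g"
  "!!g. g : CG ==> g \<notin> W ==> f (R 1 g) \<le> f g - d"
proof -
 have CG: "g : CG" if "g : C" for g using C(1) compactin_subset_topspace that by fastforce
 have "closedin T (topspace T - W)" using W(1) by blast
 then have "compactin T (C - W)"
  using closed_Int_compactin[OF _ C(1)] CG by (metis Diff_Int_distrib Int_Diff Int_absorb1 Int_commute compactin_subset_topspace C(1))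
 then have "eventually (%r. ALL g:C - W. r < slope g) (at_right 0)"
 proof (rule compactin_ev)
  fix g assume g: "g : C - W"
  then have gG: "g : CG" using CG by blast
  have "EX v. D g v ~= 0" using crit[OF gG] g by blast
  then have "slope g > 0" using slope_pos[OF gG] by blast
  then have "eventually (%x. slope x > slope g / 2) (nhdsin T g)" by (intro order_tendstoD(1)[OF slope_cont[OF gG]]) simp
  moreover have "eventually (%r. r < slope g / 2) (at_right 0)" 
   using \<open>slope g > 0\<close> unfolding eventually_at_right_field by (intro exI[of _ "slope g / 2"]) simp
  ultimately show "eventually (%(x, r). r < slope x) (nhdsin T g \<times>\<^sub>F at_right 0)"
   unfolding eventually_prod_filter by (intro exI conjI) auto
 qed
 then obtain c2 where c2: "c2 > 0" "!!r. 0 < r ==> r < c2 ==> ALL g:C - W. r < slope g"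
  by (auto simp: eventually_at_right_field)
 define c where "c = c2 / 4"
 have c: "c > 0" "!!g. g : C - W ==> 2 * c < slope g" using c2(2)[of "2 * c"] c2(1) by (auto simp: c_def)
 have "eventually (%s. ALL g:C. \<bar>D (g ** Exp ((- s) *. xi g)) (xi g) - slope g\<bar> < c / 2) (nhds 0)"
 proof (rule compactin_ev[OF C(1)])
  fix g assume "g : C"
  then have gG: "g : CG" by (rule CG)
  let ?F = "nhdsin T g \<times>\<^sub>F nhds (0::real)"
  have xi: "((%p. xi (fst p)) ---> xi g) ?F" by (rule filterlim_compose[OF xi_cont[OF gG] filterlim_fst])
  have "filterlim (%p. fst p ** Exp ((- snd p) *. xi (fst p))) (nhdsin T (g ** Exp ((- 0) *. xi g))) ?F"
   by (intro mult_lim filterlim_fst Exp_lim tendsto_scaleR xi tendsto_minus filterlim_snd) (use gG in auto)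
  then have "filterlim (%p. fst p ** Exp ((- snd p) *. xi (fst p))) (nhdsin T g) ?F" using gG by simp
  then have "((%p. D (fst p ** Exp ((- snd p) *. xi (fst p))) (xi (fst p)) - slope (fst p)) ---> D g (xi g) - slope g) ?F"
   by (intro tendsto_diff D_cont2 gG xi filterlim_compose[OF slope_cont[OF gG] filterlim_fst])
  then have "((%p. \<bar>D (fst p ** Exp ((- snd p) *. xi (fst p))) (xi (fst p)) - slope (fst p)\<bar>) ---> \<bar>0\<bar>) ?F"
   by (intro tendsto_rabs) (simp add: slope_def)
  then have "eventually (%p. \<bar>D (fst p ** Exp ((- snd p) *. xi (fst p))) (xi (fst p)) - slope (fst p)\<bar> < c / 2) ?F"
   by (rule order_tendstoD(2)) (use c in simp)
  then show "eventually (%(g, s). \<bar>D (g ** Exp ((- s) *. xi g)) (xi g) - slope g\<bar> < c / 2) ?F"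
   by (simp add: case_prod_unfold)
 qed
 then obtain s0 where s0: "s0 > 0" "!!s g. \<bar>s\<bar> < s0 ==> g : C ==> \<bar>D (g ** Exp ((- s) *. xi g)) (xi g) - slope g\<bar> < c / 2"
  unfolding eventually_nhds_metric by (auto simp: dist_real_def)
 have "eventually (%b. ALL g:C. slope g < b) at_top"
 proof (rule compactin_ev[OF C(1)])
  fix g assume "g : C"
  then have gG: "g : CG" by (rule CG)
  have "eventually (%x. slope x < slope g + 1) (nhdsin T g)" by (intro order_tendstoD(2)[OF slope_cont[OF gG]]) simp
  moreover have "eventually (%b. b \<ge> slope g + 1) at_top" by (rule eventually_ge_at_top)
  ultimately have "eventually (%p. slope (fst p) < slope g + 1 & slope g + 1 \<le> snd p) (nhdsin T g \<times>\<^sub>F at_top)"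
   by (rule eventually_prodI)
  then show "eventually (%(x, b). slope x < b) (nhdsin T g \<times>\<^sub>F at_top)" by (rule eventually_mono) auto
 qed
 then obtain b where b': "!!g. g : C ==> slope g < b" unfolding eventually_at_top_linorder by blast
 have b: "slope g < \<bar>b\<bar> + 1" if "g : C" for g using b'[OF that] by linarith
 \<comment> \<open>Keeps the total time \<tau> * \<theta> g at most s0 / 2, since \<theta> is below
   \<bar>b\<bar> + 1 on C.\<close>
 define \<tau> where "\<tau> = s0 / (2 * (\<bar>b\<bar> + 1))"
 have \<tau>: "\<tau> > 0" using s0 by (simp add: \<tau>_def)
 \<comment> \<open>A continuous cutoff. Where the slope is at most c nothing moves; where it exceeds
   c the decrease is at least c / 2 per unit time; outside W the slope exceeds 2 * c, so that
   \<theta> is at least c.\<close>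
 define \<theta> where "\<theta> g = max 0 (slope g - c)" for g
 define R where "R t g = g ** Exp ((- (t * \<tau> * \<theta> g)) *. xi g)" for t g
 have \<theta>_left: "\<theta> (a ** g) = \<theta> g" if "a : H" "g : CG" for a g using that by (simp add: \<theta>_def slope_left)
 have R_left: "R t (a ** g) = a ** R t g" if "a : H" "g : CG" for a g t
  using that H_carrier by (simp add: R_def \<theta>_left xi_left m_assoc)
 have R_right: "R t (g ** k) = R t g ** k" if k: "k : K" and g: "g : CG" for k g t
 proof -
  have kG: "k : CG" "inv k : CG" using K_carrier[OF k] by auto
  let ?s = "- (t * \<tau> * \<theta> g)"
  have \<theta>: "\<theta> (g ** k) = \<theta> g" using k g by (simp add: \<theta>_def slope_right)
  have "R t (g ** k) = g ** k ** Exp (Ad (inv k) (?s *. xi g))"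
   unfolding R_def \<theta> by (simp only: xi_right[OF k g] linear_scale[OF Ad_linear[OF kG(2)]])
  also have "... = g ** k ** (inv k ** Exp (?s *. xi g) ** k)"
   using Exp_conj[OF kG(2), of "?s *. xi g"] kG by (simp only: inv_inv)
  also have "... = R t g ** k" unfolding R_def using g kG by (simp add: m_assoc inv_cancel)
  finally show ?thesis .
 qed
 have RG: "R t g : CG" if "g : CG" for t g using that by (simp add: R_def)
 have flow: "flow CG R"
  unfolding flow_def
 proof (intro conjI ballI allI)
  show "openin T CG" using openin_topspace[of T] by simp
  fix a g k assume a: "a : H" and g: "g : CG" and k: "k : K"
  show "a ** g ** k : CG" using a g k H_carrier K_carrier by simp
  show "R t (a ** g ** k) = a ** R t g ** k" for t
   using R_right[OF k, of "a ** g"] R_left[OF a g] H_carrier[OF a] g by simp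
 next
  fix t g assume g: "g : CG"
  show "R t g : CG" by (rule RG[OF g])
  let ?F = "nhds t \<times>\<^sub>F nhdsin T g"
  have "((%p. \<theta> (snd p)) ---> \<theta> g) ?F"
   unfolding \<theta>_def by (intro tendsto_max tendsto_const tendsto_diff filterlim_compose[OF slope_cont[OF g] filterlim_snd])
  then have "filterlim (%p. R (fst p) (snd p)) (nhdsin T (R t g)) ?F"
   unfolding R_def
   by (intro mult_lim filterlim_snd Exp_lim tendsto_scaleR tendsto_minus tendsto_mult filterlim_fst tendsto_const
     filterlim_compose[OF xi_cont[OF g] filterlim_snd]) (use g in auto)
  then show "filterlim (%(t, g). R t g) (nhdsin T (R t g)) ?F" by (simp add: case_prod_unfold)
 next
  fix g assume "g : CG"
  then show "R 0 g = g" by (simp add: R_def)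
 qed
 have main: "f (R 1 g) \<le> f g - c / 2 * (\<tau> * \<theta> g)" if g: "g : C" for g
 proof (cases "slope g \<le> c")
  case True
  then have "\<theta> g = 0" by (simp add: \<theta>_def)
  then show ?thesis using CG[OF g] by (simp add: R_def)
 next
  case False
  have gG: "g : CG" by (rule CG[OF g])
  let ?s = "\<tau> * \<theta> g"
  have s: "?s \<ge> 0" using \<tau> by (simp add: \<theta>_def)
  have "\<theta> g \<le> \<bar>b\<bar> + 1" using b[OF g] c(1) by (simp add: \<theta>_def)
  then have "?s \<le> \<tau> * (\<bar>b\<bar> + 1)" using \<tau> by (intro mult_left_mono) auto
  also have "... = s0 / 2" unfolding \<tau>_def by (simp add: field_simps)
  finally have s2: "?s \<le> s0 / 2" .
  have "f (g ** Exp ((- ?s) *. xi g)) + c / 2 * ?s \<le> f (g ** Exp ((- 0) *. xi g)) + c / 2 * 0"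
  proof (rule DERIV_nonpos_imp_nonincreasing[OF s])
   fix x assume x: "0 \<le> x" "x \<le> ?s"
   have "\<bar>D (g ** Exp ((- x) *. xi g)) (xi g) - slope g\<bar> < c / 2" by (rule s0(2)[OF _ g]) (use x s2 s0(1) in auto)
   then have "- D (g ** Exp ((- x) *. xi g)) (xi g) + c / 2 * 1 \<le> 0" using False by linarith
   moreover have "((%x. f (g ** Exp ((- x) *. xi g)) + c / 2 * x) has_real_derivative
     - D (g ** Exp ((- x) *. xi g)) (xi g) + c / 2 * 1) (at x)"
    by (intro DERIV_add line_derivative[OF gG] DERIV_cmult DERIV_ident)
   ultimately show "EX y. ((%x. f (g ** Exp ((- x) *. xi g)) + c / 2 * x) has_real_derivative y) (at x) & y \<le> 0"
    by blast
  qed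
  then show ?thesis using gG by (simp add: R_def)
 qed
 have all: "f (R 1 g) \<le> f g - c / 2 * (\<tau> * \<theta> g)" if g: "g : CG" for g
 proof -
  obtain a where a: "a : H" "a ** g : C" using C(2)[OF g] by blast
  show ?thesis using main[OF a(2)] f_left[OF a(1) RG[OF g]] f_left[OF a(1) g] R_left[OF a(1) g] \<theta>_left[OF a(1) g] by simp
 qed
 show ?thesis
 proof (rule that[OF flow])
  show "c / 2 * (\<tau> * c) > 0" using c \<tau> by simp
  fix g assume g: "g : CG"
  have "c / 2 * (\<tau> * \<theta> g) \<ge> 0" using c \<tau> by (simp add: \<theta>_def)
  then show "f (R 1 g) \<le> f g" using all[OF g] by simp
  assume "g \<notin> W"
  obtain a where a: "a : H" "a ** g : C" using C(2)[OF g] by blast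
  then have "a ** g : C - W" using W(2)[OF a(1) g] \<open>g \<notin> W\<close> by blast
  then have "2 * c < slope g" using c(2) slope_left[OF a(1) g] by fastforce
  then have "c \<le> \<theta> g" by (simp add: \<theta>_def)
  then have "c / 2 * (\<tau> * c) \<le> c / 2 * (\<tau> * \<theta> g)" using c \<tau> by (intro mult_left_mono) auto
  then show "f (R 1 g) \<le> f g - c / 2 * (\<tau> * c)" using all[OF g] by simp
 qed
qed

section \<open>Covering sublevel sets\<close>

definition "covered A n \<longleftrightarrow> (EX \<U>. finite \<U> & card \<U> \<le> n & (ALL U:\<U>. good U) & q ` A \<subseteq> \<Union>\<U>)"

lemma covered_empty: "covered {} 0"
 unfolding covered_def by (intro exI[of _ "{}"]) simp

lemma covered_pullback:
 assumes F: "flow CG R" and A: "covered A n" and B: "B \<subseteq> CG" "!!g. g : B ==> R 1 g : A"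
 shows "covered B n"
proof -
 obtain \<U> where \<U>: "finite \<U>" "card \<U> \<le> n" "!!U. U : \<U> ==> good U" "q ` A \<subseteq> \<Union>\<U>" using A unfolding covered_def by blast
 let ?p = "%U. {C : topspace X. desc R 1 C : U}"
 show ?thesis unfolding covered_def
 \<comment> \<open>Empty preimages are discarded because the empty set does not contract onto an
   orbit.\<close>
 proof (intro exI[of _ "?p ` \<U> - {{}}"] conjI ballI)
  show "finite (?p ` \<U> - {{}})" using \<U>(1) by simp
  have "card (?p ` \<U> - {{}}) \<le> card (?p ` \<U>)" by (rule card_mono) (use \<U>(1) in auto)
  also have "... \<le> card \<U>" by (rule card_image_le[OF \<U>(1)])
  finally show "card (?p ` \<U> - {{}}) \<le> n" using \<U>(2) by simp
  show "good V" if V: "V : ?p ` \<U> - {{}}" for V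
  proof -
   obtain U where U: "U : \<U>" "V = ?p U" "?p U ~= {}" using V by auto
   show ?thesis unfolding U(2) by (rule good_pullback[OF F \<U>(3)[OF U(1)] U(3)])
  qed
  show "q ` B \<subseteq> \<Union> (?p ` \<U> - {{}})"
  proof clarify
   fix g assume g: "g : B"
   then have gG: "g : CG" using B(1) by blast
   obtain U where U: "U : \<U>" "q (R 1 g) : U" using \<U>(4) B(2)[OF g] by blast
   then have "q g : ?p U" using desc_eq[OF F gG, of 1] topspace_X gG by auto
   then show "q g : \<Union> (?p ` \<U> - {{}})" using U(1) by blast
  qed
 qed
qed

lemma covered_Un:
 assumes A: "covered A n" and I: "finite I" "!!i. i : I ==> good (U i)" "card I + n \<le> m"
  and B: "!!g. g : B ==> g : A \<or> (EX i:I. q g : U i)"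
 shows "covered B m"
proof -
 obtain \<U> where \<U>: "finite \<U>" "card \<U> \<le> n" "!!U. U : \<U> ==> good U" "q ` A \<subseteq> \<Union>\<U>" using A unfolding covered_def by blast
 have "card (U ` I Un \<U>) \<le> card (U ` I) + card \<U>" by (rule card_Un_le)
 also have "... \<le> m" using card_image_le[OF I(1), of U] \<U>(2) I(3) by linarith
 finally have "card (U ` I Un \<U>) \<le> m" .
 moreover have "q ` B \<subseteq> \<Union> (U ` I Un \<U>)" using B \<U>(4) by blast
 ultimately show ?thesis unfolding covered_def using \<U>(1,3) I(1,2) by (intro exI[of _ "U ` I Un \<U>"]) auto
qed

text \<open>The Lyusternik-Schnirelmann inequality with critical points grouped into clumps, each
  inside one good set and at one critical value. The sublevel set at b is covered by as many good
  sets as there are clumps with value at most b: passing a level c adds the sets of the clumps at c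
  and pulls the rest below c by the deformation.\<close>

theorem critical_clumps:
 assumes I: "finite I" "!!i. i : I ==> good (U i)"
  and crit: "!!g. g : CG ==> (!!v. D g v = 0) ==> EX i:I. q g : U i & f g = v i"
 shows "equivariant_category (subgroup_as_group G H) X (%a C. a <# C) \<le> enat (card I)"
proof -
 let ?n = "%b. card {i : I. v i \<le> b}"
 let ?L = "%b. {g : CG. f g \<le> b}"
 let ?P = "%b. covered (?L b) (?n b)"
 have Uq: "openin T {g : CG. q g : U i}" if "i : I" for i
  using I(2)[OF that] openin_X_iff unfolding good_def by blast
 have fct: "continuous_map T euclideanreal f"
  unfolding cont_iff_filterlim using f_cont by auto
 have step: "EX e>0. ALL x. c - e < x --> x < c --> ?P x --> (ALL y. c \<le> y --> y < c + e --> ?P y)" for c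
 proof -
  obtain \<eta> where \<eta>: "\<eta> > 0" "!!i. i : I ==> v i ~= c ==> \<bar>v i - c\<bar> > \<eta>"
  proof -
   \<comment> \<open>The 1 keeps the minimum defined when no other value occurs, and halving the
     minimum makes the bound strict.\<close>
   let ?S = "insert 1 ((%i. \<bar>v i - c\<bar>) ` {i : I. v i ~= c})"
   have fin: "finite ?S" using I(1) by simp
   have pos: "Min ?S > 0" using fin by (subst Min_gr_iff) auto
   show ?thesis
   proof (rule that[of "Min ?S / 2"])
    show "Min ?S / 2 > 0" using pos by simp
    fix i assume "i : I" "v i ~= c"
    then have "Min ?S \<le> \<bar>v i - c\<bar>" by (intro Min_le[OF fin]) auto
    then show "Min ?S / 2 < \<bar>v i - c\<bar>" using pos by simp
   qed
  qed
  let ?J = "{i : I. v i = c}"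
  \<comment> \<open>Points with value farther than \<eta> from c are put into W too, so that
    critical points at other levels do not prevent the deformation from decreasing f near level
    c.\<close>
  define W where "W = (\<Union>i\<in>?J. {g : CG. q g : U i}) Un {g : topspace T. f g : - cball c \<eta>}"
  have W: "openin T W" unfolding W_def
  proof (intro openin_Un openin_Union ballI)
   show "openin T {g : topspace T. f g : - cball c \<eta>}" by (rule openin_continuous_map_preimage[OF fct]) auto
  qed (use Uq in auto)
  have Winv: "g : W" if a: "a : H" and g: "g : CG" and ag: "a ** g : W" for a g
  proof -
   have "q g : U i" if "i : I" "q (a ** g) : U i" for i
   proof -
    have "inv a <# q (a ** g) = q (inv a ** (a ** g))" by (rule act_q) (use H_carrier[OF a] g in auto)
    also have "... = q g" using inv_cancel(1)[OF H_carrier[OF a] g] by simp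
    finally have e: "inv a <# q (a ** g) = q g" .
    have "inv a <# q (a ** g) : (%C. inv a <# C) ` U i" using that(2) by (rule imageI)
    then show ?thesis using I(2)[OF that(1)] H_inv[OF a] e unfolding good_def by auto
   qed
   then show ?thesis using ag g f_left[OF a g] unfolding W_def by auto
  qed
  have Wcrit: "g : W" if g: "g : CG" "!!v. D g v = 0" for g
  proof -
   obtain i where i: "i : I" "q g : U i" "f g = v i" using crit[OF g] by blast
   show ?thesis
   proof (cases "v i = c")
    case True
    then show ?thesis unfolding W_def using i g(1) by blast
   next
    case False
    then show ?thesis unfolding W_def using \<eta>(2)[OF i(1)] i(3) g(1) by (auto simp: dist_real_def)
   qed
  qed
  obtain R d where R: "flow CG R" "d > 0" "!!g. g : CG ==> f (R 1 g) \<le> f g"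
   "!!g. g : CG ==> g \<notin> W ==> f (R 1 g) \<le> f g - d"
   by (rule deformation[OF W Winv Wcrit]) (assumption+, rule that)
  \<comment> \<open>A decrease by d takes values below c + e to values below c - e, hence below x.
    Points of W that lie outside the clumps at c are already below c - \<eta>.\<close>
  define e where "e = min \<eta> (d / 2)"
  have e: "e > 0" "e \<le> \<eta>" "e \<le> d / 2" using \<eta>(1) R(2) by (auto simp: e_def)
  show ?thesis
  proof (intro exI[of _ e] conjI e(1) allI impI)
   fix x y assume x: "c - e < x" "x < c" and Px: "?P x" and y: "c \<le> y" "y < c + e"
   have "covered {g : CG. f (R 1 g) \<le> x} (?n x)"
    by (rule covered_pullback[OF R(1) Px]) (use flowD(5)[OF R(1)] in auto)
   then show "?P y"
   proof (rule covered_Un)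
    show "finite ?J" using I(1) by simp
    show "good (U i)" if "i : ?J" for i using I(2) that by simp
    have "card ?J + ?n x = card (?J Un {i : I. v i \<le> x})" by (rule card_Un_disjoint[symmetric]) (use I(1) x in auto)
    also have "... \<le> ?n y" by (rule card_mono) (use I(1) x y in auto)
    finally show "card ?J + ?n x \<le> ?n y" .
    fix g assume "g : ?L y"
    then have g: "g : CG" "f g \<le> y" by auto
    show "g : {g : CG. f (R 1 g) \<le> x} \<or> (EX i:?J. q g : U i)"
    proof (cases "g : W")
     case False
     then show ?thesis using R(4)[OF g(1)] g x y e by auto
    next
     case True
     then consider "EX i:?J. q g : U i" | "\<bar>f g - c\<bar> > \<eta>" unfolding W_def by (auto simp: dist_real_def)
     then show ?thesis
     proof cases
      case 2
      then have "f g < c - \<eta>" using g(2) y e by linarith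
      then show ?thesis using R(3)[OF g(1)] g(1) x e by auto
     qed blast
    qed
   qed
  qed
 qed
 have CG: "g : CG" if "g : C" for g using C(1) compactin_subset_topspace that by fastforce
 have bd: "EX B. ALL g:CG. \<bar>f g\<bar> \<le> B"
 proof -
  have "compactin euclideanreal (f ` C)" by (rule image_compactin[OF C(1) fct])
  then have "bounded (f ` C)" using compact_imp_bounded by (simp add: compactin_euclidean_iff)
  then obtain B where B: "!!g. g : C ==> \<bar>f g\<bar> \<le> B" unfolding bounded_iff by auto
  have "\<bar>f g\<bar> \<le> B" if g: "g : CG" for g
  proof -
   obtain a where a: "a : H" "a ** g : C" using C(2)[OF g] by blast
   show ?thesis using B[OF a(2)] f_left[OF a(1) g] by simp
  qed
  then show ?thesis by blast
 qed
 then obtain B where B: "!!g. g : CG ==> \<bar>f g\<bar> \<le> B" by blast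
 have low: "?P b" if "b < - B" for b
 proof -
  have "?L b = {}" using B that by force
  then show ?thesis using covered_empty unfolding covered_def by (auto intro!: exI[of _ "{}"])
 qed
 \<comment> \<open>Induction over the reals: the supremum of the levels up to which the claim holds
   could be pushed further by \<open>step\<close>.\<close>
 have all: "?P b" for b
 proof (rule ccontr)
  assume nb: "\<not> ?P b"
  let ?A = "{x. ALL y<=x. ?P y}"
  have A1: "- B - 1 : ?A" using low by auto
  have A2: "x \<le> b" if "x : ?A" for x
  proof (rule ccontr)
   assume "\<not> x \<le> b"
   then have "b \<le> x" by simp
   then show False using that nb by blast
  qed
  then have bdd: "bdd_above ?A" by (rule bdd_aboveI)
  obtain e where e: "e > 0" "!!x y. Sup ?A - e < x ==> x < Sup ?A ==> ?P x ==> Sup ?A \<le> y ==> y < Sup ?A + e ==> ?P y"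
   using step[of "Sup ?A"] by blast
  have up: "?P x" if x: "x < Sup ?A" for x
  proof -
   have "EX z:?A. x < z" using less_cSup_iff[of ?A x] A1 bdd x by blast
   then show ?thesis using less_imp_le by blast
  qed
  have "?P y" if y: "y \<le> Sup ?A + e / 2" for y
  proof (cases "y < Sup ?A")
   case False
   show ?thesis by (rule e(2)[of "Sup ?A - e / 2"]) (use e(1) up y False in auto)
  qed (rule up)
  then have "Sup ?A + e / 2 : ?A" by blast
  then have "Sup ?A + e / 2 \<le> Sup ?A" by (rule cSup_upper[OF _ bdd])
  then show False using e(1) by simp
 qed
 have "?L B = CG" using B by force
 with all[of B] obtain \<U> where \<U>: "finite \<U>" "card \<U> \<le> ?n B" "!!U. U : \<U> ==> good U" "q ` CG \<subseteq> \<Union>\<U>"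
  unfolding covered_def by auto
 have "U \<subseteq> topspace X" if "U : \<U>" for U using \<U>(3)[OF that] openin_subset unfolding good_def by blast
 then have "\<Union>\<U> = topspace X" using \<U>(4) unfolding topspace_X by blast
 then have "equivariant_category (subgroup_as_group G H) X (%a C. a <# C) \<le> enat (card \<U>)"
  unfolding equivariant_category_def using \<U>(1,3)
  by (intro Inf_lower CollectI exI[of _ \<U>]) (auto simp: good_def subgroup_as_group_def)
 also have "card \<U> \<le> card I" using \<U>(2) card_mono[OF I(1), of "{i : I. v i \<le> B}"] by auto
 finally show ?thesis by simp
qed

end


section \<open>Reduction to a function on the group\<close>

lemma param_cont_cong:
 assumes W: "param_open P W" and eq: "!!p x. (p, x) : W ==> F p x = F' p x" and F': "param_cont P W F'"
 shows "param_cont P W F"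
proof (rule param_contI)
 fix p x assume px: "(p, x) : W"
 have "eventually (%z. F' (fst z) (snd z) = F (fst z) (snd z)) (nhdsin P p \<times>\<^sub>F nhds x)"
  using param_open_ev[OF W px] by eventually_elim (metis eq prod.collapse)
 then show "((%z. F (fst z) (snd z)) ---> F p x) (nhdsin P p \<times>\<^sub>F nhds x)"
  using param_contD[OF F' px] eq[OF px] by (simp add: Lim_transform_eventually)
qed

lemma param_open_fiber:
 assumes "param_open P W" "(p, x) : W"
 obtains r where "r > 0" "!!y. y : ball x r ==> (p, y) : W"
 using assms by (elim param_openE) blast+

lemma pCk_on_SucI_deriv:
 assumes W: "param_open P W" and c: "param_cont P W F"
  and d: "!!p x. (p, x) : W ==> (F p has_derivative D p x) (at x)"
  and cong: "!!v. pCk_on k P W (%p x. FD (F p) x v)"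
 shows "pCk_on (Suc k) P W F"
 using c cong d by (auto simp: differentiable_def)

lemma pCk_on_cong:
 assumes W: "param_open P W" and "!!p x. (p, x) : W ==> F p x = F' p x" "pCk_on k P W F'"
 shows "pCk_on k P W F"
 using assms(2,3)
proof (induction k arbitrary: F F')
 case 0
 then show ?case using param_cont_cong[OF W 0(1)] by simp
next
 case (Suc k)
 have der: "(F p has_derivative FD (F' p) x) (at x)" if px: "(p, x) : W" for p x
 proof -
  obtain r where r: "r > 0" "!!y. y : ball x r ==> (p, y) : W" using param_open_fiber[OF W px] by blast
  show ?thesis
   by (rule has_derivative_transform_within_open[OF pCk_has_deriv[OF Suc.prems(2) px] open_ball[of x r]])
    (use r Suc.prems(1) in auto)
 qed
 show ?case
 proof (rule pCk_on_SucI_deriv[OF W _ der])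
  show "param_cont P W F"
   by (rule param_cont_cong[OF W Suc.prems(1) pCk_param_cont[OF Suc.prems(2)]])
  show "pCk_on k P W (%p x. FD (F p) x v)" for v
  proof (rule Suc.IH)
   show "FD (F p) x v = FD (F' p) x v" if "(p, x) : W" for p x
    using frechet_derivative_at[OF der[OF that]] by simp
  qed (use Suc.prems in simp)
 qed
qed

lemma pCk_on_SucI:
 assumes W: "param_open P W" and c: "param_cont P W F"
  and d: "!!p x. (p, x) : W ==> (F p has_derivative D p x) (at x)" and k: "!!v. pCk_on k P W (%p x. D p x v)"
 shows "pCk_on (Suc k) P W F"
 by (rule pCk_on_SucI_deriv[OF W c d pCk_on_cong[OF W _ k]]) (use frechet_derivative_at[OF d] in auto)

lemma pCk_on_add:
 assumes W: "param_open P W" and "pCk_on k P W F" "pCk_on k P W F'"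
 shows "pCk_on k P W (%p x. F p x + F' p x)"
 using assms(2,3)
proof (induction k arbitrary: F F')
 case 0
 then show ?case unfolding pCk_on.simps by (intro param_contI tendsto_add) (auto dest: param_contD)
next
 case (Suc k)
 show ?case
 proof (rule pCk_on_SucI[OF W])
  show "param_cont P W (%p x. F p x + F' p x)"
   using Suc.prems by (intro param_contI tendsto_add) (auto dest: param_contD)
  show "((%x. F p x + F' p x) has_derivative (%v. FD (F p) x v + FD (F' p) x v)) (at x)"
   if "(p, x) : W" for p x
   by (intro has_derivative_add pCk_has_deriv[OF Suc.prems(1) that] pCk_has_deriv[OF Suc.prems(2) that])
  show "pCk_on k P W (%p x. FD (F p) x v + FD (F' p) x v)" for v
   by (rule Suc.IH) (use Suc.prems in auto)
 qed
qed

text \<open>The linear maps depend only continuously on the parameter; since nothing is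
  differentiated in that variable, the class is preserved.\<close>

lemma pCk_on_linear_param:
 fixes A :: "'p => 'b::real_normed_vector => 'c::real_normed_vector"
 assumes fd: "findim TYPE('b)" and W: "param_open P W" and lin: "!!p x. (p, x) : W ==> linear (A p)"
  and lim: "!!p x v. (p, x) : W ==> ((%q. A q v) ---> A p v) (nhdsin P p)" and F: "pCk_on k P W F"
 shows "pCk_on k P W (%p x. A p (F p x))"
 using F
proof (induction k arbitrary: F)
 have c: "param_cont P W (%p x. A p (F p x))" if F: "param_cont P W F" for F
 proof (rule param_contI)
  fix p x assume px: "(p, x) : W"
  show "((%z. A (fst z) (F (fst z) (snd z))) ---> A p (F p x)) (nhdsin P p \<times>\<^sub>F nhds x)"
  proof (rule lin_family_tendsto[OF fd _ lin[OF px] _ param_contD[OF F px]])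
   show "eventually (%z. linear (A (fst z))) (nhdsin P p \<times>\<^sub>F nhds x)"
    using param_open_ev[OF W px] by eventually_elim (metis lin prod.collapse)
   show "((%z. A (fst z) v) ---> A p v) (nhdsin P p \<times>\<^sub>F nhds x)" for v
    by (rule filterlim_compose[OF lim[OF px] filterlim_fst])
  qed
 qed
 {
  case 0
  then show ?case using c by simp
 next
  case (Suc k)
  show ?case
  proof (rule pCk_on_SucI[OF W c])
   show "param_cont P W F" by (rule pCk_param_cont[OF Suc.prems])
   show "((%x. A p (F p x)) has_derivative (%v. A p (FD (F p) x v))) (at x)" if "(p, x) : W" for p x
    by (rule bounded_linear.has_derivative[OF fd_bounded_linear[OF fd lin[OF that]] pCk_has_deriv[OF Suc.prems that]])
   show "pCk_on k P W (%p x. A p (FD (F p) x v))" for v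
    by (rule Suc.IH) (use Suc.prems in simp)
  qed
 }
qed

lemma pCk_on_sum:
 fixes F :: "'i => 'p => 'a::real_normed_vector => 'b::real_normed_vector"
 assumes W: "param_open P W" and "finite I" "!!i. i : I ==> pCk_on k P W (F i)"
 shows "pCk_on k P W (%p x. \<Sum>i\<in>I. F i p x)"
 using assms(2,3)
proof (induction I)
 case empty
 have "pCk_on k P W (%p x. 0 :: 'b)"
  by (induction k) (simp_all add: param_cont_def case_prod_unfold)
 then show ?case by simp
next
 case (insert i I)
 then show ?case by (simp add: pCk_on_add[OF W])
qed

lemma param_open_restrict:
 assumes W: "param_open P W" and Q: "openin P Q"
 shows "param_open P {z : W. fst z : Q}"
 unfolding param_open_def
proof
 fix z assume z: "z : {z : W. fst z : Q}"
 obtain p x where px: "z = (p, x)" by (cases z)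
 then obtain U r where U: "openin P U" "p : U" "r > 0" "U \<times> ball x r \<subseteq> W"
  using param_openE[OF W, of p x] z by auto
 have "openin P (U Int Q)" using U(1) Q by blast
 then show "fst z : topspace P & (EX U r. openin P U & fst z : U & r > 0 & U \<times> ball (snd z) r \<subseteq> {z : W. fst z : Q})"
  using U z px openin_subset[OF Q] by (intro conjI exI[of _ "U Int Q"] exI[of _ r]) auto
qed

lemma finite_dim_bounded_bilinear:
 fixes B :: "'a::real_normed_vector => 'b::real_normed_vector => real"
 assumes fd: "findim TYPE('a)" "findim TYPE('b)" and lin: "!!v. linear (%u. B u v)" "!!u. linear (B u)"
 shows "bounded_bilinear B"
proof
 show "B (a + a') b = B a b + B a' b" "B (r *. a) b = r *. B a b" for a a' b r
  using linear_add[OF lin(1)[of b]] linear_scale[OF lin(1)[of b]] by auto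
 show "B a (b + b') = B a b + B a b'" "B a (r *. b) = r *. B a b" for a b b' r
  using linear_add[OF lin(2)[of a]] linear_scale[OF lin(2)[of a]] by auto
 obtain Bs :: "'a set" where Bs: "basis_of Bs" using findim_basis[OF fd(1)] unfolding basis_of_def by metis
 then have fin: "finite Bs" by (simp add: basis_of_def)
 have "EX c. ALL u. \<bar>representation Bs u b\<bar> \<le> norm u * c" if "b : Bs" for b
  using bounded_linear.bounded[OF fd_bounded_linear[OF fd(1) linear_rep[OF Bs]], of b] by auto
 then obtain c where c: "!!b u. b : Bs ==> \<bar>representation Bs u b\<bar> \<le> norm u * c b" by metis
 have "EX d. ALL v. \<bar>B b v\<bar> \<le> norm v * d" for b
  using bounded_linear.bounded[OF fd_bounded_linear[OF fd(2) lin(2)], of b] by auto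
 then obtain d where d: "!!b v. \<bar>B b v\<bar> \<le> norm v * d b" by metis
 have "norm (B u v) \<le> norm u * norm v * (\<Sum>b\<in>Bs. c b * d b)" for u v
 proof -
  have "B u v = (\<Sum>b\<in>Bs. representation Bs u b *. B b v)" by (rule linear_basis_sum[OF Bs lin(1)])
  then have "\<bar>B u v\<bar> \<le> (\<Sum>b\<in>Bs. \<bar>representation Bs u b\<bar> * \<bar>B b v\<bar>)"
   using sum_abs[of "%b. representation Bs u b * B b v" Bs] by (simp add: abs_mult)
  also have "... \<le> (\<Sum>b\<in>Bs. (norm u * c b) * (norm v * d b))"
   by (intro sum_mono mult_mono c d) (auto intro: order_trans[OF abs_ge_zero c])
  also have "... = norm u * norm v * (\<Sum>b\<in>Bs. c b * d b)" by (simp add: sum_distrib_left algebra_simps)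
  finally show ?thesis by simp
 qed
 then show "EX K. ALL a b. norm (B a b) \<le> norm a * norm b * K" by blast
qed


lemma has_derivative_ev_eq:
 assumes "(f has_derivative D) (at x)" "eventually (%y. f y = g y) (nhds x)"
 shows "(g has_derivative D) (at x)"
 by (rule has_derivative_transform_eventually[OF assms(1)])
  (use assms(2) eventually_nhds_x_imp_x in \<open>auto simp: eventually_at_filter elim: eventually_mono\<close>)

section \<open>A point of a proper action in one chart, and its isotropy representation\<close>

locale proper_point = lie_grp G GM for G :: "'a monoid" (structure) and GM :: "('a, 'b::real_normed_vector) smooth_space" +
 fixes M :: "('c, 'e::real_normed_vector) smooth_space" and \<phi> :: "'a => 'c => 'c" and m :: 'c
 assumes M: "smooth_manifold M" and action: "smooth_action G GM M \<phi>" and proper: "proper_action GM M \<phi>"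
  and m: "m : points M"
begin

lemma M_ok: "atlas_ok M" by (rule smooth_manifold_atlas_ok[OF M])

lemma fdM: "findim TYPE('e)" by (rule ok_findim[OF M_ok])

abbreviation "TM \<equiv> top_of M"

lemma ga: "group_action G (points M) \<phi>" and act_smooth: "smooth_map (product_space GM M) M (%(g, x). \<phi> g x)"
 using action by (auto simp: smooth_action_def)

lemma act_closed: "g : CG ==> x : points M ==> \<phi> g x : points M"
 using group_action.element_image[OF ga] by blast

lemma act_mult: "x : points M ==> g : CG ==> k : CG ==> \<phi> (g ** k) x = \<phi> g (\<phi> k x)"
 by (rule group_action.composition_rule[OF ga])

lemma act_one: "x : points M ==> \<phi> \<one> x = x"
 using group_action.id_eq_one[OF ga] by (metis restrict_apply')

lemma act_filterlim:
 assumes "filterlim f (nhdsin T a) F" "filterlim g (nhdsin TM b) F" "a : CG" "b : points M"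
 shows "filterlim (%x. \<phi> (f x) (g x)) (nhdsin TM (\<phi> a b)) F"
proof -
 have "filterlim (%(g, x). \<phi> g x) (nhdsin TM (\<phi> a b)) (nhdsin T a \<times>\<^sub>F nhdsin TM b)"
  using cont_filterlim[OF smooth_cont[OF act_smooth], of "(a, b)"] assms
  by (simp add: nhdsin_prod)
 from filterlim_compose[OF this filterlim_Pair[OF assms(1,2)]] show ?thesis by simp
qed

definition "Stab = stabilizer G \<phi> m"

lemma Stab_iff: "k : Stab \<longleftrightarrow> k : CG & \<phi> k m = m"
 by (simp add: Stab_def stabilizer_def)

lemma Stab_subgroup: "subgroup Stab G"
 unfolding Stab_def using group_action.stabilizer_subgroup[OF ga m] .

text \<open>The stabilizer is the projection to the group of a fibre of the proper map, over the
  pair (m, m).\<close>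

lemma Stab_compact: "compactin T Stab"
proof -
 let ?p = "%(g, x). (\<phi> g x, x)"
 have "compactin (prod_topology T TM) {z : topspace (prod_topology T TM). ?p z = (m, m)}"
  using proper m unfolding proper_action_def proper_map_def by auto
 then have "compactin T (fst ` {z : topspace (prod_topology T TM). ?p z = (m, m)})"
  by (rule image_compactin) (rule continuous_map_fst)
 moreover have "fst ` {z : topspace (prod_topology T TM). ?p z = (m, m)} = Stab"
  using m by (force simp: Stab_iff)
 ultimately show ?thesis by simp
qed

end

sublocale proper_point \<subseteq> compact_subgrp G GM Stab
 by (intro compact_subgrp.intro compact_subgrp_axioms.intro lie_grp_axioms Stab_subgroup Stab_compact)

context proper_point
begin

definition "Um = fst (chart_at M m)"
definition "crd = snd (chart_at M m)"
definition "ci = inv_into Um crd"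
definition "x0 = crd m"

lemma chart_m: "(Um, crd) : atlas M" "m : Um"
 using chart_at_atlas[OF M_ok m] by (simp_all add: Um_def crd_def)

lemma Um_points: "x : Um ==> x : points M"
 using chart_subset[OF M_ok chart_m(1)] by blast

lemma ci_crd: "x : Um ==> ci (crd x) = x"
 unfolding ci_def by (rule chart_inv[OF M_ok chart_m(1)])

lemma crd_ci: "y : crd ` Um ==> crd (ci y) = y" and ci_Um: "y : crd ` Um ==> ci y : Um"
 unfolding ci_def by (simp_all add: f_inv_into_f inv_into_into)

lemma ci_points: "y : crd ` Um ==> ci y : points M"
 by (intro Um_points ci_Um)

lemma x0: "x0 : crd ` Um" "ci x0 = m"
 using chart_m ci_crd by (auto simp: x0_def)

lemma crd_open: "open (crd ` Um)" by (rule chart_open_image_dom[OF M_ok chart_m(1)])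

lemma ci_filterlim: "y : crd ` Um ==> filterlim ci (nhdsin TM (ci y)) (nhds y)"
 using chart_inv_filterlim[OF M_ok chart_m(1), of "ci y"] ci_Um crd_ci by (simp add: ci_def)

lemma Um_nhds: "x : Um ==> eventually (%z. z : Um) (nhdsin TM x)"
 by (rule ev_nhdsin[OF chart_openin[OF M_ok chart_m(1)]])

definition "actc g y = crd (\<phi> g (ci y))"
definition "actdom = {(g, y). g : CG & y : crd ` Um & \<phi> g (ci y) : Um}"

lemma actc_pCk: "pCk_on k T actdom actc" and actdom_open: "param_open T actdom"
 using smooth_map_pCk_on[OF GM_ok M_ok M_ok act_smooth chart_m(1) chart_m(1)]
 by (simp_all add: actc_def[abs_def] actdom_def ci_def)

lemma Stab_x0: "k : Stab ==> (k, x0) : actdom" "k : Stab ==> actc k x0 = x0"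
 using x0 chart_m by (auto simp: Stab_iff actdom_def actc_def x0_def)

text \<open>For k in the stabilizer, the linear isotropy representation in chart coordinates. It is
  also defined for nearby group elements, where it is only the derivative of a chart
  expression.\<close>

definition "A k v = FD (actc k) x0 v"

lemma A_deriv: "(z, x0) : actdom ==> (actc z has_derivative A z) (at x0)"
 unfolding A_def[abs_def] using pCk_has_deriv[OF actc_pCk] by simp

lemma A_linear: "(z, x0) : actdom ==> linear (A z)"
 using A_deriv has_derivative_linear by blast

lemma A_tendsto:
 assumes "(z, x0) : actdom" shows "((%q. A q v) ---> A z v) (nhdsin T z)"
proof -
 have "pCk_on 0 T actdom (%p x. FD (actc p) x v)" using actc_pCk[of "Suc 0"] by simp
 then have "param_cont T actdom (%p x. FD (actc p) x v)" by simp
 from filterlim_compose[OF param_contD[OF this assms] filterlim_Pair[OF filterlim_ident tendsto_const]]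
 show ?thesis by (simp add: A_def)
qed

lemma actdom_ev: "(z, y) : actdom ==> eventually (%w. (z, w) : actdom) (nhds y)"
 using eventually_nhds_metric param_open_fiber[OF actdom_open] by (metis dist_commute mem_ball)

lemma actdom_ev_left: "(z, y) : actdom ==> eventually (%w. (w, y) : actdom) (nhdsin T z)"
 using eventually_compose_filterlim[OF param_open_ev[OF actdom_open] filterlim_Pair[OF filterlim_ident tendsto_const]]
 by simp

lemma actc_mult: "(l, y) : actdom ==> k : CG ==> actc k (actc l y) = actc (k ** l) y"
 by (auto simp: actc_def actdom_def ci_crd act_mult Um_points)

lemma A_rep: "compact_rep G GM Stab A"
proof unfold_locales
 show "findim TYPE('e)" by (rule fdM)
 fix k assume k: "k : Stab"
 show "eventually (%z. linear (A z)) (nhdsin T k)"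
  using actdom_ev_left[OF Stab_x0(1)[OF k]] by eventually_elim (rule A_linear)
 show "((%z. A z v) ---> A k v) (nhdsin T k)" for v by (rule A_tendsto[OF Stab_x0(1)[OF k]])
 fix l assume l: "l : Stab"
 show "A (k ** l) v = A k (A l v)" for v
 proof -
  have "(actc k has_derivative A k) (at (actc l x0))" using A_deriv[OF Stab_x0(1)[OF k]] Stab_x0(2)[OF l] by simp
  from diff_chain_at[OF A_deriv[OF Stab_x0(1)[OF l]] this]
  have "((%y. actc k (actc l y)) has_derivative (%v. A k (A l v))) (at x0)" by (simp add: comp_def)
  moreover have "eventually (%y. actc k (actc l y) = actc (k ** l) y) (nhds x0)"
   using actdom_ev[OF Stab_x0(1)[OF l]] by eventually_elim (rule actc_mult[OF _ K_carrier[OF k]])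
  ultimately have "(actc (k ** l) has_derivative (%v. A k (A l v))) (at x0)"
   by (rule has_derivative_ev_eq)
  from has_derivative_unique[OF this A_deriv[OF Stab_x0(1)[OF K_mult[OF k l]]]] show ?thesis by metis
 qed
next
 show "A \<one> v = v" for v
 proof -
  have "eventually (%y. y : crd ` Um) (nhds x0)" by (rule eventually_nhds_in_open[OF crd_open x0(1)])
  then have ev: "eventually (%y. y = actc \<one> y) (nhds x0)"
   by eventually_elim (simp add: actc_def act_one ci_points crd_ci)
  have "(actc \<one> has_derivative (%v. v)) (at x0)"
   by (rule has_derivative_ev_eq[OF has_derivative_ident ev])
  from has_derivative_unique[OF this A_deriv[OF Stab_x0(1)[OF K_one]]] show ?thesis by metis
 qed
qed

end

sublocale proper_point \<subseteq> R: compact_rep G GM Stab A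
 by (rule A_rep)

context lie_grp
begin

abbreviation "c1 \<equiv> snd (chart_at GM \<one>)"
definition "ic = inv_into U0 c1"

lemma Exp_line_chart: "((%t. c1 (Exp (t *. v))) has_vector_derivative v) (at 0)"
proof -
 have "((%t. kap (Exp (t *. v)) + c1 \<one>) has_vector_derivative v) (at 0)"
  using has_vector_derivative_add[OF Exp_line_derivative has_vector_derivative_const] by simp
 then show ?thesis by (simp add: kap_def)
qed

lemma Exp_line_ev: "eventually (%t. Exp (t *. v) : U0 & ic (c1 (Exp (t *. v))) = Exp (t *. v)) (nhds (0::real))"
proof -
 have "((%t. norm (t *. v)) ---> norm ((0::real) *. v)) (nhds 0)" by (intro tendsto_norm tendsto_scaleR filterlim_ident tendsto_const)
 then have "eventually (%t. norm (t *. v) < del / 2) (nhds 0)" by (rule order_tendstoD(2)) (use del in simp)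
 then show ?thesis by eventually_elim (use Exp_small chart_inv[OF GM_ok chart_one(1)] in \<open>auto simp: ic_def\<close>)
qed

end

section \<open>Orbit directions and the displacement along the orbit\<close>

context proper_point
begin

definition "orb x b = crd (\<phi> (ic b) x)"
definition "orbdom = {(x, b). x : points M & b : c1 ` U0 & \<phi> (ic b) x : Um}"
text \<open>Infinitesimal generators at all points of the chart domain of m, expressed in that one
  chart; at m they agree with \<open>infinitesimal_generator\<close>.\<close>

definition "zeta x v = FD (orb x) (c1 \<one>) v"

lemma orb_pCk: "pCk_on k TM orbdom orb"
proof -
 have "smooth_map (product_space M GM) M ((%(g, x). \<phi> g x) o (%z. (snd z, fst z)))"
  by (intro smooth_map_compose[OF ok_product[OF M_ok GM_ok] ok_product[OF GM_ok M_ok] M_ok _ act_smooth]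
    smooth_map_Pair[OF ok_product[OF M_ok GM_ok] GM_ok M_ok] smooth_map_snd smooth_map_fst M_ok GM_ok)
 from smooth_map_pCk_on[OF M_ok GM_ok M_ok this chart_one(1) chart_m(1)]
 show "pCk_on k TM orbdom orb"
  by (simp add: orb_def[abs_def] orbdom_def ic_def)
qed

lemma orbdom_one: "x : Um ==> (x, c1 \<one>) : orbdom"
 using chart_one chart_inv[OF GM_ok chart_one] by (auto simp: orbdom_def Um_points ic_def act_one)

lemma zeta_deriv: "x : Um ==> (orb x has_derivative zeta x) (at (c1 \<one>))"
 unfolding zeta_def[abs_def] using pCk_has_deriv[OF orb_pCk orbdom_one] by simp

lemma zeta_linear: "x : Um ==> linear (zeta x)"
 using zeta_deriv has_derivative_linear by blast

lemma zeta_tendsto: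
 assumes "x : Um" shows "((%z. zeta z v) ---> zeta x v) (nhdsin TM x)"
proof -
 have "pCk_on 0 TM orbdom (%p x. FD (orb p) x v)" using orb_pCk[of "Suc 0"] by simp
 then have "param_cont TM orbdom (%p x. FD (orb p) x v)" by simp
 from filterlim_compose[OF param_contD[OF this orbdom_one[OF assms]] filterlim_Pair[OF filterlim_ident tendsto_const]]
 show ?thesis by (simp add: zeta_def)
qed

lemma orbit_line:
 assumes x: "x : Um"
 shows "((%t. crd (\<phi> (Exp (t *. v)) x)) has_vector_derivative zeta x v) (at 0)"
proof -
 have z: "(orb x has_derivative zeta x) (at (c1 (Exp (0 *. v))))" using zeta_deriv[OF x] by simp
 have "((%t. orb x (c1 (Exp (t *. v)))) has_vector_derivative zeta x v) (at 0)"
  using diff_chain_at[OF Exp_line_chart[of v, unfolded has_vector_derivative_def] z]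
  by (simp add: has_vector_derivative_def comp_def linear_scale[OF zeta_linear[OF x]])
 moreover have "eventually (%t. orb x (c1 (Exp (t *. v))) = crd (\<phi> (Exp (t *. v)) x)) (nhds 0)"
  using Exp_line_ev[of v] by eventually_elim (simp add: orb_def)
 ultimately show ?thesis unfolding has_vector_derivative_def
  by (rule has_derivative_ev_eq)
qed

definition "V = range (zeta m)"

lemma lie_algebra_orbit_eq: "lie_algebra_orbit G GM M \<phi> m = V"
proof -
 have "infinitesimal_generator G GM M \<phi> v m = zeta m v" for v
  unfolding infinitesimal_generator_def velocity_def lie_exp_eq
  using vector_derivative_at[OF orbit_line[OF chart_m(2), of v]] m
  by (simp add: act_one coord_def crd_def comp_def)
 then show ?thesis unfolding lie_algebra_orbit_def V_def by auto
qed

lemma V_subspace: "subspace V"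
 unfolding V_def by (rule linear_subspace_image[OF zeta_linear[OF chart_m(2)] subspace_UNIV])

lemma act_line_filterlim:
 assumes x: "x : points M" shows "filterlim (%t. \<phi> (Exp (t *. v)) x) (nhdsin TM x) (nhds (0::real))"
proof -
 have "filterlim (%_::real. x) (nhdsin TM x) (nhds 0)"
  unfolding filterlim_iff using x by (auto elim: ev_nhdsinE)
 moreover have "filterlim (%t::real. t *. v) (nhds (0 *. v)) (nhds 0)"
  by (rule tendsto_scaleR[OF filterlim_ident tendsto_const])
 ultimately have "filterlim (%t. \<phi> (Exp (t *. v)) x) (nhdsin TM (\<phi> (Exp (0 *. v)) x)) (nhds 0)"
  by (intro act_filterlim Exp_lim x) auto
 then show ?thesis using x by (simp add: act_one)
qed

text \<open>Conjugating the one-parameter subgroup by k shows that A k takes the generator of w at m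
  to that of Ad k w, since inv k fixes m.\<close>

lemma V_invariant:
 assumes k: "k : Stab" and v: "v : V" shows "A k v : V"
proof -
 obtain w where w: "v = zeta m w" using v by (auto simp: V_def)
 have kG: "k : CG" by (rule K_carrier[OF k])
 have "((%t. crd (\<phi> (Exp (t *. w)) m)) has_vector_derivative v) (at 0)" unfolding w by (rule orbit_line[OF chart_m(2)])
 moreover have "(actc k has_derivative A k) (at (crd (\<phi> (Exp (0 *. w)) m)))"
  using A_deriv[OF Stab_x0(1)[OF k]] m by (simp add: act_one x0_def)
 ultimately have d: "((%t. actc k (crd (\<phi> (Exp (t *. w)) m))) has_vector_derivative A k v) (at 0)"
  unfolding has_vector_derivative_def using diff_chain_at[of "%t. crd (\<phi> (Exp (t *. w)) m)" "%t. t *. v" 0 "actc k" "A k"]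
  by (simp add: comp_def linear_scale[OF R.rep_linear[OF k]])
 from eventually_compose_filterlim[OF Um_nhds[OF chart_m(2)] act_line_filterlim[OF m, of w]]
 have "eventually (%t. actc k (crd (\<phi> (Exp (t *. w)) m)) = crd (\<phi> (Exp (t *. Ad k w)) m)) (nhds 0)"
 proof eventually_elim
  case (elim t)
  have "\<phi> (Exp (t *. Ad k w)) m = \<phi> (k ** Exp (t *. w) ** inv k) m"
   by (simp add: Exp_conj[OF kG] linear_scale[OF Ad_linear[OF kG]])
  also have "... = \<phi> k (\<phi> (Exp (t *. w)) m)"
   using K_inv[OF k] kG m act_closed by (simp add: act_mult Stab_iff)
  finally show ?case using elim by (simp add: actc_def ci_crd)
 qed
 with d have "((%t. crd (\<phi> (Exp (t *. Ad k w)) m)) has_vector_derivative A k v) (at 0)"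
  unfolding has_vector_derivative_def
  by (rule has_derivative_ev_eq)
 from vector_derivative_unique_at[OF this orbit_line[OF chart_m(2)]] show ?thesis by (simp add: V_def)
qed

definition "proj0 = (SOME p. linear p & range p \<subseteq> V & (ALL v:V. p v = v))"

lemma proj0: "linear proj0" "range proj0 \<subseteq> V" "v : V ==> proj0 v = v"
proof -
 obtain p where "linear p" "range p \<subseteq> V" "!!v. v : V ==> p v = v"
  by (rule exists_projection[OF V_subspace subspace_single_0]) (auto intro: that)
 then have "linear p & range p \<subseteq> V & (ALL v:V. p v = v)" by blast
 then have "linear proj0 & range proj0 \<subseteq> V & (ALL v:V. proj0 v = v)" 
  unfolding proj0_def by (rule someI[of "%p. linear p & range p \<subseteq> V & (ALL v:V. p v = v)"])
 then show "linear proj0" "range proj0 \<subseteq> V" "v : V ==> proj0 v = v" by auto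
qed

text \<open>The integrand of the average over the stabilizer is to be defined for every k, so all
  translates of the point have to stay in the chart.\<close>

definition "\<Omega> = {y : crd ` Um. ALL k:Stab. \<phi> k (ci y) : Um}"

text \<open>The integrand corrects the displacement of \<open>\<phi> k\<close> by the linear isotropy action, which makes
 \<open>\<alpha>\<close> equivariant. It measures the displacement of a point along the orbit of \<open>m\<close>.\<close>

definition "\<alpha> y = vmean (%k. A (inv k) (proj0 (actc k y - x0)))"
definition "proj v = vmean (%k. A (inv k) (proj0 (A k v)))"

lemma proj: "linear proj" "range proj \<subseteq> V" "v : V ==> proj v = v"
 unfolding proj_def by (rule R.invariant_projection[OF V_subspace V_invariant proj0]; assumption)+

text \<open>An open parameter domain around Stab \<times> \<Omega> on which both the chart
  expression of k and the linear map A (inv k) are defined.\<close>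

definition "\<alpha>dom = {z : actdom. fst z : {k : topspace T. \<phi> (inv k) m : Um}}"

lemma \<alpha>dom_open: "param_open T \<alpha>dom"
proof -
 have "continuous_map T TM (%k. \<phi> (inv k) m)"
  unfolding cont_iff_filterlim
 proof (intro conjI ballI act_filterlim inv_lim filterlim_ident m)
  show "(%k. \<phi> (inv k) m) ` topspace T \<subseteq> points M" using act_closed m by auto
  show "filterlim (%x. m) (nhdsin TM m) (nhdsin T a)" for a
   unfolding filterlim_iff using m by (auto elim: ev_nhdsinE)
 qed auto
 then have "openin T {k : topspace T. \<phi> (inv k) m : Um}"
  by (rule openin_continuous_map_preimage[OF _ chart_openin[OF M_ok chart_m(1)]])
 then show ?thesis unfolding \<alpha>dom_def by (rule param_open_restrict[OF actdom_open])
qed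

lemma \<alpha>dom_inv: "(k, y) : \<alpha>dom ==> (k, y) : actdom & (inv k, x0) : actdom"
 using x0 by (auto simp: \<alpha>dom_def actdom_def)

lemma \<Omega>_\<alpha>dom: "Stab \<times> \<Omega> \<subseteq> \<alpha>dom"
 using K_inv K_carrier chart_m by (auto simp: \<alpha>dom_def \<Omega>_def actdom_def Stab_iff)

lemma \<Omega>_subset: "y : \<Omega> ==> y : crd ` Um" and x0_\<Omega>: "x0 : \<Omega>"
 using x0 chart_m by (auto simp: \<Omega>_def Stab_iff)

lemma \<Omega>_open: "open \<Omega>"
proof (subst open_subopen, rule ballI)
 fix y assume y: "y : \<Omega>"
 have "eventually (%z. ALL k:Stab. (k, z) : actdom) (nhds y)"
 proof (rule compactin_ev[OF K_compact])
  fix k assume "k : Stab"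
  then have "(k, y) : actdom" using y \<Omega>_\<alpha>dom \<alpha>dom_inv by blast
  from param_open_ev[OF actdom_open this]
  show "eventually (%(k, z). (k, z) : actdom) (nhdsin T k \<times>\<^sub>F nhds y)" by (simp add: case_prod_unfold)
 qed
 then obtain S where S: "open S" "y : S" "!!z. z : S ==> ALL k:Stab. (k, z) : actdom"
  unfolding eventually_nhds by blast
 have "z : \<Omega>" if "ALL k:Stab. (k, z) : actdom" for z
  using that K_one by (auto simp: \<Omega>_def actdom_def)
 then have "S \<subseteq> \<Omega>" using S(3) by (intro subsetI) simp
 then show "EX Q. open Q & y : Q & Q \<subseteq> \<Omega>" using S(1,2) by (intro exI[of _ S] conjI)
qed

lemma \<alpha>_integrand: "pCk_on k T \<alpha>dom (%k y. A (inv k) (proj0 (actc k y - x0)))"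
proof -
 have 1: "pCk_on k T \<alpha>dom (%k y. actc k y + (- x0))"
  by (intro pCk_on_add[OF \<alpha>dom_open] pCk_on_subset[OF actc_pCk] Ck_on_pCk_on[OF open_UNIV] Ck_on_const)
   (auto simp: \<alpha>dom_def)
 show ?thesis
 proof (rule pCk_on_linear_param[OF fdM \<alpha>dom_open, of "%k v. A (inv k) (proj0 v)" k "%k y. actc k y - x0"])
  show "pCk_on k T \<alpha>dom (%k y. actc k y - x0)" using 1 by simp
  show "linear (%v. A (inv p) (proj0 v))" if "(p, x) : \<alpha>dom" for p x
   using linear_compose[OF proj0(1) A_linear] \<alpha>dom_inv[OF that] by (auto simp: comp_def)
  show "((%q. A (inv q) (proj0 v)) ---> A (inv p) (proj0 v)) (nhdsin T p)" if px: "(p, x) : \<alpha>dom" for p x v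
   by (rule filterlim_compose[OF A_tendsto inv_lim[OF filterlim_ident]])
    (use \<alpha>dom_inv[OF px] in \<open>auto simp: actdom_def\<close>)
 qed
qed

lemma \<alpha>_Ck: "Ck_on k \<Omega> \<alpha>"
 unfolding \<alpha>_def[abs_def] by (rule vmean_Ck[OF fdM fdM \<alpha>_integrand \<alpha>dom_open \<Omega>_open \<Omega>_\<alpha>dom])

lemma \<alpha>_contK: "y : \<Omega> ==> contK (%k. A (inv k) (proj0 (actc k y - x0)))"
 by (rule vmean_param_contK[OF pCk_param_cont[OF \<alpha>_integrand[of 0]] \<Omega>_\<alpha>dom])

lemma \<alpha>_x0: "\<alpha> x0 = 0"
proof -
 have "\<alpha> x0 = vmean (%k. 0)" unfolding \<alpha>_def
  by (rule vmean_cong) (use Stab_x0 K_inv linear_0[OF proj0(1)] linear_0[OF R.rep_linear] in simp)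
 then show ?thesis using vmean_const[OF fdM] by simp
qed

lemma \<alpha>_deriv_x0: "(\<alpha> has_derivative proj) (at x0)"
proof -
 let ?F = "%k y. A (inv k) (proj0 (actc k y - x0))"
 have "(\<alpha> has_derivative (%v. vmean (%k. FD (?F k) x0 v))) (at x0)"
  unfolding \<alpha>_def[abs_def]
  by (rule vmean_has_derivative[OF fdM fdM \<alpha>_integrand \<alpha>dom_open \<Omega>_open \<Omega>_\<alpha>dom x0_\<Omega>])
 moreover have "vmean (%k. FD (?F k) x0 v) = proj v" for v
  unfolding proj_def
 proof (rule vmean_cong)
  fix k assume k: "k : Stab"
  have l: "linear (%v. A (inv k) (proj0 v))"
   using linear_compose[OF proj0(1) R.rep_linear[OF K_inv[OF k]]] by (simp add: comp_def)
  have "((%y. actc k y - x0) has_derivative A k) (at x0)"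
   using has_derivative_diff[OF A_deriv[OF Stab_x0(1)[OF k]] has_derivative_const[of x0]] by simp
  from bounded_linear.has_derivative[OF fd_bounded_linear[OF fdM l] this]
  show "FD (?F k) x0 v = A (inv k) (proj0 (A k v))"
   by (metis frechet_derivative_at)
 qed
 ultimately show ?thesis by simp
qed

lemma \<alpha>_V: "y : \<Omega> ==> \<alpha> y : V"
proof -
 assume y: "y : \<Omega>"
 have "proj0 (\<alpha> y) = vmean (%k. proj0 (A (inv k) (proj0 (actc k y - x0))))"
  unfolding \<alpha>_def by (rule vmean_linear[OF fdM fdM \<alpha>_contK[OF y] proj0(1)])
 also have "... = \<alpha> y" unfolding \<alpha>_def
 proof (rule vmean_cong)
  fix k assume "k : Stab"
  moreover have "proj0 (actc k y - x0) : V" using proj0(2) by blast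
  ultimately show "proj0 (A (inv k) (proj0 (actc k y - x0))) = A (inv k) (proj0 (actc k y - x0))"
   by (intro proj0(3) V_invariant K_inv)
 qed
 finally show ?thesis using subsetD[OF proj0(2) rangeI[of proj0 "\<alpha> y"]] by simp
qed

lemma \<Omega>_invariant: "l : Stab ==> y : \<Omega> ==> actc l y : \<Omega>"
 using K_mult K_carrier
 by (auto simp: \<Omega>_def actc_def ci_crd simp flip: act_mult[OF Um_points[OF ci_Um]])

lemma \<alpha>_equivariant:
 assumes l: "l : Stab" and y: "y : \<Omega>"
 shows "\<alpha> (actc l y) = A l (\<alpha> y)"
proof -
 let ?F = "%k. A (inv k) (proj0 (actc k y - x0))"
 have ly: "(l, y) : actdom" using l y \<Omega>_\<alpha>dom \<alpha>dom_inv by blast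
 have "\<alpha> (actc l y) = vmean (%k. A l (?F (k ** l)))" unfolding \<alpha>_def
 proof (rule vmean_cong)
  fix k assume k: "k : Stab"
  have "l ** inv (k ** l) = inv k" using K_carrier[OF k] K_carrier[OF l] by (simp add: inv_mult_group flip: m_assoc)
  then have "A l (?F (k ** l)) = A (inv k) (proj0 (actc (k ** l) y - x0))"
   using R.rep_mult[OF l K_inv[OF K_mult[OF k l]]] by metis
  then show "A (inv k) (proj0 (actc k (actc l y) - x0)) = A l (?F (k ** l))"
   using actc_mult[OF ly K_carrier[OF k]] by simp
 qed
 also have "... = A l (vmean (%k. ?F (k ** l)))"
  by (rule vmean_linear[OF fdM fdM _ R.rep_linear[OF l], symmetric]) (rule contK_right[OF \<alpha>_contK[OF y] l])
 also have "vmean (%k. ?F (k ** l)) = vmean ?F" by (rule vmean_right[OF fdM \<alpha>_contK[OF y] l])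
 finally show ?thesis unfolding \<alpha>_def .
qed

abbreviation "form \<equiv> R.inv_form"

lemma form_bilinear: "bounded_bilinear form"
proof (rule finite_dim_bounded_bilinear[OF fdM fdM R.inv_form_linear])
 fix u
 have e: "form u = (%v. form v u)" by (rule ext) (rule R.inv_form_sym)
 show "linear (form u)" by (subst e) (rule R.inv_form_linear)
qed

definition "\<rho> y = form (\<alpha> y) (\<alpha> y) / 2"
definition "d\<alpha> y v = frechet_derivative \<alpha> (at y) v"

lemma \<alpha>_deriv: "y : \<Omega> ==> (\<alpha> has_derivative d\<alpha> y) (at y)"
 unfolding d\<alpha>_def[abs_def] by (rule Ck_has_deriv[OF \<alpha>_Ck[of "Suc 0"]])

lemma d\<alpha>_x0: "d\<alpha> x0 = proj"
 using has_derivative_unique[OF \<alpha>_deriv[OF x0_\<Omega>] \<alpha>_deriv_x0] .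

lemma d\<alpha>_Ck: "Ck_on k \<Omega> (%y. d\<alpha> y v)"
 using \<alpha>_Ck[of "Suc k"] unfolding d\<alpha>_def by simp

lemma \<rho>_Ck: "Ck_on k \<Omega> \<rho>"
 using Ck_on_linear_compose[OF \<Omega>_open bounded_linear_divide[of 2] Ck_on_bilinear[OF \<Omega>_open form_bilinear \<alpha>_Ck \<alpha>_Ck]]
 unfolding \<rho>_def .

lemma \<rho>_deriv: "y : \<Omega> ==> (\<rho> has_derivative (%v. form (\<alpha> y) (d\<alpha> y v))) (at y)"
proof -
 assume y: "y : \<Omega>"
 have "((%y. form (\<alpha> y) (\<alpha> y) / 2) has_derivative (%v. (form (\<alpha> y) (d\<alpha> y v) + form (d\<alpha> y v) (\<alpha> y)) / 2)) (at y)"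
  by (rule bounded_linear.has_derivative[OF bounded_linear_divide
     bounded_bilinear.FDERIV[OF form_bilinear \<alpha>_deriv[OF y] \<alpha>_deriv[OF y]]])
 then show ?thesis unfolding \<rho>_def[abs_def] by (simp add: R.inv_form_sym[of _ "\<alpha> y"])
qed

lemma \<rho>_invariant: "l : Stab ==> y : \<Omega> ==> \<rho> (actc l y) = \<rho> y"
 by (simp add: \<rho>_def \<alpha>_equivariant R.inv_form_invariant)

text \<open>Along the orbits of \<open>G\<close> near \<open>m\<close> the map \<open>\<alpha>\<close> is a submersion onto \<open>V\<close>, so a point that is
 critical for \<open>\<rho>\<close> along its orbit is a zero of \<open>\<alpha>\<close>.\<close>

lemma orbit_critical:
 "eventually (%y. y : \<Omega> & ((ALL v. form (\<alpha> y) (d\<alpha> y (zeta (ci y) v)) = 0) --> \<alpha> y = 0)) (nhds x0)"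
proof -
 obtain s where s: "linear s" "!!v. v : V ==> zeta m (s v) = v"
  using linear_exists_right_inverse_on[OF zeta_linear[OF chart_m(2)] subspace_UNIV] unfolding V_def by blast
 \<comment> \<open>With s a right inverse of \<open>zeta m\<close>, this tends to the identity of V
   as y tends to x0, so form v (?N y v) is positive on the unit sphere of V for y close to x0.
   Applied to the normalized \<alpha> y this contradicts criticality.\<close>
 let ?N = "%y v. d\<alpha> y (zeta (ci y) (s v))"
 let ?S = "V Int sphere 0 1"
 have "closed V"
 proof (rule finite_dim_closed_subspace[OF fdM linear_compose_sub[OF linear_ident proj0(1)]])
  show "x : V \<longleftrightarrow> x - proj0 x = 0" for x
   using subsetD[OF proj0(2) rangeI[of proj0 x]] proj0(3)[of x] by auto
 qed
 moreover have "closed (sphere (0::'e) 1)"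
  unfolding sphere_def by (intro closed_Collect_eq continuous_intros)
 ultimately have "compact (cball 0 1 Int (sphere 0 1 Int V))"
  by (intro compact_Int_closed compact_cball_fd[OF fdM] closed_Int)
 moreover have "cball 0 1 Int (sphere 0 1 Int V) = ?S" by auto
 ultimately have "compactin euclidean ?S" by (simp add: compactin_euclidean_iff)
 then have "eventually (%y. ALL v:?S. form v (?N y v) > 0) (nhds x0)"
 proof (rule compactin_ev)
  fix v assume v: "v : ?S"
  let ?F = "nhdsin euclidean v \<times>\<^sub>F nhds x0"
  have lv: "filterlim fst (nhds v) ?F" using filterlim_fst[of "nhdsin euclidean v" "nhds x0"] by simp
  have ly: "filterlim snd (nhds x0) ?F" by (rule filterlim_snd)
  have ev\<Omega>: "eventually (%z. snd z : \<Omega>) ?F"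
   by (rule eventually_compose_filterlim[OF eventually_nhds_in_open[OF \<Omega>_open x0_\<Omega>] ly])
  have lc: "filterlim (%z. ci (snd z)) (nhdsin TM m) ?F"
   using filterlim_compose[OF ci_filterlim[OF x0(1)] ly] x0(2) by simp
  have l1: "((%z. zeta (ci (snd z)) (s (fst z))) ---> zeta m (s v)) ?F"
  proof (rule lin_family_tendsto[OF fd _ zeta_linear[OF chart_m(2)]])
   show "eventually (%z. linear (zeta (ci (snd z)))) ?F"
    using eventually_compose_filterlim[OF Um_nhds[OF chart_m(2)] lc] by eventually_elim (rule zeta_linear)
   show "((%z. zeta (ci (snd z)) w) ---> zeta m w) ?F" for w
    by (rule filterlim_compose[OF zeta_tendsto[OF chart_m(2)] lc])
   show "((%z. s (fst z)) ---> s v) ?F"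
    by (rule bounded_linear.tendsto[OF fd_bounded_linear[OF fdM s(1)] lv])
  qed
  have "((%z. ?N (snd z) (fst z)) ---> d\<alpha> x0 (zeta m (s v))) ?F"
  proof (rule lin_family_tendsto[OF fdM _ _ _ l1])
   show "eventually (%z. linear (d\<alpha> (snd z))) ?F"
    using ev\<Omega> by eventually_elim (metis \<alpha>_deriv has_derivative_linear)
   show "linear (d\<alpha> x0)" using proj(1) by (simp add: d\<alpha>_x0)
   have "continuous (at x0) (%y. d\<alpha> y w)" for w
    using Ck_on_continuous[OF d\<alpha>_Ck[of 0 w]] \<Omega>_open x0_\<Omega> by (simp add: continuous_on_eq_continuous_at)
   then have "((%y. d\<alpha> y w) ---> d\<alpha> x0 w) (nhds x0)" for w
    unfolding isCont_def by (rule tendsto_at_iff_tendsto_nhds[THEN iffD1])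
   then show "((%z. d\<alpha> (snd z) w) ---> d\<alpha> x0 w) ?F" for w by (rule filterlim_compose[OF _ ly])
  qed
  then have "((%z. form (fst z) (?N (snd z) (fst z))) ---> form v v) ?F"
   using bounded_bilinear.tendsto[OF form_bilinear lv] v by (simp add: d\<alpha>_x0 s(2) proj(3))
  moreover have "form v v > 0" using v by (intro R.inv_form_pos) auto
  ultimately have "eventually (%z. form (fst z) (?N (snd z) (fst z)) > 0) ?F" by (rule order_tendstoD(1))
  then show "eventually (%(v, y). form v (?N y v) > 0) ?F" by (simp add: case_prod_unfold)
 qed
 with eventually_nhds_in_open[OF \<Omega>_open x0_\<Omega>] show ?thesis
 proof (eventually_elim, intro conjI impI)
  fix y assume y: "y : \<Omega>" and pos: "ALL v:?S. form v (?N y v) > 0"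
   and crit: "ALL v. form (\<alpha> y) (d\<alpha> y (zeta (ci y) v)) = 0"
  show "\<alpha> y = 0"
  proof (rule ccontr)
   assume "\<alpha> y ~= 0"
   let ?v = "(1 / norm (\<alpha> y)) *. \<alpha> y"
   have "?v : ?S" using \<open>\<alpha> y ~= 0\<close> subspace_scale[OF V_subspace \<alpha>_V[OF y]] by simp
   then have "form ?v (?N y ?v) > 0" using pos by blast
   moreover have "form ?v (?N y ?v) = 0"
    using crit by (simp only: bounded_bilinear.scaleR_left[OF form_bilinear]) simp
   ultimately show False by simp
  qed
 qed
qed

end


text \<open>The curve need only be Lipschitz at 0, as long as its image under the differential of E
  is differentiable. This is the situation of the solution branch, whose motion lies in directions
  killed by the differential.\<close>

lemma curve_derivative:
 assumes E: "(E has_derivative E') (at (\<gamma> 0))" and c: "eventually (%t. norm (\<gamma> t - \<gamma> 0) \<le> c * \<bar>t\<bar>) (nhds (0::real))"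
  and d: "((%t. E' (\<gamma> t - \<gamma> 0)) has_real_derivative d) (at 0)"
 shows "((%t. E (\<gamma> t) :: real) has_real_derivative d) (at 0)"
proof -
 let ?r = "%t. E (\<gamma> t) - E (\<gamma> 0) - E' (\<gamma> t - \<gamma> 0)"
 have E0: "E' 0 = 0" using has_derivative_linear[OF E] by (rule linear_0)
 have lim: "(\<gamma> ---> \<gamma> 0) (nhds 0)"
 proof (rule Lim_transform_bound[THEN Lim_null[THEN iffD2]])
  show "eventually (%t. norm (\<gamma> t - \<gamma> 0) \<le> norm (c * \<bar>t\<bar>)) (nhds 0)"
   using c by eventually_elim (simp add: abs_le_iff)
  show "((%t. c * \<bar>t\<bar>) ---> 0) (nhds 0)"
   using tendsto_mult[OF tendsto_const[of c] tendsto_rabs[OF filterlim_ident[of "nhds 0"]]] by simp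
 qed
 have "(?r has_derivative (%_. 0)) (at 0)"
  unfolding has_derivative_within_alt
 proof (intro conjI bounded_linear_zero allI impI)
  fix e :: real assume e: "e > 0"
  define e' where "e' = e / (\<bar>c\<bar> + 1)"
  have e': "e' > 0" "e' * \<bar>c\<bar> \<le> e" using e by (auto simp: e'_def field_simps)
  obtain d where "d > 0" "!!z. norm (z - \<gamma> 0) < d ==> norm (E z - E (\<gamma> 0) - E' (z - \<gamma> 0)) \<le> e' * norm (z - \<gamma> 0)"
   using E e'(1) unfolding has_derivative_within_alt by fastforce
  then have "eventually (%z. norm (E z - E (\<gamma> 0) - E' (z - \<gamma> 0)) \<le> e' * norm (z - \<gamma> 0)) (nhds (\<gamma> 0))"
   unfolding eventually_nhds_metric dist_norm by blast
  from eventually_compose_filterlim[OF this lim] c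
  have "eventually (%t. norm (?r t) \<le> e * norm t) (nhds 0)"
  proof eventually_elim
   case (elim t)
   have "e' * norm (\<gamma> t - \<gamma> 0) \<le> e' * (c * \<bar>t\<bar>)" using elim(2) e' by (intro mult_left_mono) auto
   also have "... \<le> (e' * \<bar>c\<bar>) * \<bar>t\<bar>" using e' by (simp add: mult_right_mono)
   also have "... \<le> e * \<bar>t\<bar>" using e' by (intro mult_right_mono) auto
   finally show ?case using elim(1) by simp
  qed
  then show "EX d>0. ALL y:UNIV. norm (y - 0) < d --> norm (?r y - ?r 0 - 0) \<le> e * norm (y - 0)"
   unfolding eventually_nhds_metric dist_norm by (simp add: E0)
 qed
 then have "(?r has_real_derivative 0) (at 0)"
  unfolding has_field_derivative_def by (rule has_derivative_eq_rhs) auto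
 from DERIV_add[OF DERIV_add[OF this d] DERIV_const[of "E (\<gamma> 0)"]] show ?thesis by simp
qed

text \<open>Encodes a functional by its values on the basis as a vector of the same space, so that
  the critical point equation becomes an equation from the model space to itself.\<close>

definition "frame T = (\<Sum>e\<in>some_basis. T e *. (e :: 'v::real_normed_vector))"

lemma frame_zero:
 assumes fd: "findim TYPE('v::real_normed_vector)" and T: "linear (T :: 'v => real)" and z: "frame T = 0"
 shows "T v = 0"
proof -
 have B: "basis_of (some_basis :: 'v set)" by (rule some_basis[OF fd])
 then have "T b = 0" if "b : some_basis" for b
  using independentD[of some_basis some_basis T b] z that by (auto simp: basis_of_def frame_def)
 then show ?thesis using linear_basis_sum[OF B T, of v] by simp
qed

lemma param_open_Times: "openin P U ==> open S ==> param_open P (U \<times> S)"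
 unfolding param_open_def
 by (auto dest: openin_subset simp: open_contains_ball) (metis Sigma_mono order_refl)

section \<open>The perturbed function in coordinates and its linearization at the orbit\<close>

locale perturbed = proper_point G GM M \<phi> m for G :: "'a monoid" (structure) and GM :: "('a, 'b::real_normed_vector) smooth_space"
 and M :: "('c, 'e::real_normed_vector) smooth_space" and \<phi> m +
 fixes H :: "'a set" and C :: "'a set" and h :: "'c => real" and \<Lambda> :: "real set" and hp :: "real => 'c => real"
 assumes H: "subgroup H G" "closedin T H" and C: "compactin T C" "g : CG ==> EX a:H. a ** g : C"
  and h: "h : invariant_smooth_functions G M \<phi>" and nd: "nondegenerate_equilibrium G GM M \<phi> h m"
  and hp: "invariant_perturbation (subgroup_as_group G H) M \<phi> h \<Lambda> hp"

sublocale perturbed \<subseteq> closed_pair G GM Stab H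
 by (intro closed_pair.intro closed_pair_axioms.intro compact_subgrp_axioms H)

context perturbed
begin

lemma \<Lambda>: "open \<Lambda>" "0 : \<Lambda>" and hp_zero: "x : points M ==> hp 0 x = h x"
 and hp_inv: "s : \<Lambda> ==> a : H ==> x : points M ==> hp s (\<phi> a x) = hp s x"
 and hp_joint: "smooth_map (product_space M (open_subspace standard_space \<Lambda>)) standard_space (%(x, s). hp s x)"
 using hp by (auto simp: invariant_perturbation_def invariant_smooth_functions_def subgroup_as_group_def)

lemma h_inv: "g : CG ==> x : points M ==> h (\<phi> g x) = h x" and h_smooth: "smooth_map M standard_space h"
 using h by (auto simp: invariant_smooth_functions_def)

abbreviation "PS \<equiv> product_space (open_subspace standard_space \<Lambda>) GM"
abbreviation "c0 \<equiv> c1 \<one>"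

lemma top_\<Lambda>: "top_of (open_subspace standard_space \<Lambda>) = subtopology euclidean \<Lambda>"
 by (simp add: open_subspace_def)

lemma PS_points: "topspace (top_of PS) = \<Lambda> \<times> CG" by (simp add: top_\<Lambda>)

lemma PS_nhds: "s : \<Lambda> ==> g : CG ==> nhdsin (top_of PS) (s, g) = nhds s \<times>\<^sub>F nhdsin T g"
 using nhdsin_subtop[of euclidean \<Lambda> s] \<Lambda>(1) by (simp add: top_\<Lambda> nhdsin_prod)

text \<open>The group occurs twice: in p as a topological parameter, over which estimates are made
  uniform, and in z as a smooth coordinate near the identity, with respect to which derivatives in
  the group direction are taken. \<open>E_shift\<close> and \<open>\<Psi>_shift\<close> move the
  coordinate into the parameter.\<close>

definition "Fn p z = hp (fst p) (\<phi> (snd p ** ic (fst z)) (ci (snd z)))"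
definition "E p z = Fn p z + \<rho> (snd z)"
definition "edom = (\<Lambda> \<times> CG) \<times> (c1 ` U0 \<times> \<Omega>)"

lemma U0_image_open: "open (c1 ` U0)" by (rule chart_open_image_dom[OF GM_ok chart_one(1)])

lemma c0: "c0 : c1 ` U0" "ic c0 = \<one>"
 using chart_one chart_inv[OF GM_ok chart_one] by (auto simp: ic_def)

lemma ic_carrier: "b : c1 ` U0 ==> ic b : CG"
 unfolding ic_def using U0_carrier by (meson inv_into_into subsetD)

lemma edom_open: "param_open (top_of PS) edom"
 unfolding edom_def by (rule param_open_Times) (simp_all add: PS_points[symmetric] open_Times U0_image_open \<Omega>_open del: top_of_product_space)

lemma Fn_pCk: "pCk_on k (top_of PS) edom Fn"
proof -
 note LO = atlas_ok_open_subspace_standard[OF findim_real \<Lambda>(1)]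
 note PO = ok_product[OF LO GM_ok] and QO = ok_product[OF GM_ok M_ok]
 note AO = ok_product[OF PO QO] and SO = atlas_ok_standard[OF findim_real]
 let ?g = "%z. \<phi> (snd (fst z) ** fst (snd z)) (snd (snd z))"
 have s1: "smooth_map (product_space PS (product_space GM M)) GM (%z. snd (fst z))"
  using smooth_map_compose[OF AO PO GM_ok smooth_map_fst[OF PO QO] smooth_map_snd[OF LO GM_ok]] by (simp add: comp_def)
 have s2: "smooth_map (product_space PS (product_space GM M)) GM (%z. fst (snd z))"
  using smooth_map_compose[OF AO QO GM_ok smooth_map_snd[OF PO QO] smooth_map_fst[OF GM_ok M_ok]] by (simp add: comp_def)
 have s3: "smooth_map (product_space PS (product_space GM M)) M (%z. snd (snd z))"
  using smooth_map_compose[OF AO QO M_ok smooth_map_snd[OF PO QO] smooth_map_snd[OF GM_ok M_ok]] by (simp add: comp_def)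
 have s4: "smooth_map (product_space PS (product_space GM M)) (open_subspace standard_space \<Lambda>) (%z. fst (fst z))"
  using smooth_map_compose[OF AO PO LO smooth_map_fst[OF PO QO] smooth_map_fst[OF LO GM_ok]] by (simp add: comp_def)
 have "smooth_map (product_space PS (product_space GM M)) M ?g"
  using smooth_map_compose[OF AO QO M_ok smooth_map_Pair[OF AO GM_ok M_ok smooth_mult[OF AO s1 s2] s3] act_smooth] by (simp add: comp_def)
 from smooth_map_compose[OF AO ok_product[OF M_ok LO] SO smooth_map_Pair[OF AO M_ok LO this s4] hp_joint]
 have sm: "smooth_map (product_space PS (product_space GM M)) standard_space (%z. hp (fst (fst z)) (?g z))" by (simp add: comp_def)
 have ch: "(U0 \<times> Um, map_prod c1 crd) : atlas (product_space GM M)"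
  using chart_one(1) chart_m(1) by (auto simp: atlas_product)
 have "(UNIV, id) : atlas (standard_space :: (real, real) smooth_space)" by simp
 note X = smooth_map_pCk_on(1)[OF PO QO SO sm ch this, of k]
 show ?thesis
 proof (rule pCk_on_cong[OF edom_open _ pCk_on_subset[OF X]])
  fix p z assume "(p, z) : edom"
  then have "inv_into (U0 \<times> Um) (map_prod c1 crd) (fst z, snd z) = (ic (fst z), ci (snd z))"
   unfolding ic_def ci_def
   by (intro inv_into_map_prod chart_inj[OF GM_ok chart_one(1)] chart_inj[OF M_ok chart_m(1)]) (auto simp: edom_def \<Omega>_subset)
  then show "Fn p z = id (hp (fst (fst (p, inv_into (U0 \<times> Um) (map_prod c1 crd) z))) (?g (p, inv_into (U0 \<times> Um) (map_prod c1 crd) z)))"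
   by (simp add: Fn_def)
 qed (auto simp: edom_def top_\<Lambda> map_prod_surj_on dest: \<Omega>_subset)
qed

lemma E_pCk: "pCk_on k (top_of PS) edom E"
proof -
 have op: "open (c1 ` U0 \<times> \<Omega>)" by (intro open_Times U0_image_open \<Omega>_open)
 have "Ck_on k (c1 ` U0 \<times> \<Omega>) (%z. \<rho> (snd z))"
  by (rule Ck_on_compose[OF fdM op \<rho>_Ck Ck_on_snd[OF op]]) auto
 then show ?thesis unfolding E_def
  by (intro pCk_on_add[OF edom_open Fn_pCk] Ck_on_pCk_on[OF op]) (auto simp: edom_def top_\<Lambda>)
qed

definition "dE p z w = FD (E p) z w"
text \<open>The derivative in the second coordinate alone; its zeros are the critical points in y
  with the group element fixed.\<close>

definition "\<Psi> p z = frame (%e. dE p z (0, e))"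

lemma E_deriv: "(p, z) : edom ==> (E p has_derivative dE p z) (at z)"
 unfolding dE_def[abs_def] by (rule pCk_has_deriv[OF E_pCk])

lemma dE_linear: "(p, z) : edom ==> linear (dE p z)"
 using E_deriv has_derivative_linear by blast

lemma dE_pCk: "pCk_on k (top_of PS) edom (%p z. dE p z w)"
 using E_pCk[of "Suc k"] unfolding pCk_on.simps dE_def by blast

lemma \<Psi>_pCk: "pCk_on k (top_of PS) edom \<Psi>"
 unfolding \<Psi>_def[abs_def] frame_def
proof (rule pCk_on_sum[OF edom_open])
 show "finite (some_basis :: 'e set)" using some_basis[OF fdM] by (simp add: basis_of_def)
 show "pCk_on k (top_of PS) edom (%p z. dE p z (0, e) *. e)" for e :: 'e
  by (rule pCk_on_linear_param[OF findim_real edom_open _ _ dE_pCk, of "%_ r. r *. e"])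
   (auto intro: bounded_linear.linear[OF bounded_linear_scaleR_left])
qed

lemma slice_deriv:
 assumes "((s, g), (b, y)) : edom"
 shows "((%y. E (s, g) (b, y)) has_derivative (%v. dE (s, g) (b, y) (0, v))) (at y)"
proof -
 have "((%y. (b, y)) has_derivative (%v. (0, v))) (at y)" by (auto intro!: derivative_eq_intros)
 from diff_chain_at[OF this E_deriv[OF assms]] show ?thesis by (simp add: comp_def)
qed

lemma \<Psi>_eqI:
 assumes p: "((s, g), (b, y)) : edom" and d: "((%y. E (s, g) (b, y)) has_derivative D) (at y)"
 shows "\<Psi> (s, g) (b, y) = frame D"
 using has_derivative_unique[OF slice_deriv[OF p] d] by (simp add: \<Psi>_def fun_eq_iff)

lemma E_shift: "g : CG ==> b : c1 ` U0 ==> E (s, g) (b, y) = E (s, g ** ic b) (c0, y)"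
 using ic_carrier[of b] by (simp add: E_def Fn_def c0)

lemma \<Psi>_shift:
 assumes "s : \<Lambda>" "g : CG" "b : c1 ` U0" "y : \<Omega>"
 shows "\<Psi> (s, g) (b, y) = \<Psi> (s, g ** ic b) (c0, y)"
proof -
 have "((s, g ** ic b), (c0, y)) : edom" "((s, g), (b, y)) : edom" using assms c0 ic_carrier by (auto simp: edom_def)
 then show ?thesis
  using \<Psi>_eqI[of s "g ** ic b" c0 y] slice_deriv[of s g b y] E_shift[OF assms(2,3)] by (simp add: \<Psi>_def)
qed

lemma E_left:
 assumes "s : \<Lambda>" "a : H" "g : CG" "b : c1 ` U0" "y : \<Omega>"
 shows "E (s, a ** g) (b, y) = E (s, g) (b, y)"
 using assms ic_carrier[OF assms(4)] H_carrier[OF assms(2)] ci_points[OF \<Omega>_subset[OF assms(5)]]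
 by (simp add: E_def Fn_def m_assoc act_mult act_closed hp_inv)

lemma \<Psi>_left:
 assumes s: "s : \<Lambda>" and a: "a : H" and g: "g : CG" and y: "y : \<Omega>"
 shows "\<Psi> (s, a ** g) (c0, y) = \<Psi> (s, g) (c0, y)"
proof -
 have p: "((s, a ** g), (c0, y)) : edom" "((s, g), (c0, y)) : edom" using s a g y c0 H_carrier by (auto simp: edom_def)
 have "eventually (%y. E (s, g) (c0, y) = E (s, a ** g) (c0, y)) (nhds y)"
  using eventually_nhds_in_open[OF \<Omega>_open y] by eventually_elim (simp add: E_left s a g c0)
 from \<Psi>_eqI[OF p(1) has_derivative_ev_eq[OF slice_deriv[OF p(2)] this]] show ?thesis by (simp add: \<Psi>_def)
qed

abbreviation "hc \<equiv> h o ci"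

lemma hc_Ck: "Ck_on k (crd ` Um) hc"
 using smooth_map_chart[OF h_smooth chart_m(1), of UNIV id k] by (simp add: ci_def)

text \<open>The second derivative at x0 of \<open>hc\<close> plus \<rho>. As \<alpha> vanishes at x0
  and has derivative \<open>proj\<close> there, only the form of the projections remains from
  \<rho>.\<close>

definition "Q u v = hessian M h m u v + form (proj u) (proj v)"

lemma hessian_eq: "hessian M h m u v = FD (%y. FD hc y v) x0 u"
 by (simp add: hessian_def coord_inv_def coord_def ci_def Um_def crd_def x0_def)

lemma hessian_deriv: "((%y. FD hc y v) has_derivative (%u. hessian M h m u v)) (at x0)"
proof -
 have "Ck_on (Suc 0) (crd ` Um) (%y. FD hc y v)" using hc_Ck[of "Suc (Suc 0)"] by simp
 from Ck_has_deriv[OF this x0(1)] show ?thesis by (simp add: hessian_eq)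
qed

text \<open>At parameter 0 the invariance of h under G removes g, so the linearization is the same
  for every group element.\<close>

lemma \<Psi>_zero:
 assumes g: "g : CG" and y: "y : \<Omega>"
 shows "\<Psi> (0, g) (c0, y) = frame (%v. FD hc y v + form (\<alpha> y) (d\<alpha> y v))"
proof (rule \<Psi>_eqI)
 show p: "((0, g), (c0, y)) : edom" using g y c0 \<Lambda> by (auto simp: edom_def)
 have "((%y. hc y + \<rho> y) has_derivative (%v. FD hc y v + form (\<alpha> y) (d\<alpha> y v))) (at y)"
  by (intro has_derivative_add \<rho>_deriv y Ck_has_deriv[OF hc_Ck[of "Suc 0"] \<Omega>_subset])
 moreover have "eventually (%y. hc y + \<rho> y = E (0, g) (c0, y)) (nhds y)"
  using eventually_nhds_in_open[OF \<Omega>_open y]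
  by eventually_elim (use g in \<open>simp add: E_def Fn_def c0 hp_zero h_inv act_closed ci_points \<Omega>_subset\<close>)
 ultimately show "((%y. E (0, g) (c0, y)) has_derivative (%v. FD hc y v + form (\<alpha> y) (d\<alpha> y v))) (at y)"
  by (rule has_derivative_ev_eq)
qed

lemma chart_at_standard: "chart_at standard_space (x :: real) = (UNIV, id)"
 unfolding chart_at_def by (rule some_equality) auto

lemma dhc_x0: "FD hc x0 v = 0"
proof -
 have "differential M standard_space h m v = 0" using nd by (simp add: nondegenerate_equilibrium_def)
 then show ?thesis
  by (simp add: differential_def coord_def coord_inv_def ci_def Um_def crd_def x0_def chart_at_standard)
qed

lemma \<Psi>_zero_x0: "g : CG ==> \<Psi> (0, g) (c0, x0) = 0"
 using \<Psi>_zero[OF _ x0_\<Omega>] bounded_bilinear.zero_left[OF form_bilinear] by (simp add: dhc_x0 \<alpha>_x0 frame_def)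

lemma \<Psi>_zero_deriv:
 assumes g: "g : CG"
 shows "FD (\<Psi> (0, g)) (c0, x0) (0, u) = frame (Q u)"
proof -
 have p: "((0, g), (c0, x0)) : edom" using g c0 \<Lambda> x0_\<Omega> by (auto simp: edom_def)
 have "((%y. (c0, y)) has_derivative (%v. (0, v))) (at x0)" by (auto intro!: derivative_eq_intros)
 from diff_chain_at[OF this pCk_has_deriv[OF \<Psi>_pCk p]]
 have 1: "((%y. \<Psi> (0, g) (c0, y)) has_derivative (%u. FD (\<Psi> (0, g)) (c0, x0) (0, u))) (at x0)"
  by (simp add: comp_def)
 have "((%y. frame (%v. FD hc y v + form (\<alpha> y) (d\<alpha> y v))) has_derivative (%u. frame (Q u))) (at x0)"
  unfolding frame_def
 proof (intro has_derivative_sum bounded_linear.has_derivative[OF bounded_linear_scaleR_left])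
  fix v
  have dd: "((%y. d\<alpha> y v) has_derivative FD (%y. d\<alpha> y v) x0) (at x0)"
   by (rule Ck_has_deriv[OF d\<alpha>_Ck[of "Suc 0"] x0_\<Omega>])
  have "((%y. form (\<alpha> y) (d\<alpha> y v)) has_derivative (%u. form (proj u) (proj v))) (at x0)"
   using bounded_bilinear.FDERIV[OF form_bilinear \<alpha>_deriv_x0 dd] bounded_bilinear.zero_left[OF form_bilinear]
   by (simp add: \<alpha>_x0 d\<alpha>_x0)
  from has_derivative_add[OF hessian_deriv this]
  show "((%y. FD hc y v + form (\<alpha> y) (d\<alpha> y v)) has_derivative (%u. Q u v)) (at x0)"
   by (simp add: Q_def)
 qed
 moreover have "eventually (%y. frame (%v. FD hc y v + form (\<alpha> y) (d\<alpha> y v)) = \<Psi> (0, g) (c0, y)) (nhds x0)"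
  using eventually_nhds_in_open[OF \<Omega>_open x0_\<Omega>] by eventually_elim (simp add: \<Psi>_zero[OF g])
 ultimately have "((%y. \<Psi> (0, g) (c0, y)) has_derivative (%u. frame (Q u))) (at x0)" by (rule has_derivative_ev_eq)
 from has_derivative_unique[OF 1 this] show ?thesis by metis
qed

text \<open>By invariance every point of the orbit is critical, so the derivative of h vanishes
  along the orbit and may be differentiated in its directions.\<close>

lemma hessian_V: "v : V ==> hessian M h m v w = 0"
proof -
 assume "v : V"
 then obtain u where u: "v = zeta m u" by (auto simp: V_def)
 let ?c = "%t. crd (\<phi> (Exp (t *. u)) m)"
 have cz: "?c 0 = x0" using m by (simp add: act_one x0_def)
 have "((%t. FD hc (?c t) w) has_derivative (%t. hessian M h m (t *. v) w)) (at 0)"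
  using diff_chain_at[OF orbit_line[OF chart_m(2), of u, unfolded has_vector_derivative_def], of "%y. FD hc y w"]
   hessian_deriv[of w] cz u by (simp add: comp_def)
 moreover have "eventually (%t. FD hc (?c t) w = 0) (nhds 0)"
  using eventually_compose_filterlim[OF Um_nhds[OF chart_m(2)] act_line_filterlim[OF m, of u]]
 proof eventually_elim
  case (elim t)
  let ?k = "Exp (t *. u)"
  have ik: "(inv ?k, ?c t) : actdom" using elim m chart_m by (simp add: actdom_def ci_crd act_mult[symmetric] act_one)
  have "actc (inv ?k) (?c t) = x0" using elim m by (simp add: actc_def ci_crd act_mult[symmetric] act_one x0_def)
  then have "(hc has_derivative (%v. 0)) (at (actc (inv ?k) (?c t)))"
   using Ck_has_deriv[OF hc_Ck[of "Suc 0"] x0(1)] ext[of "FD hc x0", OF dhc_x0] by simp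
  from diff_chain_at[OF pCk_has_deriv[OF actc_pCk ik] this]
  have "((%y. hc (actc (inv ?k) y)) has_derivative (%v. 0)) (at (?c t))" by (simp add: comp_def)
  moreover have "eventually (%y. hc (actc (inv ?k) y) = hc y) (nhds (?c t))"
   using actdom_ev[OF ik] by eventually_elim (auto simp: actdom_def actc_def ci_crd h_inv ci_points)
  ultimately have "(hc has_derivative (%v. 0)) (at (?c t))" by (rule has_derivative_ev_eq)
  then show ?case by (metis frechet_derivative_at)
 qed
 ultimately have "((%t::real. 0::real) has_derivative (%t. hessian M h m (t *. v) w)) (at 0)"
  by (rule has_derivative_ev_eq)
 from has_derivative_unique[OF this has_derivative_const] have "hessian M h m (1 *. v) w = 0" by metis
 then show ?thesis by simp
qed

lemma Q_linear: "linear (Q u)" "linear (%u. Q u v)"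
proof -
 have h: "linear (%u. hessian M h m u v)" for v using hessian_deriv has_derivative_linear by blast
 have l1: "linear (%v. form w (proj v))" "linear (%u. form (proj u) w)" for w
  using linear_compose[OF proj(1) bounded_linear.linear[OF bounded_bilinear.bounded_linear_right[OF form_bilinear]]]
   linear_compose[OF proj(1) R.inv_form_linear] by (auto simp: comp_def)
 then show "linear (%u. Q u v)" unfolding Q_def by (intro linear_compose_add h)
 have "linear (%v. FD hc y v)" if "y : crd ` Um" for y
  using Ck_has_deriv[OF hc_Ck[of "Suc 0"] that] has_derivative_linear by blast
 then have lin: "linear (FD hc y)" if "y : crd ` Um" for y using that by simp
 \<comment> \<open>Linearity in the second argument holds for FD hc y at all y near x0 and survives
   differentiation in y.\<close>
 have "linear (%v. hessian M h m u v)"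
 proof (rule linearI)
  fix a b :: 'e and r :: real
  have ev: "eventually (%y. y : crd ` Um) (nhds x0)" by (rule eventually_nhds_in_open[OF crd_open x0(1)])
  have "eventually (%y. FD hc y a + FD hc y b = FD hc y (a + b)) (nhds x0)"
   using ev by eventually_elim (simp add: linear_add[OF lin])
  from has_derivative_unique[OF has_derivative_ev_eq[OF has_derivative_add[OF hessian_deriv hessian_deriv] this] hessian_deriv]
  show "hessian M h m u (a + b) = hessian M h m u a + hessian M h m u b" by metis
  have "eventually (%y. r *. FD hc y a = FD hc y (r *. a)) (nhds x0)"
   using ev by eventually_elim (simp add: linear_scale[OF lin])
  from has_derivative_unique[OF has_derivative_ev_eq[OF has_derivative_scaleR_right[OF hessian_deriv] this] hessian_deriv]
  show "hessian M h m u (r *. a) = r *. hessian M h m u a" by metis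
 qed
 then show "linear (Q u)" unfolding Q_def[abs_def] by (intro linear_compose_add l1)
qed

text \<open>Testing against the kernel of \<open>proj\<close>, which is complementary to V, and
  using that the Hessian kills V, nondegeneracy puts u into V. There only the positive definite
  summand is left.\<close>

lemma Q_nondegenerate:
 assumes "!!v. Q u v = 0" shows "u = 0"
proof -
 let ?N = "{v. proj v = 0}"
 have N: "subspace ?N" using proj(1) by (auto simp: subspace_def linear_add linear_scale linear_0)
 have PP: "proj (proj v) = proj v" for v using proj(2,3) by blast
 have n: "v - proj v : ?N" for v by (simp add: linear_diff[OF proj(1)] PP)
 have "?N Int lie_algebra_orbit G GM M \<phi> m = {0}"
  unfolding lie_algebra_orbit_eq using proj(3) subspace_0[OF V_subspace] linear_0[OF proj(1)] by force
 moreover have "{u + w |u w. u : ?N & w : lie_algebra_orbit G GM M \<phi> m} = UNIV"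
 proof (intro equalityI subsetI UNIV_I CollectI)
  fix v show "EX u w. v = u + w & u : ?N & w : lie_algebra_orbit G GM M \<phi> m"
   unfolding lie_algebra_orbit_eq using n[of v] proj(2) by (intro exI[of _ "v - proj v"] exI[of _ "proj v"]) auto
 qed
 ultimately have nd': "ALL u:?N. (ALL v:?N. hessian M h m u v = 0) --> u = 0"
  using nd N unfolding nondegenerate_equilibrium_def by blast
 have hN: "hessian M h m (u - proj u) v = 0" if "v : ?N" for v
 proof -
  have lh: "linear (%u. hessian M h m u v)" using hessian_deriv has_derivative_linear by blast
  have "hessian M h m (proj u) v = 0" using proj(2) by (intro hessian_V) blast
  then have "hessian M h m (u - proj u) v = hessian M h m u v" by (simp add: linear_diff[OF lh])
  also have "... = Q u v" using that bounded_bilinear.zero_right[OF form_bilinear] by (simp add: Q_def)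
  finally show ?thesis using assms by simp
 qed
 have "u - proj u = 0" using bspec[OF nd' n[of u]] hN by blast
 then have u: "proj u = u" by simp
 then have "u : V" using subsetD[OF proj(2) rangeI[of proj u]] by simp
 then have "form u u = 0" using assms[of u] hessian_V by (simp add: Q_def u)
 then show ?thesis using R.inv_form_pos[of u] by fastforce
qed

end


section \<open>Estimates uniform over the compact set C, and separation by properness\<close>

context perturbed
begin

lemma edomI: "s : \<Lambda> ==> g : CG ==> y : \<Omega> ==> ((s, g), (c0, y)) : edom"
 using c0 by (simp add: edom_def)

lemma edom_tendsto:
 assumes Z: "pCk_on k (top_of PS) edom Z" and d: "((s, g), z) : edom"
  and p: "filterlim p (nhds s) F" and u: "filterlim u (nhdsin T g) F" and w: "(w ---> z) F"
 shows "((%x. Z (p x, u x) (w x)) ---> Z (s, g) z) F"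
proof -
 have "nhdsin (top_of PS) (s, g) = nhds s \<times>\<^sub>F nhdsin T g" using d by (intro PS_nhds) (auto simp: edom_def)
 with param_contD[OF pCk_param_cont[OF Z] d]
 have "((%z. Z (fst z) (snd z)) ---> Z (s, g) z) ((nhds s \<times>\<^sub>F nhdsin T g) \<times>\<^sub>F nhds z)" by metis
 from filterlim_compose[OF this filterlim_Pair[OF filterlim_Pair[OF p u] w]] show ?thesis by simp
qed

lemma frame_Q: "linear (%u. frame (Q u))" "frame (Q u) = 0 ==> u = 0"
proof -
 show "linear (%u. frame (Q u))" unfolding frame_def
  by (rule linearI) (simp_all add: linear_add[OF Q_linear(2)] linear_scale[OF Q_linear(2)]
    scaleR_add_left sum.distrib scaleR_sum_right)
 show "frame (Q u) = 0 ==> u = 0"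
  using frame_zero[OF fdM Q_linear(1)] Q_nondegenerate by blast
qed

text \<open>At s = 0 the derivative in y is the same for all g, so strict differentiability around
  each g in C has a common linear part, and compactness of C a common radius.\<close>

lemma uniform_estimate:
 assumes e: "e > 0"
 shows "EX R>0. eventually (%s. ALL g:C. ALL y:ball x0 R. ALL y':ball x0 R.
  norm (\<Psi> (s, g) (c0, y) - \<Psi> (s, g) (c0, y') - frame (Q (y - y'))) \<le> e * norm (y - y')) (nhds 0)"
proof -
 let ?P = "%g p. ALL y:ball x0 (snd p). ALL y':ball x0 (snd p).
  norm (\<Psi> (fst p, g) (c0, y) - \<Psi> (fst p, g) (c0, y') - frame (Q (y - y'))) \<le> e * norm (y - y')"
 have "eventually (%p. ALL g:C. ?P g p) (nhds 0 \<times>\<^sub>F at_right 0)"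
 proof (rule compactin_ev[OF C(1)])
  fix g assume "g : C"
  then have g: "g : CG" using C(1) compactin_subset_topspace by fastforce
  let ?F = "nhdsin T g \<times>\<^sub>F nhds 0 \<times>\<^sub>F at_right (0::real)"
  obtain U r where U: "openin (top_of PS) U" "(0, g) : U" "r > 0"
   and est: "!!p z z'. p : U ==> z : ball (c0, x0) r ==> z' : ball (c0, x0) r ==>
     norm (\<Psi> p z - \<Psi> p z' - FD (\<Psi> (0, g)) (c0, x0) (z - z')) \<le> e * norm (z - z')"
   by (rule pCk_on_derivative_close[OF findim_prod[OF fd fdM] \<Psi>_pCk edom_open edomI[OF \<Lambda>(2) g x0_\<Omega>] e]) (rule that)
  have "filterlim (%q. (fst (snd q), fst q)) (nhds 0 \<times>\<^sub>F nhdsin T g) ?F"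
   by (intro filterlim_Pair filterlim_fst filterlim_compose[OF filterlim_fst filterlim_snd])
  moreover have "eventually (%p. p : U) (nhds 0 \<times>\<^sub>F nhdsin T g)"
   using ev_nhdsin[OF U(1,2)] PS_nhds[OF \<Lambda>(2) g] by simp
  ultimately have "eventually (%q. (fst (snd q), fst q) : U) ?F" by (rule eventually_compose_filterlim[rotated])
  moreover have "eventually (%x. x < r) (at_right 0)" using U(3) by (auto simp: eventually_at_right_field)
  then have "eventually (%q. snd (snd q) < r) ?F"
   by (rule eventually_compose_filterlim[OF _ filterlim_compose[OF filterlim_snd filterlim_snd]])
  ultimately show "eventually (%(g, p). ?P g p) ?F"
  proof eventually_elim
   case (elim q)
   have "norm (\<Psi> (fst (snd q), fst q) (c0, y) - \<Psi> (fst (snd q), fst q) (c0, y') - frame (Q (y - y'))) \<le> e * norm (y - y')"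
    if "y : ball x0 (snd (snd q))" "y' : ball x0 (snd (snd q))" for y y'
    using est[OF elim(1), of "(c0, y)" "(c0, y')"] that elim(2) by (simp add: dist_Pair_Pair \<Psi>_zero_deriv[OF g] norm_Pair)
   then show ?case by (simp add: case_prod_unfold)
  qed
 qed
 then obtain Ps PR where P: "eventually Ps (nhds (0::real))" "eventually PR (at_right (0::real))"
  "!!s R. Ps s ==> PR R ==> ALL g:C. ?P g (s, R)" by (rule eventually_prodE) (rule that)
 obtain b where b: "b > 0" "!!y. 0 < y ==> y < b ==> PR y" using P(2) by (auto simp: eventually_at_right_field)
 show ?thesis
 proof (intro exI[of _ "b / 2"] conjI)
  show "b / 2 > 0" using b by simp
  show "eventually (%s. ALL g:C. ALL y:ball x0 (b / 2). ALL y':ball x0 (b / 2).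
   norm (\<Psi> (s, g) (c0, y) - \<Psi> (s, g) (c0, y') - frame (Q (y - y'))) \<le> e * norm (y - y')) (nhds 0)"
   using P(1) by eventually_elim (use P(3)[of _ "b / 2"] b in simp)
 qed
qed

lemma uniform_small:
 assumes e: "e > 0"
 shows "eventually (%s. ALL g:C. norm (\<Psi> (s, g) (c0, x0)) < e) (nhds 0)"
proof (rule compactin_ev[OF C(1)])
 fix g assume "g : C"
 then have g: "g : CG" using C(1) compactin_subset_topspace by fastforce
 have "((%q. \<Psi> (snd q, fst q) (c0, x0)) ---> \<Psi> (0, g) (c0, x0)) (nhdsin T g \<times>\<^sub>F nhds 0)"
  by (rule edom_tendsto[OF \<Psi>_pCk edomI[OF \<Lambda>(2) g x0_\<Omega>] filterlim_snd filterlim_fst tendsto_const])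
 from tendsto_norm[OF this] have "eventually (%q. norm (\<Psi> (snd q, fst q) (c0, x0)) < e) (nhdsin T g \<times>\<^sub>F nhds 0)"
  by (rule order_tendstoD(2)) (use e in \<open>simp add: \<Psi>_zero_x0[OF g]\<close>)
 then show "eventually (%(g, s). norm (\<Psi> (s, g) (c0, x0)) < e) (nhdsin T g \<times>\<^sub>F nhds 0)"
  by (simp add: case_prod_unfold)
qed

text \<open>A proper map is closed. The image of the pairs whose group element lies outside near r
  times the stabilizer is a closed set missing (m, m), so a group element carrying one point near m
  to another must lie in that product.\<close>

lemma separation:
 assumes r: "r > 0"
 shows "eventually (%z. ALL t:CG. \<phi> t (ci (fst z)) = ci (snd z) --> (EX b:near r. EX k:Stab. t = b ** k)) (nhds x0 \<times>\<^sub>F nhds x0)"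
proof -
 have "eventually (%x. x : U0) (nhdsin T \<one>)" by (rule ev_nhdsin[OF U0_open chart_one(2)])
 moreover have "eventually (%x. norm (kap x) < r) (nhdsin T \<one>)"
  by (rule order_tendstoD(2)[OF tendsto_norm[OF kap_tendsto]]) (use r chart_one in auto)
 ultimately have "eventually (%x. x : near r) (nhdsin T \<one>)" by eventually_elim (simp add: near_def)
 then obtain A where A: "openin T A" "\<one> : A" "!!x. x : A ==> x : near r" by (rule ev_nhdsinE) auto
 define W where "W = (\<Union>k\<in>Stab. {x : topspace T. x ** inv k : A})"
 let ?X = "prod_topology T TM" and ?Y = "prod_topology TM TM" and ?p = "%(g, x). (\<phi> g x, x)"
 have "openin T W" unfolding W_def
 proof (intro openin_Union ballI)
  fix S assume "S : (%k. {x : topspace T. x ** inv k : A}) ` Stab"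
  then obtain k where k: "k : Stab" "S = {x : topspace T. x ** inv k : A}" by blast
  have "continuous_map T T (%x. x ** inv k)" unfolding cont_iff_filterlim
   by (intro conjI ballI mult_lim const_lim filterlim_ident) (use K_carrier k in auto)
  then show "openin T S" unfolding k(2) by (rule openin_continuous_map_preimage[OF _ A(1)])
 qed
 then have "openin ?X (W \<times> points M)" by (simp add: openin_prod_Times_iff)
 then have "closedin ?X (topspace ?X - W \<times> points M)" by (rule openin_closedin_eq[THEN iffD1, THEN conjunct2])
 then have "closedin ?Y (?p ` (topspace ?X - W \<times> points M))"
  using proper unfolding proper_action_def proper_map_def closed_map_def by blast
 then have "openin ?Y (topspace ?Y - ?p ` (topspace ?X - W \<times> points M))" by (rule openin_diff[OF openin_topspace])
 moreover have "x : W" if "x : Stab" for x using that A(2) K_carrier by (auto simp: W_def intro!: bexI[of _ x])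
 then have "(m, m) : topspace ?Y - ?p ` (topspace ?X - W \<times> points M)" using m by (auto simp: Stab_iff)
 ultimately have "eventually (%z. z : topspace ?Y - ?p ` (topspace ?X - W \<times> points M)) (nhdsin ?Y (m, m))"
  by (rule ev_nhdsin)
 then have ev: "eventually (%z. z : topspace ?Y - ?p ` (topspace ?X - W \<times> points M)) (nhdsin TM m \<times>\<^sub>F nhdsin TM m)"
  using m by (simp add: nhdsin_prod)
 have c: "filterlim ci (nhdsin TM m) (nhds x0)" using ci_filterlim[OF x0(1)] x0(2) by simp
 have "filterlim (%z. (ci (snd z), ci (fst z))) (nhdsin TM m \<times>\<^sub>F nhdsin TM m) (nhds x0 \<times>\<^sub>F nhds x0)"
  by (rule filterlim_Pair[OF filterlim_compose[OF c filterlim_snd] filterlim_compose[OF c filterlim_fst]])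
 from eventually_compose_filterlim[OF ev this] show ?thesis
 proof eventually_elim
  case (elim z)
  have "EX b:near r. EX k:Stab. t = b ** k" if t: "t : CG" "\<phi> t (ci (fst z)) = ci (snd z)" for t
  proof -
   have "?p (t, ci (fst z)) = (ci (snd z), ci (fst z))" using t(2) by simp
   then have "t : W" using elim t(1) by (metis (no_types, lifting) DiffD1 DiffD2 DiffI SigmaD2 SigmaI imageI mem_Sigma_iff topspace_prod_topology points_eq)
   then obtain k where k: "k : Stab" "t ** inv k : A" by (auto simp: W_def)
   moreover have "t = (t ** inv k) ** k" using t(1) K_carrier[OF k(1)] by (simp add: m_assoc)
   ultimately show ?thesis using A(3) by blast
  qed
  then show ?case by blast
 qed
qed

text \<open>Transports a vanishing derivative from the chart at m, pulled back along g, to the chart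
  in which \<open>differential\<close> is computed at the image point.\<close>

lemma dh_zero:
 assumes s: "s : \<Lambda>" and g: "g : CG" and y: "y : crd ` Um"
  and d: "((%y. hp s (\<phi> g (ci y))) has_derivative (%v. 0)) (at y)"
 shows "differential M standard_space (hp s) (\<phi> g (ci y)) v = 0"
proof -
 let ?x = "\<phi> g (ci y)"
 have x: "?x : points M" using act_closed[OF g ci_points[OF y]] .
 let ?U = "fst (chart_at M ?x)" and ?c = "snd (chart_at M ?x)"
 have ch: "(?U, ?c) : atlas M" "?x : ?U" using chart_at_atlas[OF M_ok x] by auto
 have gi: "\<phi> (inv g) (\<phi> g z) = z" "\<phi> g (\<phi> (inv g) z) = z" if "z : points M" for z
  using that g by (simp_all add: act_mult[symmetric] act_one)
 have sm: "smooth_map M M (\<phi> (inv g))"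
  using smooth_map_compose[OF M_ok ok_product[OF GM_ok M_ok] M_ok
    smooth_map_Pair[OF M_ok GM_ok M_ok smooth_map_const[OF M_ok GM_ok, of "inv g"] smooth_map_ident[OF M_ok]] act_smooth] g
  by (simp add: comp_def)
 let ?S = "?U Int \<phi> (inv g) -` Um" and ?t = "%z. crd (\<phi> (inv g) (inv_into ?U ?c z))"
 have Seq: "?S = ?U Int {z : points M. \<phi> (inv g) z : Um}" using chart_subset[OF M_ok ch(1)] by auto
 have "openin TM ?S" unfolding Seq
  by (intro openin_Int chart_openin[OF M_ok ch(1)] openin_continuous_map_preimage[OF smooth_cont[OF sm] chart_openin[OF M_ok chart_m(1)]])
 then have op: "open (?c ` ?S)" by (rule chart_open_image[OF M_ok ch(1)]) auto
 have xS: "?c ?x : ?c ` ?S" using ch(2) gi(1)[OF ci_points[OF y]] ci_Um[OF y] by (intro imageI) simp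
 have "Ck_on (Suc 0) (?c ` ?S) ?t" using smooth_map_chart[OF sm ch(1) chart_m(1), of "Suc 0"] by (simp add: comp_def)
 from Ck_has_deriv[OF this xS] obtain t' where t': "(?t has_derivative t') (at (?c ?x))" by blast
 have "?t (?c ?x) = y" using chart_inv[OF M_ok ch] gi(1)[OF ci_points[OF y]] crd_ci[OF y] by simp
 from diff_chain_at[OF t'] d this
 have "((%z. hp s (\<phi> g (ci (?t z)))) has_derivative (%v. 0)) (at (?c ?x))" by (fastforce simp: comp_def)
 moreover have "eventually (%z. hp s (\<phi> g (ci (?t z))) = hp s (inv_into ?U ?c z)) (nhds (?c ?x))"
  using eventually_nhds_in_open[OF op xS]
 proof eventually_elim
  case (elim z)
  then obtain w where w: "w : ?S" "z = ?c w" by blast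
  then have "inv_into ?U ?c z = w" using chart_inv[OF M_ok ch(1)] by blast
  then show ?case using w gi(2)[of w] chart_subset[OF M_ok ch(1)] by (auto simp: ci_crd)
 qed
 ultimately have "((%z. hp s (inv_into ?U ?c z)) has_derivative (%v. 0)) (at (?c ?x))" by (rule has_derivative_ev_eq)
 from frechet_derivative_at[OF this] show ?thesis
  by (simp add: differential_def coord_def coord_inv_def chart_at_standard comp_def) metis
qed

end


section \<open>The reduced function at a fixed small parameter\<close>

context perturbed
begin

context
 fixes s R r Li
 assumes s: "s : \<Lambda>" and Li: "linear Li" "!!w. Li w = 0 ==> w = 0"
  and est: "!!g y y'. g : CG ==> y : ball x0 R ==> y' : ball x0 R ==>
   norm (Li (\<Psi> (s, g) (c0, y)) - Li (\<Psi> (s, g) (c0, y')) - (y - y')) \<le> norm (y - y') / 2"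
  and small: "!!g. g : CG ==> norm (Li (\<Psi> (s, g) (c0, x0))) \<le> r / 4"
  and r: "r > 0" "r \<le> R" "ball x0 R \<subseteq> \<Omega>" "!!k y. k : Stab ==> y : ball x0 r ==> actc k y : ball x0 R"
  and oc: "!!y. y : ball x0 R ==> (!!v. form (\<alpha> y) (d\<alpha> y (zeta (ci y) v)) = 0) ==> \<alpha> y = 0"
begin

text \<open>Existence is shown in the ball of radius r but uniqueness in the larger ball of radius
  R. The difference leaves room for the translates by the stabilizer, which are compared in
  \<open>sol_right\<close>.\<close>

definition "sol g = (SOME y. y : ball x0 r & \<Psi> (s, g) (c0, y) = 0)"
definition "fs g = E (s, g) (c0, sol g)"
definition "Ds g v = dE (s, g) (c0, sol g) (v, 0)"

lemma rR: "y : ball x0 r ==> y : ball x0 R" and R\<Omega>: "y : ball x0 R ==> y : \<Omega>"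
 using r by auto

lemma sol: "g : CG ==> sol g : ball x0 r" "g : CG ==> \<Psi> (s, g) (c0, sol g) = 0"
proof -
 assume g: "g : CG"
 have sub: "cball x0 (r / 2) \<subseteq> ball x0 R" using r(1,2) by auto
 \<comment> \<open>The contraction runs in the closed ball of radius r / 2, so that the root lies in
   the open ball of radius r; it tolerates a residual of half that radius.\<close>
 have "norm (0 - Li (\<Psi> (s, g) (c0, x0))) \<le> r / 2 / 2" using small[OF g] by simp
 then obtain y where y: "y : cball x0 (r / 2)" "Li (\<Psi> (s, g) (c0, y)) = 0"
  by (rule strict_identity_open[OF fdM half_gt_zero[OF r(1)] sub est[OF g], rotated 2])
 then have "y : ball x0 r & \<Psi> (s, g) (c0, y) = 0" using Li(2) r(1) by auto
 then have "sol g : ball x0 r & \<Psi> (s, g) (c0, sol g) = 0" unfolding sol_def by (rule someI)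
 then show "sol g : ball x0 r" "\<Psi> (s, g) (c0, sol g) = 0" by auto
qed

text \<open>The residual at a point bounds its distance to the solution. Uniqueness, continuity of
  \<open>sol\<close> and its Lipschitz bound along lines are all instances.\<close>

lemma sol_dist:
 assumes g: "g : CG" and y: "y : ball x0 R"
 shows "norm (sol g - y) \<le> 2 * norm (Li (\<Psi> (s, g) (c0, y)))"
proof -
 have "norm (Li (\<Psi> (s, g) (c0, y)) - Li (\<Psi> (s, g) (c0, sol g)) - (y - sol g)) \<le> norm (y - sol g) / 2"
  by (rule est[OF g y rR[OF sol(1)[OF g]]])
 then have "norm (Li (\<Psi> (s, g) (c0, y)) - (y - sol g)) \<le> norm (y - sol g) / 2"
  using sol(2)[OF g] linear_0[OF Li(1)] by simp
 then show ?thesis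
  using norm_triangle_sub[of "y - sol g" "Li (\<Psi> (s, g) (c0, y))"] by (simp add: norm_minus_commute)
qed

lemma sol_unique: "g : CG ==> y : ball x0 R ==> \<Psi> (s, g) (c0, y) = 0 ==> sol g = y"
 using sol_dist[of g y] linear_0[OF Li(1)] by simp

lemma sol_\<Omega>: "g : CG ==> sol g : \<Omega>" "g : CG ==> ((s, g), (c0, sol g)) : edom"
 using edomI[OF s] R\<Omega>[OF rR[OF sol(1)]] by auto

lemma sol_left: "a : H ==> g : CG ==> sol (a ** g) = sol g"
 by (rule sol_unique) (use H_carrier rR sol \<Psi>_left s sol_\<Omega> in auto)

lemma E_right:
 assumes "k : Stab" "g : CG" "y : \<Omega>"
 shows "E (s, g) (c0, actc k y) = E (s, g ** k) (c0, y)"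
 using assms K_carrier \<rho>_invariant \<Omega>_invariant[OF assms(1,3)] ci_points[OF \<Omega>_subset[OF assms(3)]]
 by (auto simp: E_def Fn_def c0 actc_def ci_crd act_mult act_closed \<Omega>_def)

text \<open>Both summands of E are compatible with the stabilizer, so the action of k carries
  critical points for g ** k to critical points for g; uniqueness identifies them.\<close>

lemma sol_right:
 assumes k: "k : Stab" and g: "g : CG"
 shows "sol g = actc k (sol (g ** k))"
proof (rule sol_unique[OF g])
 have kG: "k : CG" "g ** k : CG" using K_carrier[OF k] g by auto
 let ?y = "sol (g ** k)"
 have y\<Omega>: "?y : \<Omega>" "actc k ?y : \<Omega>" using sol_\<Omega>(1)[OF kG(2)] \<Omega>_invariant[OF k] by auto
 show "actc k ?y : ball x0 R" by (rule r(4)[OF k sol(1)[OF kG(2)]])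
 have ik: "(inv k, actc k ?y) : actdom" using \<Omega>_\<alpha>dom \<alpha>dom_inv K_inv[OF k] y\<Omega>(2) by blast
 have bk: "actc (inv k) (actc k ?y) = ?y"
  using actc_mult[of k ?y "inv k"] \<Omega>_\<alpha>dom \<alpha>dom_inv k kG y\<Omega>(1) ci_points[OF \<Omega>_subset[OF y\<Omega>(1)]] crd_ci[OF \<Omega>_subset[OF y\<Omega>(1)]]
  by (fastforce simp: actc_def act_one)
 have "dE (s, g ** k) (c0, ?y) (0, v) = 0" for v
 proof (rule frame_zero[OF fdM, of "%v. dE (s, g ** k) (c0, ?y) (0, v)"])
  show "linear (%v. dE (s, g ** k) (c0, ?y) (0, v))"
   using slice_deriv[OF sol_\<Omega>(2)[OF kG(2)]] has_derivative_linear by blast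
  show "frame (%v. dE (s, g ** k) (c0, ?y) (0, v)) = 0" using sol(2)[OF kG(2)] by (simp add: \<Psi>_def)
 qed
 then have "((%y. E (s, g ** k) (c0, y)) has_derivative (%v. 0)) (at (actc (inv k) (actc k ?y)))"
  using slice_deriv[OF sol_\<Omega>(2)[OF kG(2)]] by (simp add: bk)
 from diff_chain_at[OF pCk_has_deriv[OF actc_pCk ik] this]
 have "((%z. E (s, g ** k) (c0, actc (inv k) z)) has_derivative (%v. 0)) (at (actc k ?y))" by (simp add: comp_def)
 moreover have "eventually (%z. E (s, g ** k) (c0, actc (inv k) z) = E (s, g) (c0, z)) (nhds (actc k ?y))"
  using eventually_nhds_in_open[OF \<Omega>_open y\<Omega>(2)]
  by eventually_elim (use E_right[OF K_inv[OF k], of "g ** k"] kG g in \<open>simp add: m_assoc\<close>)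
 ultimately have "((%z. E (s, g) (c0, z)) has_derivative (%v. 0)) (at (actc k ?y))" by (rule has_derivative_ev_eq)
 from \<Psi>_eqI[OF edomI[OF s g y\<Omega>(2)] this] show "\<Psi> (s, g) (c0, actc k ?y) = 0" by (simp add: frame_def)
qed

lemma sol_tendsto:
 assumes g: "g : CG" shows "(sol ---> sol g) (nhdsin T g)"
proof -
 have "((%x. \<Psi> (s, x) (c0, sol g)) ---> \<Psi> (s, g) (c0, sol g)) (nhdsin T g)"
  by (rule edom_tendsto[OF \<Psi>_pCk sol_\<Omega>(2)[OF g] tendsto_const filterlim_ident tendsto_const])
 then have "((%x. Li (\<Psi> (s, x) (c0, sol g))) ---> Li 0) (nhdsin T g)"
  using bounded_linear.tendsto[OF fd_bounded_linear[OF fdM Li(1)]] sol(2)[OF g] by simp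
 from tendsto_mult[OF tendsto_const[of 2] tendsto_norm[OF this]]
 have "((%x. 2 * norm (Li (\<Psi> (s, x) (c0, sol g)))) ---> 0) (nhdsin T g)" using linear_0[OF Li(1)] by simp
 then have "((%x. sol x - sol g) ---> 0) (nhdsin T g)"
  by (rule Lim_null_comparison[rotated])
   (use ev_topspace[of T g] in \<open>eventually_elim, simp add: sol_dist[OF _ rR[OF sol(1)[OF g]]]\<close>)
 then show ?thesis by (rule Lim_null[THEN iffD2])
qed

lemma E_sol_deriv:
 assumes g: "g : CG"
 shows "dE (s, g) (c0, sol g) (0, v) = 0"
proof (rule frame_zero[OF fdM, of "%v. dE (s, g) (c0, sol g) (0, v)"])
 show "linear (%v. dE (s, g) (c0, sol g) (0, v))"
  using slice_deriv[OF sol_\<Omega>(2)[OF g]] has_derivative_linear by blast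
 show "frame (%v. dE (s, g) (c0, sol g) (0, v)) = 0" using sol(2)[OF g] by (simp add: \<Psi>_def)
qed

text \<open>An envelope argument: the derivative of E in y vanishes at the solution, and the
  solution moves at most linearly in t by \<open>sol_dist\<close>, so only the explicit dependence
  on the group coordinate contributes.\<close>

lemma fs_deriv:
 assumes g: "g : CG"
 shows "((%t. fs (g ** Exp (t *. v))) has_real_derivative Ds g v) (at 0)"
proof -
 let ?b = "%t. c1 (Exp (t *. v))" and ?g = "%t. g ** Exp (t *. v)"
 let ?z = "%t. (?b t, sol (?g t))"
 have z0: "?z 0 = (c0, sol g)" using g by simp
 have gG: "?g t : CG" for t using g by simp
 note E' = E_deriv[OF sol_\<Omega>(2)[OF g]]
 note lin = dE_linear[OF sol_\<Omega>(2)[OF g]]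
 have b: "(?b has_derivative (%t. t *. v)) (at 0)"
  using Exp_line_chart unfolding has_vector_derivative_def .
 have lip: "EX c>=0. eventually (%t. norm (f t - f 0) \<le> c * \<bar>t\<bar>) (nhds 0)"
  if f: "(f has_derivative f') (at (0::real))" for f :: "real => 'z::real_normed_vector" and f'
 proof -
  obtain K where K: "K > 0" "!!t. norm (f' t) \<le> norm t * K"
   using bounded_linear.pos_bounded[OF has_derivative_bounded_linear[OF f]] by blast
  obtain d where d: "d > 0" "!!t. norm (t - 0) < d ==> norm (f t - f 0 - f' (t - 0)) \<le> 1 * norm (t - 0)"
   using f unfolding has_derivative_within_alt by (meson UNIV_I zero_less_one)
  have "norm (f t - f 0) \<le> (1 + K) * \<bar>t\<bar>" if "\<bar>t\<bar> < d" for t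
   using d(2)[of t] K(2)[of t] norm_triangle_sub[of "f t - f 0" "f' t"] that by (simp add: algebra_simps)
  then show ?thesis using d(1) K(1) unfolding eventually_nhds_metric dist_norm by (intro exI[of _ "1 + K"]) auto
 qed
 obtain c where c: "c \<ge> 0" "eventually (%t. norm (?b t - ?b 0) \<le> c * \<bar>t\<bar>) (nhds 0)" using lip[OF b] by blast
 let ?L = "%t. Li (\<Psi> (s, g) (?b t, sol g))"
 have "((%t. (?b t, sol g)) has_derivative (%t. (t *. v, 0))) (at 0)" by (intro has_derivative_Pair b has_derivative_const)
 then have "((%t. \<Psi> (s, g) (?b t, sol g)) has_derivative (%t. FD (\<Psi> (s, g)) (c0, sol g) (t *. v, 0))) (at 0)"
  using diff_chain_at[of "%t. (?b t, sol g)" "%t. (t *. v, 0)" 0 "\<Psi> (s, g)"] pCk_has_deriv[OF \<Psi>_pCk sol_\<Omega>(2)[OF g]]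
  by (simp add: comp_def)
 from bounded_linear.has_derivative[OF fd_bounded_linear[OF fdM Li(1)] this]
 obtain c' where c': "c' \<ge> 0" "eventually (%t. norm (?L t - ?L 0) \<le> c' * \<bar>t\<bar>) (nhds 0)" using lip by blast
 have L0: "?L 0 = 0" using sol(2)[OF g] linear_0[OF Li(1)] by simp
 have ev: "eventually (%t. norm (?z t - ?z 0) \<le> (c + 2 * c') * \<bar>t\<bar>) (nhds 0)"
  using c(2) c'(2) Exp_line_ev[of v]
 proof eventually_elim
  case (elim t)
  have bt: "?b t : c1 ` U0" using elim(3) by blast
  have "norm (sol (?g t) - sol g) \<le> 2 * norm (Li (\<Psi> (s, ?g t) (c0, sol g)))" by (rule sol_dist[OF gG rR[OF sol(1)[OF g]]])
  also have "\<Psi> (s, ?g t) (c0, sol g) = \<Psi> (s, g) (?b t, sol g)" using \<Psi>_shift[OF s g bt sol_\<Omega>(1)[OF g]] elim(3) by simp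
  finally have "norm (sol (?g t) - sol g) \<le> 2 * (c' * \<bar>t\<bar>)" using elim(2) L0 by simp
  moreover have "norm (?z t - ?z 0) \<le> norm (?b t - ?b 0) + norm (sol (?g t) - sol g)" using norm_Pair_le g by simp
  ultimately show ?case using elim(1) by (simp add: algebra_simps)
 qed
 have "((%t. dE (s, g) (c0, sol g) (?z t - ?z 0)) has_real_derivative Ds g v) (at 0)"
 proof -
  have "dE (s, g) (c0, sol g) (x, y) = dE (s, g) (c0, sol g) (x, 0)" for x y
   using linear_add[OF lin, of "(x, 0)" "(0, y)"] E_sol_deriv[OF g, of y] by simp
  then have eq: "dE (s, g) (c0, sol g) (?z t - ?z 0) = dE (s, g) (c0, sol g) (?b t - ?b 0, 0)" for t by (metis diff_Pair)
  have "((%t. (?b t - ?b 0, 0)) has_derivative (%t. (t *. v, 0))) (at 0)"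
   by (intro has_derivative_Pair has_derivative_const has_derivative_eq_rhs[OF has_derivative_diff[OF b has_derivative_const]]) auto
  from bounded_linear.has_derivative[OF fd_bounded_linear[OF findim_prod[OF fd fdM] lin] this]
  have "((%t. dE (s, g) (c0, sol g) (?b t - ?b 0, 0)) has_derivative (%t. Ds g v * t)) (at 0)"
   using linear_scale[OF lin, of _ "(v, 0)"] by (simp add: Ds_def mult.commute)
  then show ?thesis unfolding eq has_field_derivative_def .
 qed
 from curve_derivative[of "E (s, g)" _ ?z, OF _ ev this] E'
 have "((%t. E (s, g) (?z t)) has_real_derivative Ds g v) (at 0)" using z0 by simp
 moreover have "eventually (%t. E (s, g) (?z t) = fs (?g t)) (nhds 0)"
  using Exp_line_ev[of v]
 proof eventually_elim
  case (elim t)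
  then have "?b t : c1 ` U0" by blast
  from E_shift[OF g this] elim show ?case by (simp add: fs_def)
 qed
 ultimately show ?thesis unfolding has_field_derivative_def by (rule has_derivative_ev_eq)
qed

lemma inv_function_fs: "inv_function G GM Stab H fs Ds C"
proof (intro inv_function.intro inv_function_axioms.intro closed_pair_axioms C)
 show "fs (a ** g) = fs g" if "a : H" "g : CG" for a g
  using that E_left[OF s] sol_\<Omega>(1) by (simp add: fs_def sol_left c0)
 show "fs (g ** k) = fs g" if k: "k : Stab" and g: "g : CG" for k g
  unfolding fs_def sol_right[OF k g] by (rule E_right[symmetric, OF k g sol_\<Omega>(1)]) (use K_carrier[OF k] g in simp)
 fix g assume g: "g : CG"
 have zt: "((%x. (c0, sol x)) ---> (c0, sol g)) (nhdsin T g)" by (intro tendsto_Pair tendsto_const sol_tendsto g)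
 show "(fs ---> fs g) (nhdsin T g)"
  unfolding fs_def by (rule edom_tendsto[OF E_pCk sol_\<Omega>(2)[OF g] tendsto_const filterlim_ident zt])
 show "((%x. Ds x v) ---> Ds g v) (nhdsin T g)" for v
  unfolding Ds_def by (rule edom_tendsto[OF dE_pCk sol_\<Omega>(2)[OF g] tendsto_const filterlim_ident zt])
 show "linear (Ds g)"
 proof (rule linearI)
  note lin = dE_linear[OF sol_\<Omega>(2)[OF g]]
  show "Ds g (u + v) = Ds g u + Ds g v" for u v
   using linear_add[OF lin, of "(u, 0)" "(v, 0)"] by (simp add: Ds_def)
  show "Ds g (t *. u) = t *. Ds g u" for t u
   using linear_scale[OF lin, of t "(u, 0)"] by (simp add: Ds_def)
 qed
 show "((%t. fs (g ** Exp (t *. v))) has_real_derivative Ds g v) (at 0)" for v by (rule fs_deriv[OF g])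
qed

text \<open>At a critical point of the reduced function the auxiliary term \<open>\<rho>\<close> vanishes to second order,
 so \<open>hp s\<close> itself is critical there.\<close>

lemma critical_point:
 assumes g: "g : CG" and crit: "!!v. Ds g v = 0"
 shows "\<alpha> (sol g) = 0" "differential M standard_space (hp s) (\<phi> g (ci (sol g))) v = 0"
proof -
 let ?y = "sol g" and ?F = "%y. hp s (\<phi> g (ci y))"
 have y: "?y : \<Omega>" by (rule sol_\<Omega>(1)[OF g])
 have yc: "?y : crd ` Um" by (rule \<Omega>_subset[OF y])
 have "((%y. E (s, g) (c0, y)) has_derivative (%v. 0)) (at ?y)"
  using slice_deriv[OF sol_\<Omega>(2)[OF g]] by (simp add: E_sol_deriv[OF g])
 from has_derivative_diff[OF this \<rho>_deriv[OF y]]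
 have F: "(?F has_derivative (%v. - form (\<alpha> ?y) (d\<alpha> ?y v))) (at ?y)"
  using g by (simp add: E_def Fn_def c0)
 \<comment> \<open>Moving y along its orbit changes the first summand of E exactly as moving the
   group coordinate does with y fixed. The latter derivative is Ds g v, which vanishes by
   assumption.\<close>
 have "form (\<alpha> ?y) (d\<alpha> ?y (zeta (ci ?y) v)) = 0" for v
 proof -
  let ?w = "%t. crd (\<phi> (Exp (t *. v)) (ci ?y))"
  have w0: "?w 0 = ?y" using ci_points[OF yc] crd_ci[OF yc] by (simp add: act_one)
  have "((%t. ?F (?w t)) has_derivative (%t. - form (\<alpha> ?y) (d\<alpha> ?y (t *. zeta (ci ?y) v)))) (at 0)"
   using diff_chain_at[OF orbit_line[OF ci_Um[OF yc], of v, unfolded has_vector_derivative_def], of ?F] F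
   unfolding w0 by (simp add: comp_def)
  moreover have "eventually (%t. ?F (?w t) = E (s, g) (c1 (Exp (t *. v)), ?y) - \<rho> ?y) (nhds 0)"
   using eventually_compose_filterlim[OF Um_nhds[OF ci_Um[OF yc]] act_line_filterlim[OF ci_points[OF yc], of v]] Exp_line_ev[of v]
   by eventually_elim (use g ci_points[OF yc] in \<open>simp add: E_def Fn_def ci_crd act_mult\<close>)
  ultimately have 1: "((%t. E (s, g) (c1 (Exp (t *. v)), ?y) - \<rho> ?y) has_derivative (%t. - form (\<alpha> ?y) (d\<alpha> ?y (t *. zeta (ci ?y) v)))) (at 0)"
   by (rule has_derivative_ev_eq)
  have "((%t. (c1 (Exp (t *. v)), ?y)) has_derivative (%t. (t *. v, 0))) (at 0)"
   using Exp_line_chart unfolding has_vector_derivative_def by (intro has_derivative_Pair has_derivative_const)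
  then have "((%t. E (s, g) (c1 (Exp (t *. v)), ?y)) has_derivative (%t. Ds g (t *. v))) (at 0)"
   using diff_chain_at[of "%t. (c1 (Exp (t *. v)), ?y)" "%t. (t *. v, 0)" 0 "E (s, g)"] E_deriv[OF sol_\<Omega>(2)[OF g]]
   by (simp add: comp_def Ds_def)
  from has_derivative_unique[OF 1 has_derivative_diff[OF this has_derivative_const]]
  have "- form (\<alpha> ?y) (d\<alpha> ?y (1 *. zeta (ci ?y) v)) = 0" using crit by (simp add: fun_eq_iff) (metis mult_1 scaleR_one)
  then show ?thesis by simp
 qed
 then show a0: "\<alpha> ?y = 0" by (rule oc[OF rR[OF sol(1)[OF g]]])
 show "differential M standard_space (hp s) (\<phi> g (ci ?y)) v = 0"
  by (rule dh_zero[OF s g yc]) (use F bounded_bilinear.zero_left[OF form_bilinear] in \<open>simp add: a0\<close>)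
qed

text \<open>The clumps are indexed by the orbits of equilibria that arise from critical points of
  fs. On critical points \<alpha> vanishes, so fs equals the value of hp s on the orbit and is
  constant on a clump. If the orbits are infinite in number the bound is trivial.\<close>

lemma category_bound:
 assumes rB: "!!g. g : CG ==> EX g0 W F. g0 : CG & tube g0 W F & (ALL a:H. ALL b:near rB. ALL k:Stab. a ** g ** b ** k : W)"
  and sep: "!!y y' t. y : ball x0 R ==> y' : ball x0 R ==> t : CG ==> \<phi> t (ci y) = ci y' ==> EX b:near rB. EX k:Stab. t = b ** k"
  and \<E>: "!!x. x : points M ==> (!!v. differential M standard_space (hp s) x v = 0) ==> x : \<E>"
 shows "equivariant_category (subgroup_as_group G H) (left_coset_space G GM Stab) (%a C. a <# C)
  \<le> extended_card (orbit (subgroup_as_group G H) \<phi> ` \<E>)"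
proof (cases "finite (orbit (subgroup_as_group G H) \<phi> ` \<E>)")
 case False
 then show ?thesis by (simp add: extended_card_def)
next
 case True
 interpret F: inv_function G GM Stab H fs Ds C by (rule inv_function_fs)
 let ?orb = "orbit (subgroup_as_group G H) \<phi>" and ?x = "%g. \<phi> g (ci (sol g))"
 have orb: "?orb x = {\<phi> a x |a. a : H}" for x by (simp add: orbit_def subgroup_as_group_def)
 have xp: "ci (sol g) : points M" "?x g : points M" if "g : CG" for g
  using that ci_points[OF \<Omega>_subset[OF sol_\<Omega>(1)[OF that]]] act_closed by auto
 define Cr where "Cr = {g : CG. ALL v. Ds g v = 0}"
 define I where "I = (%g. ?orb (?x g)) ` Cr"
 have sub: "I \<subseteq> ?orb ` \<E>"
  unfolding I_def
 proof (rule image_subsetI)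
  fix g assume "g : Cr"
  then have g: "g : CG" "!!v. Ds g v = 0" by (auto simp: Cr_def)
  show "?orb (?x g) : ?orb ` \<E>" by (intro imageI \<E> xp(2) critical_point(2) g)
 qed
 then have fin: "finite I" using True finite_subset by blast
 have "EX g:Cr. i = ?orb (?x g)" if "i : I" for i using that by (auto simp: I_def)
 then obtain gi where gi: "!!i. i : I ==> gi i : Cr & i = ?orb (?x (gi i))" by metis
 have giG: "gi i : CG" if "i : I" for i using gi[OF that] by (simp add: Cr_def)
 have "EX W. good (q ` W) & (ALL a:H. ALL b:near rB. ALL k:Stab. a ** gi i ** b ** k : W)" if i: "i : I" for i
  using rB[OF giG[OF i]] tube_good by blast
 then obtain W where W: "!!i. i : I ==> good (q ` W i)"
  "!!i a b k. i : I ==> a : H ==> b : near rB ==> k : Stab ==> a ** gi i ** b ** k : W i" by metis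
 have val: "fs g = hp s (?x g)" if "g : Cr" for g
  using that critical_point(1)[of g] bounded_bilinear.zero_left[OF form_bilinear]
  by (simp add: Cr_def fs_def E_def Fn_def c0 \<rho>_def)
 have "equivariant_category (subgroup_as_group G H) (left_coset_space G GM Stab) (%a C. a <# C) \<le> enat (card I)"
 proof (rule F.critical_clumps[OF fin W(1)])
  fix g assume g: "g : CG" and "!!v. Ds g v = 0"
  then have gC: "g : Cr" by (simp add: Cr_def)
  let ?i = "?orb (?x g)"
  have i: "?i : I" using gC by (simp add: I_def)
  define g' where "g' = gi ?i"
  have gg: "g' : CG" "g' : Cr" "?orb (?x g') = ?i" using giG[OF i] gi[OF i] by (auto simp: g'_def)
  have "?x g : ?orb (?x g)" unfolding orb using H_one act_one[OF xp(2)[OF g]] by (metis (mono_tags, lifting) mem_Collect_eq)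
  then obtain a where a: "a : H" "?x g = \<phi> a (?x g')" using gg(3) unfolding orb by blast
  have aG: "a : CG" by (rule H_carrier[OF a(1)])
  \<comment> \<open>When g and g' lead to the same orbit of equilibria, this element carries one
    solution point near m to the other. By separation it is near the stabilizer, which puts g into
    the tube around g'.\<close>
  let ?t = "inv g' ** inv a ** g"
  have "\<phi> ?t (ci (sol g)) = \<phi> (inv g') (\<phi> (inv a) (?x g))"
   using g gg(1) aG xp(1)[OF g] by (simp add: act_mult act_closed m_assoc)
  also have "... = ci (sol g')" unfolding a(2) using gg(1) aG xp[OF gg(1)]
   by (simp add: act_mult[symmetric] act_one m_assoc inv_cancel act_closed)
  finally obtain b k where bk: "b : near rB" "k : Stab" "?t = b ** k"
   using sep[OF rR[OF sol(1)[OF g]] rR[OF sol(1)[OF gg(1)]], of ?t] g gg(1) aG by auto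
  have "a ** g' ** b ** k = a ** g' ** ?t" unfolding bk(3) using aG gg(1) near_carrier[OF bk(1)] K_carrier[OF bk(2)] by (simp add: m_assoc)
  also have "... = g" using aG gg(1) g by (simp add: m_assoc inv_cancel)
  finally have "g : W ?i" using W(2)[OF i a(1) bk(1,2)] by (simp add: g'_def)
  moreover have "fs g = fs g'" using val[OF gC] val[OF gg(2)] a hp_inv[OF s a(1) xp(2)[OF gg(1)]] by simp
  ultimately show "EX i:I. q g : q ` W i & fs g = fs (gi i)" using i unfolding g'_def by blast
 qed
 also have "card I \<le> card (?orb ` \<E>)" by (rule card_mono[OF True sub])
 finally show ?thesis using True by (simp add: extended_card_def)
qed

end

end


section \<open>A compact set meeting every coset of H, and the conclusion\<close>

context lie_grp
begin

lemma identity_compact_nhd: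
 obtains A B where "openin T A" "\<one> : A" "A \<subseteq> B" "compactin T B"
proof -
 obtain d where d: "d > 0" "cball 0 d \<subseteq> D0" using D0_open zero_D0 open_contains_cball by blast
 let ?B = "kinv ` cball 0 d"
 have "continuous_map (top_of_set D0) T kinv"
  unfolding cont_iff_filterlim
  by (auto simp: nhdsin_subtop D0_open kinv_carrier intro: kinv_filterlim)
 moreover have "compactin (top_of_set D0) (cball 0 d)"
  using d(2) compact_cball_fd[OF fd] by (simp add: compactin_subtopology)
 ultimately have B: "compactin T ?B" by (rule image_compactin[rotated])
 have "eventually (%x. x : U0) (nhdsin T \<one>)" by (rule ev_nhdsin[OF U0_open chart_one(2)])
 moreover have "eventually (%x. norm (kap x) < d) (nhdsin T \<one>)"
  by (rule order_tendstoD(2)[OF tendsto_norm[OF kap_tendsto]]) (use d chart_one in auto)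
 ultimately have "eventually (%x. x : ?B) (nhdsin T \<one>)"
 proof eventually_elim
  case (elim x)
  then have "x = kinv (kap x)" "kap x : cball 0 d" by (simp_all add: kinv_kap)
  then show ?case by blast
 qed
 then obtain A where "openin T A" "\<one> : A" "!!x. x : A ==> x : ?B" by (rule ev_nhdsinE) auto
 then show ?thesis using that B by blast
qed

text \<open>The quotient map to the right cosets is open, so finitely many translates of an open
  neighbourhood of the identity cover the quotient; the corresponding translates of a compact
  neighbourhood form C.\<close>

lemma cocompact:
 assumes H: "subgroup H G" and co: "compact_space (right_coset_space G GM H)"
 obtains C where "compactin T C" "!!g. g : CG ==> EX a:H. a ** g : C"
proof -
 obtain A B where AB: "openin T A" "\<one> : A" "A \<subseteq> B" "compactin T B" by (rule identity_compact_nhd)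
 let ?O = "%g. {x : topspace T. inv g ** x : A}" and ?K = "%g. (%b. g ** b) ` B"
 have HG: "a : CG" if "a : H" for a using subgroup.mem_carrier[OF H that] .
 have ct: "continuous_map T T (%x. g ** x)" if "g : CG" for g
  unfolding cont_iff_filterlim
  by (intro conjI ballI mult_lim const_lim filterlim_ident) (use that in auto)
 have pre: "openin T {x : topspace T. g ** x : S}" if "g : CG" "openin T S" for g S
  by (rule openin_continuous_map_preimage[OF ct[OF that(1)] that(2)])
 have cos: "EX a:H. y = a ** x" if "H #> x = H #> y" "y : CG" for x y
 proof -
  have "\<one> ** y : H #> y" using subgroup.one_closed[OF H] unfolding r_coset_def by blast
  then show ?thesis using that unfolding r_coset_def by auto
 qed
 have opn: "openin (right_coset_space G GM H) ((%g. H #> g) ` S)" if S: "openin T S" for S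
  unfolding right_coset_space_def openin_quotient_topology
 proof
  have SG: "S \<subseteq> CG" using openin_subset[OF S] by simp
  then show "(%g. H #> g) ` S \<subseteq> (%g. H #> g) ` topspace T" by auto
  have "{x : topspace T. H #> x : (%g. H #> g) ` S} = (\<Union>a\<in>H. {x : topspace T. a ** x : S})"
  proof (intro equalityI subsetI)
   fix x assume "x : {x : topspace T. H #> x : (%g. H #> g) ` S}"
   then obtain y where y: "x : CG" "y : S" "H #> x = H #> y" by auto
   then show "x : (\<Union>a\<in>H. {x : topspace T. a ** x : S})" using cos[OF y(3)] SG by auto
  next
   fix x assume "x : (\<Union>a\<in>H. {x : topspace T. a ** x : S})"
   then obtain a where a: "a : H" "x : CG" "a ** x : S" by auto
   have "H #> a ** x = (H #> a) #> x" using coset_mult_assoc[OF subgroup.subset[OF H] HG[OF a(1)] a(2)] by simp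
   also have "... = H #> x" using coset_join2[OF HG[OF a(1)] H a(1)] by simp
   finally show "x : {x : topspace T. H #> x : (%g. H #> g) ` S}" using a by (auto simp: image_iff)
  qed
  moreover have "openin T (\<Union>a\<in>H. {x : topspace T. a ** x : S})"
   by (intro openin_Union) (use pre[OF HG S] in auto)
  ultimately show "openin T {x : topspace T. H #> x : (%g. H #> g) ` S}" by simp
 qed
 let ?U = "%g. (%x. H #> x) ` ?O g"
 have "ALL S:?U ` CG. openin (right_coset_space G GM H) S" using opn[OF pre[OF _ AB(1)]] by auto
 moreover have "topspace (right_coset_space G GM H) \<subseteq> \<Union> (?U ` CG)"
  unfolding right_coset_space_def topspace_quotient_topology using AB(2) by fastforce
 ultimately obtain \<F> where \<F>: "finite \<F>" "\<F> \<subseteq> ?U ` CG" "topspace (right_coset_space G GM H) \<subseteq> \<Union>\<F>"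
  using co unfolding compact_space_alt by (metis (no_types, lifting))
 then obtain F where F: "F \<subseteq> CG" "finite F" "\<F> = ?U ` F" by (meson finite_subset_image)
 show ?thesis
 proof (rule that[of "\<Union> (?K ` F)"])
  show "compactin T (\<Union> (?K ` F))"
   by (rule compactin_Union) (use F image_compactin[OF AB(4) ct] in auto)
  fix g assume g: "g : CG"
  then have "H #> g : \<Union>\<F>" using \<F>(3) by (auto simp: right_coset_space_def topspace_quotient_topology)
  then obtain f y where y: "f : F" "y : ?O f" "H #> g = H #> y" unfolding F(3) by blast
  then have yG: "y : CG" "f : CG" using F(1) by auto
  obtain a where a: "a : H" "y = a ** g" using cos[OF y(3) yG(1)] by blast
  have "y = f ** (inv f ** y)" using yG by (simp flip: m_assoc)
  moreover have "inv f ** y : B" using y(2) AB(3) by auto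
  ultimately have "y : \<Union> (?K ` F)" using y(1) by blast
  then show "EX a:H. a ** g : \<Union> (?K ` F)" using a(1) unfolding a(2) by (rule bexI)
 qed
qed

end

text \<open>When the differential vanishes, nondegeneracy of the form makes 0 the only vector in the
  description of \<open>hamiltonian_vector_field\<close>.\<close>

lemma equilibriaI:
 assumes "symplectic_manifold M \<omega>" and x: "x : points M" and "!!v. differential M standard_space f x v = 0"
 shows "x : equilibria M \<omega> f"
proof -
 have b: "bilinear (\<omega> x)" and n: "!!u. (!!v. \<omega> x u v = 0) ==> u = 0"
  using assms(1) x unfolding symplectic_manifold_def smooth_two_form_def by auto
 have "hamiltonian_vector_field M \<omega> f x = 0"
  unfolding hamiltonian_vector_field_def assms(3)
  by (rule the_equality) (use n bilinear_lzero[OF b] in auto)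
 then show ?thesis using x by (simp add: equilibria_def)
qed

text \<open>All radii are fixed before s: R1 by the linearization, rB by the tubes, R2 by the
  separation that belongs to rB and by \<open>orbit_critical\<close>, and r by the spread of the
  stabilizer. Only then is s taken so small that the residual at x0 fits r.\<close>

lemma (in perturbed) persistence:
 assumes \<E>: "!!s x. x : points M ==> (!!v. differential M standard_space (hp s) x v = 0) ==> x : \<E> s"
 shows "eventually (%s. equivariant_category (subgroup_as_group G H) (left_coset_space G GM Stab) (%a C. a <# C)
  \<le> extended_card (orbit (subgroup_as_group G H) \<phi> ` \<E> s)) (nhds 0)"
proof -
 obtain Li where Li: "linear Li" "!!u. Li (frame (Q u)) = u" "!!w. frame (Q (Li w)) = w"
  by (rule finite_dim_injective_inverse[OF fdM frame_Q]) (assumption, rule that)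
 have Li0: "w = 0" if "Li w = 0" for w using Li(3)[of w] linear_0[OF frame_Q(1)] that by simp
 obtain B where B: "B > 0" "!!w. norm (Li w) \<le> norm w * B"
  using bounded_linear.pos_bounded[OF fd_bounded_linear[OF fdM Li(1)]] by blast
 \<comment> \<open>Composition with Li, whose norm is at most B, turns the factor 1 / (2 * B) into
   the contraction constant 1/2.\<close>
 obtain R1 where R1: "R1 > 0" and ev1: "eventually (%s. ALL g:C. ALL y:ball x0 R1. ALL y':ball x0 R1.
   norm (\<Psi> (s, g) (c0, y) - \<Psi> (s, g) (c0, y') - frame (Q (y - y'))) \<le> (1 / (2 * B)) * norm (y - y')) (nhds 0)"
  using uniform_estimate[of "1 / (2 * B)"] B(1) by auto
 obtain rB where rB: "rB > 0" "!!g. g : CG ==> EX g0 W F. g0 : CG & tube g0 W F &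
   (ALL a:H. ALL b:near rB. ALL k:Stab. a ** g ** b ** k : W)"
  by (rule tube_uniform[OF C]) (assumption, rule that)
 obtain P1 P2 where P: "eventually P1 (nhds x0)" "eventually P2 (nhds x0)"
  and sep: "!!y y'. P1 y ==> P2 y' ==> ALL t:CG. \<phi> t (ci (fst (y, y'))) = ci (snd (y, y')) --> (EX b:near rB. EX k:Stab. t = b ** k)"
  by (rule eventually_prodE[OF separation[OF rB(1)]]) (rule that)
 obtain R2 where R2: "R2 > 0" "!!y. dist y x0 < R2 ==> P1 y & P2 y &
   (y : \<Omega> & ((ALL v. form (\<alpha> y) (d\<alpha> y (zeta (ci y) v)) = 0) --> \<alpha> y = 0))"
  using eventually_conj[OF P(1) eventually_conj[OF P(2) orbit_critical]] unfolding eventually_nhds_metric by blast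
 define R where "R = min R1 R2"
 have R: "R > 0" "R \<le> R1" "R \<le> R2" using R1 R2(1) by (auto simp: R_def)
 have near0: "P1 y" "P2 y" "y : \<Omega>" "(!!v. form (\<alpha> y) (d\<alpha> y (zeta (ci y) v)) = 0) ==> \<alpha> y = 0" if "y : ball x0 R" for y
  using R2(2)[of y] that R(3) by (auto simp: dist_commute)
 have "eventually (%y. ALL k:Stab. actc k y : ball x0 R) (nhds x0)"
 proof (rule compactin_ev[OF K_compact])
  fix k assume k: "k : Stab"
  have "((%z. actc (fst z) (snd z)) ---> x0) (nhdsin T k \<times>\<^sub>F nhds x0)"
   using param_contD[OF pCk_param_cont[OF actc_pCk[of 0]] Stab_x0(1)[OF k]] Stab_x0(2)[OF k] by simp
  then have "eventually (%z. actc (fst z) (snd z) : ball x0 R) (nhdsin T k \<times>\<^sub>F nhds x0)"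
   by (rule topological_tendstoD) (use R in auto)
  then show "eventually (%(k, y). actc k y : ball x0 R) (nhdsin T k \<times>\<^sub>F nhds x0)" by (simp add: case_prod_unfold)
 qed
 then obtain r0 where r0: "r0 > 0" "!!y. dist y x0 < r0 ==> ALL k:Stab. actc k y : ball x0 R"
  unfolding eventually_nhds_metric by blast
 define r where "r = min r0 R"
 have r: "r > 0" "r \<le> R" "r \<le> r0" using r0(1) R(1) by (auto simp: r_def)
 have "eventually (%s. ALL g:C. norm (\<Psi> (s, g) (c0, x0)) < r / (4 * B)) (nhds 0)"
  by (rule uniform_small) (use r(1) B(1) in simp)
 with ev1 eventually_nhds_in_open[OF \<Lambda>] show ?thesis
 proof eventually_elim
  case (elim s)
  \<comment> \<open>The estimates are available for g in C; left invariance under H transports them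
    to every group element.\<close>
  have left: "EX a:H. a ** g : C & (ALL y:\<Omega>. \<Psi> (s, a ** g) (c0, y) = \<Psi> (s, g) (c0, y))" if "g : CG" for g
   using C(2)[OF that] \<Psi>_left[OF elim(2) _ that] by blast
  show ?case
  proof (rule category_bound[OF elim(2) Li(1) Li0 _ _ r(1,2) _ _ near0(4) rB(2) _ \<E>])
   show "norm (Li (\<Psi> (s, g) (c0, y)) - Li (\<Psi> (s, g) (c0, y')) - (y - y')) \<le> norm (y - y') / 2"
    if g: "g : CG" and y: "y : ball x0 R" "y' : ball x0 R" for g y y'
   proof -
    obtain a where a: "a ** g : C" "!!y. y : \<Omega> ==> \<Psi> (s, a ** g) (c0, y) = \<Psi> (s, g) (c0, y)" using left[OF g] by blast
    let ?d = "\<Psi> (s, g) (c0, y) - \<Psi> (s, g) (c0, y') - frame (Q (y - y'))"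
    have "y : ball x0 R1" "y' : ball x0 R1" using y R(2) by auto
    from elim(1)[rule_format, OF a(1) this] have "norm ?d \<le> (1 / (2 * B)) * norm (y - y')"
     unfolding a(2)[OF near0(3)[OF y(1)]] a(2)[OF near0(3)[OF y(2)]] .
    then have "norm ?d * B \<le> norm (y - y') / 2" using B(1) by (simp add: field_simps)
    moreover have "Li ?d = Li (\<Psi> (s, g) (c0, y)) - Li (\<Psi> (s, g) (c0, y')) - (y - y')"
     by (simp add: linear_diff[OF Li(1)] Li(2))
    ultimately show ?thesis using B(2)[of ?d] by simp
   qed
   show "norm (Li (\<Psi> (s, g) (c0, x0))) \<le> r / 4" if g: "g : CG" for g
   proof -
    obtain a where a: "a ** g : C" "!!y. y : \<Omega> ==> \<Psi> (s, a ** g) (c0, y) = \<Psi> (s, g) (c0, y)" using left[OF g] by blast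
    have "norm (\<Psi> (s, g) (c0, x0)) \<le> r / (4 * B)" 
     using elim(3)[rule_format, OF a(1)] unfolding a(2)[OF x0_\<Omega>] by simp
    then have "norm (\<Psi> (s, g) (c0, x0)) * B \<le> r / 4" using B(1) by (simp add: field_simps)
    then show ?thesis using B(2)[of "\<Psi> (s, g) (c0, x0)"] by linarith
   qed
   show "ball x0 R \<subseteq> \<Omega>" using near0(3) by blast
   show "actc k y : ball x0 R" if "k : Stab" "y : ball x0 r" for k y
    using r0(2)[of y] that r(3) by (simp add: dist_commute)
   show "EX b:near rB. EX k:Stab. t = b ** k"
    if "y : ball x0 R" "y' : ball x0 R" "t : CG" "\<phi> t (ci y) = ci y'" for y y' t
    using sep[OF near0(1)[OF that(1)] near0(2)[OF that(2)]] that(3,4) by simp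
  qed
 qed
qed

theorem corollary2p5:
 fixes M :: "('a, 'e::real_normed_vector) smooth_space"
  and \<omega> :: "'a \<Rightarrow> 'e \<Rightarrow> 'e \<Rightarrow> real"
  and G :: "'g monoid"
  and GM :: "('g, 'f::real_normed_vector) smooth_space"
  and \<phi> :: "'g \<Rightarrow> 'a \<Rightarrow> 'a"
  and H :: "'g set"
  and h :: "'a \<Rightarrow> real"
  and m :: 'a
  and \<Lambda> :: "real set"
  and hp :: "real \<Rightarrow> 'a \<Rightarrow> real"
 assumes "symplectic_manifold M \<omega>"
  and "lie_group G GM"
  and "smooth_action G GM M \<phi>"
  and "proper_action GM M \<phi>"
  and "symplectic_action G M \<omega> \<phi>"
  and "subgroup H G"
  and "closedin (top_of GM) H"
  and "compact_space (right_coset_space G GM H)"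
  and "h \<in> invariant_smooth_functions G M \<phi>"
  and "nondegenerate_equilibrium G GM M \<phi> h m"
  and "invariant_perturbation (subgroup_as_group G H) M \<phi> h \<Lambda> hp"
 shows "\<exists>U. openin (top_of M) U \<and> m \<in> U \<and> (\<forall>g \<in> carrier G. \<phi> g ` U = U) \<and>
  (\<forall>\<^sub>F s in nhds 0.
    equivariant_category (subgroup_as_group G H)
     (left_coset_space G GM (stabilizer G \<phi> m)) (\<lambda>k C. k <#\<^bsub>G\<^esub> C)
    \<le> extended_card (orbit (subgroup_as_group G H) \<phi> ` (equilibria M \<omega> (hp s) \<inter> U)))"
proof -
 interpret lie_grp G GM by (rule lie_grp.intro[OF assms(2)])
 have M: "smooth_manifold M" using assms(1) by (simp add: symplectic_manifold_def)
 have m: "m : points M" using assms(10) by (simp add: nondegenerate_equilibrium_def)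
 obtain C where C: "compactin (top_of GM) C" "!!g. g : carrier G ==> EX a:H. a \<otimes>\<^bsub>G\<^esub> g : C"
  by (rule cocompact[OF assms(6,8)]) (rule that)
 interpret perturbed G GM M \<phi> m H C h \<Lambda> hp
  by (intro perturbed.intro perturbed_axioms.intro proper_point.intro proper_point_axioms.intro lie_grp_axioms M m C assms)
 have ev: "\<forall>\<^sub>F s in nhds 0. equivariant_category (subgroup_as_group G H) (left_coset_space G GM Stab) (%k C. k <#\<^bsub>G\<^esub> C)
   \<le> extended_card (orbit (subgroup_as_group G H) \<phi> ` (equilibria M \<omega> (hp s) Int points M))"
  by (rule persistence) (use equilibriaI[OF assms(1)] in blast)
 have "\<phi> g ` points M = points M" if "g : carrier G" for g by (rule group_action.surj_prop[OF ga that])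
 \<comment> \<open>The witness is the whole manifold, which is open, contains m and is mapped onto
   itself by every group element.\<close>
 then show ?thesis using ev m unfolding Stab_def by (intro exI[of _ "points M"]) simp
qed

end
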